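(* Let $\rho\in(1,2)$, let $b$ be an admissible kernel with exponent $\rho$ (as defined in the context), and let $A$ be an unbounded, densely defined, linear, self-adjoint, positive definite operator on the separable Hilbert space $H$ with compact inverse. Let $W$ be an $H$-valued $Q$-Wiener process and assume that $A^{\frac{r-1+1/\rho}{2}}Q^{\frac12}$ is a Hilbert–Schmidt operator on $H$ for some $r\in[1-\frac1\rho,1)$. Let $T>0$, $s<r-1+\frac2\rho$, $\kappa=(r-s-1)\rho$, and $$W_S(t):=\int_0^tS(t-\sigma)\,\mathrm dW(\sigma),\quad t\in[0,T].$$ Then there is a continuous modification $\tilde W_S$ of $W_S$. Furthermore, if $p>2$ is such that $\min\{\frac12,\frac\kappa2+1\}-\frac1p>0$, then $\tilde W_S\in L^p(\Omega;C^\beta([0,T];\dot H^s))$ for all $0<\beta<\min\{\frac12,\frac\kappa2+1\}-\frac1p$. In particular, $\tilde W_S\in L^p(\Omega;C([0,T];\dot H^s))$ for all $p\ge1$; that is, there is $C=C(T,s,p)>0$ such that $$\mathbb E\sup_{t\in[0,T]}\|\tilde W_S(t)\|_{\dot H^s}^p\le C\quad\text{for all } s<r-1+\tfrac2\rho.$$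
   Context: Kernels. For $b\in L^1_{\mathrm{loc}}(\mathbb R_+)$ real-valued and of subexponential growth (i.e. $\int_0^\infty e^{-\varepsilon t}|b(t)|\,\mathrm dt<\infty$ for all $\varepsilon>0$), let $\hat b(\lambda)=\int_0^\infty e^{-\lambda t}b(t)\,\mathrm dt$, $\operatorname{Re}\lambda>0$. $b$ is 2-regular if there is $C>0$ with $|\lambda|^j|\hat b^{(j)}(\lambda)|\le C|\hat b(\lambda)|$ for all $\operatorname{Re}\lambda>0$ and $0\le j\le2$. $b$ is sectorial of angle less than $\pi/2$ if $\sup\{|\arg\hat b(\lambda)|:\operatorname{Re}\lambda>0\}<\pi/2$. We call $b$ an admissible kernel with exponent $\rho\in(1,2)$ if $0\ne b\in L^1_{\mathrm{loc}}(\mathbb R_+)$ is of subexponential growth, 2-regular, sectorial of angle less than $\pi/2$, and its boundary function $g(k)=\lim_{\varepsilon\to0+}\hat b(\varepsilon+ik)$ ($k\in\mathbb R\setminus\{0\}$) satisfies: (1) $k\mapsto g(k)/(|k|+|g(k)|)\in L^q(\mathbb R)$ for some $1\le q<\infty$; (2) there is $C>0$ such that for all $\mu>0$ $$\int_0^\infty\frac{|g(k)|}{(|k|+\mu|g(k)|)^2}\,\mathrm dk\le\frac C\mu,\qquad \int_0^\infty\frac{|k^2g'''(k)|+|kg''(k)|+|g'(k)|+1/\mu}{(|k|+\mu|g(k)|)^2}\,\mathrm dk\le \frac{C}{\mu^{1+1/\rho}}.$$ Spaces. $A$ has eigenpairs $Ae_k=\lambda_ke_k$ with $\{e_k\}$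 an orthonormal basis of $H$ and $0<\lambda_1\le\lambda_2\le\dots\to\infty$. $A^s v=\sum_k\lambda_k^s(v,e_k)e_k$, $\dot H^\beta=D(A^{\beta/2})$ with norm $\|v\|_{\dot H^\beta}=\|A^{\beta/2}v\|$; for $\beta<0$, $\dot H^\beta$ is the completion of $H$ in this norm. Resolvent family. $S(t)v=\sum_k s_k(t)(v,e_k)e_k$, $v\in H$, where $\dot s_k(t)+\lambda_k\int_0^tb(t-s)s_k(s)\,\mathrm ds=0$, $s_k(0)=1$. Noise. $(\Omega,\mathcal F,\mathbb P,\{\mathcal F_t\}_{t\ge0})$ is a filtered probability space with normal filtration; $Q:H\to H$ is a bounded positive semidefinite operator with finite trace, $Q^{1/2}$ its positive semidefinite square root, and $W$ is an $H$-valued Wiener process with covariance operator $Q$ with respect to $\{\mathcal F_t\}$. Hölder spaces. $C^\alpha([t_1,t_2];B)$, $0<\alpha<1$, is the space of $f:[t_1,t_2]\to B$ with finite seminorm $\sup_{s\neq t}\|f(t)-f(s)\|_B/|t-s|^\alpha$. *)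

theory Defs
  imports "HOL-Probability.Probability"
begin

section \<open>Kernels\<close>

text \<open>Kernels are functions on the real line of which only the values on \<open>[0,\<infinity>)\<close> matter.\<close>

definition locally_integrable :: "(real \<Rightarrow> real) \<Rightarrow> bool" where
  "locally_integrable b \<longleftrightarrow> (\<forall>c\<ge>0. set_integrable lborel {0..c} b)"

definition subexponential :: "(real \<Rightarrow> real) \<Rightarrow> bool" where
  "subexponential b \<longleftrightarrow> (\<forall>\<epsilon>>0. set_integrable lborel {0..} (\<lambda>t. exp (- \<epsilon> * t) * \<bar>b t\<bar>))"

definition laplace :: "(real \<Rightarrow> real) \<Rightarrow> complex \<Rightarrow> complex" where
  "laplace b z = (LBINT t:{0..}. exp (- z * of_real t) * of_real (b t))"

definition two_regular :: "(real \<Rightarrow> real) \<Rightarrow> bool" where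
  "two_regular b \<longleftrightarrow> (\<exists>C>0. \<forall>z. Re z > 0 \<longrightarrow>
     (\<forall>j\<le>2. norm z ^ j * norm ((deriv ^^ j) (laplace b) z) \<le> C * norm (laplace b z)))"

definition sectorial_lt_half_pi :: "(real \<Rightarrow> real) \<Rightarrow> bool" where
  "sectorial_lt_half_pi b \<longleftrightarrow> (SUP z\<in>{z. Re z > 0}. \<bar>Arg (laplace b z)\<bar>) < pi / 2"

definition boundary_fun :: "(real \<Rightarrow> real) \<Rightarrow> real \<Rightarrow> complex" where
  "boundary_fun b k = Lim (at_right 0) (\<lambda>\<epsilon>. laplace b (Complex \<epsilon> k))"

definition real_deriv :: "nat \<Rightarrow> (real \<Rightarrow> complex) \<Rightarrow> real \<Rightarrow> complex" where
  "real_deriv j g = ((\<lambda>f x. vector_derivative f (at x)) ^^ j) g"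

text \<open>
  The existence of the boundary limits and of the derivatives up to order three away from the
  origin is implicit in the two integral conditions, and is spelled out here because
  \<^const>\<open>Lim\<close> and \<^const>\<open>vector_derivative\<close> are total. Both integral conditions concern
  nonnegative integrands and include finiteness of the integral.
\<close>

definition admissible_kernel :: "real \<Rightarrow> (real \<Rightarrow> real) \<Rightarrow> bool" where
  "admissible_kernel \<rho> b \<longleftrightarrow>
     1 < \<rho> \<and> \<rho> < 2 \<and>
     locally_integrable b \<and> \<not> (AE t in lborel. t \<ge> 0 \<longrightarrow> b t = 0) \<and>
     subexponential b \<and> two_regular b \<and> sectorial_lt_half_pi b \<and>
     (let g = boundary_fun b in
       (\<forall>k. k \<noteq> 0 \<longrightarrow> ((\<lambda>\<epsilon>. laplace b (Complex \<epsilon> k)) \<longlongrightarrow> g k) (at_right 0)) \<and>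
       (\<forall>k. k \<noteq> 0 \<longrightarrow> (\<forall>j<3. real_deriv j g differentiable (at k))) \<and>
       (\<exists>q\<ge>1. (\<lambda>k. g k / of_real (\<bar>k\<bar> + norm (g k))) \<in> borel_measurable lborel \<and>
          integrable lborel (\<lambda>k. norm (g k / of_real (\<bar>k\<bar> + norm (g k))) powr q)) \<and>
       (\<exists>C>0. \<forall>\<mu>>0.
          (\<integral>\<^sup>+k\<in>{0<..}. ennreal (norm (g k) / (\<bar>k\<bar> + \<mu> * norm (g k))\<^sup>2) \<partial>lborel)
             \<le> ennreal (C / \<mu>) \<and>
          (\<integral>\<^sup>+k\<in>{0<..}. ennreal
             ((norm (of_real (k\<^sup>2) * real_deriv 3 g k) + norm (of_real k * real_deriv 2 g k)
                 + norm (real_deriv 1 g k) + 1 / \<mu>) / (\<bar>k\<bar> + \<mu> * norm (g k))\<^sup>2) \<partial>lborel)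
             \<le> ennreal (C / \<mu> powr (1 + 1 / \<rho>))))"


section \<open>Operators on a Hilbert space\<close>

text \<open>An unbounded operator is given by its domain \<open>D\<close> and a map \<open>A\<close> used on \<open>D\<close> only.\<close>

definition linear_on_domain :: "'h::real_vector set \<Rightarrow> ('h \<Rightarrow> 'h) \<Rightarrow> bool" where
  "linear_on_domain D A \<longleftrightarrow> subspace D \<and>
     (\<forall>x\<in>D. \<forall>y\<in>D. A (x + y) = A x + A y) \<and> (\<forall>c. \<forall>x\<in>D. A (c *\<^sub>R x) = c *\<^sub>R A x)"

definition adjoint_graph :: "'h::real_inner set \<Rightarrow> ('h \<Rightarrow> 'h) \<Rightarrow> ('h \<times> 'h) set" where
  "adjoint_graph D A = {(y, z). \<forall>x\<in>D. A x \<bullet> y = x \<bullet> z}"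

definition self_adjoint_op :: "'h::real_inner set \<Rightarrow> ('h \<Rightarrow> 'h) \<Rightarrow> bool" where
  "self_adjoint_op D A \<longleftrightarrow> adjoint_graph D A = {(y, A y) | y. y \<in> D}"

definition unbounded_op :: "'h::real_normed_vector set \<Rightarrow> ('h \<Rightarrow> 'h) \<Rightarrow> bool" where
  "unbounded_op D A \<longleftrightarrow> \<not> (\<exists>C. \<forall>x\<in>D. norm (A x) \<le> C * norm x)"

definition pos_definite_op :: "'h::real_inner set \<Rightarrow> ('h \<Rightarrow> 'h) \<Rightarrow> bool" where
  "pos_definite_op D A \<longleftrightarrow> (\<forall>x\<in>D. x \<noteq> 0 \<longrightarrow> A x \<bullet> x > 0)"

definition has_compact_inverse :: "'h::real_normed_vector set \<Rightarrow> ('h \<Rightarrow> 'h) \<Rightarrow> bool" where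
  "has_compact_inverse D A \<longleftrightarrow>
     bij_betw A D UNIV \<and> compact (closure (inv_into D A ` cball 0 1))"

definition orthonormal_basis :: "(nat \<Rightarrow> 'h::real_inner) \<Rightarrow> bool" where
  "orthonormal_basis e \<longleftrightarrow>
     (\<forall>i j. e i \<bullet> e j = (if i = j then 1 else 0)) \<and> closure (span (range e)) = UNIV"

definition eigenpairs ::
    "'h::real_inner set \<Rightarrow> ('h \<Rightarrow> 'h) \<Rightarrow> (nat \<Rightarrow> 'h) \<Rightarrow> (nat \<Rightarrow> real) \<Rightarrow> bool" where
  "eigenpairs D A e lam \<longleftrightarrow>
     orthonormal_basis e \<and> (\<forall>k. e k \<in> D \<and> A (e k) = lam k *\<^sub>R e k) \<and>
     0 < lam 0 \<and> mono lam \<and> filterlim lam at_top sequentially"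

definition frac_dom :: "(nat \<Rightarrow> 'h::real_inner) \<Rightarrow> (nat \<Rightarrow> real) \<Rightarrow> real \<Rightarrow> 'h set" where
  "frac_dom e lam s = {v. summable (\<lambda>k. (lam k powr s * (v \<bullet> e k))\<^sup>2)}"

definition frac_pow ::
    "(nat \<Rightarrow> 'h::real_inner) \<Rightarrow> (nat \<Rightarrow> real) \<Rightarrow> real \<Rightarrow> 'h \<Rightarrow> 'h" where
  "frac_pow e lam s v = (\<Sum>k. (lam k powr s * (v \<bullet> e k)) *\<^sub>R e k)"

text \<open>
  For \<open>\<beta> \<ge> 0\<close> this is \<open>D(A\<^bsup>\<beta>/2\<^esup>)\<close>. For \<open>\<beta> < 0\<close> it is all of \<open>H\<close>, that is, the
  dense subspace \<open>H\<close> of the completion; this suffices for processes with values in \<open>H\<close>.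
\<close>

definition Hdot :: "(nat \<Rightarrow> 'h::real_inner) \<Rightarrow> (nat \<Rightarrow> real) \<Rightarrow> real \<Rightarrow> 'h set" where
  "Hdot e lam \<beta> = frac_dom e lam (\<beta> / 2)"

definition Hdot_norm ::
    "(nat \<Rightarrow> 'h::real_inner) \<Rightarrow> (nat \<Rightarrow> real) \<Rightarrow> real \<Rightarrow> 'h \<Rightarrow> real" where
  "Hdot_norm e lam \<beta> v = norm (frac_pow e lam (\<beta> / 2) v)"

text \<open>
  Hilbert-Schmidt norm and trace do not depend on the orthonormal basis; they are computed in
  the given basis \<open>e\<close>.
\<close>

definition hilbert_schmidt :: "(nat \<Rightarrow> 'h::real_inner) \<Rightarrow> ('h \<Rightarrow> 'h) \<Rightarrow> bool" where
  "hilbert_schmidt e L \<longleftrightarrow> bounded_linear L \<and> summable (\<lambda>k. (norm (L (e k)))\<^sup>2)"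

definition hs_norm2 :: "(nat \<Rightarrow> 'h::real_inner) \<Rightarrow> ('h \<Rightarrow> 'h) \<Rightarrow> ennreal" where
  "hs_norm2 e L = (\<Sum>k. ennreal ((norm (L (e k)))\<^sup>2))"

definition psd_op :: "('h::real_inner \<Rightarrow> 'h) \<Rightarrow> bool" where
  "psd_op Q \<longleftrightarrow> bounded_linear Q \<and> (\<forall>x y. Q x \<bullet> y = x \<bullet> Q y) \<and> (\<forall>x. Q x \<bullet> x \<ge> 0)"

definition finite_trace :: "(nat \<Rightarrow> 'h::real_inner) \<Rightarrow> ('h \<Rightarrow> 'h) \<Rightarrow> bool" where
  "finite_trace e Q \<longleftrightarrow> summable (\<lambda>k. Q (e k) \<bullet> e k)"

definition is_psd_sqrt :: "('h::real_inner \<Rightarrow> 'h) \<Rightarrow> ('h \<Rightarrow> 'h) \<Rightarrow> bool" where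
  "is_psd_sqrt R Q \<longleftrightarrow> psd_op R \<and> (\<forall>x. R (R x) = Q x)"


section \<open>The resolvent family\<close>

definition scalar_resolvent :: "(real \<Rightarrow> real) \<Rightarrow> real \<Rightarrow> (real \<Rightarrow> real) \<Rightarrow> bool" where
  "scalar_resolvent b \<mu> u \<longleftrightarrow> u 0 = 1 \<and>
     (\<forall>t\<ge>0. (u has_real_derivative - \<mu> * (LBINT \<sigma>:{0..t}. b (t - \<sigma>) * u \<sigma>)) (at t within {0..}))"

definition resolvent_family ::
    "(nat \<Rightarrow> 'h::real_inner) \<Rightarrow> (nat \<Rightarrow> real \<Rightarrow> real) \<Rightarrow> real \<Rightarrow> 'h \<Rightarrow> 'h" where
  "resolvent_family e u t v = (\<Sum>k. (u k t * (v \<bullet> e k)) *\<^sub>R e k)"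


section \<open>Wiener process and stochastic integral\<close>

text \<open>Filtrations are indexed by the reals, but only indices \<open>t \<ge> 0\<close> are used.\<close>

definition normal_filtration :: "'w measure \<Rightarrow> (real \<Rightarrow> 'w measure) \<Rightarrow> bool" where
  "normal_filtration M F \<longleftrightarrow>
     (\<forall>t\<ge>0. subalgebra M (F t)) \<and>
     (\<forall>t1 t2. 0 \<le> t1 \<longrightarrow> t1 \<le> t2 \<longrightarrow> sets (F t1) \<subseteq> sets (F t2)) \<and>
     null_sets M \<subseteq> sets (F 0) \<and>
     (\<forall>t\<ge>0. sets (F t) = (\<Inter>t'\<in>{t<..}. sets (F t')))"

definition centered_gaussian :: "real \<Rightarrow> real measure" where
  "centered_gaussian v =
     (if v = 0 then return borel 0 else density lborel (\<lambda>x. ennreal (normal_density 0 (sqrt v) x)))"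

definition Q_wiener ::
    "'w measure \<Rightarrow> (real \<Rightarrow> 'w measure) \<Rightarrow> ('h::real_inner \<Rightarrow> 'h) \<Rightarrow> (real \<Rightarrow> 'w \<Rightarrow> 'h) \<Rightarrow> bool" where
  "Q_wiener M F Q W \<longleftrightarrow>
     (\<forall>t\<ge>0. W t \<in> borel_measurable (F t)) \<and>
     (AE \<omega> in M. W 0 \<omega> = 0) \<and>
     (AE \<omega> in M. continuous_on {0..} (\<lambda>t. W t \<omega>)) \<and>
     (\<forall>t1 t2. 0 \<le> t1 \<longrightarrow> t1 < t2 \<longrightarrow>
        prob_space.indep_set M (sets (F t1))
          {(\<lambda>\<omega>. W t2 \<omega> - W t1 \<omega>) -` B \<inter> space M | B. B \<in> sets borel} \<and>
        (\<forall>h. distr M borel (\<lambda>\<omega>. (W t2 \<omega> - W t1 \<omega>) \<bullet> h)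
               = centered_gaussian ((t2 - t1) * (Q h \<bullet> h))))"

text \<open>
  An elementary process on \<open>[0,t]\<close> is given by a partition \<open>0 = \<tau> 0 \<le> \<dots> \<le> \<tau> n = t\<close> and
  operator-valued random variables \<open>L i\<close>, taking finitely many values and measurable at time
  \<open>\<tau> i\<close>; its value on \<open>(\<tau> i, \<tau> (i+1)]\<close> is \<open>L i\<close>.
\<close>

definition elementary_data ::
    "'w measure \<Rightarrow> (real \<Rightarrow> 'w measure) \<Rightarrow> real \<Rightarrow> nat \<Rightarrow> (nat \<Rightarrow> real)
      \<Rightarrow> (nat \<Rightarrow> 'w \<Rightarrow> 'h::real_normed_vector \<Rightarrow> 'h) \<Rightarrow> bool" where
  "elementary_data M F t n \<tau> L \<longleftrightarrow>
     \<tau> 0 = 0 \<and> \<tau> n = t \<and> (\<forall>i<n. \<tau> i \<le> \<tau> (Suc i)) \<and>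
     (\<forall>i<n. simple_function (F (\<tau> i)) (L i) \<and> (\<forall>\<omega>\<in>space M. bounded_linear (L i \<omega>)))"

definition elementary_process ::
    "nat \<Rightarrow> (nat \<Rightarrow> real) \<Rightarrow> (nat \<Rightarrow> 'w \<Rightarrow> 'h::real_normed_vector \<Rightarrow> 'h) \<Rightarrow> real \<Rightarrow> 'w \<Rightarrow> 'h \<Rightarrow> 'h" where
  "elementary_process n \<tau> L \<sigma> \<omega> v =
     (\<Sum>i<n. indicator {\<tau> i<..\<tau> (Suc i)} \<sigma> *\<^sub>R L i \<omega> v)"

definition elementary_integral ::
    "(real \<Rightarrow> 'w \<Rightarrow> 'h) \<Rightarrow> nat \<Rightarrow> (nat \<Rightarrow> real) \<Rightarrow> (nat \<Rightarrow> 'w \<Rightarrow> 'h::real_normed_vector \<Rightarrow> 'h) \<Rightarrow> 'w \<Rightarrow> 'h" where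
  "elementary_integral W n \<tau> L \<omega> = (\<Sum>i<n. L i \<omega> (W (\<tau> (Suc i)) \<omega> - W (\<tau> i) \<omega>))"

text \<open>
  The Ito integral over \<open>[0,t]\<close>: \<open>X\<close> is the limit in \<open>L\<^sup>2(\<Omega>;H)\<close> of the integrals of elementary
  processes that approximate \<open>\<Phi>\<close> in the norm given by the Ito isometry, whose square is the
  expectation of the integral over \<open>\<sigma> \<in> [0,t]\<close> of \<open>\<parallel>\<Phi>(\<sigma>) R\<parallel>\<^sup>2\<close> in Hilbert-Schmidt norm, where
  \<open>R\<close> is the square root of the covariance operator of \<open>W\<close>.
\<close>

definition has_stochastic_integral ::
    "'w measure \<Rightarrow> (real \<Rightarrow> 'w measure) \<Rightarrow> (nat \<Rightarrow> 'h::{real_inner,banach,second_countable_topology})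
      \<Rightarrow> ('h \<Rightarrow> 'h) \<Rightarrow> (real \<Rightarrow> 'w \<Rightarrow> 'h) \<Rightarrow> real \<Rightarrow> (real \<Rightarrow> 'w \<Rightarrow> 'h \<Rightarrow> 'h) \<Rightarrow> ('w \<Rightarrow> 'h) \<Rightarrow> bool" where
  "has_stochastic_integral M F e R W t \<Phi> X \<longleftrightarrow>
     (\<forall>\<sigma>\<in>{0..t}. \<forall>\<omega>\<in>space M. bounded_linear (\<Phi> \<sigma> \<omega>)) \<and>
     (\<forall>v. (\<lambda>(\<sigma>, \<omega>). indicator {0..t} \<sigma> *\<^sub>R \<Phi> \<sigma> \<omega> v) \<in> borel_measurable (lborel \<Otimes>\<^sub>M M)) \<and>
     X \<in> borel_measurable M \<and>
     (\<exists>n \<tau> L. (\<forall>m. elementary_data M F t (n m) (\<tau> m) (L m)) \<and>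
        (\<lambda>m. \<integral>\<^sup>+(\<sigma>, \<omega>). indicator {0..t} \<sigma> *
            hs_norm2 e (\<lambda>v. \<Phi> \<sigma> \<omega> (R v) - elementary_process (n m) (\<tau> m) (L m) \<sigma> \<omega> (R v))
            \<partial>(lborel \<Otimes>\<^sub>M M)) \<longlonglongrightarrow> 0 \<and>
        (\<lambda>m. \<integral>\<^sup>+\<omega>. ennreal ((norm (X \<omega> - elementary_integral W (n m) (\<tau> m) (L m) \<omega>))\<^sup>2) \<partial>M)
            \<longlonglongrightarrow> 0)"

text \<open>A representative of the Ito integral, which is unique up to null sets.\<close>

definition stochastic_integral ::
    "'w measure \<Rightarrow> (real \<Rightarrow> 'w measure) \<Rightarrow> (nat \<Rightarrow> 'h::{real_inner,banach,second_countable_topology})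
      \<Rightarrow> ('h \<Rightarrow> 'h) \<Rightarrow> (real \<Rightarrow> 'w \<Rightarrow> 'h) \<Rightarrow> real \<Rightarrow> (real \<Rightarrow> 'w \<Rightarrow> 'h \<Rightarrow> 'h) \<Rightarrow> 'w \<Rightarrow> 'h" where
  "stochastic_integral M F e R W t \<Phi> = (SOME X. has_stochastic_integral M F e R W t \<Phi> X)"

definition stochastic_convolution ::
    "'w measure \<Rightarrow> (real \<Rightarrow> 'w measure) \<Rightarrow> (nat \<Rightarrow> 'h::{real_inner,banach,second_countable_topology})
      \<Rightarrow> ('h \<Rightarrow> 'h) \<Rightarrow> (real \<Rightarrow> 'w \<Rightarrow> 'h) \<Rightarrow> (real \<Rightarrow> 'h \<Rightarrow> 'h) \<Rightarrow> real \<Rightarrow> 'w \<Rightarrow> 'h" where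
  "stochastic_convolution M F e R W S t =
     stochastic_integral M F e R W t (\<lambda>\<sigma> \<omega>. S (t - \<sigma>))"

definition is_modification ::
    "'w measure \<Rightarrow> real set \<Rightarrow> (real \<Rightarrow> 'w \<Rightarrow> 'h::topological_space) \<Rightarrow> (real \<Rightarrow> 'w \<Rightarrow> 'h) \<Rightarrow> bool" where
  "is_modification M I X Y \<longleftrightarrow>
     (\<forall>t\<in>I. X t \<in> borel_measurable M \<and> (AE \<omega> in M. X t \<omega> = Y t \<omega>))"


section \<open>Path spaces\<close>

text \<open>Elements of \<open>C([0,T];B)\<close> and \<open>C\<^sup>\<alpha>([0,T];B)\<close> are functions on the reals, considered on
  \<open>[0,T]\<close> only; \<open>B\<close> is the space \<^const>\<open>Hdot\<close> of order \<open>s\<close>.\<close>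

definition cont_space ::
    "(nat \<Rightarrow> 'h::real_inner) \<Rightarrow> (nat \<Rightarrow> real) \<Rightarrow> real \<Rightarrow> real \<Rightarrow> (real \<Rightarrow> 'h) set" where
  "cont_space e lam s T = {f. \<forall>t\<in>{0..T}. f t \<in> Hdot e lam s \<and>
     ((\<lambda>t'. Hdot_norm e lam s (f t' - f t)) \<longlongrightarrow> 0) (at t within {0..T})}"

definition cont_norm ::
    "(nat \<Rightarrow> 'h::real_inner) \<Rightarrow> (nat \<Rightarrow> real) \<Rightarrow> real \<Rightarrow> real \<Rightarrow> (real \<Rightarrow> 'h) \<Rightarrow> real" where
  "cont_norm e lam s T f = (SUP t\<in>{0..T}. Hdot_norm e lam s (f t))"

definition hoelder_quotients ::
    "(nat \<Rightarrow> 'h::real_inner) \<Rightarrow> (nat \<Rightarrow> real) \<Rightarrow> real \<Rightarrow> real \<Rightarrow> real \<Rightarrow> (real \<Rightarrow> 'h) \<Rightarrow> real set" where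
  "hoelder_quotients e lam s T \<alpha> f =
     {Hdot_norm e lam s (f t - f t') / \<bar>t - t'\<bar> powr \<alpha> | t t'. t \<in> {0..T} \<and> t' \<in> {0..T} \<and> t \<noteq> t'}"

definition hoelder_space ::
    "(nat \<Rightarrow> 'h::real_inner) \<Rightarrow> (nat \<Rightarrow> real) \<Rightarrow> real \<Rightarrow> real \<Rightarrow> real \<Rightarrow> (real \<Rightarrow> 'h) set" where
  "hoelder_space e lam s T \<alpha> =
     {f. (\<forall>t\<in>{0..T}. f t \<in> Hdot e lam s) \<and> bdd_above (hoelder_quotients e lam s T \<alpha> f)}"

text \<open>The supremum norm is added to the seminorm in order to have a norm.\<close>

definition hoelder_norm ::
    "(nat \<Rightarrow> 'h::real_inner) \<Rightarrow> (nat \<Rightarrow> real) \<Rightarrow> real \<Rightarrow> real \<Rightarrow> real \<Rightarrow> (real \<Rightarrow> 'h) \<Rightarrow> real" where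
  "hoelder_norm e lam s T \<alpha> f = cont_norm e lam s T f + Sup (hoelder_quotients e lam s T \<alpha> f)"

text \<open>
  \<open>L\<^sup>p(\<Omega>;V)\<close> in the sense of Bochner, for a space \<open>V\<close> of functions with norm \<open>N\<close>: \<open>X\<close> is an
  almost sure limit of simple functions and the \<open>p\<close>-th moment of \<open>N(X)\<close> is finite.
\<close>

definition bochner_Lp ::
    "'w measure \<Rightarrow> (real \<Rightarrow> 'h::real_vector) set \<Rightarrow> ((real \<Rightarrow> 'h) \<Rightarrow> real) \<Rightarrow> real
      \<Rightarrow> ('w \<Rightarrow> real \<Rightarrow> 'h) \<Rightarrow> bool" where
  "bochner_Lp M V N p X \<longleftrightarrow>
     (AE \<omega> in M. X \<omega> \<in> V) \<and>
     (\<exists>f. (\<forall>n. simple_function M (f n) \<and> f n ` space M \<subseteq> V) \<and>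
        (AE \<omega> in M. (\<lambda>n. N (\<lambda>t. f n \<omega> t - X \<omega> t)) \<longlonglongrightarrow> 0)) \<and>
     (\<integral>\<^sup>+\<omega>. ennreal (N (X \<omega>) powr p) \<partial>M) < \<infinity>"

end

theory Submission
  imports Defs "HOL-Real_Asymp.Real_Asymp"
begin

text \<open>
  By Plancherel and the integral conditions on the boundary function of the Laplace transform, the
  scalar resolvent \<open>u\<close> with parameter \<open>\<mu>\<close> satisfies \<open>\<integral> |u(t - x) - u(t' - x)|\<^sup>2 dx \<le> C min (t - t') (\<mu> powr (- 1 / \<rho>))\<close>.
  The components of the stochastic convolution in the eigenbasis are limits of Gaussian Riemann sums,
  so that the moments of order \<open>2 m\<close> of its increments in the fractional space of order \<open>s\<close> are bounded by
  those of a Gaussian with variance of order \<open>|t - t'| powr \<theta>\<close>, where \<open>\<theta> = min 1 (\<kappa> + 2)\<close>. Expanding the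
  process in the Faber-Schauder basis turns these bounds into summability of weighted coefficients,
  which yields the continuous modification, its Hoelder norms, and its approximation by simple functions.
\<close>

subsection \<open>Plancherel's identity\<close>

text \<open>The integral conditions on the kernel live on the imaginary axis, its sector and
  regularity bounds in the open half plane. Damping the resolvent by exp(-t) places Plancherel on
  the line Re z = 1, and two-regularity, read as a bound on the logarithmic derivative, compares the
  two lines; the decay in \<mu> then comes from the summand 1/\<mu> of the second integral
  condition. The two entries of the minimum are interpolated as h^\<theta>
  \<mu>^(-(1-\<theta>)/\<rho>), which trades time regularity for spatial order: the Hilbert-Schmidt
  weights allow \<theta> up to (r - 1 + 2/\<rho> - s) \<rho> = \<kappa> + 2. The stochastic integral
  is a chosen representative, so all estimates are made for an explicit series and carried over by
  uniqueness. Bochner's L^p asks for simple functions converging in Hoelder norm, although Hoelder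
  spaces are not separable. Coefficients therefore carry a weight above the target exponent, and a
  countable set of finite arrays is dense after a small loss of weight. Bounding the supremum over
  the 2^n coefficients of a level by their sum is what costs 1/p.\<close>

definition fourier :: "(real \<Rightarrow> real) \<Rightarrow> real \<Rightarrow> complex" where
  "fourier f k = (LINT x|lborel. iexp (- (k * x)) * complex_of_real (f x))"

lemma integrable_iexp_times:
  assumes "integrable lborel f"
  shows "integrable lborel (\<lambda>x. iexp (k * x) * complex_of_real (f x))"
proof (rule Bochner_Integration.integrable_bound[OF assms])
  have [measurable]: "f \<in> borel_measurable borel" using assms by (auto dest: borel_measurable_integrable)
  show "(\<lambda>x. iexp (k * x) * complex_of_real (f x)) \<in> borel_measurable lborel" by measurable
qed (auto simp: norm_mult)

lemma integrable_product_tensor: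
  fixes f g :: "real \<Rightarrow> real"
  assumes f: "integrable lborel f" and g: "integrable lborel g"
  shows "integrable (lborel \<Otimes>\<^sub>M lborel) (\<lambda>(x, y). f x * g y)"
proof (rule lborel_pair.Fubini_integrable)
  have [measurable]: "f \<in> borel_measurable borel" "g \<in> borel_measurable borel"
    using assms by (auto dest: borel_measurable_integrable)
  show "(\<lambda>(x, y). f x * g y) \<in> borel_measurable (lborel \<Otimes>\<^sub>M lborel)" by measurable
  show "integrable lborel (\<lambda>x. LINT y|lborel. norm (case (x, y) of (x, y) \<Rightarrow> f x * g y))"
    using f g by (auto simp: abs_mult intro!: integrable_mult_left)
  show "AE x in lborel. integrable lborel (\<lambda>y. case (x, y) of (x, y) \<Rightarrow> f x * g y)"
    using g by auto
qed

text \<open>Majorants of product form are available at every interchange of integrals in the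
  Gaussian average and in the positivity of convolution forms, so joint integrability is settled
  here once.\<close>

lemma Fubini_tensor_bound:
  fixes h :: "real \<Rightarrow> real \<Rightarrow> 'a::{banach, second_countable_topology}"
  assumes h: "(\<lambda>(x, y). h x y) \<in> borel_measurable (lborel \<Otimes>\<^sub>M lborel)"
    and f: "integrable lborel f" and g: "integrable lborel g"
    and le: "\<And>x y. norm (h x y) \<le> f x * g y"
  shows "(LINT x|lborel. LINT y|lborel. h x y) = (LINT y|lborel. LINT x|lborel. h x y)"
    and "integrable lborel (\<lambda>x. LINT y|lborel. h x y)"
proof -
  have *: "integrable (lborel \<Otimes>\<^sub>M lborel) (\<lambda>(x, y). h x y)"
    by (rule Bochner_Integration.integrable_bound[OF integrable_product_tensor[OF f g] h])
       (use le in \<open>auto intro!: AE_I2 order_trans[OF le abs_ge_self]\<close>)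
  show "(LINT x|lborel. LINT y|lborel. h x y) = (LINT y|lborel. LINT x|lborel. h x y)"
    using lborel_pair.Fubini_integral[OF *] by simp
  show "integrable lborel (\<lambda>x. LINT y|lborel. h x y)"
    using lborel_pair.integrable_fst'[OF *] by simp
qed

lemma norm_fourier_le: "norm (fourier f k) \<le> (LINT x|lborel. \<bar>f x\<bar>)"
  unfolding fourier_def by (rule order_trans[OF integral_norm_bound]) (simp add: norm_mult)

lemma cnj_fourier: "cnj (fourier f k) = (LINT x|lborel. iexp (k * x) * complex_of_real (f x))"
  unfolding fourier_def by (simp add: exp_cnj flip: Bochner_Integration.integral_cnj)

lemma borel_measurable_fourier [measurable]:
  assumes "integrable lborel f"
  shows "fourier f \<in> borel_measurable borel"
proof -
  have [measurable]: "f \<in> borel_measurable borel" using assms by (auto dest: borel_measurable_integrable)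
  show ?thesis unfolding fourier_def by measurable
qed

lemma integral_std_normal_iexp:
  "(LINT y|lborel. complex_of_real (std_normal_density y) * iexp (y * t))
     = complex_of_real (exp (- t\<^sup>2 / 2))"
proof -
  have "char std_normal_distribution t = (LINT y|lborel. std_normal_density y *\<^sub>R iexp (t * y))"
    unfolding char_def by (subst integral_density) (auto simp: normal_density_nonneg)
  then show ?thesis by (simp add: char_std_normal_distribution scaleR_conv_of_real mult.commute)
qed

text \<open>Averaging \<open>|f\<^sup>^|\<^sup>2\<close> against a wide Gaussian smears \<open>f\<close> at scale \<open>\<epsilon>\<close>.\<close>

lemma gaussian_average_fourier:
  fixes f :: "real \<Rightarrow> real"
  assumes f: "integrable lborel f" and eps: "\<epsilon> > 0"
  shows "(LINT k|lborel. exp (- (\<epsilon> * k)\<^sup>2 / 2) * (norm (fourier f k))\<^sup>2)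
     = (LINT x|lborel. f x * (LINT w|lborel. f (x + \<epsilon> * w) * (2 * pi * std_normal_density w)))" (is "?L = ?R")
    and "integrable lborel (\<lambda>k. exp (- (\<epsilon> * k)\<^sup>2 / 2) * (norm (fourier f k))\<^sup>2)"
proof -
  have fm [measurable]: "f \<in> borel_measurable borel" using f by (auto dest: borel_measurable_integrable)
  have Fm [measurable]: "fourier f \<in> borel_measurable borel" using f by measurable
  define N where "N = (LINT x|lborel. \<bar>f x\<bar>)"
  let ?p = "std_normal_density"
  \<comment> \<open>\<open>y\<close> stands for \<epsilon> k and \<open>x\<close> is held fixed. One
    factor of |f^|^2 contributes the exponential in \<open>x\<close>, the other an integral in
    \<open>z\<close>; after Fubini the Gaussian meets a single exponential in z - x and yields its
    characteristic function.\<close>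
  have inner: "(LINT y|lborel. ?p y * iexp (y * - x / \<epsilon>) * cnj (fourier f (y / \<epsilon>)))
     = of_real (LINT z|lborel. f z * exp (- ((z - x) / \<epsilon>)\<^sup>2 / 2))" for x
  proof -
    have "(LINT y|lborel. ?p y * iexp (y * - x / \<epsilon>) * cnj (fourier f (y / \<epsilon>)))
       = (LINT y|lborel. LINT z|lborel. ?p y * iexp (y * - x / \<epsilon>) * (iexp (y / \<epsilon> * z) * of_real (f z)))"
      by (subst integral_mult_right_zero) (simp add: cnj_fourier)
    also have "\<dots> = (LINT z|lborel. LINT y|lborel. ?p y * iexp (y * - x / \<epsilon>) * (iexp (y / \<epsilon> * z) * of_real (f z)))"
      by (rule Fubini_tensor_bound(1)[where f = ?p and g = "\<lambda>x. \<bar>f x\<bar>"])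
         (use f in \<open>auto simp: norm_mult normal_density_nonneg\<close>)
    also have "\<dots> = (LINT z|lborel. LINT y|lborel. (?p y * iexp (y * ((z - x) / \<epsilon>))) * of_real (f z))"
      by (intro Bochner_Integration.integral_cong refl)
         (simp add: exp_add[symmetric] algebra_simps diff_divide_distrib)
    also have "\<dots> = (LINT z|lborel. of_real (f z * exp (- ((z - x) / \<epsilon>)\<^sup>2 / 2)))"
      by (subst integral_mult_left_zero, subst integral_std_normal_iexp) (simp add: mult.commute)
    finally show ?thesis by (simp only: integral_complex_of_real)
  qed
  have le: "norm (?p y * iexp (y * - x / \<epsilon>) * of_real (f x) * cnj (fourier f (y / \<epsilon>))) \<le> (?p y * N) * \<bar>f x\<bar>" for x y
    using norm_fourier_le[of f "y/\<epsilon>"]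
    by (auto simp: norm_mult normal_density_nonneg N_def mult.assoc intro!: mult_left_mono) (simp add: mult.commute mult_left_mono)
  have sq: "(LINT x|lborel. ?p y * iexp (y * - x / \<epsilon>) * of_real (f x) * cnj (fourier f (y / \<epsilon>)))
      = of_real (?p y * (norm (fourier f (y / \<epsilon>)))\<^sup>2)" for y
  proof -
    have "(LINT x|lborel. ?p y * iexp (y * - x / \<epsilon>) * of_real (f x) * cnj (fourier f (y / \<epsilon>)))
      = (LINT x|lborel. (?p y * cnj (fourier f (y / \<epsilon>))) * (iexp (- (y / \<epsilon> * x)) * of_real (f x)))"
      by (intro Bochner_Integration.integral_cong refl) (simp add: algebra_simps)
    also have "\<dots> = (?p y * cnj (fourier f (y / \<epsilon>))) * fourier f (y / \<epsilon>)"
      unfolding fourier_def by simp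
    also have "\<dots> = of_real (?p y * (norm (fourier f (y / \<epsilon>)))\<^sup>2)"
      using complex_norm_square[of "fourier f (y / \<epsilon>)"] by (simp add: mult.commute mult.left_commute)
    finally show ?thesis .
  qed
  have mes: "(\<lambda>(y, x). ?p y * iexp (y * - x / \<epsilon>) * of_real (f x) * cnj (fourier f (y / \<epsilon>)))
      \<in> borel_measurable (lborel \<Otimes>\<^sub>M lborel)"
  proof -
    have [measurable]: "(\<lambda>y. cnj (fourier f (y / \<epsilon>))) \<in> borel_measurable borel"
      unfolding cnj_fourier by measurable
    show ?thesis by measurable
  qed
  note Fub = Fubini_tensor_bound[OF mes _ _ le]
  have "of_real (LINT y|lborel. ?p y * (norm (fourier f (y / \<epsilon>)))\<^sup>2)
     = (LINT y|lborel. LINT x|lborel. ?p y * iexp (y * - x / \<epsilon>) * of_real (f x) * cnj (fourier f (y / \<epsilon>)))"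
    by (simp only: sq integral_complex_of_real)
  also have "\<dots> = (LINT x|lborel. LINT y|lborel. ?p y * iexp (y * - x / \<epsilon>) * of_real (f x) * cnj (fourier f (y / \<epsilon>)))"
    by (rule Fub(1)) (use f in auto)
  also have "\<dots> = (LINT x|lborel. of_real (f x) * (LINT y|lborel. ?p y * iexp (y * - x / \<epsilon>) * cnj (fourier f (y / \<epsilon>))))"
    by (subst integral_mult_right_zero[symmetric]) (simp add: algebra_simps)
  also have "\<dots> = of_real (LINT x|lborel. f x * (LINT z|lborel. f z * exp (- ((z - x) / \<epsilon>)\<^sup>2 / 2)))"
    by (simp only: inner of_real_mult[symmetric] integral_complex_of_real)
  finally have 1: "(LINT y|lborel. ?p y * (norm (fourier f (y / \<epsilon>)))\<^sup>2)
     = (LINT x|lborel. f x * (LINT z|lborel. f z * exp (- ((z - x) / \<epsilon>)\<^sup>2 / 2)))"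
    by (simp only: of_real_eq_iff)
  have 2: "(LINT z|lborel. f z * exp (- ((z - x) / \<epsilon>)\<^sup>2 / 2)) = \<epsilon> * (LINT w|lborel. f (x + \<epsilon> * w) * exp (- w\<^sup>2 / 2))" for x
    using eps by (subst lborel_integral_real_affine[of \<epsilon> _ x]) auto
  have 3: "(LINT y|lborel. ?p y * (norm (fourier f (y / \<epsilon>)))\<^sup>2)
      = \<epsilon> * (LINT k|lborel. ?p (\<epsilon> * k) * (norm (fourier f k))\<^sup>2)"
    using eps by (subst lborel_integral_real_affine[of \<epsilon> _ 0]) auto
  have int0: "integrable lborel (\<lambda>y. ?p y * (norm (fourier f (y / \<epsilon>)))\<^sup>2)"
  proof -
    have "integrable lborel (\<lambda>y. LINT x|lborel. ?p y * iexp (y * - x / \<epsilon>) * of_real (f x) * cnj (fourier f (y / \<epsilon>)))"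
      by (rule Fub(2)) (use f in auto)
    then show ?thesis by (simp only: sq complex_of_real_integrable_eq)
  qed
  have "integrable lborel (\<lambda>k. ?p (\<epsilon> * k) * (norm (fourier f k))\<^sup>2)"
    using lborel_integrable_real_affine[OF int0, of \<epsilon> 0] eps by simp
  then have "integrable lborel (\<lambda>k. sqrt (2 * pi) * (?p (\<epsilon> * k) * (norm (fourier f k))\<^sup>2))"
    by simp
  then show "integrable lborel (\<lambda>k. exp (- (\<epsilon> * k)\<^sup>2 / 2) * (norm (fourier f k))\<^sup>2)"
    by (simp add: std_normal_density_def)
  have "?L = sqrt (2 * pi) * (LINT k|lborel. ?p (\<epsilon> * k) * (norm (fourier f k))\<^sup>2)"
    by (subst integral_mult_right_zero[symmetric]) (simp add: std_normal_density_def)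
  also have "\<dots> = sqrt (2 * pi) / \<epsilon> * (LINT y|lborel. ?p y * (norm (fourier f (y / \<epsilon>)))\<^sup>2)"
    using 3 eps by simp
  also have "\<dots> = sqrt (2 * pi) / \<epsilon> * (LINT x|lborel. f x * (\<epsilon> * (LINT w|lborel. f (x + \<epsilon> * w) * exp (- w\<^sup>2 / 2))))"
    by (simp only: 1 2)
  also have "\<dots> = (LINT x|lborel. f x * (LINT w|lborel. f (x + \<epsilon> * w) * (sqrt (2 * pi) * exp (- w\<^sup>2 / 2))))"
    using eps
    by (simp add: integral_mult_right_zero[symmetric] mult.commute mult.left_commute del: integral_mult_right_zero integral_mult_left_zero integral_divide_zero)
  also have "\<dots> = ?R"
  proof -
    \<comment> \<open>Origin of the factor 2 pi in Plancherel's identity: one sqrt(2 pi) from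
      writing the Gaussian in \<open>k\<close> as a density, one from doing the same with its
      transform in \<open>w\<close>.\<close>
    have "sqrt (2 * pi) * exp (- w\<^sup>2 / 2) = 2 * pi * ?p w" for w
    proof -
      have "2 * pi / sqrt (2 * pi) = sqrt (2 * pi)" by (rule real_div_sqrt) simp
      then show ?thesis by (simp add: std_normal_density_def field_simps)
    qed
    then show ?thesis by simp
  qed
  finally show "?L = ?R" .
qed

text \<open>The Gaussian average is followed to \<epsilon> = 0 on both sides. The left side
  increases as the Gaussian widens, so monotone convergence also gives integrability; the right side
  converges by domination, with \<open>B\<close> supplying the majorant and continuity almost
  everywhere the pointwise limit. Functions with finitely many jumps, such as truncated resolvents,
  are thus covered directly.\<close>

theorem plancherel:
  fixes f :: "real \<Rightarrow> real"
  assumes f: "integrable lborel f" and B: "\<And>x. \<bar>f x\<bar> \<le> B" and cont: "AE x in lborel. isCont f x"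
  shows "integrable lborel (\<lambda>k. (norm (fourier f k))\<^sup>2)"
    and "(LINT k|lborel. (norm (fourier f k))\<^sup>2) = 2 * pi * (LINT x|lborel. (f x)\<^sup>2)"
proof -
  have fm [measurable]: "f \<in> borel_measurable borel" using f by (auto dest: borel_measurable_integrable)
  have Fm [measurable]: "fourier f \<in> borel_measurable borel" using f by measurable
  define e where "e n = 1 / (1 + real n)" for n
  have e0: "e n > 0" for n by (simp add: e_def)
  have elim: "e \<longlonglongrightarrow> 0" unfolding e_def using LIMSEQ_inverse_real_of_nat by (simp add: inverse_eq_divide add.commute)
  have edec: "e n \<le> e m" if "m \<le> n" for m n using that by (simp add: e_def field_simps)
  let ?p = "std_normal_density"
  let ?h = "\<lambda>n k. exp (- (e n * k)\<^sup>2 / 2) * (norm (fourier f k))\<^sup>2"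
  have "(\<lambda>n. LINT x|lborel. f x * (LINT w|lborel. f (x + e n * w) * (2 * pi * ?p w)))
      \<longlonglongrightarrow> (LINT x|lborel. f x * (LINT w|lborel. f x * (2 * pi * ?p w)))"
  proof (rule integral_dominated_convergence[where w = "\<lambda>x. \<bar>f x\<bar> * (LINT w|lborel. B * (2 * pi * ?p w))"])
    show "AE x in lborel. (\<lambda>n. f x * (LINT w|lborel. f (x + e n * w) * (2 * pi * ?p w)))
        \<longlonglongrightarrow> f x * (LINT w|lborel. f x * (2 * pi * ?p w))"
      using cont
    proof eventually_elim
      fix x assume "isCont f x"
      then have "(\<lambda>n. f (x + e n * w)) \<longlonglongrightarrow> f x" for w
      proof -
        have "(\<lambda>n. x + e n * w) \<longlonglongrightarrow> x + 0 * w" by (intro tendsto_intros elim)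
        then show ?thesis using \<open>isCont f x\<close> by (auto intro: isCont_tendsto_compose)
      qed
      then show "(\<lambda>n. f x * (LINT w|lborel. f (x + e n * w) * (2 * pi * ?p w)))
        \<longlonglongrightarrow> f x * (LINT w|lborel. f x * (2 * pi * ?p w))"
        by (intro tendsto_mult tendsto_const integral_dominated_convergence[where w = "\<lambda>w. B * (2 * pi * ?p w)"])
           (auto intro!: tendsto_intros always_eventually simp: abs_mult normal_density_nonneg intro: mult_right_mono B)
    qed
    show "AE x in lborel. norm (f x * (LINT w|lborel. f (x + e n * w) * (2 * pi * ?p w)))
        \<le> \<bar>f x\<bar> * (LINT w|lborel. B * (2 * pi * ?p w))" for n
    proof (rule AE_I2)
      fix x
      have "\<bar>LINT w|lborel. f (x + e n * w) * (2 * pi * ?p w)\<bar> \<le> (LINT w|lborel. \<bar>f (x + e n * w) * (2 * pi * ?p w)\<bar>)"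
        by (rule integral_abs_bound)
      also have "\<dots> \<le> (LINT w|lborel. B * (2 * pi * ?p w))"
      proof (rule integral_mono')
        show "integrable lborel (\<lambda>w. B * (2 * pi * ?p w))" by auto
        show "\<bar>f (x + e n * w) * (2 * pi * ?p w)\<bar> \<le> B * (2 * pi * ?p w)" for w
          using B[of "x + e n * w"] by (simp add: abs_mult normal_density_nonneg mult_right_mono)
        then show "0 \<le> B * (2 * pi * ?p w)" for w by (meson abs_ge_zero order_trans)
      qed
      finally show "norm (f x * (LINT w|lborel. f (x + e n * w) * (2 * pi * ?p w)))
        \<le> \<bar>f x\<bar> * (LINT w|lborel. B * (2 * pi * ?p w))"
        by (simp add: abs_mult mult_left_mono)
    qed
  qed (use f in auto)
  also have "(LINT x|lborel. f x * (LINT w|lborel. f x * (2 * pi * ?p w))) = 2 * pi * (LINT x|lborel. (f x)\<^sup>2)"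
    by (simp add: power2_eq_square mult.assoc)
       (simp add: integral_mult_right_zero[symmetric] mult.commute mult.left_commute del: integral_mult_right_zero integral_mult_left_zero)
  finally have lim: "(\<lambda>n. LINT k|lborel. ?h n k) \<longlonglongrightarrow> 2 * pi * (LINT x|lborel. (f x)\<^sup>2)"
    by (simp only: gaussian_average_fourier(1)[OF f e0])
  have 1: "AE k in lborel. mono (\<lambda>n. ?h n k)"
    by (intro AE_I2 monoI mult_right_mono)
       (auto intro!: divide_right_mono mult_mono power_mono edec less_imp_le[OF e0] simp: power_mult_distrib mult_right_mono)
  have 2: "AE k in lborel. (\<lambda>n. ?h n k) \<longlonglongrightarrow> (norm (fourier f k))\<^sup>2"
  proof (rule AE_I2)
    fix k
    have "(\<lambda>n. ?h n k) \<longlonglongrightarrow> exp (- (0 * k)\<^sup>2 / 2) * (norm (fourier f k))\<^sup>2"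
      by (intro tendsto_intros elim) auto
    then show "(\<lambda>n. ?h n k) \<longlonglongrightarrow> (norm (fourier f k))\<^sup>2" by simp
  qed
  note mc = integral_monotone_convergence_nonneg[OF gaussian_average_fourier(2)[OF f e0] 1 _ 2 lim]
  show "integrable lborel (\<lambda>k. (norm (fourier f k))\<^sup>2)" by (rule mc(1)) auto
  show "(LINT k|lborel. (norm (fourier f k))\<^sup>2) = 2 * pi * (LINT x|lborel. (f x)\<^sup>2)" by (rule mc(2)) auto
qed

subsection \<open>The Laplace transform of the kernel\<close>

locale laplace_kernel =
  fixes b :: "real \<Rightarrow> real"
  assumes locally_integrable: "locally_integrable b" and subexponential: "subexponential b"
begin

text \<open>Extension by zero turns half line integrals and Volterra convolutions into integrals
  over the whole line.\<close>

definition b0 :: "real \<Rightarrow> real" where "b0 t = indicator {0..} t * b t"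

text \<open>\<open>b\<close> is arbitrary on the negative axis, and on the positive axis
  measurability is given for restrictions to bounded intervals, whose limit is
  \<open>b0\<close>.\<close>

lemma borel_measurable_b0 [measurable]: "b0 \<in> borel_measurable borel"
proof (rule borel_measurable_LIMSEQ_metric)
  fix n :: nat
  show "(\<lambda>t. indicator {0..real n} t *\<^sub>R b t) \<in> borel_measurable borel"
    using locally_integrable unfolding locally_integrable_def set_integrable_def
    by (auto dest!: spec[of _ "real n"] borel_measurable_integrable)
next
  fix t :: real
  obtain m where m: "t \<le> real m" using real_arch_simple by blast
  have "\<forall>\<^sub>F n in sequentially. indicator {0..real n} t *\<^sub>R b t = b0 t"
    using eventually_ge_at_top[of m]
    by eventually_elim (use m in \<open>auto simp: b0_def indicator_def\<close>)
  then show "(\<lambda>n. indicator {0..real n} t *\<^sub>R b t) \<longlonglongrightarrow> b0 t"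
    by (rule tendsto_eventually)
qed

lemma integrable_exp_b0:
  assumes "a > 0"
  shows "integrable lborel (\<lambda>t. exp (- a * t) * b0 t)"
proof (rule Bochner_Integration.integrable_bound)
  show "integrable lborel (\<lambda>t. indicator {0..} t *\<^sub>R (exp (- a * t) * \<bar>b t\<bar>))"
    using subexponential assms unfolding subexponential_def set_integrable_def by auto
  show "AE t in lborel. norm (exp (- a * t) * b0 t) \<le> norm (indicator {0..} t *\<^sub>R (exp (- a * t) * \<bar>b t\<bar>))"
    by (auto simp: b0_def abs_mult)
qed measurable

lemma laplace_eq: "laplace b z = (LINT t|lborel. exp (- z * of_real t) * of_real (b0 t))"
  unfolding laplace_def set_lebesgue_integral_def b0_def
  by (intro Bochner_Integration.integral_cong) (auto simp: indicator_def)

lemma integrable_laplace: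
  assumes "Re z > 0"
  shows "integrable lborel (\<lambda>t. exp (- z * of_real t) * complex_of_real (b0 t))"
  by (rule Bochner_Integration.integrable_bound[OF integrable_exp_b0[OF assms]])
     (auto simp: norm_mult)

lemma norm_exp_minus_one_le: "norm (exp w - 1) \<le> norm w * exp (norm w)" for w :: complex
proof -
  have "norm (exp w - exp 0) \<le> exp (norm w) * norm (w - 0)"
    by (rule field_differentiable_bound[where S = "cball 0 (norm w)" and f' = exp])
       (auto intro!: derivative_eq_intros order_trans[OF norm_exp] order_trans[OF complex_Re_le_cmod])
  then show ?thesis by (simp add: mult.commute)
qed

lemma laplace_has_field_derivative:
  assumes z: "Re z > 0"
  shows "(laplace b has_field_derivative
     (LINT t|lborel. - of_real t * (exp (- z * of_real t) * complex_of_real (b0 t)))) (at z)"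
proof -
  define x where "x = Re z"
  have x: "x > 0" using z by (simp add: x_def)
  let ?D = "LINT t|lborel. - of_real t * (exp (- z * of_real t) * complex_of_real (b0 t))"
  \<comment> \<open>Increments \<open>h\<close> with |h| < x/2 keep z + h in the half plane and let
    exp(-x t) absorb the growth of the difference quotient.\<close>
  have at: "at (0::complex) = at 0 within (ball 0 (x/2))"
    by (rule at_within_open[symmetric]) (use x in auto)
  have "((\<lambda>h. (laplace b (z + h) - laplace b z) / h) \<longlongrightarrow> ?D) (at 0 within (ball 0 (x/2)))"
    unfolding tendsto_at_iff_sequentially
  proof (intro allI impI)
    fix X :: "nat \<Rightarrow> complex" assume X: "\<forall>i. X i \<in> ball 0 (x / 2) - {0}" and X0: "X \<longlonglongrightarrow> 0"
    have Xn: "norm (X i) < x/2" "X i \<noteq> 0" for i using X by (auto simp: dist_norm norm_minus_commute)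
    have eq: "(laplace b (z + X i) - laplace b z) / X i
        = (LINT t|lborel. (exp (- X i * of_real t) - 1) / X i * (exp (- z * of_real t) * complex_of_real (b0 t)))" for i
    proof -
      have c: "Re (z + X i) > 0" using Xn(1)[of i] abs_Re_le_cmod[of "X i"] x by (auto simp: x_def)
      have "laplace b (z + X i) - laplace b z
        = (LINT t|lborel. exp (- (z + X i) * of_real t) * of_real (b0 t) - exp (- z * of_real t) * of_real (b0 t))"
        unfolding laplace_eq
        by (intro Bochner_Integration.integral_diff[symmetric] integrable_laplace z c)
      also have "\<dots> = (LINT t|lborel. X i * ((exp (- X i * of_real t) - 1) / X i * (exp (- z * of_real t) * complex_of_real (b0 t))))"
      proof (intro Bochner_Integration.integral_cong refl)
        fix t :: real
        have "exp (- (z + X i) * of_real t) = exp (- X i * of_real t) * exp (- z * of_real t)"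
          by (simp add: exp_add[symmetric] algebra_simps)
        then show "exp (- (z + X i) * of_real t) * of_real (b0 t) - exp (- z * of_real t) * of_real (b0 t)
            = X i * ((exp (- X i * of_real t) - 1) / X i * (exp (- z * of_real t) * complex_of_real (b0 t)))"
          using Xn(2)[of i] by (simp only:) (simp add: field_simps)
      qed
      finally show ?thesis using Xn(2)[of i] by simp
    qed
    show "((\<lambda>h. (laplace b (z + h) - laplace b z) / h) \<circ> X) \<longlonglongrightarrow> ?D"
      unfolding o_def eq
    \<comment> \<open>Budget of exponents: the quotient is at most t exp(|h| t). The rate x/2 pays
      for |h|, the rate x/4 for the factor \<open>t\<close>, and x/4 of the decay remains.\<close>
    proof (rule integral_dominated_convergence[where w = "\<lambda>t. 4 / x * \<bar>exp (- (x/4) * t) * b0 t\<bar>"])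
      show "integrable lborel (\<lambda>t. 4 / x * \<bar>exp (- (x/4) * t) * b0 t\<bar>)"
        using integrable_exp_b0[of "x/4"] x by auto
      show "AE t in lborel. (\<lambda>i. (exp (- X i * of_real t) - 1) / X i * (exp (- z * of_real t) * complex_of_real (b0 t)))
          \<longlonglongrightarrow> - of_real t * (exp (- z * of_real t) * complex_of_real (b0 t))"
      proof (rule AE_I2, rule tendsto_mult_right)
        fix t :: real
        have "((\<lambda>h. exp (- h * of_real t)) has_field_derivative - of_real t) (at 0)"
          by (auto intro!: derivative_eq_intros)
        then have "((\<lambda>h. (exp (- h * complex_of_real t) - 1) / h) \<longlongrightarrow> - of_real t) (at 0)"
          by (simp add: has_field_derivative_iff)
        then show "(\<lambda>i. (exp (- X i * of_real t) - 1) / X i) \<longlonglongrightarrow> - complex_of_real t"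
          unfolding tendsto_at_iff_sequentially using X0 Xn by (auto simp: o_def)
      qed
      show "AE t in lborel. norm ((exp (- X i * of_real t) - 1) / X i * (exp (- z * of_real t) * complex_of_real (b0 t)))
          \<le> 4 / x * \<bar>exp (- (x/4) * t) * b0 t\<bar>" for i
      proof (rule AE_I2)
        fix t :: real
        show "norm ((exp (- X i * of_real t) - 1) / X i * (exp (- z * of_real t) * complex_of_real (b0 t)))
          \<le> 4 / x * \<bar>exp (- (x/4) * t) * b0 t\<bar>"
        proof (cases "t \<ge> 0")
          case False then show ?thesis by (simp add: b0_def)
        next
          case True
          have 0: "norm (exp (- X i * of_real t) - 1) \<le> norm (X i) * t * exp (norm (X i) * t)"
            using norm_exp_minus_one_le[of "- X i * of_real t"] True by (simp add: norm_mult)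
          have "norm ((exp (- X i * of_real t) - 1) / X i) \<le> t * exp (norm (X i) * t)"
            using 0 Xn(2)[of i] by (simp add: norm_divide divide_le_eq mult_ac)
          also have "\<dots> \<le> t * exp (x/2 * t)"
            using mult_right_mono[OF less_imp_le[OF Xn(1)[of i]] True] True by (intro mult_left_mono) auto
          also have "t * exp (x/2 * t) \<le> 4 / x * exp (x/4 * t) * exp (x/2 * t)"
          proof (rule mult_right_mono)
            have "x/4*t \<le> exp (x/4*t)" using exp_ge_add_one_self[of "x/4*t"] by linarith
            then show "t \<le> 4 / x * exp (x/4 * t)" using x by (simp add: field_simps)
          qed simp
          finally have 1: "norm ((exp (- X i * of_real t) - 1) / X i) \<le> 4 / x * exp (x/4 * t) * exp (x/2 * t)" .
          have "norm ((exp (- X i * of_real t) - 1) / X i * (exp (- z * of_real t) * complex_of_real (b0 t)))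
              = norm ((exp (- X i * of_real t) - 1) / X i) * (exp (- x * t) * \<bar>b0 t\<bar>)"
            unfolding norm_mult by (simp add: x_def)
          also have "\<dots> \<le> (4 / x * exp (x/4 * t) * exp (x/2 * t)) * (exp (- x * t) * \<bar>b0 t\<bar>)"
            by (rule mult_right_mono[OF 1]) auto
          also have "\<dots> = 4 / x * (exp (x/4 * t) * exp (x/2 * t) * exp (- x * t)) * \<bar>b0 t\<bar>" by simp
          also have "exp (x/4 * t) * exp (x/2 * t) * exp (- x * t) = exp (- (x/4) * t)"
            by (simp add: exp_add[symmetric]) 
          finally show ?thesis by (simp add: abs_mult)
        qed
      qed
    qed auto
  qed
  then show ?thesis unfolding DERIV_def at[symmetric] .
qed

lemma laplace_differentiable: "Re z > 0 \<Longrightarrow> (laplace b has_field_derivative deriv (laplace b) z) (at z)"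
  using laplace_has_field_derivative DERIV_deriv_iff_field_differentiable field_differentiable_def by blast

end

text \<open>Gronwall along a segment: \<open>\<tau> \<mapsto> exp (- 2 C |z\<^sub>1 - z\<^sub>0| \<tau>) |f|\<^sup>2\<close> decreases.\<close>

lemma norm_le_exp_segment:
  fixes f f' :: "complex \<Rightarrow> complex"
  assumes der: "\<And>\<zeta>. \<zeta> \<in> closed_segment z0 z1 \<Longrightarrow> (f has_field_derivative f' \<zeta>) (at \<zeta>)"
    and le: "\<And>\<zeta>. \<zeta> \<in> closed_segment z0 z1 \<Longrightarrow> norm (f' \<zeta>) \<le> C * norm (f \<zeta>)"
  shows "norm (f z1) \<le> exp (C * norm (z1 - z0)) * norm (f z0)"
proof -
  define d where "d = z1 - z0"
  define p where "p \<tau> = z0 + of_real \<tau> * d" for \<tau> :: real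
  have p: "p \<tau> \<in> closed_segment z0 z1" if "0 \<le> \<tau>" "\<tau> \<le> 1" for \<tau>
    unfolding in_segment p_def d_def using that
    by (intro exI[of _ \<tau>]) (auto simp: scaleR_conv_of_real algebra_simps)
  have 1: "((\<lambda>\<tau>. f (p \<tau>)) has_vector_derivative (d * f' (p \<tau>))) (at \<tau>)" if "0 \<le> \<tau>" "\<tau> \<le> 1" for \<tau>
  proof -
    have "(p has_vector_derivative d) (at \<tau>)"
      unfolding p_def by (auto intro!: derivative_eq_intros has_vector_derivative_real_field)
    from field_vector_diff_chain_at[OF this der[OF p[OF that]]] show ?thesis by (simp add: o_def)
  qed
  let ?g = "\<lambda>\<tau>. exp (- (2 * C * norm d) * \<tau>) * (f (p \<tau>) \<bullet> f (p \<tau>))"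
  let ?g' = "\<lambda>\<tau>. exp (- (2 * C * norm d) * \<tau>) * (2 * (f (p \<tau>) \<bullet> (d * f' (p \<tau>))) - 2 * C * norm d * (f (p \<tau>) \<bullet> f (p \<tau>)))"
  have 2: "(?g has_real_derivative ?g' \<tau>) (at \<tau>)" if "0 \<le> \<tau>" "\<tau> \<le> 1" for \<tau>
  proof -
    have "((\<lambda>\<tau>. f (p \<tau>) \<bullet> f (p \<tau>)) has_real_derivative (2 * (f (p \<tau>) \<bullet> (d * f' (p \<tau>))))) (at \<tau>)"
      using has_derivative_inner[OF 1[OF that, unfolded has_vector_derivative_def] 1[OF that, unfolded has_vector_derivative_def]]
      unfolding has_field_derivative_def
      by (rule has_derivative_eq_rhs) (auto simp: inner_commute algebra_simps)
    then show ?thesis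
      by (auto intro!: derivative_eq_intros simp: algebra_simps)
  qed
  have 3: "?g' \<tau> \<le> 0" if "0 \<le> \<tau>" "\<tau> \<le> 1" for \<tau>
  proof -
    have "f (p \<tau>) \<bullet> (d * f' (p \<tau>)) \<le> norm (f (p \<tau>)) * norm (d * f' (p \<tau>))"
      by (rule norm_cauchy_schwarz)
    also have "\<dots> \<le> norm (f (p \<tau>)) * (norm d * (C * norm (f (p \<tau>))))"
      unfolding norm_mult by (intro mult_left_mono le p that) auto
    also have "\<dots> = C * norm d * (f (p \<tau>) \<bullet> f (p \<tau>))"
      by (simp add: power2_norm_eq_inner[symmetric] power2_eq_square)
    finally show ?thesis by (intro mult_nonneg_nonpos) auto
  qed
  have "?g 1 \<le> ?g 0"
    by (rule DERIV_nonpos_imp_nonincreasing[of 0 1]) (use 2 3 in auto)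
  then have "exp (- (2 * C * norm d)) * (norm (f z1))\<^sup>2 \<le> (norm (f z0))\<^sup>2"
    by (simp add: p_def d_def power2_norm_eq_inner)
  then have "(norm (f z1))\<^sup>2 \<le> exp (2 * C * norm d) * (norm (f z0))\<^sup>2"
    by (simp add: exp_minus field_simps)
  also have "\<dots> = (exp (C * norm d) * norm (f z0))\<^sup>2"
    by (simp add: power_mult_distrib exp_double[symmetric] mult.assoc)
  finally show ?thesis unfolding d_def by (rule power2_le_imp_le) auto
qed

text \<open>The constant is the cosine of the supremum of |Arg|. That supremum is meaningful as a
  real number because \<open>Arg\<close> is bounded by pi.\<close>

lemma sector_real_part:
  assumes "sectorial_lt_half_pi b"
  obtains \<delta> where "\<delta> > 0" "\<delta> \<le> 1" "\<And>z. Re z > 0 \<Longrightarrow> Re (laplace b z) \<ge> \<delta> * norm (laplace b z)"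
proof -
  define \<phi> where "\<phi> = (SUP z\<in>{z. Re z > 0}. \<bar>Arg (laplace b z)\<bar>)"
  have bdd: "bdd_above ((\<lambda>z. \<bar>Arg (laplace b z)\<bar>) ` {z. Re z > 0})"
    by (rule bdd_aboveI[of _ pi]) (use Arg_bounded in \<open>auto simp: abs_le_iff intro: less_imp_le order.trans\<close>, smt (verit) Arg_bounded)
  have le: "\<bar>Arg (laplace b z)\<bar> \<le> \<phi>" if "Re z > 0" for z
    unfolding \<phi>_def by (rule cSUP_upper[OF _ bdd]) (use that in auto)
  have \<phi>: "0 \<le> \<phi>" "\<phi> < pi/2" using le[of 1] assms by (auto simp: \<phi>_def sectorial_lt_half_pi_def)
  show ?thesis
  proof (rule that[of "cos \<phi>"])
    show "cos \<phi> > 0" using \<phi> by (intro cos_gt_zero_pi) auto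
    fix z :: complex assume z: "Re z > 0"
    have "cos \<phi> \<le> cos \<bar>Arg (laplace b z)\<bar>" using le[OF z] \<phi> by (intro cos_monotone_0_pi_le) auto
    then have "cos \<phi> * norm (laplace b z) \<le> cos (Arg (laplace b z)) * norm (laplace b z)"
      by (intro mult_right_mono) auto
    also have "\<dots> = Re (laplace b z)" by (cases "laplace b z = 0") (auto simp: cos_Arg)
    finally show "Re (laplace b z) \<ge> cos \<phi> * norm (laplace b z)" .
  qed auto
qed

text \<open>No cancellation occurs between a point of the right half plane and a point of a strictly
  smaller sector: the real part of the sum controls \<open>w\<close>, and the triangle inequality
  then controls \<open>z\<close>. With w = \<mu> b^(z) this makes the symbol z + \<mu> b^(z)
  comparable to the sum of the moduli.\<close>

lemma norm_add_sector_ge: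
  fixes z w :: complex
  assumes "Re z \<ge> 0" "Re w \<ge> \<delta> * norm w" "0 < \<delta>" "\<delta> \<le> 1"
  shows "norm z + norm w \<le> 3 / \<delta> * norm (z + w)"
proof -
  have "\<delta> * norm w \<le> norm (z + w)"
    using assms complex_Re_le_cmod[of "z + w"] by auto
  then have w: "norm w \<le> norm (z + w) / \<delta>" using assms by (simp add: field_simps)
  have "norm z \<le> norm (z + w) + norm w" using norm_triangle_ineq4[of "z + w" w] by simp
  moreover have "norm (z + w) \<le> norm (z + w) / \<delta>" using assms mult_right_mono[of \<delta> 1 "norm (z + w)"] by (simp add: field_simps)
  ultimately have "norm z + norm w \<le> 3 * (norm (z + w) / \<delta>)" using w by linarith
  then show ?thesis by simp
qed

section \<open>Convolution forms on the Fourier side\<close>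

lemma fourier_shift:
  "fourier (\<lambda>x. f (x - z)) k = iexp (- (k * z)) * fourier f k"
proof -
  have "fourier (\<lambda>x. f (x - z)) k = (LINT x|lborel. iexp (- (k * (z + 1 * x))) * complex_of_real (f ((z + 1 * x) - z)))"
    unfolding fourier_def by (subst lborel_integral_real_affine[of 1 _ z]) auto
  also have "\<dots> = (LINT x|lborel. iexp (- (k * z)) * (iexp (- (k * x)) * complex_of_real (f x)))"
    by (intro Bochner_Integration.integral_cong) (auto simp: exp_add[symmetric] algebra_simps)
  finally show ?thesis unfolding fourier_def by simp
qed

lemma integrable_fourier_integrand:
  "integrable lborel f \<Longrightarrow> integrable lborel (\<lambda>x. iexp (- (k * x)) * complex_of_real (f x))"
  using integrable_iexp_times[of f "-k"] by simp

lemma fourier_add: "integrable lborel f \<Longrightarrow> integrable lborel g \<Longrightarrow>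
    fourier (\<lambda>x. f x + g x) k = fourier f k + fourier g k"
  unfolding fourier_def
  by (simp only: of_real_add distrib_left) (intro Bochner_Integration.integral_add integrable_fourier_integrand)

lemma fourier_diff: "integrable lborel f \<Longrightarrow> integrable lborel g \<Longrightarrow>
    fourier (\<lambda>x. f x - g x) k = fourier f k - fourier g k"
  unfolding fourier_def
  by (simp only: of_real_diff right_diff_distrib) (intro Bochner_Integration.integral_diff integrable_fourier_integrand)

lemma integrable_shift: "integrable lborel (f::real \<Rightarrow> real) \<Longrightarrow> integrable lborel (\<lambda>x. f (x - z))"
  using lborel_integrable_real_affine[of f 1 "-z"] by (simp add: add.commute)

lemma integral_shift: "(LINT x|lborel. f (x - z)) = (LINT x|lborel. (f :: real \<Rightarrow> real) x)"
  by (subst lborel_integral_real_affine[of 1 _ z]) auto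

lemma AE_isCont_shift:
  fixes f :: "real \<Rightarrow> real"
  assumes "AE x in lborel. isCont f x"
  shows "AE x in lborel. isCont (\<lambda>x. f (x - z)) x"
proof -
  obtain N where N: "{x. \<not> isCont f x} \<subseteq> N" "N \<in> null_sets lborel"
    using assms by (auto elim!: AE_E simp: null_sets_def)
  have "AE x in lborel. x \<notin> N" using N(2) by (rule AE_not_in)
  have "AE x in lborel. - z + 1 * x \<notin> N"
    using \<open>AE x in lborel. x \<notin> N\<close> N(2) by (intro AE_borel_affine) (auto simp: null_sets_def)
  then show ?thesis
  proof eventually_elim
    fix x assume "- z + 1 * x \<notin> N"
    then have "x - z \<notin> N" by (simp add: add.commute)
    then have "isCont f (x - z)" using N by auto
    then show "isCont (\<lambda>x. f (x - z)) x"
      by (intro isCont_o2[where g = f and f = "\<lambda>x. x - z"] continuous_intros) auto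
  qed
qed

lemma norm_one_plus_minus_iexp:
  "(norm (1 + iexp a))\<^sup>2 - (norm (1 - iexp a))\<^sup>2 = 4 * cos a"
  unfolding cmod_power2 by (simp add: Re_exp Im_exp power2_eq_square algebra_simps)

text \<open>Polarisation: 4 f(x) f(x - z) is the difference of the squares of f + f(. - z) and f -
  f(. - z), both real functions to which \<open>plancherel\<close> applies. The transforms differ
  from that of \<open>f\<close> by the factors 1 + exp(-ikz) and 1 - exp(-ikz), whose squared moduli
  differ by 4 cos(kz).\<close>

lemma autocorrelation_fourier:
  fixes f :: "real \<Rightarrow> real"
  assumes f: "integrable lborel f" and B: "\<And>x. \<bar>f x\<bar> \<le> B" and cont: "AE x in lborel. isCont f x"
  shows "2 * pi * (LINT x|lborel. f x * f (x - z)) = (LINT k|lborel. (norm (fourier f k))\<^sup>2 * cos (k * z))"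
proof -
  have fm [measurable]: "f \<in> borel_measurable borel" using f by (auto dest: borel_measurable_integrable)
  let ?p = "\<lambda>x. f x + f (x - z)" and ?m = "\<lambda>x. f x - f (x - z)"
  note fs = integrable_shift[OF f, of z]
  have Bz: "\<bar>f (x - z)\<bar> \<le> B" for x by (rule B)
  have c: "AE x in lborel. isCont ?p x" "AE x in lborel. isCont ?m x"
    using cont AE_isCont_shift[OF cont, of z] by (eventually_elim, auto)+
  have b: "\<bar>?p x\<bar> \<le> 2 * B" "\<bar>?m x\<bar> \<le> 2 * B" for x using B[of x] Bz[of x] by auto
  have i: "integrable lborel ?p" "integrable lborel ?m" using f fs by auto
  note P = plancherel[OF i(1) b(1) c(1)] and M = plancherel[OF i(2) b(2) c(2)]
  have sq: "integrable lborel (\<lambda>x. g x * h x)" if "integrable lborel g" "\<And>x. \<bar>h x\<bar> \<le> C" "h \<in> borel_measurable borel" for g h :: "real \<Rightarrow> real" and C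
  proof (rule Bochner_Integration.integrable_bound[OF integrable_mult_right[OF that(1), of C]])
    show "(\<lambda>x. g x * h x) \<in> borel_measurable lborel"
      using that borel_measurable_integrable[OF that(1)] by auto
    show "AE x in lborel. norm (g x * h x) \<le> norm (C * g x)"
    proof (rule AE_I2)
      fix x
      have "\<bar>h x\<bar> \<le> \<bar>C\<bar>" using that(2)[of x] by linarith
      from mult_left_mono[OF this, of "\<bar>g x\<bar>"] show "norm (g x * h x) \<le> norm (C * g x)"
        by (simp add: abs_mult mult.commute)
    qed
  qed
  have s1: "integrable lborel (\<lambda>x. (?p x)\<^sup>2)" "integrable lborel (\<lambda>x. (?m x)\<^sup>2)"
    unfolding power2_eq_square by (rule sq[OF i(1) b(1)] sq[OF i(2) b(2)]; measurable)+
  have "4 * (LINT x|lborel. f x * f (x - z)) = (LINT x|lborel. (?p x)\<^sup>2 - (?m x)\<^sup>2)"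
    by (subst integral_mult_right_zero[symmetric], intro Bochner_Integration.integral_cong)
       (auto simp: power2_eq_square algebra_simps)
  also have "\<dots> = (LINT x|lborel. (?p x)\<^sup>2) - (LINT x|lborel. (?m x)\<^sup>2)"
    by (rule Bochner_Integration.integral_diff[OF s1])
  finally have "2 * pi * (4 * (LINT x|lborel. f x * f (x - z)))
      = 2 * pi * ((LINT x|lborel. (?p x)\<^sup>2) - (LINT x|lborel. (?m x)\<^sup>2))"
    by (simp only:)
  then have "4 * (2 * pi * (LINT x|lborel. f x * f (x - z)))
      = 2 * pi * (LINT x|lborel. (?p x)\<^sup>2) - 2 * pi * (LINT x|lborel. (?m x)\<^sup>2)"
    by (simp add: algebra_simps)
  also have "\<dots> = (LINT k|lborel. (norm (fourier ?p k))\<^sup>2 - (norm (fourier ?m k))\<^sup>2)"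
    unfolding P(2)[symmetric] M(2)[symmetric]
    by (rule Bochner_Integration.integral_diff[OF P(1) M(1), symmetric])
  also have "\<dots> = (LINT k|lborel. 4 * ((norm (fourier f k))\<^sup>2 * cos (k * z)))"
  proof (intro Bochner_Integration.integral_cong refl)
    fix k
    have 1: "fourier ?p k = (1 + iexp (- (k * z))) * fourier f k" "fourier ?m k = (1 - iexp (- (k * z))) * fourier f k"
      by (simp_all only: fourier_add[OF f fs] fourier_diff[OF f fs] fourier_shift) (auto simp: algebra_simps)
    show "(norm (fourier ?p k))\<^sup>2 - (norm (fourier ?m k))\<^sup>2 = 4 * ((norm (fourier f k))\<^sup>2 * cos (k * z))"
      unfolding 1 norm_mult power_mult_distrib left_diff_distrib[symmetric] norm_one_plus_minus_iexp by simp
  qed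
  finally show ?thesis by simp
qed

lemma integral_reflect_shift:
  "(LINT y|lborel. g (x - y)) = (LINT y|lborel. (g :: real \<Rightarrow> 'a::{banach,second_countable_topology}) y)"
  by (subst lborel_integral_real_affine[of "-1" _ x]) auto

text \<open>The form is the integral of \<open>c\<close> against the autocorrelation of
  \<open>f\<close>, and the latter is the cosine transform of |f^|^2 / (2 pi). Exchanging the
  integrals leaves |f^|^2 times the real part of the transform of \<open>c\<close>.\<close>

lemma convolution_form_nonneg:
  fixes f c :: "real \<Rightarrow> real"
  assumes f: "integrable lborel f" and B: "\<And>x. \<bar>f x\<bar> \<le> B" and cont: "AE x in lborel. isCont f x"
    and c: "integrable lborel c" and pos: "\<And>k. Re (fourier c k) \<ge> 0"
  shows "(LINT x|lborel. f x * (LINT y|lborel. c (x - y) * f y)) \<ge> 0"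
    and "integrable lborel (\<lambda>x. f x * (LINT y|lborel. c (x - y) * f y))"
proof -
  have fm [measurable]: "f \<in> borel_measurable borel" using f by (auto dest: borel_measurable_integrable)
  have cm [measurable]: "c \<in> borel_measurable borel" using c by (auto dest: borel_measurable_integrable)
  have Fm [measurable]: "fourier f \<in> borel_measurable borel" using f by measurable
  have conv: "(LINT y|lborel. c (x - y) * f y) = (LINT z|lborel. c z * f (x - z))" for x
    using integral_reflect_shift[of "\<lambda>y. c (x - y) * f y" x] by simp
  have mes: "(\<lambda>(x, z). f x * (c z * f (x - z))) \<in> borel_measurable (lborel \<Otimes>\<^sub>M lborel)" by measurable
  have le: "norm (f x * (c z * f (x - z))) \<le> (\<bar>f x\<bar>) * (\<bar>c z\<bar> * B)" for x z
    using B[of "x - z"] by (auto simp: abs_mult intro!: mult_left_mono)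
  have intb: "integrable lborel (\<lambda>x. \<bar>f x\<bar>)" "integrable lborel (\<lambda>z. \<bar>c z\<bar> * B)" using f c by auto
  note Fub = Fubini_tensor_bound[OF mes intb le]
  show "integrable lborel (\<lambda>x. f x * (LINT y|lborel. c (x - y) * f y))"
    using Fub(2) by (simp add: conv)
  have pl: "integrable lborel (\<lambda>k. (norm (fourier f k))\<^sup>2)" by (rule plancherel(1)[OF f B cont])
  have "2 * pi * (LINT x|lborel. f x * (LINT y|lborel. c (x - y) * f y))
      = 2 * pi * (LINT x|lborel. LINT z|lborel. f x * (c z * f (x - z)))"
    by (simp add: conv)
  also have "\<dots> = 2 * pi * (LINT z|lborel. LINT x|lborel. f x * (c z * f (x - z)))"
    by (simp only: Fub(1))
  also have "\<dots> = (LINT z|lborel. c z * (2 * pi * (LINT x|lborel. f x * f (x - z))))"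
    by (simp add: mult_ac flip: integral_mult_right_zero)
  also have "\<dots> = (LINT z|lborel. LINT k|lborel. c z * ((norm (fourier f k))\<^sup>2 * cos (k * z)))"
    by (simp only: autocorrelation_fourier[OF f B cont] integral_mult_right_zero)
  also have "\<dots> = (LINT k|lborel. LINT z|lborel. c z * ((norm (fourier f k))\<^sup>2 * cos (k * z)))"
  proof (rule Fubini_tensor_bound(1)[where f = "\<lambda>z. \<bar>c z\<bar>" and g = "\<lambda>k. (norm (fourier f k))\<^sup>2"])
    show "norm (c z * ((norm (fourier f k))\<^sup>2 * cos (k * z))) \<le> \<bar>c z\<bar> * (norm (fourier f k))\<^sup>2" for z k
      by (auto simp: abs_mult intro!: mult_left_mono mult_right_le_one_le)
  qed (use c pl in auto)
  also have "\<dots> = (LINT k|lborel. (norm (fourier f k))\<^sup>2 * Re (fourier c k))"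
  proof (intro Bochner_Integration.integral_cong refl)
    fix k
    have "Re (fourier c k) = (LINT z|lborel. Re (iexp (- (k * z)) * complex_of_real (c z)))"
      unfolding fourier_def by (rule integral_Re[symmetric]) (rule integrable_fourier_integrand[OF c])
    also have "\<dots> = (LINT z|lborel. c z * cos (k * z))"
      by (simp add: Re_exp mult.commute)
    finally show "(LINT z|lborel. c z * ((norm (fourier f k))\<^sup>2 * cos (k * z))) = (norm (fourier f k))\<^sup>2 * Re (fourier c k)"
      by (simp add: mult_ac flip: integral_mult_right_zero)
  qed
  also have "\<dots> \<ge> 0"
    by (rule integral_nonneg_AE) (use pos in auto)
  finally show "(LINT x|lborel. f x * (LINT y|lborel. c (x - y) * f y)) \<ge> 0"
    using pi_gt_zero by (simp add: zero_le_mult_iff)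
qed

text \<open>Applied to functions that already carry the factor exp(-z t), this is the product rule
  for Laplace transforms.\<close>

lemma convolution_integral:
  fixes p q :: "real \<Rightarrow> complex"
  assumes p: "integrable lborel p" and q: "integrable lborel q"
  shows "integrable lborel (\<lambda>t. LINT \<sigma>|lborel. p (t - \<sigma>) * q \<sigma>)"
    and "(LINT t|lborel. LINT \<sigma>|lborel. p (t - \<sigma>) * q \<sigma>) = (LINT t|lborel. p t) * (LINT t|lborel. q t)"
proof -
  have [measurable]: "p \<in> borel_measurable borel" "q \<in> borel_measurable borel"
    using p q by (auto dest: borel_measurable_integrable)
  have sh: "integrable lborel (\<lambda>t. p (t - \<sigma>))" for \<sigma>
    using lborel_integrable_real_affine[OF p, of 1 "-\<sigma>"] by (simp add: add.commute)
  have ish: "(LINT t|lborel. g (t - \<sigma>)) = (LINT t|lborel. g t)" for \<sigma> and g :: "real \<Rightarrow> 'b::{banach,second_countable_topology}"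
    by (subst lborel_integral_real_affine[of 1 _ \<sigma>]) auto
  have *: "integrable (lborel \<Otimes>\<^sub>M lborel) (\<lambda>(\<sigma>, t). p (t - \<sigma>) * q \<sigma>)"
  proof (rule lborel_pair.Fubini_integrable)
    show "integrable lborel (\<lambda>\<sigma>. LINT t|lborel. norm (case (\<sigma>, t) of (\<sigma>, t) \<Rightarrow> p (t - \<sigma>) * q \<sigma>))"
      using q by (simp add: norm_mult ish[of "\<lambda>x. norm (p x)"])
    show "AE \<sigma> in lborel. integrable lborel (\<lambda>t. case (\<sigma>, t) of (\<sigma>, t) \<Rightarrow> p (t - \<sigma>) * q \<sigma>)"
      using sh by auto
  qed measurable
  then have **: "integrable (lborel \<Otimes>\<^sub>M lborel) (\<lambda>(t, \<sigma>). p (t - \<sigma>) * q \<sigma>)"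
    by (subst lborel_pair.integrable_product_swap_iff[symmetric]) (simp add: case_prod_beta')
  show "integrable lborel (\<lambda>t. LINT \<sigma>|lborel. p (t - \<sigma>) * q \<sigma>)"
    using lborel_pair.integrable_fst'[OF **] by simp
  have "(LINT t|lborel. LINT \<sigma>|lborel. p (t - \<sigma>) * q \<sigma>) = (LINT \<sigma>|lborel. LINT t|lborel. p (t - \<sigma>) * q \<sigma>)"
    using lborel_pair.Fubini_integral[OF *] by simp
  also have "\<dots> = (LINT t|lborel. p t) * (LINT t|lborel. q t)"
    by (simp add: ish)
  finally show "(LINT t|lborel. LINT \<sigma>|lborel. p (t - \<sigma>) * q \<sigma>) = (LINT t|lborel. p t) * (LINT t|lborel. q t)" .
qed

subsection \<open>The scalar Volterra equation\<close>

lemma AE_isCont_cofinite: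
  fixes f :: "real \<Rightarrow> real"
  assumes "open U" "continuous_on U f" "finite (- U)"
  shows "AE x in lborel. isCont f x"
proof -
  have "AE x in lborel. x \<notin> - U"
    using assms(3) by (intro AE_not_in finite_imp_null_set_lborel)
  then show ?thesis
    by eventually_elim (use assms in \<open>auto simp: continuous_on_eq_continuous_at\<close>)
qed

text \<open>\<open>pos\<close> says that the kernel is of positive type, which drives the energy
  estimate. The quantitative sector constant is passed separately to the lemmas that divide by the
  symbol.\<close>

locale scalar_volterra = laplace_kernel +
  fixes \<mu> :: real and u :: "real \<Rightarrow> real"
  assumes mu: "\<mu> > 0" and res: "scalar_resolvent b \<mu> u"
    and pos: "\<And>z. Re z > 0 \<Longrightarrow> Re (laplace b z) \<ge> 0"
begin

definition u0 :: "real \<Rightarrow> real" where "u0 t = indicator {0..} t * u t"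
definition conv :: "real \<Rightarrow> real" where "conv t = (LINT \<sigma>|lborel. b0 (t - \<sigma>) * u0 \<sigma>)"

lemma deriv_u: "t \<ge> 0 \<Longrightarrow> (u has_real_derivative - \<mu> * conv t) (at t within {0..})"
proof -
  assume t: "t \<ge> 0"
  have "(LBINT \<sigma>:{0..t}. b (t - \<sigma>) * u \<sigma>) = conv t"
    unfolding set_lebesgue_integral_def conv_def b0_def u0_def
    by (intro Bochner_Integration.integral_cong) (auto simp: indicator_def)
  then show ?thesis using res t unfolding scalar_resolvent_def by auto
qed

lemma u_zero [simp]: "u 0 = 1" using res by (simp add: scalar_resolvent_def)

lemma continuous_u: "continuous_on {0..} u"
  by (rule DERIV_continuous_on) (rule deriv_u, simp)

lemma borel_measurable_u0 [measurable]: "u0 \<in> borel_measurable borel"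
  using borel_measurable_continuous_on_indicator[OF _ continuous_u] by (simp add: u0_def[abs_def])

lemma fourier_exp_b0:
  assumes "a > 0"
  shows "fourier (\<lambda>t. exp (- a * t) * b0 t) k = laplace b (Complex a k)"
  unfolding fourier_def laplace_eq
proof (intro Bochner_Integration.integral_cong refl)
  fix x
  have "iexp (- (k * x)) * of_real (exp (- a * x)) = exp (- Complex a k * of_real x)"
    unfolding exp_of_real[symmetric] exp_add[symmetric] by (simp add: Complex_eq algebra_simps)
  then show "iexp (- (k * x)) * of_real (exp (- a * x) * b0 x) = exp (- Complex a k * of_real x) * of_real (b0 x)"
    by (simp add: mult.assoc[symmetric])
qed

text \<open>Energy estimate: the kernel is of positive type, so \<open>exp (- a t) |u t|\<close> stays below its
  initial value.\<close>

lemma resolvent_le_exp: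
  assumes a: "a > 0" and "\<tau> \<ge> 0"
  shows "\<bar>u \<tau>\<bar> \<le> exp (a * \<tau>)"
proof (cases "\<tau> = 0")
  case False
  with assms have \<tau>: "\<tau> > 0" by simp
  define c where "c t = exp (- a * t) * b0 t" for t
  \<comment> \<open>Truncation at \<tau> makes \<open>f\<close> integrable without any growth bound
    on \<open>u\<close>. By causality it does not change the convolution on the interval up to
    \<tau>, which is what \<open>gconv\<close> records.\<close>
  define f where "f t = indicator {0..\<tau>} t * (exp (- a * t) * u0 t)" for t
  have cm [measurable]: "c \<in> borel_measurable borel" unfolding c_def[abs_def] by measurable
  have fm [measurable]: "f \<in> borel_measurable borel" unfolding f_def[abs_def] by measurable
  have c: "integrable lborel c" unfolding c_def[abs_def] by (rule integrable_exp_b0[OF a])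
  have cu: "continuous_on {0..\<tau>} (\<lambda>t. exp (- a * t) * u t)"
    by (intro continuous_intros continuous_on_subset[OF continuous_u]) auto
  then have "bounded ((\<lambda>t. exp (- a * t) * u t) ` {0..\<tau>})"
    by (intro compact_imp_bounded compact_continuous_image) auto
  then obtain B where B: "B > 0" "\<And>t. t \<in> {0..\<tau>} \<Longrightarrow> \<bar>exp (- a * t) * u t\<bar> \<le> B"
    unfolding bounded_pos by auto
  have fB: "\<bar>f t\<bar> \<le> B" for t
    using B(1) B(2)[of t] by (auto simp: f_def u0_def indicator_def)
  have fint: "integrable lborel f"
  proof (rule Bochner_Integration.integrable_bound)
    show "integrable lborel (\<lambda>t. B * indicator {0..\<tau>} t)"
      by (rule integrable_mult_right) (use \<tau> in auto)
    show "AE t in lborel. norm (f t) \<le> norm (B * indicator {0..\<tau>} t)"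
    proof (rule AE_I2)
      fix t show "norm (f t) \<le> norm (B * indicator {0..\<tau>} t)"
        using fB[of t] B(1) by (cases "t \<in> {0..\<tau>}") (auto simp: f_def)
    qed
  qed simp
  have fcont: "AE x in lborel. isCont f x"
  proof (rule AE_isCont_cofinite)
    show "open ({..<0} \<union> {0<..<\<tau>} \<union>  {\<tau><..})"
      by (intro open_Un open_lessThan open_greaterThan open_greaterThanLessThan)
    have "- ({..<0} \<union> {0<..<\<tau>} \<union> {\<tau><..}) \<subseteq> {0, \<tau>}" by auto
    then show "finite (- ({..<0} \<union> {0<..<\<tau>} \<union> {\<tau><..}))" by (rule finite_subset) auto
    have "continuous_on {..<0} f"
      by (rule continuous_on_eq[of _ "\<lambda>_. 0"]) (auto simp: f_def)
    moreover have "continuous_on {\<tau><..} f"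
      by (rule continuous_on_eq[of _ "\<lambda>_. 0"]) (auto simp: f_def)
    moreover have "continuous_on {0<..<\<tau>} f"
      by (rule continuous_on_eq[OF continuous_on_subset[OF cu]]) (auto simp: f_def u0_def)
    ultimately show "continuous_on ({..<0} \<union> {0<..<\<tau>} \<union> {\<tau><..}) f"
      by (intro continuous_on_open_Un) auto
  qed
  have posc: "Re (fourier c k) \<ge> 0" for k
    unfolding c_def[abs_def] fourier_exp_b0[OF a] using a by (intro pos) auto
  define g where "g x = (LINT y|lborel. c (x - y) * f y)" for x
  define P where "P = (LINT x|lborel. f x * g x)"
  note cf = convolution_form_nonneg[OF fint fB fcont c posc]
  have P0: "P \<ge> 0" using cf(1) by (simp add: P_def g_def)
  have "((\<lambda>x. f x * g x) has_integral P) UNIV"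
    unfolding P_def g_def by (rule has_integral_integral_lborel[OF cf(2)])
  moreover have "(\<lambda>x. f x * g x) = (\<lambda>x. if x \<in> {0..\<tau>} then f x * g x else 0)"
    by (auto simp: f_def)
  ultimately have "((\<lambda>x. if x \<in> {0..\<tau>} then f x * g x else 0) has_integral P) UNIV"
    by metis
  then have hP: "((\<lambda>x. f x * g x) has_integral P) {0..\<tau>}"
    by (simp only: has_integral_restrict_UNIV)
  have gconv: "exp (- a * t) * conv t = g t" if "t \<in> {0..\<tau>}" for t
    unfolding g_def conv_def integral_mult_right_zero[symmetric]
  proof (intro Bochner_Integration.integral_cong refl)
    fix \<sigma>
    have "exp (- a * t) = exp (- a * (t - \<sigma>)) * exp (- a * \<sigma>)"
      by (simp add: exp_add[symmetric] algebra_simps)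
    then show "exp (- a * t) * (b0 (t - \<sigma>) * u0 \<sigma>) = c (t - \<sigma>) * f \<sigma>"
      using that by (auto simp: c_def f_def b0_def u0_def indicator_def)
  qed
  let ?v = "\<lambda>t. exp (- a * t) * u t"
  let ?D = "\<lambda>t. 2 * ?v t * (- a * ?v t - \<mu> * (exp (- a * t) * conv t))"
  have "(?D has_integral (?v \<tau>)\<^sup>2 - (?v 0)\<^sup>2) {0..\<tau>}"
  proof (rule fundamental_theorem_of_calculus)
    fix t assume t: "t \<in> {0..\<tau>}"
    have "(u has_real_derivative - \<mu> * conv t) (at t within {0..\<tau>})"
      by (rule DERIV_subset[OF deriv_u]) (use t in auto)
    then have "((\<lambda>t. (?v t)\<^sup>2) has_real_derivative ?D t) (at t within {0..\<tau>})"
      by (auto intro!: derivative_eq_intros simp: algebra_simps power2_eq_square)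
    then show "((\<lambda>t. (?v t)\<^sup>2) has_vector_derivative ?D t) (at t within {0..\<tau>})"
      by (simp add: has_real_derivative_iff_has_vector_derivative)
  qed (use \<tau> in auto)
  \<comment> \<open>Adding 2 \<mu> P cancels the convolution term in the derivative of v^2 and
    leaves the integrand -2 a v^2; since P is nonnegative, v^2 has not grown.\<close>
  from has_integral_add[OF this has_integral_mult_right[OF hP, of "2 * \<mu>"]]
  have h: "((\<lambda>t. ?D t + 2 * \<mu> * (f t * g t)) has_integral ((?v \<tau>)\<^sup>2 - (?v 0)\<^sup>2) + 2 * \<mu> * P) {0..\<tau>}" .
  have "((?v \<tau>)\<^sup>2 - (?v 0)\<^sup>2) + 2 * \<mu> * P \<le> 0"
  proof (rule has_integral_le[OF h has_integral_0])
    fix t assume t: "t \<in> {0..\<tau>}"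
    have "f t = ?v t" using t by (auto simp: f_def u0_def)
    then have "?D t + 2 * \<mu> * (f t * g t) = - 2 * a * (?v t)\<^sup>2"
      using gconv[OF t] by (simp add: power2_eq_square algebra_simps)
    then show "?D t + 2 * \<mu> * (f t * g t) \<le> 0" using a by simp
  qed
  moreover have "0 \<le> 2 * \<mu> * P" using mu P0 by (intro mult_nonneg_nonneg) auto
  ultimately have "(?v \<tau>)\<^sup>2 \<le> (?v 0)\<^sup>2" by linarith
  then have "(?v \<tau>)\<^sup>2 \<le> 1\<^sup>2" by simp
  then have "\<bar>?v \<tau>\<bar> \<le> 1" by (simp only: abs_le_square_iff[symmetric] abs_one)
  then have "exp (- a * \<tau>) * \<bar>u \<tau>\<bar> \<le> 1" by (simp add: abs_mult)
  then show ?thesis by (simp add: exp_minus field_simps)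
qed simp

text \<open>Damping makes the solution integrable, and the Fourier transform of the damped solution
  is the Laplace transform of \<open>u0\<close> on the line Re z = 1, where the bounds on the kernel
  hold. On [0,T] it can be undone at the cost of a factor exp T.\<close>

definition v1 :: "real \<Rightarrow> real" where "v1 t = exp (- t) * u0 t"

lemma borel_measurable_v1 [measurable]: "v1 \<in> borel_measurable borel"
  unfolding v1_def[abs_def] by measurable

text \<open>The energy estimate with rate 1/2 uses up half of the damping; the other half gives
  integrability.\<close>

lemma v1_le: "\<bar>v1 t\<bar> \<le> indicator {0..} t * exp (- t / 2)"
proof (cases "t \<ge> 0")
  case True
  have "exp (- t) * \<bar>u t\<bar> \<le> exp (- t) * exp (1/2 * t)"
    by (intro mult_left_mono resolvent_le_exp True) auto
  also have "\<dots> = exp (- t / 2)" by (simp add: exp_add[symmetric])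
  finally show ?thesis using True by (simp add: v1_def u0_def abs_mult)
qed (simp add: v1_def u0_def)

lemma integrable_exp_half: "has_bochner_integral lborel (\<lambda>t. indicator {0..} t * exp (- t / 2)) (2::real)"
proof -
  have "has_bochner_integral lborel (\<lambda>x. exp (-x) * x ^ 0 * indicator {0 ..} x :: real) (fact 0)"
    using has_bochner_integral_I0i_power_exp_m'[of 0] by (simp add: mult_ac)
  then have "has_bochner_integral lborel (\<lambda>x. exp (- (0 + 1/2 * x)) * (0 + 1/2 * x) ^ 0 * indicator {0 ..} (0 + 1/2 * x :: real)) (fact 0 /\<^sub>R \<bar>1/2::real\<bar>)"
    by (rule lborel_has_bochner_integral_real_affine_iff[THEN iffD1, rotated]) simp
  also have "(\<lambda>x. exp (- (0 + 1/2 * x)) * (0 + 1/2 * x) ^ 0 * indicator {0 ..} (0 + 1/2 * x :: real)) = (\<lambda>t. indicator {0..} t * exp (- t / 2))"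
    by (auto simp: fun_eq_iff indicator_def)
  finally show ?thesis by simp
qed

lemma integrable_v1: "integrable lborel v1"
proof (rule Bochner_Integration.integrable_bound)
  show "integrable lborel (\<lambda>t. indicator {0..} t * exp (- t / 2) :: real)"
    using integrable_exp_half by (simp add: has_bochner_integral_iff)
  show "AE t in lborel. norm (v1 t) \<le> norm (indicator {0..} t * exp (- t / 2) :: real)"
    using v1_le by (intro AE_I2) (simp add: abs_mult)
qed simp

lemma v1_bounded: "\<bar>v1 t\<bar> \<le> 1"
  by (rule order_trans[OF v1_le]) (auto simp: indicator_def)

lemma v1_isCont: "AE x in lborel. isCont v1 x"
proof (rule AE_isCont_cofinite)
  show "open ({..<0} \<union> {0::real<..})" by auto
  have "- ({..<0} \<union> {0::real<..}) \<subseteq> {0}" by auto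
  then show "finite (- ({..<0} \<union> {0::real<..}))" by (rule finite_subset) auto
  have "continuous_on {..<0} v1"
    by (rule continuous_on_eq[of _ "\<lambda>_. 0"]) (auto simp: v1_def u0_def)
  moreover have "continuous_on {0<..} (\<lambda>t. exp (- t) * u t)"
    by (intro continuous_intros continuous_on_subset[OF continuous_u]) auto
  then have "continuous_on {0<..} v1"
    by (rule continuous_on_eq) (auto simp: v1_def u0_def)
  ultimately show "continuous_on ({..<0} \<union> {0<..}) v1"
    by (intro continuous_on_open_Un) auto
qed

text \<open>The transformed equation (z + \<mu> b^(z)) u^(z) = 1 at z = 1 + ik, the right side being
  the initial value. It is obtained by integrating the derivative of exp(-z t) u(t) over [0,N] and
  letting N grow.\<close>

lemma fourier_v1:
  "(Complex 1 k + of_real \<mu> * laplace b (Complex 1 k)) * fourier v1 k = 1"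
proof -
  define z where "z = Complex 1 k"
  define p where "p t = exp (- z * of_real t) * complex_of_real (b0 t)" for t
  define q where "q t = exp (- z * of_real t) * complex_of_real (u0 t)" for t
  have ez: "norm (exp (- z * of_real t)) = exp (- t)" for t by (simp add: z_def)
  have pi: "integrable lborel p" unfolding p_def[abs_def] by (rule integrable_laplace) (simp add: z_def)
  have q_eq: "q t = iexp (- (k * t)) * of_real (v1 t)" for t
  proof -
    have "exp (- z * of_real t) = iexp (- (k * t)) * of_real (exp (- t))"
      unfolding exp_of_real[symmetric] exp_add[symmetric] by (simp add: z_def Complex_eq algebra_simps)
    then show ?thesis by (simp add: q_def v1_def)
  qed
  have qi: "integrable lborel q" unfolding q_eq[abs_def] by (rule integrable_fourier_integrand[OF integrable_v1])
  have Iq: "(LINT t|lborel. q t) = fourier v1 k" unfolding q_eq fourier_def ..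
  have Ip: "(LINT t|lborel. p t) = laplace b z" unfolding p_def laplace_eq ..
  define cv where "cv t = (LINT \<sigma>|lborel. p (t - \<sigma>) * q \<sigma>)" for t
  have cvi: "integrable lborel cv" and cvI: "(LINT t|lborel. cv t) = laplace b z * fourier v1 k"
    using convolution_integral[OF pi qi] by (simp_all add: cv_def[abs_def] Ip Iq)
  have cv_eq: "cv t = exp (- z * of_real t) * of_real (conv t)" for t
    unfolding cv_def conv_def integral_complex_of_real[symmetric] integral_mult_right_zero[symmetric]
  proof (intro Bochner_Integration.integral_cong refl)
    fix \<sigma>
    have e: "exp (- z * of_real t) = exp (- z * of_real (t - \<sigma>)) * exp (- z * of_real \<sigma>)"
      unfolding exp_add[symmetric] by (simp add: algebra_simps)
    show "p (t - \<sigma>) * q \<sigma> = exp (- z * of_real t) * of_real (b0 (t - \<sigma>) * u0 \<sigma>)"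
      unfolding e by (simp add: p_def q_def)
  qed
  have neg: "q t = 0" "cv t = 0" if "t < 0" for t
  proof -
    show "q t = 0" using that by (simp add: q_def u0_def)
    have "p (t - \<sigma>) * q \<sigma> = 0" for \<sigma> using that by (auto simp: p_def q_def b0_def u0_def indicator_def)
    then show "cv t = 0" unfolding cv_def by (simp only: Bochner_Integration.integral_zero)
  qed
  \<comment> \<open>On the half line this is the derivative of \<open>G\<close>, and it vanishes on
    the negative axis; its total integral is therefore minus the initial value of
    \<open>G\<close>.\<close>
  define h where "h t = - z * q t - of_real \<mu> * cv t" for t
  have hi: "integrable lborel h" unfolding h_def[abs_def] using qi cvi by auto
  have hm [measurable]: "h \<in> borel_measurable borel" using hi by (auto dest: borel_measurable_integrable)
  define G where "G t = exp (- z * of_real t) * complex_of_real (u t)" for t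
  have ftc: "(LINT t|lborel. indicator {0..real N} t *\<^sub>R h t) = G (real N) - 1" for N :: nat
  proof -
    have "(h has_integral G (real N) - G 0) {0..real N}"
    proof (rule fundamental_theorem_of_calculus)
      fix t assume t: "t \<in> {0..real N}"
      have "(u has_real_derivative - \<mu> * conv t) (at t within {0..real N})"
        by (rule DERIV_subset[OF deriv_u]) (use t in auto)
      then have 1: "((\<lambda>t. complex_of_real (u t)) has_vector_derivative of_real (- \<mu> * conv t)) (at t within {0..real N})"
        by (intro has_vector_derivative_of_real) (simp add: has_real_derivative_iff_has_vector_derivative)
      have "((\<lambda>\<tau>. exp (- z * complex_of_real \<tau>)) has_vector_derivative (- z * exp (- z * of_real t))) (at t within {0..real N})"
        by (rule has_vector_derivative_real_field) (auto intro!: derivative_eq_intros)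
      from has_vector_derivative_mult[OF this 1]
      have 2: "(G has_vector_derivative exp (- z * of_real t) * of_real (- \<mu> * conv t) + - z * exp (- z * of_real t) * of_real (u t))
          (at t within {0..real N})"
        unfolding G_def[abs_def] .
      have "u0 t = u t" using t by (simp add: u0_def)
      then have "h t = exp (- z * of_real t) * of_real (- \<mu> * conv t) + - z * exp (- z * of_real t) * of_real (u t)"
        unfolding h_def cv_eq q_def by simp
      with 2 show "(G has_vector_derivative h t) (at t within {0..real N})" by (simp only:)
    qed auto
    moreover have "set_integrable lborel {0..real N} h"
      unfolding set_integrable_def by (rule integrable_mult_indicator[OF _ hi]) auto
    from set_borel_integral_eq_integral(2)[OF this]
    have "(LINT t|lborel. indicator {0..real N} t *\<^sub>R h t) = integral {0..real N} h"
      by (simp add: set_lebesgue_integral_def)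
    ultimately show ?thesis by (simp add: integral_unique G_def)
  qed
  have "(\<lambda>N. LINT t|lborel. indicator {0..real N} t *\<^sub>R h t) \<longlonglongrightarrow> (LINT t|lborel. h t)"
  proof (rule integral_dominated_convergence[where w = "\<lambda>t. norm (h t)"])
    show "AE t in lborel. (\<lambda>N. indicator {0..real N} t *\<^sub>R h t) \<longlonglongrightarrow> h t"
    proof (rule AE_I2, rule tendsto_eventually)
      fix t :: real
      obtain m where m: "t \<le> real m" using real_arch_simple by blast
      show "\<forall>\<^sub>F N in sequentially. indicator {0..real N} t *\<^sub>R h t = h t"
        using eventually_ge_at_top[of m]
        by eventually_elim (use m neg[of t] in \<open>auto simp: h_def indicator_def\<close>)
    qed
  qed (use hi in \<open>auto simp: indicator_def\<close>)
  moreover have "(\<lambda>N. G (real N) - 1) \<longlonglongrightarrow> 0 - 1"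
  proof (intro tendsto_diff tendsto_const)
    have "norm (G (real N)) \<le> exp (- (real N / 2))" for N
    proof -
      have "norm (G (real N)) = exp (- real N) * \<bar>u (real N)\<bar>"
        by (simp only: G_def norm_mult ez norm_of_real)
      also have "\<dots> = \<bar>v1 (real N)\<bar>" by (simp add: v1_def u0_def abs_mult)
      also have "\<dots> \<le> exp (- (real N / 2))" using v1_le[of "real N"] by simp
      finally show ?thesis .
    qed
    then have ev: "\<forall>\<^sub>F N in sequentially. norm (G (real N)) \<le> exp (- (real N / 2))"
      by (rule always_eventually[OF allI])
    have "(\<lambda>N. exp (- (real N / 2))) \<longlonglongrightarrow> 0" by real_asymp
    with ev show "(\<lambda>N. G (real N)) \<longlonglongrightarrow> 0" by (rule Lim_null_comparison)
  qed
  ultimately have "(LINT t|lborel. h t) = 0 - 1"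
    unfolding ftc by (rule LIMSEQ_unique)
  then have "(LINT t|lborel. h t) = - 1" by simp
  moreover have "(LINT t|lborel. h t) = - z * fourier v1 k - of_real \<mu> * (laplace b z * fourier v1 k)"
    unfolding h_def using qi cvi by (simp add: Iq cvI)
  ultimately have "- (z * fourier v1 k + of_real \<mu> * (laplace b z * fourier v1 k)) = - 1"
    by (simp add: algebra_simps)
  then have "z * fourier v1 k + of_real \<mu> * (laplace b z * fourier v1 k) = 1"
    by (simp only: neg_equal_iff_equal)
  then show ?thesis by (simp add: z_def algebra_simps)
qed

end

section \<open>Mean square increments of the scalar resolvent\<close>

definition zero_extension :: "(real \<Rightarrow> real) \<Rightarrow> real \<Rightarrow> real" where
  "zero_extension u t = indicator {0..} t * u t"

lemma integrable_inverse_one_plus_square: "integrable lborel (\<lambda>x::real. 1 / (1 + x\<^sup>2))"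
proof -
  have 1: "integrable lborel (\<lambda>x::real. indicator {0<..} x * (1 / (1 + x\<^sup>2)))"
    using integrable_I0i_1_div_plus_square
    by (simp add: einterval_eq_Ici[of 0, unfolded zero_ereal_def[symmetric]] interval_lebesgue_integrable_def set_integrable_def)
  from lborel_integrable_real_affine[OF 1, of "-1" 0]
  have 2: "integrable lborel (\<lambda>x::real. indicator {0<..} (- x) * (1 / (1 + x\<^sup>2)))" by simp
  have "AE x in lborel. x \<noteq> (0::real)" by (rule AE_lborel_singleton)
  then have "AE x in lborel. (indicator {0<..} x * (1 / (1 + x\<^sup>2)) + indicator {0<..} (- x) * (1 / (1 + x\<^sup>2)) :: real) = 1 / (1 + x\<^sup>2)"
    by eventually_elim (auto simp: indicator_def)
  note cong = integrable_cong_AE[OF _ _ this]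
  show ?thesis
    by (rule cong[THEN iffD1, OF _ _ Bochner_Integration.integrable_add[OF 1 2]]) measurable
qed

lemma norm_one_minus_iexp: "(norm (1 - iexp a))\<^sup>2 \<le> 4" "(norm (1 - iexp a))\<^sup>2 \<le> a\<^sup>2"
proof -
  have "(norm (1 - iexp a))\<^sup>2 = 1 + ((sin a)\<^sup>2 + (cos a)\<^sup>2) - 2 * cos a"
    unfolding cmod_power2 by (simp add: Re_exp Im_exp power2_eq_square algebra_simps)
  then have 1: "(norm (1 - iexp a))\<^sup>2 = 2 - 2 * cos a" by simp
  then show "(norm (1 - iexp a))\<^sup>2 \<le> 4" using cos_ge_minus_one[of a] by linarith
  have "2 - 2 * cos a = (2 * sin (a/2))\<^sup>2"
    using cos_double_sin[of "a/2"] by (simp add: power_mult_distrib)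
  also have "\<dots> \<le> a\<^sup>2"
    using abs_sin_x_le_abs_x[of "a/2"] by (intro abs_le_square_iff[THEN iffD1]) (simp add: abs_mult)
  finally show "(norm (1 - iexp a))\<^sup>2 \<le> a\<^sup>2" using 1 by simp
qed

context scalar_volterra
begin

text \<open>The transform is the reciprocal of the symbol z + \<mu> b^(z), and sectoriality bounds
  the symbol below by the sum of the moduli of its two terms. One term gives decay in
  \<open>k\<close>, the other decay in \<mu>.\<close>

lemma norm_fourier_v1_le:
  assumes sector: "\<And>z. Re z > 0 \<Longrightarrow> Re (laplace b z) \<ge> \<delta> * norm (laplace b z)"
    and d: "0 < \<delta>" "\<delta> \<le> 1"
  shows "norm (fourier v1 k) \<le> (3 / \<delta>) / (norm (Complex 1 k) + \<mu> * norm (laplace b (Complex 1 k)))"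
proof -
  define z where "z = Complex 1 k"
  define w where "w = of_real \<mu> * laplace b z"
  have "Re (laplace b z) \<ge> \<delta> * norm (laplace b z)" by (rule sector) (simp add: z_def)
  then have "\<mu> * Re (laplace b z) \<ge> \<mu> * (\<delta> * norm (laplace b z))" using mu by (intro mult_left_mono) auto
  then have "Re w \<ge> \<delta> * norm w" using mu by (simp add: w_def norm_mult mult_ac)
  from norm_add_sector_ge[OF _ this d, of z]
  have le: "norm z + norm w \<le> 3 / \<delta> * norm (z + w)" by (simp add: z_def)
  have z1: "norm z > 0" by (simp add: z_def complex_eq_iff)
  have "norm (z + w) * norm (fourier v1 k) = norm ((z + w) * fourier v1 k)" by (rule norm_mult[symmetric])
  also have "(z + w) * fourier v1 k = 1" using fourier_v1[of k] by (simp only: z_def w_def)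
  finally have 1: "norm (z + w) * norm (fourier v1 k) = 1" by simp
  then have n0: "norm (z + w) \<noteq> 0" by auto
  with 1 have "norm (fourier v1 k) = 1 / norm (z + w)" by (simp add: field_simps)
  also have "\<dots> \<le> (3 / \<delta>) / (norm z + norm w)"
  proof (subst pos_le_divide_eq)
    show "norm z + norm w > 0" using z1 by (simp add: add_pos_nonneg)
    have "1 / norm (z + w) * (norm z + norm w) \<le> 1 / norm (z + w) * (3 / \<delta> * norm (z + w))"
      by (rule mult_left_mono[OF le]) simp
    also have "\<dots> = 3 / \<delta>" using n0 by simp
    finally show "1 / norm (z + w) * (norm z + norm w) \<le> 3 / \<delta>" .
  qed
  finally show ?thesis using mu by (simp add: z_def w_def norm_mult)
qed

lemma u0_eq: "u0 = zero_extension u"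
  by (simp add: fun_eq_iff u0_def zero_extension_def)

lemma v1_sq: "integrable lborel (\<lambda>x. (v1 x)\<^sup>2)" "(LINT x|lborel. (v1 x)\<^sup>2) \<le> 2"
proof -
  have le: "(v1 x)\<^sup>2 \<le> indicator {0..} x * exp (- x / 2)" for x
  proof -
    have "\<bar>v1 x\<bar> * \<bar>v1 x\<bar> \<le> 1 * (indicator {0..} x * exp (- x / 2))"
      by (rule mult_mono[OF v1_bounded v1_le]) auto
    moreover have "(v1 x)\<^sup>2 = \<bar>v1 x\<bar> * \<bar>v1 x\<bar>" by (simp add: power2_eq_square)
    ultimately show ?thesis by simp
  qed
  have i: "integrable lborel (\<lambda>t. indicator {0..} t * exp (- t / 2) :: real)"
    and I: "(LINT t|lborel. indicator {0..} t * exp (- t / 2) :: real) = 2"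
    using integrable_exp_half by (auto simp: has_bochner_integral_iff)
  show 1: "integrable lborel (\<lambda>x. (v1 x)\<^sup>2)"
    by (rule Bochner_Integration.integrable_bound[OF i]) (use le in auto)
  have "(LINT x|lborel. (v1 x)\<^sup>2) \<le> (LINT t|lborel. indicator {0..} t * exp (- t / 2))"
    by (rule integral_mono[OF 1 i]) (rule le)
  then show "(LINT x|lborel. (v1 x)\<^sup>2) \<le> 2" using I by simp
qed

text \<open>A bound without gain in the shift: it serves increments longer than the scale
  \<mu>^(-1/\<rho>), where the size of \<open>v1\<close> itself is already small.\<close>

lemma v1_shift_sq:
  shows "integrable lborel (\<lambda>x. (v1 x - v1 (x - h))\<^sup>2)"
    and "(LINT x|lborel. (v1 x - v1 (x - h))\<^sup>2) \<le> 4 * (LINT x|lborel. (v1 x)\<^sup>2)"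
proof -
  note s = integrable_shift[OF v1_sq(1), of h]
  have le: "(v1 x - v1 (x - h))\<^sup>2 \<le> 2 * (v1 x)\<^sup>2 + 2 * (v1 (x - h))\<^sup>2" for x
    using sum_squares_ge_zero[of "v1 x + v1 (x-h)" 0] by (simp add: power2_eq_square algebra_simps)
  have i: "integrable lborel (\<lambda>x. 2 * (v1 x)\<^sup>2 + 2 * (v1 (x - h))\<^sup>2)" using s v1_sq by auto
  show 1: "integrable lborel (\<lambda>x. (v1 x - v1 (x - h))\<^sup>2)"
    by (rule Bochner_Integration.integrable_bound[OF i]) (use le in auto)
  have "(LINT x|lborel. (v1 x - v1 (x - h))\<^sup>2) \<le> (LINT x|lborel. 2 * (v1 x)\<^sup>2 + 2 * (v1 (x - h))\<^sup>2)"
    by (rule integral_mono[OF 1 i]) (rule le)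
  also have "\<dots> = 4 * (LINT x|lborel. (v1 x)\<^sup>2)"
    using s v1_sq integral_shift[of "\<lambda>x. (v1 x)\<^sup>2" h] by simp
  finally show "(LINT x|lborel. (v1 x - v1 (x - h))\<^sup>2) \<le> 4 * (LINT x|lborel. (v1 x)\<^sup>2)" .
qed

text \<open>On the Fourier side the shift gives the factor |1 - exp(-ikh)|^2, and the transform of
  \<open>v1\<close> decays like 1/|1 + ik|. The majorant h^2/(1 + (hk)^2) scales, so its integral is
  a constant times \<open>h\<close>. The first power is the natural one, since \<open>v1\<close>
  jumps from 0 to 1 at the origin. The constant 45 is 9 from the squared 3 of the symbol bound times
  5 from \<open>A2\<close>.\<close>

lemma v1_increment_le:
  assumes sector: "\<And>z. Re z > 0 \<Longrightarrow> Re (laplace b z) \<ge> \<delta> * norm (laplace b z)"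
    and d: "0 < \<delta>" "\<delta> \<le> 1" and h: "h > 0"
  shows "(LINT x|lborel. (v1 x - v1 (x - h))\<^sup>2) \<le> 45 / \<delta>\<^sup>2 * (LINT x|lborel. 1 / (1 + x\<^sup>2)) * h"
proof -
  let ?f = "\<lambda>x. v1 x - v1 (x - h)"
  note s = integrable_shift[OF integrable_v1, of h]
  have i: "integrable lborel ?f" using integrable_v1 s by auto
  have B: "\<bar>?f x\<bar> \<le> 2" for x using v1_bounded[of x] v1_bounded[of "x - h"] by linarith
  have c: "AE x in lborel. isCont ?f x"
    using v1_isCont AE_isCont_shift[OF v1_isCont, of h] by eventually_elim auto
  note P = plancherel[OF i B c]
  let ?g = "\<lambda>k. 45 / \<delta>\<^sup>2 * h\<^sup>2 * (1 / (1 + (0 + h * k)\<^sup>2))"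
  have gi: "integrable lborel ?g"
    using h by (intro integrable_mult_right lborel_integrable_real_affine[OF integrable_inverse_one_plus_square]) auto
  have le: "(norm (fourier ?f k))\<^sup>2 \<le> ?g k" for k
  proof -
    define A where "A = (norm (1 - iexp (- (k * h))))\<^sup>2"
    have A: "0 \<le> A" "A \<le> 4" "A \<le> (k * h)\<^sup>2" using norm_one_minus_iexp[of "- (k * h)"] by (auto simp: A_def)
    \<comment> \<open>The scaling majorant cleared of denominators. The cases meet where the two
      bounds on A, namely 4 and (kh)^2, coincide.\<close>
    have A2: "A * (1 + (h * k)\<^sup>2) \<le> 5 * (h\<^sup>2 * (1 + k\<^sup>2))"
    proof (cases "(k * h)\<^sup>2 \<le> 4")
      case True
      then have "A * (1 + (h * k)\<^sup>2) \<le> (k*h)\<^sup>2 * 5" using A by (intro mult_mono) (auto simp: mult.commute)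
      also have "\<dots> \<le> 5 * (h\<^sup>2 * (1 + k\<^sup>2))" by (simp add: power_mult_distrib algebra_simps)
      finally show ?thesis .
    next
      case False
      have "A * (1 + (h * k)\<^sup>2) \<le> 4 * (1 + (h * k)\<^sup>2)" using A by (intro mult_right_mono) auto
      also have "\<dots> \<le> 5 * (h * k)\<^sup>2" using False by (simp add: mult.commute)
      also have "\<dots> \<le> 5 * (h\<^sup>2 * (1 + k\<^sup>2))" by (simp add: power_mult_distrib algebra_simps)
      finally show ?thesis .
    qed
    have "fourier ?f k = (1 - iexp (- (k * h))) * fourier v1 k"
      by (simp only: fourier_diff[OF integrable_v1 s] fourier_shift) (simp add: algebra_simps)
    then have "(norm (fourier ?f k))\<^sup>2 = A * (norm (fourier v1 k))\<^sup>2"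
      by (simp only: norm_mult power_mult_distrib A_def)
    also have "\<dots> \<le> A * ((3 / \<delta>) / norm (Complex 1 k))\<^sup>2"
    proof (intro mult_left_mono power_mono A)
      have n: "norm (Complex 1 k) > 0" by (simp add: complex_eq_iff)
      have "norm (fourier v1 k) \<le> (3 / \<delta>) / (norm (Complex 1 k) + \<mu> * norm (laplace b (Complex 1 k)))"
        by (rule norm_fourier_v1_le[OF sector d])
      also have "\<dots> \<le> (3 / \<delta>) / norm (Complex 1 k)"
        using n mu d by (intro divide_left_mono mult_pos_pos add_pos_nonneg) auto
      finally show "norm (fourier v1 k) \<le> (3 / \<delta>) / norm (Complex 1 k)" .
    qed auto
    also have "\<dots> = 9 / \<delta>\<^sup>2 * (A / (1 + k\<^sup>2))"
      by (simp add: power_divide power_mult_distrib cmod_power2)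
    also have "\<dots> \<le> 9 / \<delta>\<^sup>2 * (5 * h\<^sup>2 / (1 + (h * k)\<^sup>2))"
    proof (rule mult_left_mono)
      show "A / (1 + k\<^sup>2) \<le> 5 * h\<^sup>2 / (1 + (h * k)\<^sup>2)"
    proof (subst pos_divide_le_eq)
      show p: "0 < 1 + k\<^sup>2" by (simp add: add_pos_nonneg)
      have p2: "0 < 1 + (h * k)\<^sup>2" by (simp add: add_pos_nonneg)
      then show "A \<le> 5 * h\<^sup>2 / (1 + (h * k)\<^sup>2) * (1 + k\<^sup>2)"
        using A2 by (simp add: pos_le_divide_eq mult_ac)
    qed
    qed simp
    finally show ?thesis by (simp add: mult_ac)
  qed
  have "2 * pi * (LINT x|lborel. (?f x)\<^sup>2) = (LINT k|lborel. (norm (fourier ?f k))\<^sup>2)" using P(2) by simp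
  also have "\<dots> \<le> (LINT k|lborel. ?g k)" by (rule integral_mono[OF P(1) gi]) (rule le)
  also have "\<dots> = 45 / \<delta>\<^sup>2 * h\<^sup>2 * (LINT k|lborel. 1 / (1 + (0 + h * k)\<^sup>2))"
    by (rule integral_mult_right_zero)
  also have "(LINT k|lborel. 1 / (1 + (0 + h * k)\<^sup>2)) = (LINT x|lborel. 1 / (1 + x\<^sup>2)) / h"
    using h by (subst lborel_integral_real_affine[of h "\<lambda>x. 1 / (1 + x\<^sup>2)" 0]) auto
  finally have 1: "2 * pi * (LINT x|lborel. (?f x)\<^sup>2) \<le> 45 / \<delta>\<^sup>2 * (LINT x|lborel. 1 / (1 + x\<^sup>2)) * h"
    using h by (simp add: power2_eq_square mult_ac)
  have "0 \<le> (LINT x|lborel. (?f x)\<^sup>2)" by simp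
  have "(LINT x|lborel. (?f x)\<^sup>2) \<le> 2 * pi * (LINT x|lborel. (?f x)\<^sup>2)"
    using mult_right_mono[OF _ \<open>0 \<le> (LINT x|lborel. (?f x)\<^sup>2)\<close>, of 1 "2 * pi"] pi_gt3 by simp
  with 1 show ?thesis by linarith
qed

text \<open>After reflection about \<open>t\<close> the zero extensions express the increment of two
  convolutions with different upper limits as one difference over [0,t]. Undoing the damping
  produces, besides the increment of \<open>v1\<close>, the mismatch 1 - exp(-h) times
  \<open>v1\<close>; its square is at most min 1 h, hence again small in \<open>h\<close> and
  bounded.\<close>

lemma increment_split:
  assumes t: "0 \<le> t'" "t' \<le> t" "t \<le> T"
  shows "(LINT x|lborel. indicator {0..t} x * (zero_extension u (t - x) - zero_extension u (t' - x))\<^sup>2)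
    \<le> 2 * exp (2 * T) * ((LINT x|lborel. (v1 x - v1 (x - (t - t')))\<^sup>2) + min 1 (t - t') * (LINT x|lborel. (v1 x)\<^sup>2))"
proof -
  define h where "h = t - t'"
  have h: "0 \<le> h" using t by (simp add: h_def)
  let ?r = "\<lambda>y. (v1 y - v1 (y - h))\<^sup>2 + min 1 h * (v1 (y - h))\<^sup>2"
  let ?l = "\<lambda>y. indicator {0..t} (t - y) * (u0 y - u0 (y - h))\<^sup>2"
  have ri: "integrable lborel ?r"
    using v1_shift_sq(1)[of h] integrable_shift[OF v1_sq(1), of h] by auto
  have le: "?l y \<le> 2 * exp (2 * T) * ?r y" for y
  proof (cases "t - y \<in> {0..t}")
    case True
    then have y: "0 \<le> y" "y \<le> T" using t by auto
    have v: "u0 x = exp x * v1 x" for x by (simp add: v1_def exp_minus)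
    have "u0 y - u0 (y - h) = exp y * ((v1 y - v1 (y - h)) + (1 - exp (- h)) * v1 (y - h))"
      by (simp add: v algebra_simps exp_diff exp_minus divide_inverse)
    then have "(u0 y - u0 (y - h))\<^sup>2 = exp (2 * y) * ((v1 y - v1 (y - h)) + (1 - exp (- h)) * v1 (y - h))\<^sup>2"
      by (simp add: power_mult_distrib exp_double)
    also have "\<dots> \<le> exp (2 * T) * (2 * ?r y)"
    proof (rule mult_mono)
      have "(p + q)\<^sup>2 \<le> 2 * p\<^sup>2 + 2 * q\<^sup>2" for p q :: real
        using sum_squares_ge_zero[of "p - q" 0] by (simp add: power2_eq_square algebra_simps)
      then have "((v1 y - v1 (y - h)) + (1 - exp (- h)) * v1 (y - h))\<^sup>2
          \<le> 2 * (v1 y - v1 (y - h))\<^sup>2 + 2 * ((1 - exp (- h))\<^sup>2 * (v1 (y - h))\<^sup>2)"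
        by (metis power_mult_distrib)
      also have "(1 - exp (- h))\<^sup>2 * (v1 (y - h))\<^sup>2 \<le> min 1 h * (v1 (y - h))\<^sup>2"
      proof (rule mult_right_mono)
        have 1: "0 \<le> 1 - exp (-h)" "1 - exp (- h) \<le> 1" "1 - exp (-h) \<le> h"
          using h exp_ge_add_one_self[of "-h"] by auto
        have "(1 - exp (- h)) * (1 - exp (- h)) \<le> 1 * (1 - exp (-h))"
          by (rule mult_right_mono) (use 1 in auto)
        then have "(1 - exp (- h)) * (1 - exp (- h)) \<le> 1 - exp (-h)" by simp
        then show "(1 - exp (- h))\<^sup>2 \<le> min 1 h" using 1 unfolding power2_eq_square by linarith
      qed simp
      finally show "((v1 y - v1 (y - h)) + (1 - exp (- h)) * v1 (y - h))\<^sup>2 \<le> 2 * ?r y" by simp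
    qed (use y in auto)
    finally show ?thesis using True by (simp add: distrib_left mult_ac)
  next
    case False
    have "0 \<le> ?r y" using h by simp
    with False show ?thesis by simp
  qed
  have li: "integrable lborel ?l"
  proof (rule Bochner_Integration.integrable_bound[OF integrable_mult_right[OF ri, of "2 * exp (2 * T)"]])
    show "AE y in lborel. norm (?l y) \<le> norm (2 * exp (2 * T) * ?r y)"
      using le by (intro AE_I2) (smt (verit) indicator_pos_le mult_nonneg_nonneg real_norm_def zero_le_power2)
  qed simp
  have "(LINT x|lborel. indicator {0..t} x * (zero_extension u (t - x) - zero_extension u (t' - x))\<^sup>2) = (LINT y|lborel. ?l y)"
    by (subst integral_reflect_shift[of _ t, symmetric]) (simp add: u0_eq h_def algebra_simps)
  also have "\<dots> \<le> (LINT y|lborel. 2 * exp (2 * T) * ?r y)"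
    by (rule integral_mono[OF li integrable_mult_right[OF ri]]) (rule le)
  also have "\<dots> = 2 * exp (2 * T) * ((LINT x|lborel. (v1 x - v1 (x - h))\<^sup>2) + min 1 h * (LINT x|lborel. (v1 x)\<^sup>2))"
    using v1_shift_sq(1)[of h] integrable_shift[OF v1_sq(1), of h] integral_shift[of "\<lambda>x. (v1 x)\<^sup>2" h] by simp
  finally show ?thesis unfolding h_def .
qed

end

text \<open>The entry t - t' comes from the decay of the transform of \<open>v1\<close> along Re z =
  1, the entry in \<mu> from the square norm of \<open>v1\<close>, estimated through the boundary
  function. The constant may depend on \<open>T\<close> and the kernel but not on \<mu> or
  \<open>u\<close>: it has to serve all modes at once.\<close>

theorem resolvent_increment:
  assumes adm: "admissible_kernel \<rho> b"
  obtains C where "C > 0"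
    "\<And>\<mu> u t' t. \<mu> > 0 \<Longrightarrow> scalar_resolvent b \<mu> u \<Longrightarrow> 0 \<le> t' \<Longrightarrow> t' \<le> t \<Longrightarrow> t \<le> T \<Longrightarrow>
      (LINT x|lborel. indicator {0..t} x * (zero_extension u (t - x) - zero_extension u (t' - x))\<^sup>2)
        \<le> C * min (t - t') (\<mu> powr (- 1 / \<rho>))"
proof -
  define g where "g = boundary_fun b"
  have li: "locally_integrable b" and se: "subexponential b" and tr: "two_regular b"
    and sec: "sectorial_lt_half_pi b"
    and lim: "\<And>k. k \<noteq> 0 \<Longrightarrow> ((\<lambda>\<epsilon>. laplace b (Complex \<epsilon> k)) \<longlongrightarrow> g k) (at_right 0)"
    using adm unfolding admissible_kernel_def g_def Let_def by auto
  obtain C2 where C2: "C2 > 0" "\<And>\<mu>. \<mu> > 0 \<Longrightarrow>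
     (\<integral>\<^sup>+k\<in>{0<..}. ennreal
             ((norm (of_real (k\<^sup>2) * real_deriv 3 g k) + norm (of_real k * real_deriv 2 g k)
                 + norm (real_deriv 1 g k) + 1 / \<mu>) / (\<bar>k\<bar> + \<mu> * norm (g k))\<^sup>2) \<partial>lborel)
             \<le> ennreal (C2 / \<mu> powr (1 + 1 / \<rho>))"
    using adm unfolding admissible_kernel_def g_def Let_def by blast
  obtain Cr where Cr: "Cr > 0" "\<And>z. Re z > 0 \<Longrightarrow> norm z * norm (deriv (laplace b) z) \<le> Cr * norm (laplace b z)"
  proof -
    obtain Cr where Cr: "Cr > 0" "\<forall>z. Re z > 0 \<longrightarrow>
     (\<forall>j\<le>2. norm z ^ j * norm ((deriv ^^ j) (laplace b) z) \<le> Cr * norm (laplace b z))"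
      using tr unfolding two_regular_def by blast
    show ?thesis
    proof (rule that[OF Cr(1)])
      fix z :: complex assume "Re z > 0"
      from Cr(2)[rule_format, OF this, of 1]
      show "norm z * norm (deriv (laplace b) z) \<le> Cr * norm (laplace b z)" by simp
    qed
  qed
  obtain \<delta> where d: "\<delta> > 0" "\<delta> \<le> 1" and sector: "\<And>z. Re z > 0 \<Longrightarrow> Re (laplace b z) \<ge> \<delta> * norm (laplace b z)"
    using sector_real_part[OF sec] by blast
  interpret laplace_kernel b by unfold_locales (rule li se)+
  \<comment> \<open>Two-regularity with j = 1 bounds the logarithmic derivative by Cr/|\<zeta>|,
    hence by Cr where |\<zeta>| is at least 1. Values of the transform at distance d in such a
    convex region differ at most by the factor exp(Cr d).\<close>
  have seg: "norm (laplace b z1) \<le> exp (Cr * norm (z1 - z0)) * norm (laplace b z0)"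
    if K: "convex K" "z0 \<in> K" "z1 \<in> K" "\<And>\<zeta>. \<zeta> \<in> K \<Longrightarrow> Re \<zeta> > 0 \<and> norm \<zeta> \<ge> 1" for z0 z1 K
  proof (rule norm_le_exp_segment)
    fix \<zeta> assume "\<zeta> \<in> closed_segment z0 z1"
    then have "\<zeta> \<in> K" using closed_segment_subset[OF K(2,3,1)] by auto
    from K(4)[OF this] have \<zeta>: "Re \<zeta> > 0" "norm \<zeta> \<ge> 1" by auto
    show "(laplace b has_field_derivative deriv (laplace b) \<zeta>) (at \<zeta>)"
      by (rule laplace_differentiable[OF \<zeta>(1)])
    have "norm (deriv (laplace b) \<zeta>) \<le> norm \<zeta> * norm (deriv (laplace b) \<zeta>)"
      using mult_right_mono[OF \<zeta>(2), of "norm (deriv (laplace b) \<zeta>)"] by simp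
    also have "\<dots> \<le> Cr * norm (laplace b \<zeta>)" by (rule Cr(2)[OF \<zeta>(1)])
    finally show "norm (deriv (laplace b) \<zeta>) \<le> Cr * norm (laplace b \<zeta>)" .
  qed
  define E where "E = exp Cr"
  have E: "E \<ge> 1" using Cr by (simp add: E_def)
  \<comment> \<open>A horizontal move of length less than 1, from \<epsilon> + ik to 1 + ik,
    followed by the limit at the boundary. The restriction to k >= 1 keeps the region outside the
    unit disc.\<close>
  have gle: "norm (g k) \<le> E * norm (laplace b (Complex 1 k))" if k: "k \<ge> 1" for k
  proof (rule tendsto_upperbound)
    show "((\<lambda>\<epsilon>. norm (laplace b (Complex \<epsilon> k))) \<longlongrightarrow> norm (g k)) (at_right 0)"
      using lim[of k] k by (intro tendsto_norm) auto
    have "norm (laplace b (Complex \<epsilon> k)) \<le> E * norm (laplace b (Complex 1 k))" if "0 < \<epsilon>" "\<epsilon> < 1" for \<epsilon>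
    proof -
      let ?K = "{z. Re z > 0} \<inter> {z. Im z \<ge> k}"
      have "norm (laplace b (Complex \<epsilon> k)) \<le> exp (Cr * norm (Complex \<epsilon> k - Complex 1 k)) * norm (laplace b (Complex 1 k))"
      proof (rule seg[of ?K])
        show "convex ?K"
          by (intro convex_Int convex_halfspace_Re_gt convex_halfspace_Im_ge)
        fix \<zeta> assume "\<zeta> \<in> ?K"
        then show "Re \<zeta> > 0 \<and> norm \<zeta> \<ge> 1" using abs_Im_le_cmod[of \<zeta>] k by auto
      qed (use that in auto)
      also have "\<dots> \<le> E * norm (laplace b (Complex 1 k))"
      proof (rule mult_right_mono)
        have "Complex \<epsilon> k - Complex 1 k = of_real (\<epsilon> - 1)" by (simp add: complex_eq_iff)
        then have "norm (Complex \<epsilon> k - Complex 1 k) \<le> 1" using that by (simp only: norm_of_real)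
        then show "exp (Cr * norm (Complex \<epsilon> k - Complex 1 k)) \<le> E"
          using Cr(1) by (simp add: E_def mult_left_le)
      qed simp
      finally show ?thesis .
    qed
    then show "\<forall>\<^sub>F \<epsilon> in at_right 0. norm (laplace b (Complex \<epsilon> k)) \<le> E * norm (laplace b (Complex 1 k))"
      unfolding eventually_at_right_field by (intro exI[of _ 1]) auto
  qed auto
  \<comment> \<open>3 is the largest distance between a frequency in [-1,1] and one in
    [1,2].\<close>
  have vert: "norm (laplace b (Complex 1 k')) \<le> E ^ 3 * norm (laplace b (Complex 1 k))" if "\<bar>k' - k\<bar> \<le> 3" for k k'
  proof -
    let ?K = "{z. Re z = 1}"
    have "norm (laplace b (Complex 1 k')) \<le> exp (Cr * norm (Complex 1 k' - Complex 1 k)) * norm (laplace b (Complex 1 k))"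
    proof (rule seg[of ?K])
      show "convex ?K" by (auto simp: convex_def simp flip: distrib_right)
      fix \<zeta> assume "\<zeta> \<in> ?K"
      then show "Re \<zeta> > 0 \<and> norm \<zeta> \<ge> 1" using abs_Re_le_cmod[of \<zeta>] by auto
    qed auto
    also have "\<dots> \<le> E ^ 3 * norm (laplace b (Complex 1 k))"
    proof (rule mult_right_mono)
      have "norm (Complex 1 k' - Complex 1 k) = \<bar>k' - k\<bar>" by (simp add: cmod_def)
      then have "Cr * norm (Complex 1 k' - Complex 1 k) \<le> Cr * 3" using that Cr(1) by (intro mult_left_mono) auto
      then show "exp (Cr * norm (Complex 1 k' - Complex 1 k)) \<le> E ^ 3"
        by (simp add: E_def exp_of_nat_mult[symmetric] mult.commute)
    qed simp
    finally show ?thesis .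
  qed
  \<comment> \<open>First summand: the two half lines |k| >= 1. Second summand: the interval [-1,1],
    of length 2.\<close>
  define C3 where "C3 = C2 * (2 * (3 * E / \<delta>)\<^sup>2 + 2 * (6 * E ^ 4 / \<delta>)\<^sup>2)"
  define C5 where "C5 = 45 / \<delta>\<^sup>2 * (LINT x|lborel. 1 / (1 + x\<^sup>2))"
  have C5: "C5 \<ge> 0" unfolding C5_def by (intro mult_nonneg_nonneg integral_nonneg_AE) auto
  have C3: "C3 \<ge> 0" using C2 by (simp add: C3_def)
  \<comment> \<open>C5 and 2 serve short increments. For long ones, 4 C3 comes from the crude shift
    bound and C3 from the damping mismatch. The last 1 makes the constant positive.\<close>
  define C where "C = 2 * exp (2 * T) * (C5 + 4 * C3 + C3 + 2) + 1"
  show ?thesis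
  proof (rule that[of C])
    show "C > 0" unfolding C_def using C3 C5 by (intro add_nonneg_pos mult_nonneg_nonneg) auto
    fix \<mu> u t' t assume mu: "\<mu> > 0" and res: "scalar_resolvent b \<mu> u" and t: "0 \<le> t'" "t' \<le> t" "t \<le> T"
    interpret scalar_volterra b \<mu> u
    proof
      show "Re (laplace b z) \<ge> 0" if "Re z > 0" for z
        using sector[OF that] d by (meson mult_nonneg_nonneg norm_ge_zero order_trans less_imp_le)
    qed (rule mu res)+
    let ?F = "\<lambda>k. (norm (fourier v1 k))\<^sup>2"
    let ?I = "\<lambda>k. ennreal ((norm (of_real (k\<^sup>2) * real_deriv 3 g k) + norm (of_real k * real_deriv 2 g k)
                 + norm (real_deriv 1 g k) + 1 / \<mu>) / (\<bar>k\<bar> + \<mu> * norm (g k))\<^sup>2)"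
    define m where "m = \<mu> powr (- 1 / \<rho>)"
    define J where "J = C2 / \<mu> powr (1 + 1 / \<rho>)"
    have m: "m > 0" "\<mu> * J = C2 * m"
      using mu by (auto simp: m_def J_def powr_add powr_minus field_simps)
    have J0: "J \<ge> 0" using C2 by (simp add: J_def)
    note pl = plancherel[OF integrable_v1 v1_bounded v1_isCont]
    have Fm [measurable]: "fourier v1 \<in> borel_measurable borel" using integrable_v1 by measurable
    \<comment> \<open>\<open>h\<close> is compared with the summand 1/\<mu> of the integrand, the
      other summands being nonnegative. Multiplying J by \<mu> gives exactly C2
      \<mu>^(-1/\<rho>).\<close>
    have key: "(\<integral>\<^sup>+k. ennreal (h k) \<partial>lborel) \<le> ennreal J"
      if h: "\<And>k. k > 0 \<Longrightarrow> h k \<le> (1 / \<mu>) / (k + \<mu> * norm (g k))\<^sup>2" "\<And>k. k \<le> 0 \<Longrightarrow> h k = 0" for h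
    proof -
      have "(\<integral>\<^sup>+k. ennreal (h k) \<partial>lborel) \<le> (\<integral>\<^sup>+k\<in>{0<..}. ?I k \<partial>lborel)"
      proof (rule nn_integral_mono)
        fix k :: real
        show "ennreal (h k) \<le> ?I k * indicator {0<..} k"
        proof (cases "k > 0")
          case True
          have "h k \<le> (1 / \<mu>) / (k + \<mu> * norm (g k))\<^sup>2" by (rule h(1)[OF True])
          also have "\<dots> \<le> (norm (of_real (k\<^sup>2) * real_deriv 3 g k) + norm (of_real k * real_deriv 2 g k)
                 + norm (real_deriv 1 g k) + 1 / \<mu>) / (\<bar>k\<bar> + \<mu> * norm (g k))\<^sup>2"
            using True by (simp only: abs_of_pos) (intro divide_right_mono, auto)
          finally show ?thesis using True by (simp only: indicator_eq_1_iff[THEN iffD2] greaterThan_iff mult_1_right ennreal_leI)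
        qed (use h(2) in auto)
      qed
      also have "\<dots> \<le> ennreal J" unfolding J_def by (rule C2(2)[OF mu])
      finally show ?thesis .
    qed
    have c1: "\<delta> / (3 * E) * ((3 / \<delta>) / X) = 1 / (E * X)"
      and c2: "\<delta> / (6 * E ^ 4) * ((3 / \<delta>) / X) = 1 / (2 * E ^ 4 * X)" for X
      using d E by (auto simp: divide_simps)
    have Fle: "norm (fourier v1 k) \<le> (3 / \<delta>) / (norm (Complex 1 k) + \<mu> * norm (laplace b (Complex 1 k)))" for k
      by (rule norm_fourier_v1_le[OF sector d])
    have F1: "1 / \<mu> * (\<delta> / (3 * E))\<^sup>2 * ?F k \<le> (1 / \<mu>) / (k + \<mu> * norm (g k))\<^sup>2" if k: "k \<ge> 1" for k
    proof -
      have p: "0 < k + \<mu> * norm (g k)" using k mu by (intro add_pos_nonneg) auto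
      have "k \<le> E * norm (Complex 1 k)"
      proof -
        have "k \<le> 1 * norm (Complex 1 k)" using abs_Im_le_cmod[of "Complex 1 k"] k by simp
        also have "\<dots> \<le> E * norm (Complex 1 k)" by (rule mult_right_mono[OF E]) simp
        finally show ?thesis .
      qed
      moreover have "\<mu> * norm (g k) \<le> \<mu> * (E * norm (laplace b (Complex 1 k)))" using gle[OF k] mu by simp
      ultimately have le: "k + \<mu> * norm (g k) \<le> E * (norm (Complex 1 k) + \<mu> * norm (laplace b (Complex 1 k)))"
        by (simp add: algebra_simps)
      have p2: "0 < norm (Complex 1 k) + \<mu> * norm (laplace b (Complex 1 k))"
        using mu by (intro add_pos_nonneg) (auto simp: complex_eq_iff)
      have "\<delta> / (3 * E) * norm (fourier v1 k) \<le> \<delta> / (3 * E) * ((3 / \<delta>) / (norm (Complex 1 k) + \<mu> * norm (laplace b (Complex 1 k))))"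
        using d E by (intro mult_left_mono Fle) auto
      also have "\<dots> = 1 / (E * (norm (Complex 1 k) + \<mu> * norm (laplace b (Complex 1 k))))"
        by (rule c1)
      also have "\<dots> \<le> 1 / (k + \<mu> * norm (g k))"
        using le p p2 E by (intro divide_left_mono mult_pos_pos zero_less_power) auto
      finally have "(\<delta> / (3 * E) * norm (fourier v1 k))\<^sup>2 \<le> (1 / (k + \<mu> * norm (g k)))\<^sup>2"
        using d E by (intro power_mono) auto
      then have "1 / \<mu> * (\<delta> / (3 * E) * norm (fourier v1 k))\<^sup>2 \<le> 1 / \<mu> * (1 / (k + \<mu> * norm (g k)))\<^sup>2"
        using mu by (intro mult_left_mono) auto
      then show ?thesis by (simp only: power_mult_distrib power_divide mult.assoc power_one) (simp add: mult_ac)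
    qed
    \<comment> \<open>For small \<open>k\<close> the way to the boundary enters the unit disc, where
      \<open>seg\<close> does not apply. The value at \<open>k\<close> is compared instead with the
      boundary at every k' in [1,2], reached along Re z = 1 and then horizontally: E^3 for the first
      move, E for the second, and 2 because k' <= 2.\<close>
    have F0: "1 / \<mu> * (\<delta> / (6 * E ^ 4))\<^sup>2 * ?F k \<le> (1 / \<mu>) / (k' + \<mu> * norm (g k'))\<^sup>2"
      if k: "\<bar>k\<bar> \<le> 1" and k': "1 \<le> k'" "k' \<le> 2" for k k'
    proof -
      let ?B = "norm (laplace b (Complex 1 k))"
      have p: "0 < k' + \<mu> * norm (g k')" using k' mu by (intro add_pos_nonneg) auto
      have "norm (g k') \<le> E * (E ^ 3 * ?B)"
        by (rule order_trans[OF gle[OF k'(1)]]) (use E k k' in \<open>intro mult_left_mono vert, auto\<close>)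
      then have 1: "\<mu> * norm (g k') \<le> \<mu> * (2 * E ^ 4 * ?B)" using mu E
        by (intro mult_left_mono) (auto simp: power_eq_if intro: order_trans)
      have "k' \<le> 2 * E ^ 4" using k' one_le_power[OF E, of 4] by linarith
      moreover have "norm (Complex 1 k) \<ge> 1" using abs_Re_le_cmod[of "Complex 1 k"] by simp
      then have "2 * E ^ 4 * 1 \<le> 2 * E ^ 4 * norm (Complex 1 k)" using E by (intro mult_left_mono) auto
      ultimately have "k' \<le> 2 * E ^ 4 * norm (Complex 1 k)" by linarith
      with 1 have le: "k' + \<mu> * norm (g k') \<le> 2 * E ^ 4 * (norm (Complex 1 k) + \<mu> * ?B)"
        by (simp add: algebra_simps)
      have p2: "0 < norm (Complex 1 k) + \<mu> * ?B"
        using mu by (intro add_pos_nonneg) (auto simp: complex_eq_iff)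
      have "\<delta> / (6 * E ^ 4) * norm (fourier v1 k) \<le> \<delta> / (6 * E ^ 4) * ((3 / \<delta>) / (norm (Complex 1 k) + \<mu> * ?B))"
        using d E by (intro mult_left_mono Fle) auto
      also have "\<dots> = 1 / (2 * E ^ 4 * (norm (Complex 1 k) + \<mu> * ?B))"
        by (rule c2)
      also have "\<dots> \<le> 1 / (k' + \<mu> * norm (g k'))"
        using le p p2 E by (intro divide_left_mono mult_pos_pos zero_less_power) auto
      finally have "(\<delta> / (6 * E ^ 4) * norm (fourier v1 k))\<^sup>2 \<le> (1 / (k' + \<mu> * norm (g k')))\<^sup>2"
        using d E by (intro power_mono) auto
      then have "1 / \<mu> * (\<delta> / (6 * E ^ 4) * norm (fourier v1 k))\<^sup>2 \<le> 1 / \<mu> * (1 / (k' + \<mu> * norm (g k')))\<^sup>2"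
        using mu by (intro mult_left_mono) auto
      then show ?thesis by (simp only: power_mult_distrib power_divide mult.assoc power_one) (simp add: mult_ac)
    qed
    have Fi: "integrable lborel ?F" by (rule pl(1))
    have I1: "(LINT k|lborel. indicator {1..} k * ?F k) \<le> (3 * E / \<delta>)\<^sup>2 * (C2 * m)"
    proof -
      let ?h = "\<lambda>k. 1 / \<mu> * (\<delta> / (3 * E))\<^sup>2 * (indicator {1..} k * ?F k)"
      have i: "integrable lborel (\<lambda>k. indicator {1..} k * ?F k)"
        using integrable_mult_indicator[OF _ Fi, of "{1..}"] by simp
      then have hi: "integrable lborel ?h" by simp
      have "ennreal (LINT k|lborel. ?h k) = (\<integral>\<^sup>+k. ennreal (?h k) \<partial>lborel)"
        using mu by (intro nn_integral_eq_integral[symmetric] hi) auto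
      also have "\<dots> \<le> ennreal J"
      proof (rule key)
        fix k :: real assume "k > 0"
        then show "?h k \<le> 1 / \<mu> / (k + \<mu> * norm (g k))\<^sup>2"
          using F1[of k] mu by (cases "k \<ge> 1") auto
      qed auto
      finally have "(LINT k|lborel. ?h k) \<le> J" using J0 by simp
      then have "1 / \<mu> * (\<delta> / (3 * E))\<^sup>2 * (LINT k|lborel. indicator {1..} k * ?F k) \<le> J"
        by (simp only: integral_mult_right_zero)
      then have "\<mu> * (3 * E / \<delta>)\<^sup>2 * (1 / \<mu> * (\<delta> / (3 * E))\<^sup>2 * (LINT k|lborel. indicator {1..} k * ?F k)) \<le> \<mu> * (3 * E / \<delta>)\<^sup>2 * J"
        using mu by (intro mult_left_mono) auto
      moreover have "\<mu> * (3 * E / \<delta>)\<^sup>2 * (1 / \<mu> * (\<delta> / (3 * E))\<^sup>2 * x) = x" for x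
        using mu d E by (simp add: field_simps)
      moreover have "\<mu> * (3 * E / \<delta>)\<^sup>2 * J = (3 * E / \<delta>)\<^sup>2 * (C2 * m)" using m(2) by (simp add: mult_ac)
      ultimately show ?thesis by simp
    qed
    \<comment> \<open>A pointwise bound: the value at \<open>k\<close> does not involve k', and
      integrating it over the unit interval [1,2] preserves it.\<close>
    have I0: "?F k \<le> (6 * E ^ 4 / \<delta>)\<^sup>2 * (C2 * m)" if k: "\<bar>k\<bar> \<le> 1" for k
    proof -
      let ?c = "1 / \<mu> * (\<delta> / (6 * E ^ 4))\<^sup>2 * ?F k"
      have c0: "?c \<ge> 0" using mu by simp
      have "ennreal ?c = (\<integral>\<^sup>+k'. ennreal ?c * indicator {1..2::real} k' \<partial>lborel)"
        by (subst nn_integral_cmult_indicator) auto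
      also have "\<dots> = (\<integral>\<^sup>+k'. ennreal (?c * indicator {1..2::real} k') \<partial>lborel)"
        using c0 by (intro nn_integral_cong) (auto simp: indicator_def)
      also have "\<dots> \<le> ennreal J"
      proof (rule key)
        fix k' :: real assume "k' > 0"
        then show "?c * indicator {1..2} k' \<le> 1 / \<mu> / (k' + \<mu> * norm (g k'))\<^sup>2"
          using F0[OF k, of k'] mu by (cases "k' \<in> {1..2}") auto
      qed auto
      finally have "?c \<le> J" using J0 by simp
      then have "\<mu> * (6 * E ^ 4 / \<delta>)\<^sup>2 * ?c \<le> \<mu> * (6 * E ^ 4 / \<delta>)\<^sup>2 * J"
        using mu by (intro mult_left_mono) auto
      moreover have "\<mu> * (6 * E ^ 4 / \<delta>)\<^sup>2 * (1 / \<mu> * (\<delta> / (6 * E ^ 4))\<^sup>2 * x) = x" for x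
        using mu d E by (simp add: field_simps)
      moreover have "\<mu> * (6 * E ^ 4 / \<delta>)\<^sup>2 * J = (6 * E ^ 4 / \<delta>)\<^sup>2 * (C2 * m)" using m(2) by (simp add: mult_ac)
      ultimately show ?thesis by simp
    qed
    have sym: "?F (- k) = ?F k" for k
    proof -
      have "fourier v1 (- k) = cnj (fourier v1 k)" unfolding cnj_fourier by (simp add: fourier_def)
      then show ?thesis by simp
    qed
    have IF: "(LINT k|lborel. ?F k) \<le> C3 * m"
    proof -
      let ?i = "\<lambda>k. indicator {1..} k * ?F k"
      let ?c = "(6 * E ^ 4 / \<delta>)\<^sup>2 * (C2 * m)"
      have c0: "?c \<ge> 0" using C2 m by simp
      have i: "integrable lborel ?i"
        using integrable_mult_indicator[OF _ Fi, of "{1..}"] by simp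
      have i': "integrable lborel (\<lambda>k. ?i (- k))"
        using lborel_integrable_real_affine[OF i, of "-1" 0] by simp
      have i0: "integrable lborel (\<lambda>k. ?c * indicator {-1..1::real} k)"
        by (rule integrable_mult_right) auto
      have "(LINT k|lborel. ?F k) \<le> (LINT k|lborel. ?i k + ?i (- k) + ?c * indicator {-1..1} k)"
      proof (rule integral_mono[OF Fi])
        show "integrable lborel (\<lambda>k. ?i k + ?i (- k) + ?c * indicator {-1..1} k)"
          by (intro Bochner_Integration.integrable_add i i' i0)
        fix k :: real
        show "?F k \<le> ?i k + ?i (- k) + ?c * indicator {-1..1} k"
        proof (cases "\<bar>k\<bar> \<le> 1")
          case True
          then have "k \<in> {-1..1}" by auto
          then have "?F k \<le> ?c * indicator {-1..1} k" using I0[OF True] by simp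
          moreover have "0 \<le> ?i k" "0 \<le> ?i (-k)" by simp_all
          ultimately show ?thesis by linarith
        next
          case False
          then consider "k > 1" | "k < -1" by linarith
          then show ?thesis using c0 sym[of k] by cases auto
        qed
      qed
      also have "\<dots> = (LINT k|lborel. ?i k) + (LINT k|lborel. ?i (- k)) + ?c * 2"
        using i i' i0 by (simp add: Bochner_Integration.integral_add)
      also have "(LINT k|lborel. ?i (- k)) = (LINT k|lborel. ?i k)"
        using integral_reflect_shift[of ?i 0] by simp
      also have "(LINT k|lborel. ?i k) + (LINT k|lborel. ?i k) + ?c * 2 \<le> C3 * m"
        using I1 by (simp add: C3_def algebra_simps)
      finally show ?thesis .
    qed
    define n2 where "n2 = (LINT x|lborel. (v1 x)\<^sup>2)"
    have n20: "n2 \<ge> 0" by (simp add: n2_def)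
    have "2 * pi * n2 = (LINT k|lborel. ?F k)" using pl(2) by (simp add: n2_def)
    moreover have "n2 \<le> 2 * pi * n2" using mult_right_mono[OF _ n20, of 1 "2 * pi"] pi_gt3 by simp
    ultimately have n2m: "n2 \<le> C3 * m" using IF by linarith
    have n22: "n2 \<le> 2" unfolding n2_def by (rule v1_sq(2))
    define D where "D = (LINT x|lborel. (v1 x - v1 (x - (t - t')))\<^sup>2)"
    have D4: "D \<le> 4 * n2" unfolding D_def n2_def by (rule v1_shift_sq(2))
    define h where "h = t - t'"
    have h0: "h \<ge> 0" using t by (simp add: h_def)
    have Dh: "D \<le> C5 * h"
    proof (cases "h = 0")
      case True then show ?thesis by (simp add: D_def h_def)
    next
      case False
      then have "h > 0" using h0 by simp
      from v1_increment_le[OF sector d this] show ?thesis by (simp add: D_def h_def C5_def)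
    qed
    \<comment> \<open>Increments shorter than m use the linear bounds in \<open>h\<close>, longer
      ones the smallness of the square norm of \<open>v1\<close>.\<close>
    have "D + min 1 h * n2 \<le> (C5 + 4 * C3 + C3 + 2) * min h m"
    proof (cases "h \<le> m")
      case True
      have "min 1 h * n2 \<le> h * 2" using h0 n20 n22 by (intro mult_mono) auto
      then have "D + min 1 h * n2 \<le> (C5 + 2) * h" using Dh by (simp add: algebra_simps)
      also have "\<dots> \<le> (C5 + 4 * C3 + C3 + 2) * h" using h0 C3 by (intro mult_right_mono) auto
      finally show ?thesis using True by simp
    next
      case False
      have "min 1 h * n2 \<le> 1 * n2" using n20 by (intro mult_right_mono) auto
      then have "D + min 1 h * n2 \<le> (4 * C3 + C3) * m" using D4 n2m by (simp add: algebra_simps)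
      also have "\<dots> \<le> (C5 + 4 * C3 + C3 + 2) * m" using m C5 by (intro mult_right_mono) auto
      finally show ?thesis using False by simp
    qed
    then have "2 * exp (2 * T) * (D + min 1 h * n2) \<le> 2 * exp (2 * T) * ((C5 + 4 * C3 + C3 + 2) * min h m)"
      by (intro mult_left_mono) auto
    also have "\<dots> \<le> C * min h m" using h0 m by (simp add: C_def algebra_simps)
    finally show "(LINT x|lborel. indicator {0..t} x * (zero_extension u (t - x) - zero_extension u (t' - x))\<^sup>2)
        \<le> C * min (t - t') (\<mu> powr (- 1 / \<rho>))"
      using increment_split[OF t] unfolding D_def n2_def h_def m_def by linarith
  qed
qed

section \<open>Coordinates in an orthonormal basis\<close>

lemma orthonormal_basisD:
  assumes "orthonormal_basis e"
  shows "e i \<bullet> e j = (if i = j then 1 else 0)" "closure (span (range e)) = UNIV"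
  using assms by (auto simp: orthonormal_basis_def)

locale onb =
  fixes e :: "nat \<Rightarrow> 'h::{real_inner,banach,second_countable_topology}"
  assumes onb: "orthonormal_basis e"
begin

lemma inner_e [simp]: "e i \<bullet> e j = (if i = j then 1 else 0)"
  by (rule orthonormal_basisD(1)[OF onb])

lemma inner_sum_e: "finite A \<Longrightarrow> (\<Sum>k\<in>A. a k *\<^sub>R e k) \<bullet> e j = (if j \<in> A then a j else 0)"
  by (simp add: inner_sum_left if_distrib cong: if_cong)

lemma norm_sum_e: "finite A \<Longrightarrow> (norm (\<Sum>k\<in>A. a k *\<^sub>R e k))\<^sup>2 = (\<Sum>k\<in>A. (a k)\<^sup>2)"
  by (simp add: power2_norm_eq_inner inner_sum_right inner_sum_e) (simp add: power2_eq_square)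

lemma summable_e:
  assumes "summable (\<lambda>k. (a k)\<^sup>2)"
  shows "summable (\<lambda>k. a k *\<^sub>R e k)"
  unfolding summable_Cauchy
proof (intro allI impI)
  fix d :: real assume d: "d > 0"
  then obtain N where N: "\<And>m n. m \<ge> N \<Longrightarrow> norm (\<Sum>k=m..<n. (a k)\<^sup>2) < d\<^sup>2"
    using assms unfolding summable_Cauchy by (meson zero_less_power)
  have "norm (\<Sum>k=m..<n. a k *\<^sub>R e k) < d" if "m \<ge> N" for m n
  proof (rule power2_less_imp_less)
    show "(norm (\<Sum>k=m..<n. a k *\<^sub>R e k))\<^sup>2 < d\<^sup>2"
      using N[OF that, of n] by (simp add: norm_sum_e)
  qed (use d in auto)
  then show "\<exists>N. \<forall>m\<ge>N. \<forall>n. norm (\<Sum>k=m..<n. a k *\<^sub>R e k) < d" by blast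
qed

lemma suminf_e_inner:
  assumes "summable (\<lambda>k. (a k)\<^sup>2)"
  shows "(\<Sum>k. a k *\<^sub>R e k) \<bullet> e j = a j"
proof -
  have "(\<Sum>k. a k *\<^sub>R e k) \<bullet> e j = (\<Sum>k. (a k *\<^sub>R e k) \<bullet> e j)"
    by (rule bounded_linear.suminf[OF bounded_linear_inner_left summable_e[OF assms]])
  also have "\<dots> = (\<Sum>k. if k = j then a k else 0)"
    by (intro suminf_cong) auto
  also have "\<dots> = a j" by (rule sums_unique[symmetric, OF sums_single])
  finally show ?thesis .
qed

lemma suminf_e_norm:
  assumes "summable (\<lambda>k. (a k)\<^sup>2)"
  shows "(\<lambda>k. (a k)\<^sup>2) sums (norm (\<Sum>k. a k *\<^sub>R e k))\<^sup>2"
proof -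
  have "(\<lambda>n. (norm (\<Sum>k<n. a k *\<^sub>R e k))\<^sup>2) \<longlonglongrightarrow> (norm (\<Sum>k. a k *\<^sub>R e k))\<^sup>2"
    by (intro tendsto_intros summable_LIMSEQ summable_e assms)
  then show ?thesis by (simp add: norm_sum_e sums_def)
qed

lemma bessel: "(\<Sum>k<n. (v \<bullet> e k)\<^sup>2) \<le> (norm v)\<^sup>2"
proof -
  let ?p = "\<Sum>k<n. (v \<bullet> e k) *\<^sub>R e k"
  have "v \<bullet> ?p = (\<Sum>k<n. (v \<bullet> e k)\<^sup>2)" by (simp add: inner_sum_right power2_eq_square)
  moreover have "?p \<bullet> ?p = (\<Sum>k<n. (v \<bullet> e k)\<^sup>2)" using norm_sum_e[of "{..<n}" "\<lambda>k. v \<bullet> e k"] by (simp add: power2_norm_eq_inner)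
  moreover have "0 \<le> (v - ?p) \<bullet> (v - ?p)" by simp
  ultimately show ?thesis
    by (simp add: power2_norm_eq_inner inner_diff_left inner_diff_right inner_commute)
qed

lemma summable_inner_sq: "summable (\<lambda>k. (v \<bullet> e k)\<^sup>2)"
  by (rule summableI_nonneg_bounded[of _ "(norm v)\<^sup>2"]) (auto intro: bessel)

lemma orthogonal_zero:
  assumes "\<And>k. v \<bullet> e k = 0"
  shows "v = 0"
proof -
  have "x \<in> span (range e) \<Longrightarrow> v \<bullet> x = 0" for x
  proof (induction rule: span_induct_alt)
    case (step c x y)
    then show ?case using assms by (auto simp: inner_add_right)
  qed auto
  then have "span (range e) \<subseteq> {x. v \<bullet> x = 0}" by auto
  moreover have "closed {x. v \<bullet> x = 0}" by (intro closed_Collect_eq continuous_intros)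
  ultimately have "closure (span (range e)) \<subseteq> {x. v \<bullet> x = 0}" by (rule closure_minimal)
  then have "v \<in> {x. v \<bullet> x = 0}" unfolding orthonormal_basisD(2)[OF onb] by (rule subsetD) simp
  then show ?thesis by simp
qed

lemma e_eqI: "(\<And>k. v \<bullet> e k = w \<bullet> e k) \<Longrightarrow> v = w"
  using orthogonal_zero[of "v - w"] by (simp add: inner_diff_left)

lemma expansion: "(\<Sum>k. (v \<bullet> e k) *\<^sub>R e k) = v"
  by (rule e_eqI) (rule suminf_e_inner[OF summable_inner_sq])

lemma expansion_sums: "(\<lambda>k. (v \<bullet> e k) *\<^sub>R e k) sums v"
  using summable_sums[OF summable_e[OF summable_inner_sq[of v]]] by (simp add: expansion)

lemma parseval: "(\<lambda>k. (v \<bullet> e k)\<^sup>2) sums (norm v)\<^sup>2"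
  using suminf_e_norm[OF summable_inner_sq[of v]] by (simp add: expansion)

lemma parseval_ennreal: "(\<Sum>k. ennreal ((v \<bullet> e k)\<^sup>2)) = ennreal ((norm v)\<^sup>2)"
  using parseval[of v] by (intro suminf_ennreal_eq) auto

text \<open>The representing vector is the sum of the f(e k) e k. Applying the bound on
  \<open>f\<close> to a partial sum with squared norm s gives s <= sqrt s K, so the coefficients are
  square summable. It supplies the adjoints of the integrands of elementary integrals.\<close>

lemma riesz:
  fixes f :: "'h \<Rightarrow> real"
  assumes f: "bounded_linear f"
  shows "\<exists>y. \<forall>v. f v = v \<bullet> y"
proof -
  interpret f: bounded_linear f by (rule f)
  obtain K where K: "K > 0" "\<And>v. norm (f v) \<le> norm v * K" using f.pos_bounded by blast
  define a where "a k = f (e k)" for k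
  have "(\<Sum>k<n. (a k)\<^sup>2) \<le> K\<^sup>2" for n
  proof -
    define s where "s = (\<Sum>k<n. (a k)\<^sup>2)"
    have s0: "s \<ge> 0" by (simp add: s_def sum_nonneg)
    have "s = f (\<Sum>k<n. a k *\<^sub>R e k)" by (simp add: s_def f.sum f.scale a_def power2_eq_square)
    also have "\<dots> \<le> norm (\<Sum>k<n. a k *\<^sub>R e k) * K" using K(2) by (metis abs_le_D1 real_norm_def)
    also have "norm (\<Sum>k<n. a k *\<^sub>R e k) = sqrt s"
      using norm_sum_e[of "{..<n}" a] by (simp add: s_def real_sqrt_unique)
    finally have "sqrt s * sqrt s \<le> sqrt s * K" using s0 by simp
    have "sqrt s \<le> K"
    proof (cases "s = 0")
      case False
      then have "0 < sqrt s" using s0 by simp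
      with \<open>sqrt s * sqrt s \<le> sqrt s * K\<close> show ?thesis by (rule mult_left_le_imp_le)
    qed (use K(1) in simp)
    then have "(sqrt s)\<^sup>2 \<le> K\<^sup>2" using s0 by (intro power_mono) auto
    then show ?thesis using s0 by (simp add: s_def)
  qed
  then have sm: "summable (\<lambda>k. (a k)\<^sup>2)" by (intro summableI_nonneg_bounded[of _ "K\<^sup>2"]) auto
  define y where "y = (\<Sum>k. a k *\<^sub>R e k)"
  have y: "y \<bullet> e k = a k" for k unfolding y_def by (rule suminf_e_inner[OF sm])
  have "f v = v \<bullet> y" for v
  proof -
    have 1: "(\<lambda>k. f ((v \<bullet> e k) *\<^sub>R e k)) sums f v"
      by (rule f.sums[OF expansion_sums])
    have 2: "(\<lambda>k. ((v \<bullet> e k) *\<^sub>R e k) \<bullet> y) sums (v \<bullet> y)"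
      by (rule bounded_linear.sums[OF bounded_linear_inner_left expansion_sums])
    have "f ((v \<bullet> e k) *\<^sub>R e k) = ((v \<bullet> e k) *\<^sub>R e k) \<bullet> y" for k
    proof -
      have "e k \<bullet> y = f (e k)" using y[of k] by (subst inner_commute) (simp only: a_def)
      then show ?thesis by (simp only: f.scaleR inner_scaleR_left real_scaleR_def)
    qed
    then have "(\<lambda>k. f ((v \<bullet> e k) *\<^sub>R e k)) = (\<lambda>k. ((v \<bullet> e k) *\<^sub>R e k) \<bullet> y)" by (rule ext)
    from sums_unique2[OF 1[unfolded this] 2] show ?thesis .
  qed
  then show ?thesis by blast
qed

end

subsection \<open>Domains of fractional powers\<close>

locale onb_weights = onb e for e :: "nat \<Rightarrow> 'h::{real_inner,banach,second_countable_topology}" +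
  fixes lam :: "nat \<Rightarrow> real"
begin

text \<open>The squared norm with value infinity outside \<open>Hdot\<close>. Being defined and
  measurable everywhere, it allows moments to be estimated before membership in \<open>Hdot\<close>
  is known, which then follows from finiteness.\<close>

definition hnorm2 :: "real \<Rightarrow> 'h \<Rightarrow> ennreal" where
  "hnorm2 s v = (\<Sum>k. ennreal ((lam k powr (s / 2) * (v \<bullet> e k))\<^sup>2))"

lemma Hdot_iff_summable: "v \<in> Hdot e lam s \<longleftrightarrow> summable (\<lambda>k. (lam k powr (s / 2) * (v \<bullet> e k))\<^sup>2)"
  by (simp add: Hdot_def frac_dom_def)

lemma Hdot_iff: "v \<in> Hdot e lam s \<longleftrightarrow> hnorm2 s v < \<top>"
proof -
  let ?a = "\<lambda>k. (lam k powr (s / 2) * (v \<bullet> e k))\<^sup>2"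
  have "hnorm2 s v \<noteq> \<top>" if "summable ?a"
    unfolding hnorm2_def using that by (intro ennreal_suminf_neq_top) auto
  moreover have "summable ?a" if "hnorm2 s v \<noteq> \<top>"
    by (rule summable_suminf_not_top) (use that in \<open>auto simp: hnorm2_def\<close>)
  ultimately show ?thesis unfolding Hdot_iff_summable by (auto simp: less_top)
qed

lemma frac_pow_inner: "v \<in> Hdot e lam s \<Longrightarrow> frac_pow e lam (s / 2) v \<bullet> e k = lam k powr (s / 2) * (v \<bullet> e k)"
  unfolding frac_pow_def Hdot_iff_summable by (rule suminf_e_inner)

lemma Hdot_norm_eq: "v \<in> Hdot e lam s \<Longrightarrow> ennreal ((Hdot_norm e lam s v)\<^sup>2) = hnorm2 s v"
  unfolding Hdot_norm_def hnorm2_def parseval_ennreal[symmetric] by (simp add: frac_pow_inner)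

lemma Hdot_zero: "0 \<in> Hdot e lam s" by (simp add: Hdot_iff_summable)

lemma Hdot_scaleR: "v \<in> Hdot e lam s \<Longrightarrow> c *\<^sub>R v \<in> Hdot e lam s"
  unfolding Hdot_iff_summable by (simp add: power_mult_distrib mult.left_commute[of _ c] summable_mult)

lemma Hdot_add:
  assumes "v \<in> Hdot e lam s" "w \<in> Hdot e lam s" shows "v + w \<in> Hdot e lam s"
proof -
  have "summable (\<lambda>k. 2 * (lam k powr (s / 2) * (v \<bullet> e k))\<^sup>2 + 2 * (lam k powr (s / 2) * (w \<bullet> e k))\<^sup>2)"
    using assms unfolding Hdot_iff_summable by (intro summable_add summable_mult)
  then show ?thesis unfolding Hdot_iff_summable
  proof (rule summable_comparison_test'[where N = 0])
    fix k
    have "(p + q)\<^sup>2 \<le> 2 * p\<^sup>2 + 2 * q\<^sup>2" for p q :: real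
      using sum_squares_ge_zero[of "p - q" 0] by (simp add: power2_eq_square algebra_simps)
    from this[of "lam k powr (s / 2) * (v \<bullet> e k)" "lam k powr (s / 2) * (w \<bullet> e k)"]
    show "norm ((lam k powr (s / 2) * ((v + w) \<bullet> e k))\<^sup>2)
        \<le> 2 * (lam k powr (s / 2) * (v \<bullet> e k))\<^sup>2 + 2 * (lam k powr (s / 2) * (w \<bullet> e k))\<^sup>2"
      by (simp add: inner_add_left distrib_left)
  qed
qed

lemma Hdot_diff: "v \<in> Hdot e lam s \<Longrightarrow> w \<in> Hdot e lam s \<Longrightarrow> v - w \<in> Hdot e lam s"
  using Hdot_add[of v s "- 1 *\<^sub>R w"] Hdot_scaleR[of w s "-1"] by simp

lemma Hdot_sum: "(\<And>i. i \<in> A \<Longrightarrow> f i \<in> Hdot e lam s) \<Longrightarrow> sum f A \<in> Hdot e lam s"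
  by (induction A rule: infinite_finite_induct) (auto intro: Hdot_zero Hdot_add)

lemma frac_pow_diff: "v \<in> Hdot e lam s \<Longrightarrow> w \<in> Hdot e lam s \<Longrightarrow>
    frac_pow e lam (s/2) (v - w) = frac_pow e lam (s/2) v - frac_pow e lam (s/2) w"
  by (rule e_eqI) (simp add: frac_pow_inner Hdot_diff inner_diff_left right_diff_distrib)

lemma frac_pow_scaleR: "v \<in> Hdot e lam s \<Longrightarrow>
    frac_pow e lam (s/2) (c *\<^sub>R v) = c *\<^sub>R frac_pow e lam (s/2) v"
  by (rule e_eqI) (simp add: frac_pow_inner Hdot_scaleR)

lemma frac_pow_sum: "finite A \<Longrightarrow> (\<And>i. i \<in> A \<Longrightarrow> f i \<in> Hdot e lam s) \<Longrightarrow>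
    frac_pow e lam (s/2) (sum f A) = (\<Sum>i\<in>A. frac_pow e lam (s/2) (f i))"
  by (rule e_eqI) (simp add: frac_pow_inner Hdot_sum inner_sum_left sum_distrib_left)

text \<open>Closedness of the fractional power, read off from coordinates. It puts the sum of a
  series convergent in H into \<open>Hdot\<close> and computes its image termwise.\<close>

lemma frac_pow_closed:
  assumes v: "f sums v" and f: "\<And>i. f i \<in> Hdot e lam s" and y: "(\<lambda>i. frac_pow e lam (s/2) (f i)) sums y"
  shows "v \<in> Hdot e lam s" "frac_pow e lam (s/2) v = y"
proof -
  have k: "lam k powr (s / 2) * (v \<bullet> e k) = y \<bullet> e k" for k
  proof -
    have "(\<lambda>i. lam k powr (s / 2) * (f i \<bullet> e k)) sums (lam k powr (s / 2) * (v \<bullet> e k))"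
      by (intro sums_mult bounded_linear.sums[OF bounded_linear_inner_left v])
    moreover have "(\<lambda>i. lam k powr (s / 2) * (f i \<bullet> e k)) sums (y \<bullet> e k)"
      using bounded_linear.sums[OF bounded_linear_inner_left y, of "e k"] by (simp add: frac_pow_inner f)
    ultimately show ?thesis by (rule sums_unique2)
  qed
  show 1: "v \<in> Hdot e lam s" unfolding Hdot_iff_summable k by (rule summable_inner_sq)
  show "frac_pow e lam (s/2) v = y" by (rule e_eqI) (simp add: frac_pow_inner 1 k)
qed

lemma borel_measurable_hnorm2 [measurable]: "hnorm2 s \<in> borel_measurable borel"
  unfolding hnorm2_def[abs_def] by measurable

lemma hnorm2_zero [simp]: "hnorm2 0 v = ennreal ((norm v)\<^sup>2)" if "\<And>k. lam k > 0"
proof -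
  have "lam k powr 0 = 1" for k using that[of k] by simp
  then show ?thesis unfolding hnorm2_def parseval_ennreal[symmetric] by simp
qed

text \<open>The spectrum is bounded below by \<open>c\<close>, so lowering the order costs a power
  of \<open>c\<close>. Countably many orders can thereby stand for all.\<close>

lemma hnorm2_mono:
  assumes lam: "\<And>k. lam k \<ge> c" "c > 0" and s: "s \<le> s'"
  shows "hnorm2 s v \<le> ennreal (c powr (s - s')) * hnorm2 s' v"
  unfolding hnorm2_def ennreal_suminf_cmult[symmetric]
proof (rule suminf_le)
  fix k
  have l: "lam k > 0" using lam(1)[of k] lam(2) by linarith
  have "lam k powr s = lam k powr (s - s') * lam k powr s'" by (simp add: powr_add[symmetric])
  also have "\<dots> \<le> c powr (s - s') * lam k powr s'"
    using lam s by (intro mult_right_mono powr_mono2') auto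
  finally have "lam k powr s * (v \<bullet> e k)\<^sup>2 \<le> c powr (s - s') * lam k powr s' * (v \<bullet> e k)\<^sup>2"
    by (rule mult_right_mono) simp
  moreover have "(lam k powr (q / 2) * x)\<^sup>2 = lam k powr q * x\<^sup>2" for q x
    by (simp add: power_mult_distrib power2_eq_square flip: powr_add)
  ultimately show "ennreal ((lam k powr (s / 2) * (v \<bullet> e k))\<^sup>2)
      \<le> ennreal (c powr (s - s')) * ennreal ((lam k powr (s' / 2) * (v \<bullet> e k))\<^sup>2)"
    by (simp add: ennreal_mult[symmetric] mult.assoc ennreal_leI)
qed auto

end

subsection \<open>Gaussian variables and the Wiener process\<close>

lemma sum_telescope_between:
  fixes f :: "real \<Rightarrow> 'a::ab_group_add"
  assumes p: "strict_mono_on {..N} p" and a: "\<alpha> = p a" "a \<le> N" and b: "\<beta> = p b" "b \<le> N" and le: "\<alpha> \<le> \<beta>"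
  shows "(\<Sum>j | j < N \<and> \<alpha> \<le> p j \<and> p j < \<beta>. f (p (Suc j)) - f (p j)) = f \<beta> - f \<alpha>"
proof -
  have less: "p i < p j \<longleftrightarrow> i < j" if "i \<le> N" "j \<le> N" for i j
    using strict_mono_on_less[OF p] that by auto
  have ab: "a \<le> b" using less[OF b(2) a(2)] le a b by (metis linorder_not_less)
  have "{j. j < N \<and> \<alpha> \<le> p j \<and> p j < \<beta>} = {a..<b}"
  proof (intro set_eqI iffI)
    fix j assume "j \<in> {j. j < N \<and> \<alpha> \<le> p j \<and> p j < \<beta>}"
    then show "j \<in> {a..<b}" using a b less[of j a] less[of j b] by auto
  next
    fix j assume "j \<in> {a..<b}"
    then show "j \<in> {j. j < N \<and> \<alpha> \<le> p j \<and> p j < \<beta>}" using a b less[of j a] less[of j b] by auto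
  qed
  then show ?thesis using sum_Suc_diff'[OF ab, of "\<lambda>j. f (p j)"] a b by simp
qed

lemma finite_set_enumeration:
  fixes P :: "real set"
  assumes "finite P" "P \<noteq> {}"
  obtains N :: nat and p :: "nat \<Rightarrow> real" where "strict_mono_on {..N} p" "P = p ` {..N}"
proof -
  let ?l = "sorted_list_of_set P"
  have l: "sorted_wrt (<) ?l" "set ?l = P" "length ?l = card P" using assms by auto
  then have c: "card P > 0" using assms by (simp add: card_gt_0_iff)
  show ?thesis
  proof (rule that[of "card P - 1" "\<lambda>i. ?l ! i"])
    show "strict_mono_on {..card P - 1} (\<lambda>i. ?l ! i)"
      using sorted_wrt_nth_less[OF l(1)] c l(3) by (auto simp: strict_mono_on_def)
    show "P = (\<lambda>i. ?l ! i) ` {..card P - 1}"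
    proof -
      have "{..card P - 1} = {..<length ?l}" using c l(3) by auto
      then show ?thesis using l(2) nth_image[of "length ?l" ?l] by (simp add: atLeast0LessThan)
    qed
  qed
qed

text \<open>The double factorial (2m-1)!!, that is, the moment of order 2m of a standard normal
  variable; it equals 1 for m = 1, which is used to read off variances.\<close>

definition gaussian_moment :: "nat \<Rightarrow> real" where
  "gaussian_moment m = fact (2 * m) / (2 ^ m * fact m)"

context prob_space
begin

lemma centered_gaussian_distributed:
  assumes v: "v > 0" and X: "X \<in> borel_measurable M" and d: "distr M borel X = centered_gaussian v"
  shows "distributed M lborel X (\<lambda>x. ennreal (normal_density 0 (sqrt v) x))"
proof -
  have "distr M lborel X = distr M borel X" by (rule distr_cong) auto
  then show ?thesis using v X d by (auto simp: distributed_def centered_gaussian_def)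
qed

lemma centered_gaussian_zero:
  assumes X: "X \<in> borel_measurable M" and d: "distr M borel X = centered_gaussian 0"
  shows "AE \<omega> in M. X \<omega> = 0"
proof -
  have "AE x in return borel (0::real). x = 0" by (subst AE_return) auto
  moreover have "distr M borel X = return borel 0" using d by (simp add: centered_gaussian_def)
  ultimately have "AE x in distr M borel X. x = 0" by (simp only:)
  then show ?thesis using X by (subst (asm) AE_distr_iff) auto
qed

lemma centered_gaussian_nn_moment:
  assumes v: "v \<ge> 0" and X: "X \<in> borel_measurable M" and d: "distr M borel X = centered_gaussian v"
  shows "(\<integral>\<^sup>+\<omega>. ennreal (X \<omega> ^ (2 * m)) \<partial>M) = ennreal (gaussian_moment m * v ^ m)"
proof (cases "v = 0")
  case True
  have "(\<integral>\<^sup>+\<omega>. ennreal (X \<omega> ^ (2 * m)) \<partial>M) = (\<integral>\<^sup>+\<omega>. ennreal (0 ^ (2 * m)) \<partial>M)"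
    using centered_gaussian_zero[OF X d[unfolded True]] by (intro nn_integral_cong_AE) auto
  then show ?thesis using True emeasure_space_1 by (cases "m = 0") (auto simp: gaussian_moment_def zero_power)
next
  case False
  with v have v: "v > 0" by simp
  have "(\<integral>\<^sup>+\<omega>. ennreal (X \<omega> ^ (2 * m)) \<partial>M)
     = (\<integral>\<^sup>+x. ennreal (normal_density 0 (sqrt v) x) * ennreal (x ^ (2 * m)) \<partial>lborel)"
    by (rule distributed_nn_integral[OF centered_gaussian_distributed[OF v X d], symmetric]) auto
  also have "\<dots> = (\<integral>\<^sup>+x. ennreal (normal_density 0 (sqrt v) x * (x - 0) ^ (2 * m)) \<partial>lborel)"
    by (intro nn_integral_cong) (simp add: ennreal_mult)
  also have "\<dots> = ennreal (fact (2 * m) / ((2 / (sqrt v)\<^sup>2) ^ m * fact m))"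
    using normal_moment_even[of "sqrt v" 0 m] v
    by (subst nn_integral_eq_integral) (auto simp: has_bochner_integral_iff)
  also have "fact (2 * m) / ((2 / (sqrt v)\<^sup>2) ^ m * fact m) = gaussian_moment m * v ^ m"
    using v by (simp add: gaussian_moment_def power_divide)
  finally show ?thesis .
qed

lemma centered_gaussian_integrals:
  assumes v: "v \<ge> 0" and X: "X \<in> borel_measurable M" and d: "distr M borel X = centered_gaussian v"
  shows "integrable M (\<lambda>\<omega>. (X \<omega>)\<^sup>2)" "(LINT \<omega>|M. (X \<omega>)\<^sup>2) = v" "integrable M X" "(LINT \<omega>|M. X \<omega>) = 0"
proof -
  have nn: "(\<integral>\<^sup>+\<omega>. ennreal ((X \<omega>)\<^sup>2) \<partial>M) = ennreal v"
    using centered_gaussian_nn_moment[OF v X d, of 1] by (simp add: gaussian_moment_def)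
  show 1: "integrable M (\<lambda>\<omega>. (X \<omega>)\<^sup>2)"
    using nn X by (intro integrableI_nonneg) auto
  show "(LINT \<omega>|M. (X \<omega>)\<^sup>2) = v"
    using nn v X by (subst integral_eq_nn_integral) auto
  show 3: "integrable M X" using X by (rule square_integrable_imp_integrable[OF _ 1])
  show "(LINT \<omega>|M. X \<omega>) = 0"
  proof (cases "v = 0")
    case True
    then have "(LINT \<omega>|M. X \<omega>) = (LINT \<omega>|M. 0)"
      using centered_gaussian_zero[OF X] d X by (intro integral_cong_AE) auto
    then show ?thesis by simp
  next
    case False
    with v have v: "v > 0" by simp
    show ?thesis
      using normal_distributed_expectation[OF _ centered_gaussian_distributed[OF v X d]] v by simp
  qed
qed

text \<open>Zero variance is a point mass without density; in that case the degenerate summand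
  vanishes almost surely and drops out. Otherwise the densities convolve.\<close>

lemma centered_gaussian_add:
  assumes "v \<ge> 0" "w \<ge> 0" and ind: "indep_var borel X borel Y"
    and dX: "distr M borel X = centered_gaussian v" and dY: "distr M borel Y = centered_gaussian w"
  shows "distr M borel (\<lambda>\<omega>. X \<omega> + Y \<omega>) = centered_gaussian (v + w)"
proof -
  have X [measurable]: "X \<in> borel_measurable M" and Y [measurable]: "Y \<in> borel_measurable M"
    using indep_var_rv1[OF ind] indep_var_rv2[OF ind] by auto
  consider "v = 0" | "w = 0" | "v > 0" "w > 0" using assms by linarith
  then show ?thesis
  proof cases
    case 1
    then have "distr M borel (\<lambda>\<omega>. X \<omega> + Y \<omega>) = distr M borel Y"
      using centered_gaussian_zero[OF X] dX by (intro distr_cong_AE) auto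
    then show ?thesis using 1 dY by simp
  next
    case 2
    then have "distr M borel (\<lambda>\<omega>. X \<omega> + Y \<omega>) = distr M borel X"
      using centered_gaussian_zero[OF Y] dY by (intro distr_cong_AE) auto
    then show ?thesis using 2 dX by simp
  next
    case 3
    have "distributed M lborel (\<lambda>\<omega>. X \<omega> + Y \<omega>) (normal_density (0 + 0) (sqrt ((sqrt v)\<^sup>2 + (sqrt w)\<^sup>2)))"
      by (rule add_indep_normal[OF ind])
         (use 3 centered_gaussian_distributed[OF _ X dX] centered_gaussian_distributed[OF _ Y dY] in auto)
    then have "distributed M lborel (\<lambda>\<omega>. X \<omega> + Y \<omega>) (normal_density 0 (sqrt (v + w)))" using 3 by simp
    moreover have "distr M lborel (\<lambda>\<omega>. X \<omega> + Y \<omega>) = distr M borel (\<lambda>\<omega>. X \<omega> + Y \<omega>)" by (rule distr_cong) auto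
    ultimately show ?thesis using 3 by (auto simp: distributed_def centered_gaussian_def)
  qed
qed

lemma centered_gaussian_scale:
  assumes X [measurable]: "X \<in> borel_measurable M" and d: "distr M borel X = centered_gaussian v" and v: "v \<ge> 0"
  shows "distr M borel (\<lambda>\<omega>. a * X \<omega>) = centered_gaussian (a\<^sup>2 * v)"
proof (cases "a = 0 \<or> v = 0")
  case True
  have "AE \<omega> in M. a * X \<omega> = 0"
    using True centered_gaussian_zero[OF X] d by (cases "a = 0") auto
  then have "distr M borel (\<lambda>\<omega>. a * X \<omega>) = distr M borel (\<lambda>\<omega>. 0)" by (intro distr_cong_AE) auto
  also have "\<dots> = return borel 0" by (rule distr_const) auto
  finally show ?thesis using True by (auto simp: centered_gaussian_def)
next
  case False
  then have v: "v > 0" and a: "a \<noteq> 0" using v by auto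
  have "distributed M lborel (\<lambda>\<omega>. 0 + a * X \<omega>) (normal_density (0 + a * 0) (\<bar>a\<bar> * sqrt v))"
    by (rule normal_density_affine[OF centered_gaussian_distributed[OF v X d]]) (use v a in auto)
  moreover have "\<bar>a\<bar> * sqrt v = sqrt (a\<^sup>2 * v)" by (simp add: real_sqrt_mult)
  moreover have "distr M lborel (\<lambda>\<omega>. a * X \<omega>) = distr M borel (\<lambda>\<omega>. a * X \<omega>)" by (rule distr_cong) auto
  ultimately show ?thesis using v a by (auto simp: distributed_def centered_gaussian_def)
qed

end

locale wiener = prob_space M + onb e
  for M :: "'w measure" and e :: "nat \<Rightarrow> 'h::{real_inner,banach,second_countable_topology}" +
  fixes F :: "real \<Rightarrow> 'w measure" and Q R :: "'h \<Rightarrow> 'h" and W :: "real \<Rightarrow> 'w \<Rightarrow> 'h"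
  assumes filt: "normal_filtration M F" and Q: "psd_op Q" and R: "is_psd_sqrt R Q" and QW: "Q_wiener M F Q W"
begin

lemma R_linear: "bounded_linear R" and R_sym: "R x \<bullet> y = x \<bullet> R y"
  using R by (auto simp: is_psd_sqrt_def psd_op_def)

lemma Q_inner: "Q h \<bullet> h = (norm (R h))\<^sup>2"
  using R R_sym[of "R h" h] by (simp add: is_psd_sqrt_def power2_norm_eq_inner)

lemmas filt' = filt[unfolded normal_filtration_def]

lemma subalg_all: "\<forall>t\<ge>0. subalgebra M (F t)"
  by (rule filt'[THEN conjunct1])

lemma F_mono_all: "\<forall>t1 t2. 0 \<le> t1 \<longrightarrow> t1 \<le> t2 \<longrightarrow> sets (F t1) \<subseteq> sets (F t2)"
  by (rule filt'[THEN conjunct2, THEN conjunct1])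

lemma subalg: "t \<ge> 0 \<Longrightarrow> subalgebra M (F t)" using subalg_all by blast

lemma space_F [simp]: "t \<ge> 0 \<Longrightarrow> space (F t) = space M" using subalg[of t] by (simp add: subalgebra_def)

lemma sets_F: "t \<ge> 0 \<Longrightarrow> sets (F t) \<subseteq> sets M" using subalg[of t] by (simp add: subalgebra_def)

lemma subalg_mono: "0 \<le> s \<Longrightarrow> s \<le> t \<Longrightarrow> subalgebra (F t) (F s)"
proof -
  assume s: "0 \<le> s" "s \<le> t"
  have "sets (F s) \<subseteq> sets (F t)" using F_mono_all s by blast
  then show ?thesis using s by (simp add: subalgebra_def)
qed

lemma measurable_F_mono: "0 \<le> s \<Longrightarrow> s \<le> t \<Longrightarrow> f \<in> measurable (F s) N \<Longrightarrow> f \<in> measurable (F t) N"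
  using measurable_from_subalg[OF subalg_mono] .

lemma measurable_F: "0 \<le> s \<Longrightarrow> f \<in> measurable (F s) N \<Longrightarrow> f \<in> measurable M N"
  using measurable_from_subalg[OF subalg] .

lemma W_F: "t \<ge> 0 \<Longrightarrow> W t \<in> borel_measurable (F t)" using QW unfolding Q_wiener_def by blast

lemma W_measurable: "t \<ge> 0 \<Longrightarrow> W t \<in> borel_measurable M" by (rule measurable_F[OF _ W_F])

lemma increment_measurable: "0 \<le> a \<Longrightarrow> a \<le> b \<Longrightarrow> (\<lambda>\<omega>. W b \<omega> - W a \<omega>) \<in> borel_measurable M"
  using W_measurable[of a] W_measurable[of b] by measurable

lemma increment_measurable_F: "0 \<le> a \<Longrightarrow> a \<le> b \<Longrightarrow> (\<lambda>\<omega>. W b \<omega> - W a \<omega>) \<in> borel_measurable (F b)"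
  using measurable_F_mono[of a b, OF _ _ W_F] W_F[of b] by auto

lemma increment_gaussian: "0 \<le> a \<Longrightarrow> a < b \<Longrightarrow>
    distr M borel (\<lambda>\<omega>. (W b \<omega> - W a \<omega>) \<bullet> h) = centered_gaussian ((b - a) * (norm (R h))\<^sup>2)"
  using QW unfolding Q_wiener_def Q_inner by blast

text \<open>Preimages under \<open>Z\<close> lie in the past and preimages under a functional of the
  increment are preimages under the increment, so both generating families inherit the independence;
  being stable under intersection, they pass it on to the generated sigma algebras.\<close>

lemma increment_indep:
  assumes ab: "0 \<le> a" "a < b" and Z: "Z \<in> borel_measurable (F a)"
  shows "indep_var borel Z borel (\<lambda>\<omega>. (W b \<omega> - W a \<omega>) \<bullet> h)"
proof -
  let ?D = "\<lambda>\<omega>. W b \<omega> - W a \<omega>"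
  let ?A = "{Z -` A \<inter> space M |A. A \<in> sets borel}"
  let ?B = "{(\<lambda>\<omega>. ?D \<omega> \<bullet> h) -` A \<inter> space M |A. A \<in> sets borel}"
  have Zm: "Z \<in> borel_measurable M" using measurable_F[OF ab(1) Z] .
  have Dm: "?D \<in> borel_measurable M" using increment_measurable[of a b] ab by auto
  have ind: "indep_set (sets (F a)) {?D -` B \<inter> space M | B. B \<in> sets borel}"
    using QW ab unfolding Q_wiener_def by blast
  have A: "?A \<subseteq> sets (F a)"
    using measurable_sets[OF Z] ab by auto
  have B: "?B \<subseteq> {?D -` B \<inter> space M | B. B \<in> sets borel}"
  proof
    fix X assume "X \<in> ?B"
    then obtain A where A: "A \<in> sets borel" "X = (\<lambda>\<omega>. ?D \<omega> \<bullet> h) -` A \<inter> space M" by auto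
    have "(\<lambda>x. x \<bullet> h) -` A \<inter> space borel \<in> sets borel"
      by (rule measurable_sets[OF _ A(1)]) measurable
    then show "X \<in> {?D -` B \<inter> space M | B. B \<in> sets borel}"
      using A(2) by (intro CollectI exI[of _ "(\<lambda>x. x \<bullet> h) -` A"]) auto
  qed
  have "indep_set ?A ?B"
    unfolding indep_set_def
    by (rule indep_sets_mono_sets[OF ind[unfolded indep_set_def]]) (use A B in \<open>auto split: bool.split\<close>)
  moreover have "Int_stable {f -` A \<inter> space M |A. A \<in> sets borel}" for f :: "'w \<Rightarrow> real"
  proof (rule Int_stableI)
    fix P Q assume "P \<in> {f -` A \<inter> space M |A. A \<in> sets borel}" "Q \<in> {f -` A \<inter> space M |A. A \<in> sets borel}"
    then obtain A A' where "A \<in> sets borel" "A' \<in> sets borel" "P = f -` A \<inter> space M" "Q = f -` A' \<inter> space M" by auto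
    then show "P \<inter> Q \<in> {f -` A \<inter> space M |A. A \<in> sets borel}"
      by (intro CollectI exI[of _ "A \<inter> A'"]) auto
  qed
  ultimately have "indep_set (sigma_sets (space M) ?A) (sigma_sets (space M) ?B)"
    by (intro indep_set_sigma_sets)
  then show ?thesis
    unfolding indep_var_eq using Zm Dm by auto
qed

lemma simple_function_expand:
  assumes "simple_function N Y" "\<omega> \<in> space N"
  shows "\<phi> (Y \<omega>) = (\<Sum>l\<in>Y ` space N. indicator (Y -` {l} \<inter> space N) \<omega> * (\<phi> l :: real))"
proof -
  have "(\<Sum>l\<in>Y ` space N. indicator (Y -` {l} \<inter> space N) \<omega> * \<phi> l) = (\<Sum>l\<in>Y ` space N. if l = Y \<omega> then \<phi> l else 0)"
    using assms(2) by (intro sum.cong) (auto simp: indicator_def)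
  also have "\<dots> = \<phi> (Y \<omega>)" using assms by (simp add: simple_functionD)
  finally show ?thesis by simp
qed

text \<open>\<open>Y\<close> takes finitely many values, on events of the past. On each event the
  increment is paired with a fixed vector and is independent of the past, so conditional
  expectations are avoided. The result is the isometry on a single cell together with orthogonality
  to every square integrable \<open>Z\<close> of the past.\<close>

lemma increment_simple:
  assumes ab: "0 \<le> a" "a < b" and Y: "simple_function (F a) Y"
    and Z: "Z \<in> borel_measurable (F a)" "integrable M (\<lambda>\<omega>. (Z \<omega>)\<^sup>2)"
  defines "D \<equiv> (\<lambda>\<omega>. (W b \<omega> - W a \<omega>) \<bullet> Y \<omega>)"
  shows "D \<in> borel_measurable (F b)" "integrable M (\<lambda>\<omega>. (D \<omega>)\<^sup>2)" "integrable M (\<lambda>\<omega>. (norm (R (Y \<omega>)))\<^sup>2)"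
    "(LINT \<omega>|M. (D \<omega>)\<^sup>2) = (b - a) * (LINT \<omega>|M. (norm (R (Y \<omega>)))\<^sup>2)"
    "integrable M (\<lambda>\<omega>. Z \<omega> * D \<omega>)" "(LINT \<omega>|M. Z \<omega> * D \<omega>) = 0"
proof -
  define S where "S = Y ` space M"
  have S: "finite S" using simple_functionD(1)[OF Y] ab by (simp add: S_def)
  define A where "A l = Y -` {l} \<inter> space M" for l
  have AF: "A l \<in> sets (F a)" for l using simple_functionD(2)[OF Y, of "{l}"] ab by (simp add: A_def)
  then have AM [measurable]: "A l \<in> sets M" for l using sets_F[OF ab(1)] by auto
  have ex: "\<phi> (Y \<omega>) = (\<Sum>l\<in>S. indicator (A l) \<omega> * (\<phi> l :: real))" if "\<omega> \<in> space M" for \<phi> \<omega>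
    using simple_function_expand[OF Y, of \<omega> \<phi>] that ab by (simp add: S_def A_def)
  define G where "G l \<omega> = (W b \<omega> - W a \<omega>) \<bullet> l" for l \<omega>
  have Dm: "(\<lambda>\<omega>. W b \<omega> - W a \<omega>) \<in> borel_measurable M" using increment_measurable[of a b] ab by auto
  have Gm [measurable]: "G l \<in> borel_measurable M" for l unfolding G_def using Dm by measurable
  have v0: "0 \<le> (b - a) * (norm (R l))\<^sup>2" for l using ab by simp
  note g = centered_gaussian_integrals[OF v0 Gm increment_gaussian[OF ab, folded G_def]]
  have ind: "indep_var borel f borel (G l)" if "f \<in> borel_measurable (F a)" for f l
    using increment_indep[OF ab that, of l] by (simp add: G_def[abs_def])
  have indF: "(\<lambda>\<omega>. indicator (A l) \<omega> :: real) \<in> borel_measurable (F a)" for l using AF by simp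
  have ind2: "indep_var borel f borel (\<lambda>\<omega>. (G l \<omega>)\<^sup>2)" if "f \<in> borel_measurable (F a)" for f l
    using indep_var_compose[OF ind[OF that, of l], of "\<lambda>x. x" borel "\<lambda>x. x\<^sup>2" borel] by (simp add: o_def)
  have Dex: "D \<omega> = (\<Sum>l\<in>S. indicator (A l) \<omega> * G l \<omega>)" if "\<omega> \<in> space M" for \<omega>
    using ex[OF that, of "\<lambda>l. G l \<omega>"] by (simp add: D_def G_def)
  have D2ex: "(D \<omega>)\<^sup>2 = (\<Sum>l\<in>S. indicator (A l) \<omega> * (G l \<omega>)\<^sup>2)" if "\<omega> \<in> space M" for \<omega>
    using ex[OF that, of "\<lambda>l. (G l \<omega>)\<^sup>2"] by (simp add: D_def G_def)
  have indi: "integrable M (\<lambda>\<omega>. indicator (A l) \<omega> :: real)" for l by (simp add: emeasure_eq_measure)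
  show "D \<in> borel_measurable (F b)"
  proof -
    have "(\<lambda>\<omega>. indicator (A l) \<omega> * G l \<omega>) \<in> borel_measurable (F b)" for l
    proof -
      have "(\<lambda>\<omega>. indicator (A l) \<omega> :: real) \<in> borel_measurable (F b)"
        using measurable_F_mono[OF ab(1) less_imp_le[OF ab(2)] indF] .
      moreover have "G l \<in> borel_measurable (F b)"
        unfolding G_def using increment_measurable_F[OF ab(1) less_imp_le[OF ab(2)]] by measurable
      ultimately show ?thesis by measurable
    qed
    then have "(\<lambda>\<omega>. \<Sum>l\<in>S. indicator (A l) \<omega> * G l \<omega>) \<in> borel_measurable (F b)" by measurable
    then show ?thesis by (rule measurable_cong[THEN iffD1, rotated]) (use Dex ab in auto)
  qed
  have i2: "integrable M (\<lambda>\<omega>. indicator (A l) \<omega> * (G l \<omega>)\<^sup>2)" for l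
    by (rule indep_var_integrable[OF ind2[OF indF] indi g(1)])
  have I2: "(LINT \<omega>|M. indicator (A l) \<omega> * (G l \<omega>)\<^sup>2) = prob (A l) * ((b - a) * (norm (R l))\<^sup>2)" for l
    using indep_var_lebesgue_integral[OF ind2[OF indF] indi g(1), of l l] g(2)[of l] by simp
  show "integrable M (\<lambda>\<omega>. (D \<omega>)\<^sup>2)"
    by (rule Bochner_Integration.integrable_cong[THEN iffD2, OF refl D2ex]) (auto intro: i2)
  have iR: "integrable M (\<lambda>\<omega>. indicator (A l) \<omega> * (norm (R l))\<^sup>2)" for l using indi by auto
  show "integrable M (\<lambda>\<omega>. (norm (R (Y \<omega>)))\<^sup>2)"
    by (rule Bochner_Integration.integrable_cong[THEN iffD2, OF refl ex]) (auto intro: iR)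
  have "(LINT \<omega>|M. (D \<omega>)\<^sup>2) = (LINT \<omega>|M. (\<Sum>l\<in>S. indicator (A l) \<omega> * (G l \<omega>)\<^sup>2))"
    by (rule Bochner_Integration.integral_cong[OF refl D2ex])
  also have "\<dots> = (\<Sum>l\<in>S. prob (A l) * ((b - a) * (norm (R l))\<^sup>2))"
    by (simp add: Bochner_Integration.integral_sum[OF i2] I2)
  also have "\<dots> = (b - a) * (LINT \<omega>|M. (\<Sum>l\<in>S. indicator (A l) \<omega> * (norm (R l))\<^sup>2))"
    by (simp add: Bochner_Integration.integral_sum[OF iR] sum_distrib_left mult_ac)
  also have "(LINT \<omega>|M. (\<Sum>l\<in>S. indicator (A l) \<omega> * (norm (R l))\<^sup>2)) = (LINT \<omega>|M. (norm (R (Y \<omega>)))\<^sup>2)"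
    by (rule Bochner_Integration.integral_cong[OF refl ex[symmetric]])
  finally show "(LINT \<omega>|M. (D \<omega>)\<^sup>2) = (b - a) * (LINT \<omega>|M. (norm (R (Y \<omega>)))\<^sup>2)" .
  have Zi: "integrable M Z"
    by (rule square_integrable_imp_integrable[OF measurable_F[OF ab(1) Z(1)] Z(2)])
  have ZA: "integrable M (\<lambda>\<omega>. indicator (A l) \<omega> * Z \<omega>)" for l
    using integrable_mult_indicator[OF AM Zi] by simp
  have ZAF: "(\<lambda>\<omega>. indicator (A l) \<omega> * Z \<omega>) \<in> borel_measurable (F a)" for l
    using indF[of l] Z(1) by measurable
  have i1: "integrable M (\<lambda>\<omega>. indicator (A l) \<omega> * Z \<omega> * G l \<omega>)" for l
    by (rule indep_var_integrable[OF ind[OF ZAF] ZA g(3)])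
  have I1: "(LINT \<omega>|M. indicator (A l) \<omega> * Z \<omega> * G l \<omega>) = 0" for l
    using indep_var_lebesgue_integral[OF ind[OF ZAF] ZA g(3), of l l] g(4)[of l] by simp
  have ZDex: "Z \<omega> * D \<omega> = (\<Sum>l\<in>S. indicator (A l) \<omega> * Z \<omega> * G l \<omega>)" if "\<omega> \<in> space M" for \<omega>
    using Dex[OF that] by (simp add: sum_distrib_left mult_ac)
  show "integrable M (\<lambda>\<omega>. Z \<omega> * D \<omega>)"
    by (rule Bochner_Integration.integrable_cong[THEN iffD2, OF refl ZDex]) (auto intro: i1)
  have "(LINT \<omega>|M. Z \<omega> * D \<omega>) = (LINT \<omega>|M. (\<Sum>l\<in>S. indicator (A l) \<omega> * Z \<omega> * G l \<omega>))"
    by (rule Bochner_Integration.integral_cong[OF refl ZDex])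
  then show "(LINT \<omega>|M. Z \<omega> * D \<omega>) = 0"
    by (simp add: Bochner_Integration.integral_sum[OF i1] I1)
qed

end

section \<open>The Ito isometry over common partitions\<close>

lemma sq_sum2_le: "(a + b)\<^sup>2 \<le> 2 * a\<^sup>2 + 2 * (b::real)\<^sup>2"
  using sum_squares_ge_zero[of "a - b" 0] by (simp add: power2_eq_square algebra_simps)

lemma norm_sq_diff_le: "(norm (a - b))\<^sup>2 \<le> 2 * (norm (c - a))\<^sup>2 + 2 * (norm (c - b))\<^sup>2"
proof -
  have "norm (a - b) \<le> norm (c - a) + norm (c - b)"
    using norm_triangle_ineq4[of "c - b" "c - a"] by (simp add: algebra_simps)
  then have "(norm (a - b))\<^sup>2 \<le> (norm (c - a) + norm (c - b))\<^sup>2" by (intro power_mono) auto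
  also have "\<dots> \<le> 2 * (norm (c - a))\<^sup>2 + 2 * (norm (c - b))\<^sup>2" by (rule sq_sum2_le)
  finally show ?thesis .
qed

text \<open>Increments over overlapping intervals are not independent, those over the cells of a
  common partition are. The additive maps \<open>g i\<close> let one statement serve the increments
  of W, paired with vectors, and those of step functions of the endpoint.\<close>

lemma refine_sum:
  fixes f :: "real \<Rightarrow> 'a::real_vector" and g :: "'i \<Rightarrow> 'a \<Rightarrow> 'b::comm_monoid_add"
  assumes p: "strict_mono_on {..N} p" and I: "finite I"
    and ab: "\<And>i. i \<in> I \<Longrightarrow> \<alpha> i \<in> p ` {..N} \<and> \<beta> i \<in> p ` {..N} \<and> \<alpha> i \<le> \<beta> i"
    and g: "\<And>i A h. i \<in> I \<Longrightarrow> finite A \<Longrightarrow> g i (sum h A) = (\<Sum>j\<in>A. g i (h (j::nat)))"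
  shows "(\<Sum>i\<in>I. g i (f (\<beta> i) - f (\<alpha> i)))
     = (\<Sum>j<N. \<Sum>i | i \<in> I \<and> \<alpha> i \<le> p j \<and> p j < \<beta> i. g i (f (p (Suc j)) - f (p j)))"
proof -
  have "g i (f (\<beta> i) - f (\<alpha> i)) = (\<Sum>j | j < N \<and> \<alpha> i \<le> p j \<and> p j < \<beta> i. g i (f (p (Suc j)) - f (p j)))"
    if i: "i \<in> I" for i
  proof -
    obtain a b where "a \<le> N" "b \<le> N" "\<alpha> i = p a" "\<beta> i = p b" using ab[OF i] by auto
    note ab' = this
    have "f (\<beta> i) - f (\<alpha> i) = (\<Sum>j | j < N \<and> \<alpha> i \<le> p j \<and> p j < \<beta> i. f (p (Suc j)) - f (p j))"
      by (rule sum_telescope_between[OF p ab'(3,1,4,2), symmetric]) (use ab[OF i] in simp)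
    then show ?thesis by (simp only:) (rule g[OF i], simp)
  qed
  then have "(\<Sum>i\<in>I. g i (f (\<beta> i) - f (\<alpha> i)))
     = (\<Sum>i\<in>I. \<Sum>j | j \<in> {..<N} \<and> \<alpha> i \<le> p j \<and> p j < \<beta> i. g i (f (p (Suc j)) - f (p j)))" by simp
  also have "\<dots> = (\<Sum>j<N. \<Sum>i | i \<in> I \<and> \<alpha> i \<le> p j \<and> p j < \<beta> i. g i (f (p (Suc j)) - f (p j)))"
    by (rule sum.swap_restrict) (use I in auto)
  finally show ?thesis .
qed

lemma partition_exists:
  fixes \<alpha> \<beta> :: "'i \<Rightarrow> real"
  assumes I: "finite I" and nn: "\<And>i. i \<in> I \<Longrightarrow> 0 \<le> \<alpha> i \<and> \<alpha> i \<le> \<beta> i"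
  shows "\<exists>N p. strict_mono_on {..N::nat} p \<and> (\<forall>j\<le>N. 0 \<le> p j) \<and>
    (\<forall>i\<in>I. \<alpha> i \<in> p ` {..N} \<and> \<beta> i \<in> p ` {..N} \<and> \<alpha> i \<le> \<beta> i)"
proof -
  let ?P = "insert 0 (\<alpha> ` I \<union> \<beta> ` I)"
  obtain N :: nat and p where p: "strict_mono_on {..N} p" "?P = p ` {..N}"
    by (rule finite_set_enumeration[of ?P]) (use I in auto)
  have "0 \<le> x" if "x \<in> ?P" for x using that nn by force
  then have "0 \<le> p j" if "j \<le> N" for j using p(2) that by blast
  moreover have "\<alpha> i \<in> p ` {..N}" "\<beta> i \<in> p ` {..N}" if "i \<in> I" for i
    using that unfolding p(2)[symmetric] by auto
  ultimately show ?thesis using p(1) nn by blast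
qed

text \<open>Indicators of half open intervals are increments of a function of the endpoint. In this
  form \<open>refine_sum\<close> applies to integrands just as to integrals.\<close>

lemma indicator_increment:
  "a \<le> (b::real) \<Longrightarrow> indicator {a<..b} \<sigma> = (indicator {\<sigma>..} b - indicator {\<sigma>..} a :: real)"
  by (auto simp: indicator_def)

lemma cell_unique:
  fixes p :: "nat \<Rightarrow> real"
  assumes p: "strict_mono_on {..N} p" and j: "j < N" "j' < N" "\<sigma> \<in> {p j<..p (Suc j)}" "\<sigma> \<in> {p j'<..p (Suc j')}"
  shows "j = j'"
proof (rule ccontr)
  have le: "p (Suc i) \<le> p i'" if "i < i'" "i' < N" for i i'
    using strict_mono_onD[OF p, of "Suc i" i'] that by (cases "Suc i = i'") auto
  assume "j \<noteq> j'"
  then consider "j < j'" | "j' < j" by linarith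
  then show False
  proof cases
    case 1 from le[OF 1 j(2)] j(3,4) show False by simp
  next
    case 2 from le[OF 2 j(1)] j(3,4) show False by simp
  qed
qed

context wiener
begin

lemma simple_function_F_mono:
  assumes "0 \<le> s" "s \<le> t" "simple_function (F s) f" shows "simple_function (F t) f"
  by (rule simple_function_subalgebra[OF assms(3)]) (use subalg_mono[OF assms(1,2)] in \<open>simp_all add: subalgebra_def\<close>)

lemma simple_function_F:
  assumes "0 \<le> s" "simple_function (F s) f" shows "simple_function M f"
  by (rule simple_function_subalgebra[OF assms(2)]) (use subalg[OF assms(1)] in \<open>simp_all add: subalgebra_def\<close>)

text \<open>Induction over the cells: the sum over earlier cells is measurable at the left end of
  the new one, so the cross term has mean zero and the variances add.\<close>

lemma partition_isometry:
  assumes p: "strict_mono_on {..N} p" and p0: "\<And>j. j \<le> N \<Longrightarrow> 0 \<le> p j"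
    and Y: "\<And>j. j < N \<Longrightarrow> simple_function (F (p j)) (Y j)" and n: "n \<le> N"
  defines "Z \<equiv> \<lambda>n \<omega>. \<Sum>j<n. (W (p (Suc j)) \<omega> - W (p j) \<omega>) \<bullet> Y j \<omega>"
  shows "Z n \<in> borel_measurable (F (p n)) \<and> integrable M (\<lambda>\<omega>. (Z n \<omega>)\<^sup>2) \<and>
    (LINT \<omega>|M. (Z n \<omega>)\<^sup>2) = (\<Sum>j<n. (p (Suc j) - p j) * (LINT \<omega>|M. (norm (R (Y j \<omega>)))\<^sup>2))"
  using n
proof (induction n)
  case 0
  then show ?case by (simp add: Z_def)
next
  case (Suc n)
  define D where "D \<omega> = (W (p (Suc n)) \<omega> - W (p n) \<omega>) \<bullet> Y n \<omega>" for \<omega>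
  have pn: "0 \<le> p n" "p n < p (Suc n)"
    using p0[of n] strict_mono_onD[OF p, of n "Suc n"] Suc.prems by auto
  have IH: "Z n \<in> borel_measurable (F (p n))" "integrable M (\<lambda>\<omega>. (Z n \<omega>)\<^sup>2)"
    "(LINT \<omega>|M. (Z n \<omega>)\<^sup>2) = (\<Sum>j<n. (p (Suc j) - p j) * (LINT \<omega>|M. (norm (R (Y j \<omega>)))\<^sup>2))"
    using Suc.IH Suc.prems by auto
  have Yn: "simple_function (F (p n)) (Y n)" using Y Suc.prems by auto
  note inc = increment_simple[OF pn Yn IH(1,2), folded D_def]
  have Zs: "Z (Suc n) = (\<lambda>\<omega>. Z n \<omega> + D \<omega>)" by (simp add: Z_def D_def fun_eq_iff)
  have sq: "(Z (Suc n) \<omega>)\<^sup>2 = ((Z n \<omega>)\<^sup>2 + 2 * (Z n \<omega> * D \<omega>)) + (D \<omega>)\<^sup>2" for \<omega>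
    unfolding Zs by (simp add: power2_eq_square algebra_simps)
  have 1: "Z (Suc n) \<in> borel_measurable (F (p (Suc n)))"
    unfolding Zs using measurable_F_mono[OF pn(1) less_imp_le[OF pn(2)] IH(1)] inc(1)[folded D_def] by measurable
  have 2: "integrable M (\<lambda>\<omega>. (Z (Suc n) \<omega>)\<^sup>2)" unfolding sq
    by (intro Bochner_Integration.integrable_add integrable_mult_right) (use IH(2) inc[folded D_def] in auto)
  have "(LINT \<omega>|M. (Z (Suc n) \<omega>)\<^sup>2) = (LINT \<omega>|M. (Z n \<omega>)\<^sup>2) + 2 * (LINT \<omega>|M. Z n \<omega> * D \<omega>) + (LINT \<omega>|M. (D \<omega>)\<^sup>2)"
    unfolding sq using IH(2) inc(2,5)[folded D_def]
    by (subst Bochner_Integration.integral_add, simp, simp, subst Bochner_Integration.integral_add) auto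
  then show ?case using 1 2 IH(3) inc(4,6)[folded D_def] by simp
qed

text \<open>The intervals may overlap. This matters for differences of two elementary integrals,
  whose partitions are unrelated: both enter as one family.\<close>

lemma isometry:
  fixes I :: "'i set"
  assumes I: "finite I" and nn: "\<And>i. i \<in> I \<Longrightarrow> 0 \<le> \<alpha> i \<and> \<alpha> i \<le> \<beta> i"
    and y: "\<And>i. i \<in> I \<Longrightarrow> simple_function (F (\<alpha> i)) (y i)"
  shows "(\<integral>\<^sup>+\<omega>. ennreal ((\<Sum>i\<in>I. (W (\<beta> i) \<omega> - W (\<alpha> i) \<omega>) \<bullet> y i \<omega>)\<^sup>2) \<partial>M)
    = (\<integral>\<^sup>+\<sigma>. \<integral>\<^sup>+\<omega>. ennreal ((norm (R (\<Sum>i\<in>I. indicator {\<alpha> i<..\<beta> i} \<sigma> *\<^sub>R y i \<omega>)))\<^sup>2) \<partial>M \<partial>lborel)"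
proof -
  have "\<exists>N p. strict_mono_on {..N::nat} p \<and> (\<forall>j\<le>N. 0 \<le> p j) \<and>
    (\<forall>i\<in>I. \<alpha> i \<in> p ` {..N} \<and> \<beta> i \<in> p ` {..N} \<and> \<alpha> i \<le> \<beta> i)"
    by (rule partition_exists[OF I]) (rule nn)
  then obtain N p where Np: "strict_mono_on {..N::nat} p" "\<forall>j\<le>N. 0 \<le> p j"
    "\<forall>i\<in>I. \<alpha> i \<in> p ` {..N} \<and> \<beta> i \<in> p ` {..N} \<and> \<alpha> i \<le> \<beta> i" by (elim exE conjE)
  note p = Np(1)
  have p0: "\<And>j. j \<le> N \<Longrightarrow> 0 \<le> p j" using Np(2) by blast
  have ab: "\<And>i. i \<in> I \<Longrightarrow> \<alpha> i \<in> p ` {..N} \<and> \<beta> i \<in> p ` {..N} \<and> \<alpha> i \<le> \<beta> i" using Np(3) by blast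
  \<comment> \<open>The intervals that cover cell j. Each of them starts no later than the cell, so
    the sum \<open>Y j\<close> of their vectors is known at the left end p j.\<close>
  define K where "K j = {i. i \<in> I \<and> \<alpha> i \<le> p j \<and> p j < \<beta> i}" for j
  define Y where "Y j \<omega> = (\<Sum>i\<in>K j. y i \<omega>)" for j \<omega>
  define c where "c j = (LINT \<omega>|M. (norm (R (Y j \<omega>)))\<^sup>2)" for j
  have Ysf: "simple_function (F (p j)) (Y j)" if "j < N" for j
    unfolding Y_def by (rule simple_function_sum) (use nn y in \<open>auto simp: K_def intro: simple_function_F_mono\<close>)
  have "(\<Sum>i\<in>I. (W (\<beta> i) \<omega> - W (\<alpha> i) \<omega>) \<bullet> y i \<omega>) = (\<Sum>j<N. (W (p (Suc j)) \<omega> - W (p j) \<omega>) \<bullet> Y j \<omega>)" for \<omega>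
    unfolding Y_def inner_sum_right K_def
    by (rule refine_sum[where g = "\<lambda>i x. x \<bullet> y i \<omega>" and f = "\<lambda>t. W t \<omega>", OF p I]) (erule ab, simp add: inner_sum_left)
  note Seq = this
  note iso = partition_isometry[OF p p0 Ysf order_refl]
  have step: "(\<Sum>i\<in>I. indicator {\<alpha> i<..\<beta> i} \<sigma> *\<^sub>R y i \<omega>) = (\<Sum>j<N. indicator {p j<..p (Suc j)} \<sigma> *\<^sub>R Y j \<omega>)" for \<sigma> \<omega>
  proof -
    have "(\<Sum>i\<in>I. indicator {\<alpha> i<..\<beta> i} \<sigma> *\<^sub>R y i \<omega>) = (\<Sum>i\<in>I. (indicator {\<sigma>..} (\<beta> i) - indicator {\<sigma>..} (\<alpha> i)) *\<^sub>R y i \<omega>)"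
      using nn by (intro sum.cong) (simp_all add: indicator_increment)
    also have "\<dots> = (\<Sum>j<N. \<Sum>i\<in>K j. (indicator {\<sigma>..} (p (Suc j)) - indicator {\<sigma>..} (p j)) *\<^sub>R y i \<omega>)"
      unfolding K_def by (rule refine_sum[where g = "\<lambda>i x. x *\<^sub>R y i \<omega>", OF p I]) (erule ab, simp add: scaleR_sum_left)
    also have "\<dots> = (\<Sum>j<N. indicator {p j<..p (Suc j)} \<sigma> *\<^sub>R Y j \<omega>)"
    proof (rule sum.cong[OF refl])
      fix j assume "j \<in> {..<N}"
      then have "p j \<le> p (Suc j)" using strict_mono_onD[OF p, of j "Suc j"] by auto
      then show "(\<Sum>i\<in>K j. (indicator {\<sigma>..} (p (Suc j)) - indicator {\<sigma>..} (p j)) *\<^sub>R y i \<omega>) = indicator {p j<..p (Suc j)} \<sigma> *\<^sub>R Y j \<omega>"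
        by (simp add: indicator_increment Y_def scaleR_sum_right)
    qed
    finally show ?thesis .
  qed
  have cY: "(\<integral>\<^sup>+\<omega>. ennreal ((norm (R (Y j \<omega>)))\<^sup>2) \<partial>M) = ennreal (c j)" if j: "j < N" for j
  proof -
    have pj: "0 \<le> p j" "p j < p (Suc j)" using p0[of j] strict_mono_onD[OF p, of j "Suc j"] j by auto
    have "integrable M (\<lambda>\<omega>. (norm (R (Y j \<omega>)))\<^sup>2)"
      by (rule increment_simple(3)[OF pj Ysf[OF j], of "\<lambda>_. 0"]) auto
    then show ?thesis unfolding c_def by (rule nn_integral_eq_integral) auto
  qed
  have inner: "(\<integral>\<^sup>+\<omega>. ennreal ((norm (R (\<Sum>j<N. indicator {p j<..p (Suc j)} \<sigma> *\<^sub>R Y j \<omega>)))\<^sup>2) \<partial>M)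
      = (\<Sum>j<N. ennreal (c j) * indicator {p j<..p (Suc j)} \<sigma>)" for \<sigma>
  proof (cases "\<exists>j<N. \<sigma> \<in> {p j<..p (Suc j)}")
    case True
    then obtain j where j: "j < N" "\<sigma> \<in> {p j<..p (Suc j)}" by blast
    have other: "\<sigma> \<notin> {p j'<..p (Suc j')}" if "j' < N" "j' \<noteq> j" for j'
      using cell_unique[OF p j(1) that(1) j(2)] that(2) by blast
    have "(\<Sum>j'<N. indicator {p j'<..p (Suc j')} \<sigma> *\<^sub>R Y j' \<omega>) = (\<Sum>j'\<in>{j}. Y j' \<omega>)" for \<omega>
      using j other by (intro sum.mono_neutral_cong_right) auto
    moreover have "(\<Sum>j'<N. ennreal (c j') * indicator {p j'<..p (Suc j')} \<sigma>) = (\<Sum>j'\<in>{j}. ennreal (c j'))"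
      using j other by (intro sum.mono_neutral_cong_right) auto
    ultimately show ?thesis using cY[OF j(1)] by simp
  next
    case False
    then have "indicator {p j<..p (Suc j)} \<sigma> = (0::real)" "indicator {p j<..p (Suc j)} \<sigma> = (0::ennreal)" if "j < N" for j
      using that by auto
    then show ?thesis using linear_simps(3)[OF R_linear] by simp
  qed
  have "(\<integral>\<^sup>+\<omega>. ennreal ((\<Sum>i\<in>I. (W (\<beta> i) \<omega> - W (\<alpha> i) \<omega>) \<bullet> y i \<omega>)\<^sup>2) \<partial>M) = ennreal (\<Sum>j<N. (p (Suc j) - p j) * c j)"
    unfolding Seq c_def using iso by (subst nn_integral_eq_integral) auto
  also have "\<dots> = (\<Sum>j<N. ennreal (c j) * ennreal (p (Suc j) - p j))"
  proof -
    have "0 \<le> p (Suc j) - p j" "0 \<le> c j" if "j < N" for j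
      using strict_mono_onD[OF p, of j "Suc j"] that by (auto simp: c_def)
    then show ?thesis by (subst sum_ennreal[symmetric]) (auto simp: ennreal_mult mult.commute)
  qed
  also have "\<dots> = (\<integral>\<^sup>+\<sigma>. (\<Sum>j<N. ennreal (c j) * indicator {p j<..p (Suc j)} \<sigma>) \<partial>lborel)"
  proof (subst nn_integral_sum)
    show "(\<Sum>j<N. ennreal (c j) * ennreal (p (Suc j) - p j))
        = (\<Sum>j<N. \<integral>\<^sup>+ \<sigma>. ennreal (c j) * indicator {p j<..p (Suc j)} \<sigma> \<partial>lborel)"
    proof (rule sum.cong[OF refl])
      fix j assume "j \<in> {..<N}"
      then have "p j \<le> p (Suc j)" using strict_mono_onD[OF p, of j "Suc j"] by auto
      then show "ennreal (c j) * ennreal (p (Suc j) - p j) = (\<integral>\<^sup>+ \<sigma>. ennreal (c j) * indicator {p j<..p (Suc j)} \<sigma> \<partial>lborel)"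
        by (subst nn_integral_cmult_indicator) auto
    qed
  qed auto
  finally show ?thesis unfolding step inner .
qed

text \<open>With deterministic coefficients each new increment is independent of the sum before it,
  and centred Gaussians add. The variance stays existential; it is identified later from the second
  moment.\<close>

lemma partition_gaussian:
  assumes p: "strict_mono_on {..N} p" and p0: "\<And>j. j \<le> N \<Longrightarrow> 0 \<le> p j" and n: "n \<le> N"
  shows "\<exists>v\<ge>0. (\<lambda>\<omega>. \<Sum>j<n. a j * ((W (p (Suc j)) \<omega> - W (p j) \<omega>) \<bullet> h)) \<in> borel_measurable (F (p n)) \<and>
    distr M borel (\<lambda>\<omega>. \<Sum>j<n. a j * ((W (p (Suc j)) \<omega> - W (p j) \<omega>) \<bullet> h)) = centered_gaussian v"
  using n
proof (induction n)
  case 0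
  then show ?case by (intro exI[of _ 0]) (auto simp: centered_gaussian_def distr_const)
next
  case (Suc n)
  define Z where "Z \<omega> = (\<Sum>j<n. a j * ((W (p (Suc j)) \<omega> - W (p j) \<omega>) \<bullet> h))" for \<omega>
  define D where "D \<omega> = (W (p (Suc n)) \<omega> - W (p n) \<omega>) \<bullet> h" for \<omega>
  have pn: "0 \<le> p n" "p n < p (Suc n)"
    using p0[of n] strict_mono_onD[OF p, of n "Suc n"] Suc.prems by auto
  obtain v where v: "v \<ge> 0" "Z \<in> borel_measurable (F (p n))" "distr M borel Z = centered_gaussian v"
    using Suc unfolding Z_def by auto
  have DF: "D \<in> borel_measurable (F (p (Suc n)))"
    unfolding D_def using increment_measurable_F[OF pn(1) less_imp_le[OF pn(2)]] by measurable
  have Dm: "D \<in> borel_measurable M" by (rule measurable_F[OF _ DF]) (use pn in auto)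
  have dD: "distr M borel D = centered_gaussian ((p (Suc n) - p n) * (norm (R h))\<^sup>2)"
    unfolding D_def by (rule increment_gaussian[OF pn])
  have ind: "indep_var borel Z borel (\<lambda>\<omega>. a n * D \<omega>)"
    using indep_var_compose[OF increment_indep[OF pn v(2), of h], of "\<lambda>x. x" borel "\<lambda>x. a n * x" borel]
    by (simp add: o_def D_def)
  have "distr M borel (\<lambda>\<omega>. Z \<omega> + a n * D \<omega>) = centered_gaussian (v + (a n)\<^sup>2 * ((p (Suc n) - p n) * (norm (R h))\<^sup>2))"
    by (rule centered_gaussian_add[OF v(1) _ ind v(3) centered_gaussian_scale[OF Dm dD]]) (use pn in auto)
  moreover have "(\<lambda>\<omega>. Z \<omega> + a n * D \<omega>) \<in> borel_measurable (F (p (Suc n)))"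
    using measurable_F_mono[OF pn(1) less_imp_le[OF pn(2)] v(2)] DF by measurable
  moreover have "v + (a n)\<^sup>2 * ((p (Suc n) - p n) * (norm (R h))\<^sup>2) \<ge> 0" using v pn by auto
  ultimately show ?case by (auto simp: Z_def D_def)
qed

text \<open>The law is a centred Gaussian of some variance v. Its second moment is v, and the
  isometry computes that moment from the step function; all higher even moments are then
  explicit.\<close>

lemma gaussian_family_moment:
  fixes I :: "'i set" and a :: "'i \<Rightarrow> real"
  assumes I: "finite I" and nn: "\<And>i. i \<in> I \<Longrightarrow> 0 \<le> \<alpha> i \<and> \<alpha> i \<le> \<beta> i"
  shows "(\<integral>\<^sup>+\<omega>. ennreal ((\<Sum>i\<in>I. a i * ((W (\<beta> i) \<omega> - W (\<alpha> i) \<omega>) \<bullet> h)) ^ (2 * m)) \<partial>M)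
    = ennreal (gaussian_moment m * ((norm (R h))\<^sup>2 * (LINT \<sigma>|lborel. (\<Sum>i\<in>I. a i * indicator {\<alpha> i<..\<beta> i} \<sigma>)\<^sup>2)) ^ m)"
proof -
  have "\<exists>N p. strict_mono_on {..N::nat} p \<and> (\<forall>j\<le>N. 0 \<le> p j) \<and>
    (\<forall>i\<in>I. \<alpha> i \<in> p ` {..N} \<and> \<beta> i \<in> p ` {..N} \<and> \<alpha> i \<le> \<beta> i)"
    by (rule partition_exists[OF I]) (rule nn)
  then obtain N p where Np: "strict_mono_on {..N::nat} p" "\<forall>j\<le>N. 0 \<le> p j"
    "\<forall>i\<in>I. \<alpha> i \<in> p ` {..N} \<and> \<beta> i \<in> p ` {..N} \<and> \<alpha> i \<le> \<beta> i" by (elim exE conjE)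
  note p = Np(1)
  have p0: "\<And>j. j \<le> N \<Longrightarrow> 0 \<le> p j" using Np(2) by blast
  have ab: "\<And>i. i \<in> I \<Longrightarrow> \<alpha> i \<in> p ` {..N} \<and> \<beta> i \<in> p ` {..N} \<and> \<alpha> i \<le> \<beta> i" using Np(3) by blast
  let ?S = "\<lambda>\<omega>. \<Sum>i\<in>I. a i * ((W (\<beta> i) \<omega> - W (\<alpha> i) \<omega>) \<bullet> h)"
  let ?f = "\<lambda>\<sigma>. \<Sum>i\<in>I. a i * indicator {\<alpha> i<..\<beta> i} \<sigma>"
  define c where "c j = (\<Sum>i | i \<in> I \<and> \<alpha> i \<le> p j \<and> p j < \<beta> i. a i)" for j
  have "?S \<omega> = (\<Sum>j<N. c j * ((W (p (Suc j)) \<omega> - W (p j) \<omega>) \<bullet> h))" for \<omega>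
    unfolding c_def sum_distrib_right
    by (rule refine_sum[where g = "\<lambda>i x. a i * (x \<bullet> h)" and f = "\<lambda>t. W t \<omega>", OF p I]) (erule ab, simp add: inner_sum_left sum_distrib_left)
  then have Seq: "?S = (\<lambda>\<omega>. \<Sum>j<N. c j * ((W (p (Suc j)) \<omega> - W (p j) \<omega>) \<bullet> h))" by auto
  obtain v where v: "v \<ge> 0" "?S \<in> borel_measurable (F (p N))" "distr M borel ?S = centered_gaussian v"
    using partition_gaussian[OF p p0 order_refl, of c h] unfolding Seq by auto
  have Sm: "?S \<in> borel_measurable M" using measurable_F[OF _ v(2)] p0 by auto
  have i: "integrable lborel (\<lambda>\<sigma>. a i * indicator {\<alpha> i<..\<beta> i} \<sigma>)" if "i \<in> I" for i
    using nn[OF that] by (intro integrable_mult_right) auto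
  have fi: "integrable lborel (\<lambda>\<sigma>. (?f \<sigma>)\<^sup>2)"
  proof (rule Bochner_Integration.integrable_bound)
    show "integrable lborel (\<lambda>\<sigma>. (\<Sum>i\<in>I. \<bar>a i\<bar>) * (\<Sum>i\<in>I. \<bar>a i * indicator {\<alpha> i<..\<beta> i} \<sigma>\<bar>))"
      by (rule integrable_mult_right, rule Bochner_Integration.integrable_sum, rule integrable_abs, erule i)
    show "AE \<sigma> in lborel. norm ((?f \<sigma>)\<^sup>2) \<le> norm ((\<Sum>i\<in>I. \<bar>a i\<bar>) * (\<Sum>i\<in>I. \<bar>a i * indicator {\<alpha> i<..\<beta> i} \<sigma>\<bar>))"
    proof (rule AE_I2)
      fix \<sigma>
      have 1: "\<bar>?f \<sigma>\<bar> \<le> (\<Sum>i\<in>I. \<bar>a i * indicator {\<alpha> i<..\<beta> i} \<sigma>\<bar>)" by (rule sum_abs)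
      also have 2: "\<dots> \<le> (\<Sum>i\<in>I. \<bar>a i\<bar>)" by (intro sum_mono) (auto simp: indicator_def)
      finally have "\<bar>?f \<sigma>\<bar> * \<bar>?f \<sigma>\<bar> \<le> (\<Sum>i\<in>I. \<bar>a i\<bar>) * (\<Sum>i\<in>I. \<bar>a i * indicator {\<alpha> i<..\<beta> i} \<sigma>\<bar>)"
        using 1 by (intro mult_mono) (auto simp: sum_nonneg)
      moreover have "norm ((?f \<sigma>)\<^sup>2) = \<bar>?f \<sigma>\<bar> * \<bar>?f \<sigma>\<bar>" by (simp add: power2_eq_square abs_mult)
      ultimately show "norm ((?f \<sigma>)\<^sup>2) \<le> norm ((\<Sum>i\<in>I. \<bar>a i\<bar>) * (\<Sum>i\<in>I. \<bar>a i * indicator {\<alpha> i<..\<beta> i} \<sigma>\<bar>))"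
        unfolding real_norm_def by linarith
    qed
  qed auto
  have "ennreal v = (\<integral>\<^sup>+\<omega>. ennreal ((?S \<omega>)\<^sup>2) \<partial>M)"
    using centered_gaussian_nn_moment[OF v(1) Sm v(3), of 1] by (simp add: gaussian_moment_def)
  also have "\<dots> = (\<integral>\<^sup>+\<omega>. ennreal ((\<Sum>i\<in>I. (W (\<beta> i) \<omega> - W (\<alpha> i) \<omega>) \<bullet> (a i *\<^sub>R h))\<^sup>2) \<partial>M)" by simp
  also have "\<dots> = (\<integral>\<^sup>+\<sigma>. \<integral>\<^sup>+\<omega>. ennreal ((norm (R (\<Sum>i\<in>I. indicator {\<alpha> i<..\<beta> i} \<sigma> *\<^sub>R (a i *\<^sub>R h))))\<^sup>2) \<partial>M \<partial>lborel)"
    by (rule isometry[OF I nn]) auto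
  also have "\<dots> = (\<integral>\<^sup>+\<sigma>. ennreal ((norm (R h))\<^sup>2 * (?f \<sigma>)\<^sup>2) \<partial>lborel)"
  proof (rule nn_integral_cong)
    fix \<sigma>
    have "(\<Sum>i\<in>I. indicator {\<alpha> i<..\<beta> i} \<sigma> *\<^sub>R (a i *\<^sub>R h)) = ?f \<sigma> *\<^sub>R h"
      by (simp add: scaleR_sum_left mult.commute)
    then have "(norm (R (\<Sum>i\<in>I. indicator {\<alpha> i<..\<beta> i} \<sigma> *\<^sub>R (a i *\<^sub>R h))))\<^sup>2 = (norm (R h))\<^sup>2 * (?f \<sigma>)\<^sup>2"
      by (simp add: linear_simps(5)[OF R_linear] power_mult_distrib mult.commute)
    then show "(\<integral>\<^sup>+\<omega>. ennreal ((norm (R (\<Sum>i\<in>I. indicator {\<alpha> i<..\<beta> i} \<sigma> *\<^sub>R (a i *\<^sub>R h))))\<^sup>2) \<partial>M)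
        = ennreal ((norm (R h))\<^sup>2 * (?f \<sigma>)\<^sup>2)" by (simp add: emeasure_space_1)
  qed
  also have "\<dots> = ennreal (LINT \<sigma>|lborel. (norm (R h))\<^sup>2 * (?f \<sigma>)\<^sup>2)"
    by (rule nn_integral_eq_integral) (use fi in auto)
  also have "(LINT \<sigma>|lborel. (norm (R h))\<^sup>2 * (?f \<sigma>)\<^sup>2) = (norm (R h))\<^sup>2 * (LINT \<sigma>|lborel. (?f \<sigma>)\<^sup>2)"
    by (rule integral_mult_right_zero)
  finally have "v = (norm (R h))\<^sup>2 * (LINT \<sigma>|lborel. (?f \<sigma>)\<^sup>2)"
    using v(1) by (simp add: ennreal_inj)
  then show ?thesis using centered_gaussian_nn_moment[OF v(1) Sm v(3), of m] by simp
qed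

end

subsection \<open>The stochastic integral\<close>

lemma elementary_data_range:
  assumes "elementary_data M F t n \<tau> L" "i \<le> n"
  shows "0 \<le> \<tau> i" "\<tau> i \<le> t"
proof -
  have mono: "\<tau> j \<le> \<tau> (Suc j)" if "j < n" for j using assms that by (simp add: elementary_data_def)
  have "\<tau> j \<le> \<tau> i" if "j \<le> i" "i \<le> n" for i j
    using that
  proof (induction i rule: dec_induct)
    case (step k)
    then have "\<tau> j \<le> \<tau> k" "\<tau> k \<le> \<tau> (Suc k)" using mono[of k] by auto
    then show ?case by linarith
  qed simp
  from this[of 0 i] this[of i n] show "0 \<le> \<tau> i" "\<tau> i \<le> t" using assms by (auto simp: elementary_data_def)
qed

context wiener
begin

lemma elementary_process_measurable:
  fixes L :: "nat \<Rightarrow> 'w \<Rightarrow> 'h \<Rightarrow> 'h"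
  assumes el: "elementary_data M F t n \<tau> L"
  shows "(\<lambda>(\<sigma>, \<omega>). elementary_process n \<tau> L \<sigma> \<omega> v) \<in> borel_measurable (lborel \<Otimes>\<^sub>M M)"
proof -
  have Lm: "(\<lambda>\<omega>. L i \<omega> v) \<in> borel_measurable M" if "i < n" for i
  proof -
    have "simple_function (F (\<tau> i)) (L i)" using el that by (simp add: elementary_data_def)
    then have "simple_function M (L i)" using elementary_data_range(1)[OF el, of i] that by (intro simple_function_F) auto
    from simple_function_compose1[OF this, of "\<lambda>l. l v"] show ?thesis by (rule borel_measurable_simple_function)
  qed
  have "(\<lambda>x. indicator {\<tau> i<..\<tau> (Suc i)} (fst x) *\<^sub>R L i (snd x) v) \<in> borel_measurable (lborel \<Otimes>\<^sub>M M)" if "i < n" for i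
  proof -
    have [measurable]: "(\<lambda>\<omega>. L i \<omega> v) \<in> borel_measurable M" by (rule Lm[OF that])
    show ?thesis by measurable
  qed
  then have "(\<lambda>x. \<Sum>i<n. indicator {\<tau> i<..\<tau> (Suc i)} (fst x) *\<^sub>R L i (snd x) v) \<in> borel_measurable (lborel \<Otimes>\<^sub>M M)"
    by (intro borel_measurable_sum) auto
  then show ?thesis by (simp add: elementary_process_def case_prod_beta')
qed

text \<open>The adjoint of \<open>l\<close> applied to e k, chosen through \<open>riesz\<close> and
  meaningful for bounded \<open>l\<close>.\<close>

definition representer :: "nat \<Rightarrow> ('h \<Rightarrow> 'h) \<Rightarrow> 'h" where
  "representer k l = (SOME y. \<forall>v. l v \<bullet> e k = v \<bullet> y)"

lemma representer: "bounded_linear l \<Longrightarrow> l v \<bullet> e k = v \<bullet> representer k l"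
proof -
  assume "bounded_linear l"
  then have "bounded_linear (\<lambda>v. l v \<bullet> e k)"
    by (rule bounded_linear_compose[OF bounded_linear_inner_left])
  from someI_ex[OF riesz[OF this]] show ?thesis unfolding representer_def by (rule spec)
qed

lemma elementary_integral_inner:
  assumes el: "elementary_data M F t n \<tau> L" and w: "\<omega> \<in> space M"
  shows "elementary_integral W n \<tau> L \<omega> \<bullet> e k = (\<Sum>i<n. (W (\<tau> (Suc i)) \<omega> - W (\<tau> i) \<omega>) \<bullet> representer k (L i \<omega>))"
  using el w unfolding elementary_integral_def elementary_data_def by (simp add: inner_sum_left representer)

lemma elementary_integral_measurable:
  assumes el: "elementary_data M F t n \<tau> L"
  shows "(\<lambda>\<omega>. elementary_integral W n \<tau> L \<omega> \<bullet> e k) \<in> borel_measurable M"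
proof -
  have "(\<lambda>\<omega>. (W (\<tau> (Suc i)) \<omega> - W (\<tau> i) \<omega>) \<bullet> representer k (L i \<omega>)) \<in> borel_measurable M" if i: "i < n" for i
  proof -
    have "simple_function (F (\<tau> i)) (L i)" using el i by (simp add: elementary_data_def)
    then have "simple_function M (L i)" using elementary_data_range(1)[OF el, of i] i by (intro simple_function_F) auto
    from simple_function_compose1[OF this, of "representer k"]
    have "(\<lambda>\<omega>. representer k (L i \<omega>)) \<in> borel_measurable M" by (rule borel_measurable_simple_function)
    moreover have "(\<lambda>\<omega>. W (\<tau> (Suc i)) \<omega> - W (\<tau> i) \<omega>) \<in> borel_measurable M"
      using el i elementary_data_range(1)[OF el, of i] by (intro increment_measurable) (auto simp: elementary_data_def)
    ultimately show ?thesis by measurable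
  qed
  then have "(\<lambda>\<omega>. \<Sum>i<n. (W (\<tau> (Suc i)) \<omega> - W (\<tau> i) \<omega>) \<bullet> representer k (L i \<omega>)) \<in> borel_measurable M"
    by (intro borel_measurable_sum) auto
  then show ?thesis by (rule measurable_cong[THEN iffD1, rotated]) (simp add: elementary_integral_inner[OF el])
qed

text \<open>The adjoints of the integrands turn the components of the two integrals into the scalar sums
  treated by the isometry.\<close>

lemma elementary_difference_le:
  fixes \<Phi> :: "real \<Rightarrow> 'w \<Rightarrow> 'h \<Rightarrow> 'h"
  assumes el: "elementary_data M F t n \<tau> L" and el': "elementary_data M F t n' \<tau>' L'"
    and \<Phi>: "\<And>v. (\<lambda>(\<sigma>, \<omega>). indicator {0..t} \<sigma> *\<^sub>R \<Phi> \<sigma> \<omega> v) \<in> borel_measurable (lborel \<Otimes>\<^sub>M M)"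
  defines "G \<equiv> \<lambda>n \<tau> L. \<lambda>(\<sigma>, \<omega>). indicator {0..t} \<sigma> *
            hs_norm2 e (\<lambda>v. \<Phi> \<sigma> \<omega> (R v) - elementary_process n \<tau> L \<sigma> \<omega> (R v))"
  shows "(\<integral>\<^sup>+\<omega>. ennreal (((elementary_integral W n \<tau> L \<omega> - elementary_integral W n' \<tau>' L' \<omega>) \<bullet> e k)\<^sup>2) \<partial>M)
    \<le> 2 * (\<integral>\<^sup>+x. G n \<tau> L x \<partial>(lborel \<Otimes>\<^sub>M M)) + 2 * (\<integral>\<^sup>+x. G n' \<tau>' L' x \<partial>(lborel \<Otimes>\<^sub>M M))"
proof -
  \<comment> \<open>The disjoint union of the two index sets; the vectors of the second partition
    enter with a minus sign, so the difference of the integrals is one sum of increments.\<close>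
  let ?I = "{..<n} <+> {..<n'}"
  define \<alpha> where "\<alpha> = case_sum \<tau> \<tau>'"
  define \<beta> where "\<beta> = case_sum (\<lambda>i. \<tau> (Suc i)) (\<lambda>i. \<tau>' (Suc i))"
  define y where "y = case_sum (\<lambda>i \<omega>. representer k (L i \<omega>)) (\<lambda>i \<omega>. - representer k (L' i \<omega>))"
  have sf: "simple_function (F (\<tau> i)) (L i)" "\<tau> i \<le> \<tau> (Suc i)" "0 \<le> \<tau> i" "\<tau> (Suc i) \<le> t" if "i < n" for i
    using el that elementary_data_range[OF el, of i] elementary_data_range[OF el, of "Suc i"]
    by (auto simp: elementary_data_def)
  have sf': "simple_function (F (\<tau>' i)) (L' i)" "\<tau>' i \<le> \<tau>' (Suc i)" "0 \<le> \<tau>' i" "\<tau>' (Suc i) \<le> t" if "i < n'" for i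
    using el' that elementary_data_range[OF el', of i] elementary_data_range[OF el', of "Suc i"]
    by (auto simp: elementary_data_def)
  have bl: "bounded_linear (L i \<omega>)" if "i < n" "\<omega> \<in> space M" for i \<omega> using el that by (simp add: elementary_data_def)
  have bl': "bounded_linear (L' i \<omega>)" if "i < n'" "\<omega> \<in> space M" for i \<omega> using el' that by (simp add: elementary_data_def)
  have I: "finite ?I" by auto
  have nn: "0 \<le> \<alpha> i \<and> \<alpha> i \<le> \<beta> i" if "i \<in> ?I" for i
    using that sf sf' by (auto simp: \<alpha>_def \<beta>_def)
  have ysf: "simple_function (F (\<alpha> i)) (y i)" if "i \<in> ?I" for i
    using that
  proof (elim PlusE)
    fix x assume x: "x \<in> {..<n}" "i = Inl x"
    have "simple_function (F (\<tau> x)) (\<lambda>\<omega>. representer k (L x \<omega>))"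
      by (rule simple_function_compose1[OF sf(1)]) (use x in simp)
    then show ?thesis using x by (simp add: \<alpha>_def y_def)
  next
    fix x assume x: "x \<in> {..<n'}" "i = Inr x"
    have "simple_function (F (\<tau>' x)) (\<lambda>\<omega>. - representer k (L' x \<omega>))"
      by (rule simple_function_compose1[OF sf'(1)]) (use x in simp)
    then show ?thesis using x by (simp add: \<alpha>_def y_def)
  qed
  have GM: "G n \<tau> L \<in> borel_measurable (lborel \<Otimes>\<^sub>M M)" if "elementary_data M F t n \<tau> L" for n \<tau> L
  proof -
    have *: "(\<lambda>(\<sigma>, \<omega>). indicator {0..t} \<sigma> *\<^sub>R \<Phi> \<sigma> \<omega> v - indicator {0..t} \<sigma> *\<^sub>R elementary_process n \<tau> L \<sigma> \<omega> v)
        \<in> borel_measurable (lborel \<Otimes>\<^sub>M M)" for v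
    proof -
      have "(\<lambda>x. indicator {0..t} (fst x) *\<^sub>R elementary_process n \<tau> L (fst x) (snd x) v) \<in> borel_measurable (lborel \<Otimes>\<^sub>M M)"
        using elementary_process_measurable[OF that, of v] by (simp add: case_prod_beta')
      then show ?thesis using \<Phi>[of v] by (simp add: case_prod_beta')
    qed
    have "(\<lambda>x. \<Sum>j. ennreal ((norm (case x of (\<sigma>, \<omega>) \<Rightarrow> indicator {0..t} \<sigma> *\<^sub>R \<Phi> \<sigma> \<omega> (R (e j)) - indicator {0..t} \<sigma> *\<^sub>R elementary_process n \<tau> L \<sigma> \<omega> (R (e j))))\<^sup>2))
        \<in> borel_measurable (lborel \<Otimes>\<^sub>M M)"
      by (intro borel_measurable_suminf_order measurable_compose[OF _ measurable_ennreal] borel_measurable_power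
          borel_measurable_norm)
        (use * in \<open>simp add: case_prod_beta' id_def\<close>)
    moreover have "G n \<tau> L = (\<lambda>x. \<Sum>j. ennreal ((norm (case x of (\<sigma>, \<omega>) \<Rightarrow> indicator {0..t} \<sigma> *\<^sub>R \<Phi> \<sigma> \<omega> (R (e j)) - indicator {0..t} \<sigma> *\<^sub>R elementary_process n \<tau> L \<sigma> \<omega> (R (e j))))\<^sup>2))"
    proof (rule ext)
      fix x :: "real \<times> 'w"
      obtain \<sigma> \<omega> where x: "x = (\<sigma>, \<omega>)" by (cases x)
      show "G n \<tau> L x = (\<Sum>j. ennreal ((norm (case x of (\<sigma>, \<omega>) \<Rightarrow> indicator {0..t} \<sigma> *\<^sub>R \<Phi> \<sigma> \<omega> (R (e j)) - indicator {0..t} \<sigma> *\<^sub>R elementary_process n \<tau> L \<sigma> \<omega> (R (e j))))\<^sup>2))"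
        unfolding x by (cases "\<sigma> \<in> {0..t}") (simp_all add: G_def hs_norm2_def)
    qed
    ultimately show ?thesis by (simp only:)
  qed
  have key: "ennreal ((norm (R (\<Sum>i\<in>?I. indicator {\<alpha> i<..\<beta> i} \<sigma> *\<^sub>R y i \<omega>)))\<^sup>2) \<le> 2 * G n \<tau> L (\<sigma>, \<omega>) + 2 * G n' \<tau>' L' (\<sigma>, \<omega>)"
    if w: "\<omega> \<in> space M" for \<sigma> \<omega>
  proof -
    let ?Y = "\<Sum>i\<in>?I. indicator {\<alpha> i<..\<beta> i} \<sigma> *\<^sub>R y i \<omega>"
    let ?E = "elementary_process n \<tau> L \<sigma> \<omega>" and ?E' = "elementary_process n' \<tau>' L' \<sigma> \<omega>"
    have Y: "?Y \<bullet> v = (?E v - ?E' v) \<bullet> e k" for v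
    proof -
      have 1: "?E v \<bullet> e k = (\<Sum>i<n. indicator {\<tau> i<..\<tau> (Suc i)} \<sigma> * (representer k (L i \<omega>) \<bullet> v))"
        unfolding elementary_process_def inner_sum_left inner_scaleR_left
      proof (intro sum.cong refl arg_cong2[where f = "(*)"])
        fix i assume "i \<in> {..<n}"
        then have "bounded_linear (L i \<omega>)" using bl w by simp
        then have "L i \<omega> v \<bullet> e k = v \<bullet> representer k (L i \<omega>)" by (rule representer)
        then show "L i \<omega> v \<bullet> e k = representer k (L i \<omega>) \<bullet> v" by (simp only: inner_commute[of v])
      qed
      have 2: "?E' v \<bullet> e k = (\<Sum>i<n'. indicator {\<tau>' i<..\<tau>' (Suc i)} \<sigma> * (representer k (L' i \<omega>) \<bullet> v))"
        unfolding elementary_process_def inner_sum_left inner_scaleR_left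
      proof (intro sum.cong refl arg_cong2[where f = "(*)"])
        fix i assume "i \<in> {..<n'}"
        then have "bounded_linear (L' i \<omega>)" using bl' w by simp
        then have "L' i \<omega> v \<bullet> e k = v \<bullet> representer k (L' i \<omega>)" by (rule representer)
        then show "L' i \<omega> v \<bullet> e k = representer k (L' i \<omega>) \<bullet> v" by (simp only: inner_commute[of v])
      qed
      have "?Y \<bullet> v = (\<Sum>i<n. indicator {\<tau> i<..\<tau> (Suc i)} \<sigma> * (representer k (L i \<omega>) \<bullet> v))
          + (\<Sum>i<n'. indicator {\<tau>' i<..\<tau>' (Suc i)} \<sigma> * - (representer k (L' i \<omega>) \<bullet> v))"
        by (simp only: sum.Plus[OF finite_lessThan finite_lessThan] comp_def \<alpha>_def \<beta>_def y_def sum.case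
            inner_add_left inner_sum_left inner_scaleR_left inner_minus_left)
      then show ?thesis unfolding inner_diff_left 1 2 by (simp only: mult_minus_right sum_negf diff_conv_add_uminus)
    qed
    show ?thesis
    proof (cases "\<sigma> \<in> {0..t}")
      case False
      have "indicator {\<alpha> i<..\<beta> i} \<sigma> = (0::real)" if "i \<in> ?I" for i
      proof -
        have "\<beta> i \<le> t" using that sf(4) sf'(4) by (auto simp: \<beta>_def)
        then show ?thesis using False nn[OF that] by (auto simp: indicator_def)
      qed
      then have "?Y = 0" by (intro sum.neutral) auto
      then have "R ?Y = 0" using linear_simps(3)[OF R_linear] by simp
      then show ?thesis by simp
    next
      case True
      \<comment> \<open>By symmetry of R, coordinate j of R applied to the adjoint vector is
        coordinate k of the difference of the two processes at R e_j, hence at most its norm.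
        Inserting \<Phi> between them and summing over j gives the two Hilbert-Schmidt
        errors.\<close>
      have le: "ennreal ((R ?Y \<bullet> e j)\<^sup>2) \<le> 2 * ennreal ((norm (\<Phi> \<sigma> \<omega> (R (e j)) - ?E (R (e j))))\<^sup>2)
          + 2 * ennreal ((norm (\<Phi> \<sigma> \<omega> (R (e j)) - ?E' (R (e j))))\<^sup>2)" for j
      proof -
        have "\<bar>R ?Y \<bullet> e j\<bar> \<le> norm (?E (R (e j)) - ?E' (R (e j)))"
          using Cauchy_Schwarz_ineq2[of "?E (R (e j)) - ?E' (R (e j))" "e k"] Y[of "R (e j)"]
          by (simp add: R_sym norm_eq_sqrt_inner[of "e k"])
        from power_mono[OF this abs_ge_zero, of 2]
        have "(R ?Y \<bullet> e j)\<^sup>2 \<le> (norm (?E (R (e j)) - ?E' (R (e j))))\<^sup>2"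
          by (simp only: power2_abs)
        also have "\<dots> \<le> 2 * (norm (\<Phi> \<sigma> \<omega> (R (e j)) - ?E (R (e j))))\<^sup>2 + 2 * (norm (\<Phi> \<sigma> \<omega> (R (e j)) - ?E' (R (e j))))\<^sup>2"
          by (rule norm_sq_diff_le)
        finally have "ennreal ((R ?Y \<bullet> e j)\<^sup>2) \<le> ennreal (2 * (norm (\<Phi> \<sigma> \<omega> (R (e j)) - ?E (R (e j))))\<^sup>2 + 2 * (norm (\<Phi> \<sigma> \<omega> (R (e j)) - ?E' (R (e j))))\<^sup>2)"
          by (rule ennreal_leI)
        then show ?thesis by (simp add: ennreal_plus ennreal_mult)
      qed
      have "ennreal ((norm (R ?Y))\<^sup>2) = (\<Sum>j. ennreal ((R ?Y \<bullet> e j)\<^sup>2))" by (rule parseval_ennreal[symmetric])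
      also have "\<dots> \<le> (\<Sum>j. 2 * ennreal ((norm (\<Phi> \<sigma> \<omega> (R (e j)) - ?E (R (e j))))\<^sup>2)
          + 2 * ennreal ((norm (\<Phi> \<sigma> \<omega> (R (e j)) - ?E' (R (e j))))\<^sup>2))"
        by (intro suminf_le le) auto
      also have "\<dots> = 2 * G n \<tau> L (\<sigma>, \<omega>) + 2 * G n' \<tau>' L' (\<sigma>, \<omega>)"
        unfolding suminf_add[OF summableI summableI, symmetric] ennreal_suminf_cmult
        using True by (simp only: G_def hs_norm2_def prod.case indicator_simps mult_1_left)
      finally show ?thesis .
    qed
  qed
  have "(elementary_integral W n \<tau> L \<omega> - elementary_integral W n' \<tau>' L' \<omega>) \<bullet> e k
      = (\<Sum>i\<in>?I. (W (\<beta> i) \<omega> - W (\<alpha> i) \<omega>) \<bullet> y i \<omega>)" if "\<omega> \<in> space M" for \<omega>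
    by (subst inner_diff_left) (simp only: elementary_integral_inner[OF el that] elementary_integral_inner[OF el' that]
        sum.Plus[OF finite_lessThan finite_lessThan] comp_def \<alpha>_def \<beta>_def y_def sum.case inner_minus_right sum_negf
        diff_conv_add_uminus)
  then have "(\<integral>\<^sup>+\<omega>. ennreal (((elementary_integral W n \<tau> L \<omega> - elementary_integral W n' \<tau>' L' \<omega>) \<bullet> e k)\<^sup>2) \<partial>M)
      = (\<integral>\<^sup>+\<omega>. ennreal ((\<Sum>i\<in>?I. (W (\<beta> i) \<omega> - W (\<alpha> i) \<omega>) \<bullet> y i \<omega>)\<^sup>2) \<partial>M)"
    by (intro nn_integral_cong) simp
  also have "\<dots> = (\<integral>\<^sup>+\<sigma>. \<integral>\<^sup>+\<omega>. ennreal ((norm (R (\<Sum>i\<in>?I. indicator {\<alpha> i<..\<beta> i} \<sigma> *\<^sub>R y i \<omega>)))\<^sup>2) \<partial>M \<partial>lborel)"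
    by (rule isometry[OF I]) (erule nn, erule ysf)
  also have "\<dots> \<le> (\<integral>\<^sup>+\<sigma>. \<integral>\<^sup>+\<omega>. (2 * G n \<tau> L (\<sigma>, \<omega>) + 2 * G n' \<tau>' L' (\<sigma>, \<omega>)) \<partial>M \<partial>lborel)"
    by (intro nn_integral_mono key) auto
  also have "\<dots> = (\<integral>\<^sup>+x. 2 * G n \<tau> L x + 2 * G n' \<tau>' L' x \<partial>(lborel \<Otimes>\<^sub>M M))"
    using GM[OF el] GM[OF el'] by (subst nn_integral_fst[symmetric]) auto
  also have "\<dots> = 2 * (\<integral>\<^sup>+x. G n \<tau> L x \<partial>(lborel \<Otimes>\<^sub>M M)) + 2 * (\<integral>\<^sup>+x. G n' \<tau>' L' x \<partial>(lborel \<Otimes>\<^sub>M M))"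
    using GM[OF el] GM[OF el'] by (simp add: nn_integral_add nn_integral_cmult)
  finally show ?thesis .
qed

text \<open>\<open>stochastic_integral\<close> is a choice among all admissible limits, so nothing
  can be transferred to it without uniqueness. Two approximating sequences are compared coordinate
  by coordinate: the approximation errors tend to zero by assumption, the distance between the
  elementary integrals by \<open>elementary_difference_le\<close>.\<close>

theorem stochastic_integral_unique:
  assumes X: "has_stochastic_integral M F e R W t \<Phi> X" and X': "has_stochastic_integral M F e R W t \<Phi> X'"
  shows "AE \<omega> in M. X \<omega> = X' \<omega>"
proof -
  have \<Phi>: "(\<lambda>(\<sigma>, \<omega>). indicator {0..t} \<sigma> *\<^sub>R \<Phi> \<sigma> \<omega> v) \<in> borel_measurable (lborel \<Otimes>\<^sub>M M)" for v
    using X unfolding has_stochastic_integral_def by blast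
  have Xm: "X \<in> borel_measurable M" "X' \<in> borel_measurable M"
    using X X' unfolding has_stochastic_integral_def by blast+
  let ?G = "\<lambda>n \<tau> L. \<integral>\<^sup>+(\<sigma>, \<omega>). indicator {0..t} \<sigma> *
            hs_norm2 e (\<lambda>v. \<Phi> \<sigma> \<omega> (R v) - elementary_process n \<tau> L \<sigma> \<omega> (R v)) \<partial>(lborel \<Otimes>\<^sub>M M)"
  let ?H = "\<lambda>X n \<tau> L. \<integral>\<^sup>+\<omega>. ennreal ((norm (X \<omega> - elementary_integral W n \<tau> L \<omega>))\<^sup>2) \<partial>M"
  obtain n \<tau> L where el: "\<And>m. elementary_data M F t (n m) (\<tau> m) (L m)"
    and G: "(\<lambda>m. ?G (n m) (\<tau> m) (L m)) \<longlonglongrightarrow> 0" and H: "(\<lambda>m. ?H X (n m) (\<tau> m) (L m)) \<longlonglongrightarrow> 0"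
    using X unfolding has_stochastic_integral_def by blast
  obtain n' \<tau>' L' where el': "\<And>m. elementary_data M F t (n' m) (\<tau>' m) (L' m)"
    and G': "(\<lambda>m. ?G (n' m) (\<tau>' m) (L' m)) \<longlonglongrightarrow> 0" and H': "(\<lambda>m. ?H X' (n' m) (\<tau>' m) (L' m)) \<longlonglongrightarrow> 0"
    using X' unfolding has_stochastic_integral_def by blast
  have "AE \<omega> in M. X \<omega> \<bullet> e k = X' \<omega> \<bullet> e k" for k
  proof -
    let ?I = "\<lambda>m. elementary_integral W (n m) (\<tau> m) (L m)" and ?I' = "\<lambda>m. elementary_integral W (n' m) (\<tau>' m) (L' m)"
    have Im: "(\<lambda>\<omega>. ?I m \<omega> \<bullet> e k) \<in> borel_measurable M" "(\<lambda>\<omega>. ?I' m \<omega> \<bullet> e k) \<in> borel_measurable M" for m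
      by (rule elementary_integral_measurable[OF el] elementary_integral_measurable[OF el'])+
    have Xk: "(\<lambda>\<omega>. X \<omega> \<bullet> e k) \<in> borel_measurable M" "(\<lambda>\<omega>. X' \<omega> \<bullet> e k) \<in> borel_measurable M" using Xm by measurable
    have cs: "(v \<bullet> e k)\<^sup>2 \<le> (norm v)\<^sup>2" for v
    proof -
      have "\<bar>v \<bullet> e k\<bar> \<le> norm v" using Cauchy_Schwarz_ineq2[of v "e k"] by (simp add: norm_eq_sqrt_inner[of "e k"])
      from power_mono[OF this abs_ge_zero, of 2] show ?thesis by (simp only: power2_abs)
    qed
    let ?B = "\<lambda>m. 3 * ?H X (n m) (\<tau> m) (L m) + 3 * (2 * ?G (n m) (\<tau> m) (L m) + 2 * ?G (n' m) (\<tau>' m) (L' m)) + 3 * ?H X' (n' m) (\<tau>' m) (L' m)"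
    have bound: "(\<integral>\<^sup>+\<omega>. ennreal (((X \<omega> - X' \<omega>) \<bullet> e k)\<^sup>2) \<partial>M) \<le> ?B m" for m
    proof -
      have "ennreal (((X \<omega> - X' \<omega>) \<bullet> e k)\<^sup>2) \<le> 3 * ennreal ((X \<omega> \<bullet> e k - ?I m \<omega> \<bullet> e k)\<^sup>2) + 3 * ennreal ((?I m \<omega> \<bullet> e k - ?I' m \<omega> \<bullet> e k)\<^sup>2)
          + 3 * ennreal ((X' \<omega> \<bullet> e k - ?I' m \<omega> \<bullet> e k)\<^sup>2)" for \<omega>
      proof -
        have "(p + q - s)\<^sup>2 \<le> 3 * p\<^sup>2 + 3 * q\<^sup>2 + 3 * s\<^sup>2" for p q s :: real
          using sum_squares_ge_zero[of "p - q" "p + s"] zero_le_power2[of "q + s"] by (simp add: power2_eq_square algebra_simps)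
        from this[of "X \<omega> \<bullet> e k - ?I m \<omega> \<bullet> e k" "?I m \<omega> \<bullet> e k - ?I' m \<omega> \<bullet> e k" "X' \<omega> \<bullet> e k - ?I' m \<omega> \<bullet> e k"]
        have "((X \<omega> - X' \<omega>) \<bullet> e k)\<^sup>2 \<le> 3 * (X \<omega> \<bullet> e k - ?I m \<omega> \<bullet> e k)\<^sup>2 + 3 * (?I m \<omega> \<bullet> e k - ?I' m \<omega> \<bullet> e k)\<^sup>2
            + 3 * (X' \<omega> \<bullet> e k - ?I' m \<omega> \<bullet> e k)\<^sup>2" by (simp add: inner_diff_left)
        from ennreal_leI[OF this] show ?thesis by (simp add: ennreal_plus ennreal_mult)
      qed
      then have "(\<integral>\<^sup>+\<omega>. ennreal (((X \<omega> - X' \<omega>) \<bullet> e k)\<^sup>2) \<partial>M) \<le> (\<integral>\<^sup>+\<omega>. 3 * ennreal ((X \<omega> \<bullet> e k - ?I m \<omega> \<bullet> e k)\<^sup>2)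
          + 3 * ennreal ((?I m \<omega> \<bullet> e k - ?I' m \<omega> \<bullet> e k)\<^sup>2) + 3 * ennreal ((X' \<omega> \<bullet> e k - ?I' m \<omega> \<bullet> e k)\<^sup>2) \<partial>M)"
        by (intro nn_integral_mono)
      also have "\<dots> = 3 * (\<integral>\<^sup>+\<omega>. ennreal ((X \<omega> \<bullet> e k - ?I m \<omega> \<bullet> e k)\<^sup>2) \<partial>M)
          + 3 * (\<integral>\<^sup>+\<omega>. ennreal ((?I m \<omega> \<bullet> e k - ?I' m \<omega> \<bullet> e k)\<^sup>2) \<partial>M) + 3 * (\<integral>\<^sup>+\<omega>. ennreal ((X' \<omega> \<bullet> e k - ?I' m \<omega> \<bullet> e k)\<^sup>2) \<partial>M)"
        using Im[of m] Xk by (simp add: nn_integral_add nn_integral_cmult)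
      also have "\<dots> \<le> ?B m"
      proof (intro add_mono mult_left_mono)
        show "(\<integral>\<^sup>+\<omega>. ennreal ((X \<omega> \<bullet> e k - ?I m \<omega> \<bullet> e k)\<^sup>2) \<partial>M) \<le> ?H X (n m) (\<tau> m) (L m)"
          by (intro nn_integral_mono ennreal_leI) (use cs in \<open>simp flip: inner_diff_left\<close>)
        show "(\<integral>\<^sup>+\<omega>. ennreal ((X' \<omega> \<bullet> e k - ?I' m \<omega> \<bullet> e k)\<^sup>2) \<partial>M) \<le> ?H X' (n' m) (\<tau>' m) (L' m)"
          by (intro nn_integral_mono ennreal_leI) (use cs in \<open>simp flip: inner_diff_left\<close>)
        show "(\<integral>\<^sup>+\<omega>. ennreal ((?I m \<omega> \<bullet> e k - ?I' m \<omega> \<bullet> e k)\<^sup>2) \<partial>M) \<le> 2 * ?G (n m) (\<tau> m) (L m) + 2 * ?G (n' m) (\<tau>' m) (L' m)"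
          using elementary_difference_le[OF el el' \<Phi>, of m m k] by (simp add: inner_diff_left)
      qed auto
      finally show ?thesis .
    qed
    have "?B \<longlonglongrightarrow> 3 * 0 + 3 * (2 * 0 + 2 * 0) + 3 * 0"
      by (intro tendsto_add ennreal_tendsto_cmult H H' G G') auto
    then have "(\<integral>\<^sup>+\<omega>. ennreal (((X \<omega> - X' \<omega>) \<bullet> e k)\<^sup>2) \<partial>M) \<le> 3 * 0 + 3 * (2 * 0 + 2 * 0) + 3 * 0"
      by (rule tendsto_lowerbound[OF _ always_eventually[OF allI[OF bound]]]) simp
    then have "(\<integral>\<^sup>+\<omega>. ennreal (((X \<omega> - X' \<omega>) \<bullet> e k)\<^sup>2) \<partial>M) = 0" by simp
    then have "AE \<omega> in M. ennreal (((X \<omega> - X' \<omega>) \<bullet> e k)\<^sup>2) = 0"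
      using Xm by (subst nn_integral_0_iff_AE[symmetric]) auto
    then show ?thesis by eventually_elim (simp add: inner_diff_left)
  qed
  then have "AE \<omega> in M. \<forall>k. X \<omega> \<bullet> e k = X' \<omega> \<bullet> e k" by (simp add: AE_all_countable)
  then show ?thesis by eventually_elim (auto intro: e_eqI)
qed

end

text \<open>The derivative is -\<mu> times a convolution, bounded by exp T times the L^1 norm of the
  kernel on [0,T]. The constant grows with \<mu>; it is used mode by mode for the convergence of
  Riemann sums, while uniform estimates rest on the energy bound.\<close>

lemma (in scalar_volterra) Lipschitz_on_interval:
  assumes T: "T \<ge> 0"
  shows "\<exists>\<Lambda>\<ge>0. \<forall>x\<in>{0..T}. \<forall>y\<in>{0..T}. \<bar>u x - u y\<bar> \<le> \<Lambda> * \<bar>x - y\<bar>"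
proof -
  have ub: "\<bar>u t\<bar> \<le> exp T" if "0 \<le> t" "t \<le> T" for t
    using resolvent_le_exp[of 1 t] that by (smt (verit) exp_le_cancel_iff mult_cancel_right1)
  let ?g = "\<lambda>x. indicator {0..T} x * \<bar>b0 x\<bar>"
  have gi: "integrable lborel ?g"
  proof (rule Bochner_Integration.integrable_bound)
    show "integrable lborel (\<lambda>t. exp T * (exp (- 1 * t) * b0 t))"
      by (intro integrable_mult_right integrable_exp_b0) auto
    show "AE t in lborel. norm (?g t) \<le> norm (exp T * (exp (- 1 * t) * b0 t))"
    proof (rule AE_I2)
      fix t
      have "1 * \<bar>b0 t\<bar> \<le> (exp T * exp (- t)) * \<bar>b0 t\<bar>" if "t \<le> T"
        using that by (intro mult_right_mono) (auto simp: exp_add[symmetric])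
      then show "norm (?g t) \<le> norm (exp T * (exp (- 1 * t) * b0 t))"
        by (cases "t \<in> {0..T}") (auto simp: abs_mult mult.assoc)
    qed
  qed measurable
  have conv_le: "\<bar>conv t\<bar> \<le> exp T * (LINT x|lborel. ?g x)" if t: "t \<in> {0..T}" for t
  proof -
    have gt: "integrable lborel (\<lambda>\<sigma>. ?g (t - \<sigma>))"
      using lborel_integrable_real_affine[OF gi, of "-1" t] by simp
    have "\<bar>conv t\<bar> \<le> (LINT \<sigma>|lborel. \<bar>b0 (t - \<sigma>) * u0 \<sigma>\<bar>)" unfolding conv_def by (rule integral_abs_bound)
    also have "\<dots> \<le> (LINT \<sigma>|lborel. exp T * ?g (t - \<sigma>))"
    proof (rule integral_mono')
      show "integrable lborel (\<lambda>\<sigma>. exp T * ?g (t - \<sigma>))" by (rule integrable_mult_right[OF gt])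
      fix \<sigma>
      show "\<bar>b0 (t - \<sigma>) * u0 \<sigma>\<bar> \<le> exp T * ?g (t - \<sigma>)"
      proof (cases "0 \<le> \<sigma> \<and> \<sigma> \<le> t")
        case True
        then have "\<bar>u \<sigma>\<bar> * \<bar>b0 (t - \<sigma>)\<bar> \<le> exp T * \<bar>b0 (t - \<sigma>)\<bar>" using t by (intro mult_right_mono ub) auto
        then show ?thesis using True t by (simp add: u0_def abs_mult mult.commute)
      qed (auto simp: u0_def b0_def)
      show "0 \<le> exp T * ?g (t - \<sigma>)" by simp
    qed
    also have "\<dots> = exp T * (LINT x|lborel. ?g x)" using integral_reflect_shift[of ?g t] by simp
    finally show ?thesis .
  qed
  define \<Lambda> where "\<Lambda> = \<mu> * (exp T * (LINT x|lborel. ?g x))"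
  have "0 \<le> \<Lambda>" unfolding \<Lambda>_def using mu by (intro mult_nonneg_nonneg integral_nonneg_AE) auto
  moreover have "\<bar>u x - u y\<bar> \<le> \<Lambda> * \<bar>x - y\<bar>" if "x \<in> {0..T}" "y \<in> {0..T}" for x y
  proof -
    have "norm (u x - u y) \<le> \<Lambda> * norm (x - y)"
    proof (rule field_differentiable_bound[where S = "{0..T}" and f' = "\<lambda>t. - \<mu> * conv t"])
      fix t assume t: "t \<in> {0..T}"
      show "(u has_field_derivative - \<mu> * conv t) (at t within {0..T})"
        by (rule DERIV_subset[OF deriv_u]) (use t in auto)
      show "norm (- \<mu> * conv t) \<le> \<Lambda>"
        using mult_left_mono[OF conv_le[OF t], of \<mu>] mu by (simp add: abs_mult \<Lambda>_def)
    qed (use that in auto)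
    then show ?thesis by simp
  qed
  ultimately show ?thesis by blast
qed

section \<open>Wiener integrals of Lipschitz functions by dyadic Riemann sums\<close>

context wiener
begin

definition grid :: "real \<Rightarrow> nat \<Rightarrow> nat \<Rightarrow> real" where "grid t n i = t * real i / 2 ^ n"

definition riemann :: "real \<Rightarrow> (real \<Rightarrow> real) \<Rightarrow> 'h \<Rightarrow> nat \<Rightarrow> 'w \<Rightarrow> real" where
  "riemann t \<psi> h n \<omega> = (\<Sum>i<2^n. \<psi> (grid t n i) * ((W (grid t n (Suc i)) \<omega> - W (grid t n i) \<omega>) \<bullet> h))"

definition stepf :: "real \<Rightarrow> (real \<Rightarrow> real) \<Rightarrow> nat \<Rightarrow> real \<Rightarrow> real" where
  "stepf t \<psi> n \<sigma> = (\<Sum>i<2^n. \<psi> (grid t n i) * indicator {grid t n i<..grid t n (Suc i)} \<sigma>)"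

text \<open>The cut off is to a half open interval because the cells of the step functions tile
  exactly that set. The point 0 is therefore exceptional whenever \<open>restr\<close> meets an
  integrand on [0,t].\<close>

definition restr :: "real \<Rightarrow> (real \<Rightarrow> real) \<Rightarrow> real \<Rightarrow> real" where
  "restr t \<psi> \<sigma> = \<psi> \<sigma> * indicator {0<..t} \<sigma>"

definition lip :: "real \<Rightarrow> (real \<Rightarrow> real) \<Rightarrow> real \<Rightarrow> bool" where
  "lip t \<psi> \<Lambda> \<longleftrightarrow> 0 \<le> \<Lambda> \<and> (\<forall>x\<in>{0..t}. \<forall>y\<in>{0..t}. \<bar>\<psi> x - \<psi> y\<bar> \<le> \<Lambda> * \<bar>x - y\<bar>)"

lemma grid_facts: "t \<ge> 0 \<Longrightarrow> 0 \<le> grid t n i" "t \<ge> 0 \<Longrightarrow> grid t n i \<le> grid t n (Suc i)"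
    "t \<ge> 0 \<Longrightarrow> i \<le> 2 ^ n \<Longrightarrow> grid t n i \<le> t" "grid t n 0 = 0" "grid t n (2 ^ n) = t"
    "grid t n (Suc i) - grid t n i = t / 2 ^ n"
proof -
  show "t \<ge> 0 \<Longrightarrow> 0 \<le> grid t n i" "grid t n 0 = 0" "grid t n (2 ^ n) = t" by (auto simp: grid_def)
  show 1: "grid t n (Suc i) - grid t n i = t / 2 ^ n" by (simp add: grid_def field_simps)
  show "t \<ge> 0 \<Longrightarrow> grid t n i \<le> grid t n (Suc i)" using 1 by (smt (verit) divide_nonneg_nonneg zero_le_power)
  assume t: "t \<ge> 0" and "i \<le> 2 ^ n"
  then have "real i \<le> 2 ^ n" by (metis of_nat_le_iff of_nat_numeral of_nat_power)
  then have "t * real i \<le> t * 2 ^ n" using t by (intro mult_left_mono)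
  then show "grid t n i \<le> t" by (simp add: grid_def divide_le_eq)
qed

lemma stepf_cells:
  assumes t: "t \<ge> 0"
  shows "(\<Sum>i<2^n. indicator {grid t n i<..grid t n (Suc i)} \<sigma> :: real) = indicator {0<..t} \<sigma>"
proof -
  have "(\<Sum>i<2^n. indicator {grid t n i<..grid t n (Suc i)} \<sigma> :: real)
      = (\<Sum>i<2^n. indicator {\<sigma>..} (grid t n (Suc i)) - indicator {\<sigma>..} (grid t n i))"
    using grid_facts(2)[OF t] by (intro sum.cong) (simp_all add: indicator_increment)
  also have "\<dots> = indicator {\<sigma>..} t - indicator {\<sigma>..} 0"
    by (subst sum_lessThan_telescope) (simp add: grid_facts)
  also have "\<dots> = indicator {0<..t} \<sigma>" using t by (simp add: indicator_increment)
  finally show ?thesis .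
qed

lemma stepf_restr:
  assumes t: "t \<ge> 0" and \<psi>: "lip t \<psi> \<Lambda>"
  shows "\<bar>stepf t \<psi> n \<sigma> - restr t \<psi> \<sigma>\<bar> \<le> \<Lambda> * t / 2 ^ n * indicator {0<..t} \<sigma>"
proof -
  let ?c = "\<lambda>i. indicator {grid t n i<..grid t n (Suc i)} \<sigma> :: real"
  have "stepf t \<psi> n \<sigma> - restr t \<psi> \<sigma> = (\<Sum>i<2^n. (\<psi> (grid t n i) - \<psi> \<sigma>) * ?c i)"
    unfolding stepf_def restr_def stepf_cells[OF t, of n, symmetric]
    by (simp only: sum_distrib_left sum_subtractf[symmetric] left_diff_distrib)
  also have "\<bar>\<dots>\<bar> \<le> (\<Sum>i<2^n. \<bar>(\<psi> (grid t n i) - \<psi> \<sigma>) * ?c i\<bar>)" by (rule sum_abs)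
  also have "\<dots> \<le> (\<Sum>i<2^n. \<Lambda> * t / 2 ^ n * ?c i)"
  proof (rule sum_mono)
    fix i :: nat assume "i \<in> {..<2^n}"
    then have i: "Suc i \<le> 2 ^ n" "i \<le> 2 ^ n" by auto
    show "\<bar>(\<psi> (grid t n i) - \<psi> \<sigma>) * ?c i\<bar> \<le> \<Lambda> * t / 2 ^ n * ?c i"
    proof (cases "\<sigma> \<in> {grid t n i<..grid t n (Suc i)}")
      case True
      have s: "grid t n i \<in> {0..t}" "\<sigma> \<in> {0..t}"
        using True grid_facts(1)[OF t, of n i] grid_facts(3)[OF t i(1)] grid_facts(3)[OF t i(2)] by auto
      have "\<bar>\<psi> (grid t n i) - \<psi> \<sigma>\<bar> \<le> \<Lambda> * \<bar>grid t n i - \<sigma>\<bar>" using \<psi> s by (auto simp: lip_def)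
      also have "\<dots> \<le> \<Lambda> * (t / 2 ^ n)"
        using True grid_facts(6)[of t n i] \<psi> by (intro mult_left_mono) (auto simp: lip_def)
      finally show ?thesis using True by simp
    qed simp
  qed
  also have "\<dots> = \<Lambda> * t / 2 ^ n * indicator {0<..t} \<sigma>"
    by (simp only: sum_distrib_left[symmetric] stepf_cells[OF t])
  finally show ?thesis .
qed

lemma stepf_measurable [measurable]: "stepf t \<psi> n \<in> borel_measurable borel"
  unfolding stepf_def[abs_def] by measurable

lemma stepf_LIMSEQ:
  assumes t: "t \<ge> 0" and \<psi>: "lip t \<psi> \<Lambda>"
  shows "(\<lambda>n. stepf t \<psi> n \<sigma>) \<longlonglongrightarrow> restr t \<psi> \<sigma>"
proof (rule LIM_zero_cancel, rule Lim_null_comparison)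
  show "\<forall>\<^sub>F n in sequentially. norm (stepf t \<psi> n \<sigma> - restr t \<psi> \<sigma>) \<le> \<Lambda> * t * indicator {0<..t} \<sigma> * (1/2) ^ n"
    using stepf_restr[OF t \<psi>] by (intro always_eventually allI) (simp add: power_divide mult_ac)
  show "(\<lambda>n. \<Lambda> * t * indicator {0<..t} \<sigma> * (1/2) ^ n) \<longlonglongrightarrow> 0"
    by (intro tendsto_mult_right_zero LIMSEQ_power_zero) auto
qed

lemma restr_measurable:
  assumes t: "t \<ge> 0" and \<psi>: "lip t \<psi> \<Lambda>"
  shows "restr t \<psi> \<in> borel_measurable borel"
  by (rule borel_measurable_LIMSEQ_metric[OF stepf_measurable stepf_LIMSEQ[OF t \<psi>]])

lemma lip_bound:
  assumes t: "t \<ge> 0" and \<psi>: "lip t \<psi> \<Lambda>"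
  shows "\<exists>B\<ge>0. \<forall>\<sigma>. \<bar>restr t \<psi> \<sigma>\<bar> \<le> B * indicator {0..t} \<sigma> \<and> (\<forall>n. \<bar>stepf t \<psi> n \<sigma>\<bar> \<le> B * indicator {0..t} \<sigma>)"
proof -
  define B where "B = \<bar>\<psi> 0\<bar> + 2 * (\<Lambda> * t)"
  have \<Lambda>: "\<Lambda> \<ge> 0" using \<psi> by (simp add: lip_def)
  have r: "\<bar>restr t \<psi> \<sigma>\<bar> \<le> (\<bar>\<psi> 0\<bar> + \<Lambda> * t) * indicator {0<..t} \<sigma>" for \<sigma>
  proof (cases "\<sigma> \<in> {0<..t}")
    case True
    then have "\<bar>\<psi> \<sigma> - \<psi> 0\<bar> \<le> \<Lambda> * \<bar>\<sigma> - 0\<bar>"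
      using \<psi>[unfolded lip_def, THEN conjunct2, rule_format, of \<sigma> 0] t by simp
    also have "\<dots> \<le> \<Lambda> * t" using True \<Lambda> by (intro mult_left_mono) auto
    finally show ?thesis using True by (simp add: restr_def)
  qed (simp add: restr_def)
  have s: "\<bar>stepf t \<psi> n \<sigma>\<bar> \<le> B * indicator {0<..t} \<sigma>" for n \<sigma>
  proof -
    have "\<Lambda> * t / 2 ^ n \<le> \<Lambda> * t" using divide_left_mono[of 1 "2 ^ n" "\<Lambda> * t"] mult_nonneg_nonneg[OF \<Lambda> t] by simp
    then have "\<Lambda> * t / 2 ^ n * indicator {0<..t} \<sigma> \<le> \<Lambda> * t * indicator {0<..t} \<sigma>" by (rule mult_right_mono) simp
    then show ?thesis using stepf_restr[OF t \<psi>, of n \<sigma>] r[of \<sigma>] by (cases "\<sigma> \<in> {0<..t}") (auto simp: B_def)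
  qed
  have i: "indicator {0<..t} \<sigma> \<le> (indicator {0..t} \<sigma> :: real)" for \<sigma> by (auto simp: indicator_def)
  have B: "B \<ge> 0" "\<bar>\<psi> 0\<bar> + \<Lambda> * t \<le> B" using \<Lambda> t by (auto simp: B_def)
  show ?thesis
  proof (intro exI[of _ B] conjI allI B(1))
    fix \<sigma>
    have "B * indicator {0<..t} \<sigma> \<le> B * indicator {0..t} \<sigma>" using B i by (intro mult_left_mono) auto
    then show "\<bar>stepf t \<psi> n \<sigma>\<bar> \<le> B * indicator {0..t} \<sigma>" for n using s[of n \<sigma>] by linarith
    have "(\<bar>\<psi> 0\<bar> + \<Lambda> * t) * indicator {0<..t} \<sigma> \<le> B * indicator {0..t} \<sigma>" using B i by (intro mult_mono) auto
    then show "\<bar>restr t \<psi> \<sigma>\<bar> \<le> B * indicator {0..t} \<sigma>" using r[of \<sigma>] by linarith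
  qed
qed

lemma riemann_measurable:
  assumes t: "t \<ge> 0" shows "riemann t \<psi> h n \<in> borel_measurable M"
proof -
  have "(\<lambda>\<omega>. W (grid t n (Suc i)) \<omega> - W (grid t n i) \<omega>) \<in> borel_measurable M" for i
    by (intro increment_measurable grid_facts t)
  then show ?thesis unfolding riemann_def[abs_def] by measurable
qed

text \<open>Two Riemann sums over different grids form a single Gaussian family, indexed by the
  disjoint union of the grids with negated coefficients on the second.\<close>

lemma riemann_diff_moment:
  assumes t: "t \<ge> 0" and t': "t' \<ge> 0"
  shows "(\<integral>\<^sup>+\<omega>. ennreal ((riemann t \<psi> h n \<omega> - riemann t' \<psi>' h n' \<omega>) ^ (2 * m)) \<partial>M)
    = ennreal (gaussian_moment m * ((norm (R h))\<^sup>2 * (LINT \<sigma>|lborel. (stepf t \<psi> n \<sigma> - stepf t' \<psi>' n' \<sigma>)\<^sup>2)) ^ m)"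
proof -
  let ?I = "{..<2^n::nat} <+> {..<2^n'::nat}"
  define \<alpha> where "\<alpha> = case_sum (grid t n) (grid t' n')"
  define \<beta> where "\<beta> = case_sum (\<lambda>i. grid t n (Suc i)) (\<lambda>i. grid t' n' (Suc i))"
  define a where "a = case_sum (\<lambda>i. \<psi> (grid t n i)) (\<lambda>i. - \<psi>' (grid t' n' i))"
  have I: "finite ?I" by auto
  have nn: "0 \<le> \<alpha> i \<and> \<alpha> i \<le> \<beta> i" if "i \<in> ?I" for i
    using grid_facts(1,2)[OF t] grid_facts(1,2)[OF t'] by (cases i) (auto simp: \<alpha>_def \<beta>_def)
  have 1: "riemann t \<psi> h n \<omega> - riemann t' \<psi>' h n' \<omega> = (\<Sum>i\<in>?I. a i * ((W (\<beta> i) \<omega> - W (\<alpha> i) \<omega>) \<bullet> h))" for \<omega>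
    by (simp only: riemann_def sum.Plus[OF finite_lessThan finite_lessThan] comp_def \<alpha>_def \<beta>_def a_def sum.case
        mult_minus_left sum_negf diff_conv_add_uminus)
  have 2: "stepf t \<psi> n \<sigma> - stepf t' \<psi>' n' \<sigma> = (\<Sum>i\<in>?I. a i * indicator {\<alpha> i<..\<beta> i} \<sigma>)" for \<sigma>
    by (simp only: stepf_def sum.Plus[OF finite_lessThan finite_lessThan] comp_def \<alpha>_def \<beta>_def a_def sum.case
        mult_minus_left sum_negf diff_conv_add_uminus)
  show ?thesis unfolding 1 2 by (rule gaussian_family_moment[OF I]) (erule nn)
qed

text \<open>A pointwise limit instead of a limit in L^2: dyadic grids make the sums converge almost
  surely, and the result is a concrete measurable function. Where the sums diverge the value is an
  unspecified default on a null set.\<close>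

definition wiener_integral :: "real \<Rightarrow> (real \<Rightarrow> real) \<Rightarrow> 'h \<Rightarrow> 'w \<Rightarrow> real" where
  "wiener_integral t \<psi> h \<omega> = lim (\<lambda>n. riemann t \<psi> h n \<omega>)"

lemma wiener_integral_measurable:
  assumes t: "t \<ge> 0" shows "wiener_integral t \<psi> h \<in> borel_measurable M"
  unfolding wiener_integral_def[abs_def] by (rule borel_measurable_lim_metric) (rule riemann_measurable[OF t])

lemma wiener_integral_zero: "wiener_integral 0 \<psi> h \<omega> = 0"
  by (simp add: wiener_integral_def riemann_def grid_def)

text \<open>Consecutive sums differ in mean square by O(4^-n), since the step functions differ by
  O(2^-n). The weight 2^n leaves a convergent series of expectations, so almost surely the
  differences are at most a constant times 2^(-n/2) and the sums telescope absolutely.\<close>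

lemma riemann_LIMSEQ:
  assumes t: "t \<ge> 0" and \<psi>: "lip t \<psi> \<Lambda>"
  shows "AE \<omega> in M. (\<lambda>n. riemann t \<psi> h n \<omega>) \<longlonglongrightarrow> wiener_integral t \<psi> h \<omega>"
proof -
  note [measurable] = riemann_measurable[OF t]
  let ?D = "\<lambda>n \<omega>. riemann t \<psi> h (Suc n) \<omega> - riemann t \<psi> h n \<omega>"
  define C where "C = (norm (R h))\<^sup>2 * ((2 * \<Lambda> * t)\<^sup>2 * t)"
  have \<Lambda>: "\<Lambda> \<ge> 0" using \<psi> by (simp add: lip_def)
  have C0: "C \<ge> 0" using t by (simp add: C_def)
  have ED: "(\<integral>\<^sup>+\<omega>. ennreal ((?D n \<omega>)\<^sup>2) \<partial>M) \<le> ennreal (C * (1/4)^n)" for n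
  proof -
    have le: "(stepf t \<psi> (Suc n) \<sigma> - stepf t \<psi> n \<sigma>)\<^sup>2 \<le> (2 * \<Lambda> * t / 2 ^ n)\<^sup>2 * indicator {0<..t} \<sigma>" for \<sigma>
    proof (cases "\<sigma> \<in> {0<..t}")
      case True
      have "\<Lambda> * t / 2 ^ Suc n \<le> \<Lambda> * t / 2 ^ n" using \<Lambda> t by (intro divide_left_mono) auto
      then have "\<bar>stepf t \<psi> (Suc n) \<sigma> - stepf t \<psi> n \<sigma>\<bar> \<le> 2 * \<Lambda> * t / 2 ^ n"
        using stepf_restr[OF t \<psi>, of n \<sigma>] stepf_restr[OF t \<psi>, of "Suc n" \<sigma>] True by simp
      from power_mono[OF this abs_ge_zero, of 2] show ?thesis using True by simp
    next
      case False
      then show ?thesis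
        using stepf_restr[OF t \<psi>, of n \<sigma>] stepf_restr[OF t \<psi>, of "Suc n" \<sigma>] by simp
    qed
    have gi: "integrable lborel (\<lambda>\<sigma>. (2 * \<Lambda> * t / 2 ^ n)\<^sup>2 * indicator {0<..t} \<sigma>)"
      using t by (intro integrable_mult_right) auto
    have "(LINT \<sigma>|lborel. (stepf t \<psi> (Suc n) \<sigma> - stepf t \<psi> n \<sigma>)\<^sup>2) \<le> (LINT \<sigma>|lborel. (2 * \<Lambda> * t / 2 ^ n)\<^sup>2 * indicator {0<..t} \<sigma>)"
      by (rule integral_mono'[OF gi le]) auto
    also have "\<dots> = (2 * \<Lambda> * t / 2 ^ n)\<^sup>2 * t" using t by simp
    also have "\<dots> = (2 * \<Lambda> * t)\<^sup>2 * t * (1/4)^n"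
      by (simp add: power_divide power_mult[symmetric] mult.commute power2_eq_square flip: power_mult_distrib)
    finally have "(norm (R h))\<^sup>2 * (LINT \<sigma>|lborel. (stepf t \<psi> (Suc n) \<sigma> - stepf t \<psi> n \<sigma>)\<^sup>2) \<le> (norm (R h))\<^sup>2 * ((2 * \<Lambda> * t)\<^sup>2 * t * (1/4)^n)"
      by (rule mult_left_mono) simp
    also have "\<dots> = C * (1/4)^n" by (simp add: C_def)
    finally have 1: "gaussian_moment 1 * ((norm (R h))\<^sup>2 * (LINT \<sigma>|lborel. (stepf t \<psi> (Suc n) \<sigma> - stepf t \<psi> n \<sigma>)\<^sup>2)) ^ 1 \<le> C * (1/4)^n"
      by (simp add: gaussian_moment_def)
    show ?thesis
      using riemann_diff_moment[OF t t, of \<psi> h "Suc n" \<psi> n 1] ennreal_leI[OF 1] by simp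
  qed
  have "(\<integral>\<^sup>+\<omega>. (\<Sum>n. ennreal (2 ^ n * (?D n \<omega>)\<^sup>2)) \<partial>M) = (\<Sum>n. \<integral>\<^sup>+\<omega>. ennreal (2 ^ n * (?D n \<omega>)\<^sup>2) \<partial>M)"
    by (intro nn_integral_suminf) measurable
  also have "\<dots> \<le> (\<Sum>n. ennreal (C * (1/2)^n))"
  proof (intro suminf_le allI)
    fix n
    have "(\<integral>\<^sup>+\<omega>. ennreal (2 ^ n * (?D n \<omega>)\<^sup>2) \<partial>M) = (\<integral>\<^sup>+\<omega>. ennreal (2 ^ n) * ennreal ((?D n \<omega>)\<^sup>2) \<partial>M)"
      by (intro nn_integral_cong ennreal_mult) auto
    also have "\<dots> = ennreal (2 ^ n) * (\<integral>\<^sup>+\<omega>. ennreal ((?D n \<omega>)\<^sup>2) \<partial>M)"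
      by (intro nn_integral_cmult) measurable
    also have "\<dots> \<le> ennreal (2 ^ n) * ennreal (C * (1/4)^n)" by (intro mult_left_mono ED) auto
    also have "\<dots> = ennreal (2 ^ n * (C * (1/4)^n))" using C0 by (intro ennreal_mult[symmetric]) auto
    also have "2 ^ n * (C * (1/4)^n) = C * (1/2)^n" by (simp add: power_divide field_simps flip: power_mult_distrib)
    finally show "(\<integral>\<^sup>+\<omega>. ennreal (2 ^ n * (?D n \<omega>)\<^sup>2) \<partial>M) \<le> ennreal (C * (1/2)^n)" .
  qed auto
  also have "\<dots> < \<top>"
  proof -
    have "summable (\<lambda>n. C * (1/2::real)^n)" by (intro summable_mult summable_geometric) auto
    then have "(\<Sum>n. ennreal (C * (1/2)^n)) \<noteq> \<top>" using C0 by (intro ennreal_suminf_neq_top) auto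
    then show ?thesis by (simp add: less_top)
  qed
  finally have fin: "(\<integral>\<^sup>+\<omega>. (\<Sum>n. ennreal (2 ^ n * (?D n \<omega>)\<^sup>2)) \<partial>M) < \<top>" .
  have "AE \<omega> in M. (\<Sum>n. ennreal (2 ^ n * (?D n \<omega>)\<^sup>2)) \<noteq> \<infinity>"
    by (rule nn_integral_PInf_AE) (use fin in auto)
  then show ?thesis
  proof eventually_elim
    fix \<omega> assume "(\<Sum>n. ennreal (2 ^ n * (?D n \<omega>)\<^sup>2)) \<noteq> \<infinity>"
    then have sm: "summable (\<lambda>n. 2 ^ n * (?D n \<omega>)\<^sup>2)" by (intro summable_suminf_not_top) auto
    define K where "K = (\<Sum>n. 2 ^ n * (?D n \<omega>)\<^sup>2)"
    have K: "2 ^ n * (?D n \<omega>)\<^sup>2 \<le> K" for n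
      unfolding K_def using sum_le_suminf[OF sm, of "{n}"] by simp
    have Dle: "\<bar>?D n \<omega>\<bar> \<le> sqrt K * (1 / sqrt 2) ^ n" for n
    proof -
      have "(?D n \<omega>)\<^sup>2 \<le> K / 2 ^ n" using K[of n] by (simp add: field_simps)
      then have "sqrt ((?D n \<omega>)\<^sup>2) \<le> sqrt (K / 2 ^ n)" by (rule real_sqrt_le_mono)
      then show ?thesis unfolding real_sqrt_abs by (simp add: real_sqrt_divide real_sqrt_power power_divide)
    qed
    have "summable (\<lambda>n. sqrt K * (1 / sqrt 2) ^ n)" by (intro summable_mult summable_geometric) simp
    then have "summable (\<lambda>n. ?D n \<omega>)"
      by (rule summable_comparison_test'[where N = 0]) (use Dle in simp)
    then have "convergent (\<lambda>n. \<Sum>i<n. ?D i \<omega>)" by (simp add: summable_iff_convergent)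
    then obtain l where "(\<lambda>n. \<Sum>i<n. ?D i \<omega>) \<longlonglongrightarrow> l" by (auto simp: convergent_def)
    then have "(\<lambda>n. (\<Sum>i<n. ?D i \<omega>) + riemann t \<psi> h 0 \<omega>) \<longlonglongrightarrow> l + riemann t \<psi> h 0 \<omega>" by (intro tendsto_intros)
    moreover have "(\<Sum>i<n. ?D i \<omega>) = riemann t \<psi> h n \<omega> - riemann t \<psi> h 0 \<omega>" for n
      by (rule sum_lessThan_telescope)
    ultimately have "convergent (\<lambda>n. riemann t \<psi> h n \<omega>)" by (auto simp: convergent_def)
    then show "(\<lambda>n. riemann t \<psi> h n \<omega>) \<longlonglongrightarrow> wiener_integral t \<psi> h \<omega>"
      unfolding wiener_integral_def by (simp add: convergent_LIMSEQ_iff)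
  qed
qed

text \<open>Fatou's lemma along the Riemann sums, whose moments are exact. The subsequence \<nu>
  covers two uses: \<nu> n = n compares two integrals, constant \<nu> compares an integral with one
  of its Riemann sums.\<close>

lemma wiener_integral_moment_general:
  assumes t: "t \<ge> 0" and \<psi>: "lip t \<psi> \<Lambda>" and t': "t' \<ge> 0" and \<psi>': "lip t' \<psi>' \<Lambda>'"
    and lim: "\<And>\<sigma>. (\<lambda>n. stepf t' \<psi>' (\<nu> n) \<sigma>) \<longlonglongrightarrow> g \<sigma>"
    and Z: "AE \<omega> in M. (\<lambda>n. riemann t' \<psi>' h (\<nu> n) \<omega>) \<longlonglongrightarrow> Z \<omega>"
  shows "(\<integral>\<^sup>+\<omega>. ennreal ((wiener_integral t \<psi> h \<omega> - Z \<omega>) ^ (2 * m)) \<partial>M)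
    \<le> ennreal (gaussian_moment m * ((norm (R h))\<^sup>2 * (LINT \<sigma>|lborel. (restr t \<psi> \<sigma> - g \<sigma>)\<^sup>2)) ^ m)"
proof -
  note [measurable] = riemann_measurable[OF t] riemann_measurable[OF t']
  let ?f = "\<lambda>n \<omega>. riemann t \<psi> h n \<omega> - riemann t' \<psi>' h (\<nu> n) \<omega>"
  let ?c = "\<lambda>n. LINT \<sigma>|lborel. (stepf t \<psi> n \<sigma> - stepf t' \<psi>' (\<nu> n) \<sigma>)\<^sup>2"
  obtain B where B: "B \<ge> 0" "\<And>\<sigma> n. \<bar>stepf t \<psi> n \<sigma>\<bar> \<le> B * indicator {0..t} \<sigma>" using lip_bound[OF t \<psi>] by auto
  obtain B' where B': "B' \<ge> 0" "\<And>\<sigma> n. \<bar>stepf t' \<psi>' n \<sigma>\<bar> \<le> B' * indicator {0..t'} \<sigma>" using lip_bound[OF t' \<psi>'] by auto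
  have gm [measurable]: "g \<in> borel_measurable borel"
    by (rule borel_measurable_LIMSEQ_metric[OF _ lim]) measurable
  have rm [measurable]: "restr t \<psi> \<in> borel_measurable borel" by (rule restr_measurable[OF t \<psi>])
  have lc: "?c \<longlonglongrightarrow> (LINT \<sigma>|lborel. (restr t \<psi> \<sigma> - g \<sigma>)\<^sup>2)"
  proof (rule integral_dominated_convergence[where w = "\<lambda>\<sigma>. (B + B')\<^sup>2 * (indicator {0..t} \<sigma> + indicator {0..t'} \<sigma>)"])
    show "integrable lborel (\<lambda>\<sigma>. (B + B')\<^sup>2 * (indicator {0..t} \<sigma> + indicator {0..t'} \<sigma>) :: real)"
      using t t' by (intro integrable_mult_right Bochner_Integration.integrable_add) auto
    show "AE \<sigma> in lborel. (\<lambda>n. (stepf t \<psi> n \<sigma> - stepf t' \<psi>' (\<nu> n) \<sigma>)\<^sup>2) \<longlonglongrightarrow> (restr t \<psi> \<sigma> - g \<sigma>)\<^sup>2"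
      by (intro AE_I2 tendsto_intros stepf_LIMSEQ[OF t \<psi>] lim)
    show "AE \<sigma> in lborel. norm ((stepf t \<psi> n \<sigma> - stepf t' \<psi>' (\<nu> n) \<sigma>)\<^sup>2)
        \<le> (B + B')\<^sup>2 * (indicator {0..t} \<sigma> + indicator {0..t'} \<sigma>)" for n
    proof (rule AE_I2)
      fix \<sigma>
      define i where "i = (indicator {0..t} \<sigma> :: real)" define i' where "i' = (indicator {0..t'} \<sigma> :: real)"
      define s where "s = \<bar>stepf t \<psi> n \<sigma> - stepf t' \<psi>' (\<nu> n) \<sigma>\<bar>"
      have ii: "(i = 0 \<or> i = 1) \<and> (i' = 0 \<or> i' = 1)" by (auto simp: i_def i'_def indicator_def)
      have s: "0 \<le> s" "s \<le> B * i + B' * i'"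
        using B(2)[of n \<sigma>] B'(2)[of "\<nu> n" \<sigma>] unfolding s_def i_def i'_def by linarith+
      have "s\<^sup>2 \<le> (B + B')\<^sup>2 * (i + i')"
      proof (cases "i = 0 \<and> i' = 0")
        case True then show ?thesis using s by simp
      next
        case False
        then have 1: "1 \<le> i + i'" using ii by auto
        have "s \<le> B + B'" using s ii B(1) B'(1) by auto
        then have "s\<^sup>2 \<le> (B + B')\<^sup>2" using s(1) by (rule power_mono)
        also have "\<dots> \<le> (B + B')\<^sup>2 * (i + i')" using mult_left_mono[OF 1, of "(B + B')\<^sup>2"] by simp
        finally show ?thesis .
      qed
      then show "norm ((stepf t \<psi> n \<sigma> - stepf t' \<psi>' (\<nu> n) \<sigma>)\<^sup>2)
        \<le> (B + B')\<^sup>2 * (indicator {0..t} \<sigma> + indicator {0..t'} \<sigma>)" by (simp add: s_def i_def i'_def)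
    qed
  qed measurable
  have "(\<integral>\<^sup>+\<omega>. ennreal ((wiener_integral t \<psi> h \<omega> - Z \<omega>) ^ (2 * m)) \<partial>M)
      = (\<integral>\<^sup>+\<omega>. liminf (\<lambda>n. ennreal ((?f n \<omega>) ^ (2 * m))) \<partial>M)"
  proof (rule nn_integral_cong_AE)
    show "AE \<omega> in M. ennreal ((wiener_integral t \<psi> h \<omega> - Z \<omega>) ^ (2 * m)) = liminf (\<lambda>n. ennreal ((?f n \<omega>) ^ (2 * m)))"
      using riemann_LIMSEQ[OF t \<psi>, of h] Z
    proof eventually_elim
      fix \<omega> assume "(\<lambda>n. riemann t \<psi> h n \<omega>) \<longlonglongrightarrow> wiener_integral t \<psi> h \<omega>" "(\<lambda>n. riemann t' \<psi>' h (\<nu> n) \<omega>) \<longlonglongrightarrow> Z \<omega>"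
      then have "(\<lambda>n. ennreal ((?f n \<omega>) ^ (2 * m))) \<longlonglongrightarrow> ennreal ((wiener_integral t \<psi> h \<omega> - Z \<omega>) ^ (2 * m))"
        by (intro tendsto_ennrealI tendsto_intros)
      then show "ennreal ((wiener_integral t \<psi> h \<omega> - Z \<omega>) ^ (2 * m)) = liminf (\<lambda>n. ennreal ((?f n \<omega>) ^ (2 * m)))"
        by (intro lim_imp_Liminf[symmetric]) auto
    qed
  qed
  also have "\<dots> \<le> liminf (\<lambda>n. \<integral>\<^sup>+\<omega>. ennreal ((?f n \<omega>) ^ (2 * m)) \<partial>M)"
    by (intro nn_integral_liminf) measurable
  also have "\<dots> = ennreal (gaussian_moment m * ((norm (R h))\<^sup>2 * (LINT \<sigma>|lborel. (restr t \<psi> \<sigma> - g \<sigma>)\<^sup>2)) ^ m)"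
    unfolding riemann_diff_moment[OF t t'] by (intro lim_imp_Liminf tendsto_ennrealI tendsto_intros lc) auto
  finally show ?thesis .
qed

lemma wiener_integral_diff_moment:
  assumes "t \<ge> 0" "lip t \<psi> \<Lambda>" "t' \<ge> 0" "lip t' \<psi>' \<Lambda>'"
  shows "(\<integral>\<^sup>+\<omega>. ennreal ((wiener_integral t \<psi> h \<omega> - wiener_integral t' \<psi>' h \<omega>) ^ (2 * m)) \<partial>M)
    \<le> ennreal (gaussian_moment m * ((norm (R h))\<^sup>2 * (LINT \<sigma>|lborel. (restr t \<psi> \<sigma> - restr t' \<psi>' \<sigma>)\<^sup>2)) ^ m)"
  by (rule wiener_integral_moment_general[where \<nu> = "\<lambda>n. n", OF assms stepf_LIMSEQ[OF assms(3,4)] riemann_LIMSEQ[OF assms(3,4)]])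

lemma wiener_integral_riemann:
  assumes "t \<ge> 0" "lip t \<psi> \<Lambda>"
  shows "(\<integral>\<^sup>+\<omega>. ennreal ((wiener_integral t \<psi> h \<omega> - riemann t \<psi> h n \<omega>)\<^sup>2) \<partial>M)
    \<le> ennreal ((norm (R h))\<^sup>2 * (LINT \<sigma>|lborel. (restr t \<psi> \<sigma> - stepf t \<psi> n \<sigma>)\<^sup>2))"
  using wiener_integral_moment_general[where \<nu> = "\<lambda>_. n" and m = 1 and Z = "riemann t \<psi> h n" and h = h, OF assms assms tendsto_const]
  by (simp add: gaussian_moment_def)

end

subsection \<open>Faber-Schauder expansions\<close>

definition tent :: "real \<Rightarrow> real" where "tent y = max 0 (1 - \<bar>y - 1\<bar>)"

definition schauder :: "real \<Rightarrow> nat \<Rightarrow> nat \<Rightarrow> real \<Rightarrow> real" where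
  "schauder T n j t = tent (2 ^ n * t / T - 2 * real j)"

text \<open>For n >= 1 these are the hats whose support lies in [0,T]. For n = 0 the condition
  leaves j = 0, a hat with peak at \<open>T\<close> whose restriction to [0,T] is the linear
  function t/T; the constant function is absent because all processes start at 0.\<close>

definition level_index :: "nat \<Rightarrow> nat set" where "level_index n = {j. 2 * j < 2 ^ n}"

definition level :: "real \<Rightarrow> (nat \<Rightarrow> nat \<Rightarrow> 'a::real_normed_vector) \<Rightarrow> nat \<Rightarrow> real \<Rightarrow> 'a" where
  "level T c n t = (\<Sum>j\<in>level_index n. schauder T n j t *\<^sub>R c n j)"

definition faber :: "real \<Rightarrow> (nat \<Rightarrow> nat \<Rightarrow> 'a::real_normed_vector) \<Rightarrow> real \<Rightarrow> 'a" where
  "faber T c t = (\<Sum>n. level T c n t)"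

lemma finite_level_index [simp]: "finite (level_index n)"
  by (rule finite_subset[of _ "{..<2^n}"]) (auto simp: level_index_def)

lemma tent_bounds: "0 \<le> tent y" "tent y \<le> 1" by (auto simp: tent_def)

lemma tent_Lipschitz: "\<bar>tent x - tent y\<bar> \<le> \<bar>x - y\<bar>" by (auto simp: tent_def)

lemma tent_nonzero: "tent y \<noteq> 0 \<Longrightarrow> 0 < y \<and> y < 2" by (auto simp: tent_def abs_if split: if_splits)

lemma schauder_bounds: "0 \<le> schauder T n j t" "schauder T n j t \<le> 1"
  by (simp_all add: schauder_def tent_bounds)

lemma schauder_unique: "schauder T n j t \<noteq> 0 \<Longrightarrow> schauder T n j' t \<noteq> 0 \<Longrightarrow> j = j'"
proof -
  assume "schauder T n j t \<noteq> 0" "schauder T n j' t \<noteq> 0"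
  then have "2 * real j < 2 * real j' + 2" "2 * real j' < 2 * real j + 2"
    unfolding schauder_def by (auto dest!: tent_nonzero)
  then have "real j < real (j' + 1)" "real j' < real (j + 1)" by auto
  then show "j = j'" unfolding of_nat_less_iff by simp
qed

lemma schauder_Lipschitz:
  assumes "T > 0" shows "\<bar>schauder T n j t - schauder T n j t'\<bar> \<le> min 1 (2 ^ n * \<bar>t - t'\<bar> / T)"
proof -
  have "\<bar>schauder T n j t - schauder T n j t'\<bar> \<le> \<bar>(2 ^ n * t / T - 2 * real j) - (2 ^ n * t' / T - 2 * real j)\<bar>"
    unfolding schauder_def by (rule tent_Lipschitz)
  also have "\<dots> = \<bar>2 ^ n * (t - t') / T\<bar>" by (simp add: diff_divide_distrib right_diff_distrib)
  also have "\<dots> = 2 ^ n * \<bar>t - t'\<bar> / T" using assms by (simp add: abs_mult)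
  finally show ?thesis using schauder_bounds[of T n j t] schauder_bounds[of T n j t'] by auto
qed

text \<open>Supports within a level do not overlap, so at each of the two times at most one hat is
  nonzero. This gives the factor 2, independent of the number of coefficients.\<close>

lemma level_increment:
  assumes T: "T > 0" and c: "\<And>j. j \<in> level_index n \<Longrightarrow> norm (c n j) \<le> m" and m: "m \<ge> 0"
  shows "norm (level T c n t - level T c n t') \<le> 2 * m * min 1 (2 ^ n * \<bar>t - t'\<bar> / T)"
proof -
  define A where "A t = {j \<in> level_index n. schauder T n j t \<noteq> 0}" for t
  have cA: "card (A t) \<le> 1" for t
    using card_le_Suc0_iff_eq[of "A t"] schauder_unique by (auto simp: A_def)
  have cK: "card (A t \<union> A t') \<le> 2" using card_Un_le[of "A t" "A t'"] cA[of t] cA[of t'] by linarith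
  let ?d = "min 1 (2 ^ n * \<bar>t - t'\<bar> / T)"
  have d0: "0 \<le> ?d" using T by simp
  have "level T c n t - level T c n t' = (\<Sum>j\<in>level_index n. (schauder T n j t - schauder T n j t') *\<^sub>R c n j)"
    by (simp add: level_def sum_subtractf[symmetric] scaleR_left_diff_distrib)
  also have "\<dots> = (\<Sum>j\<in>A t \<union> A t'. (schauder T n j t - schauder T n j t') *\<^sub>R c n j)"
    by (rule sum.mono_neutral_right) (auto simp: A_def)
  also have "norm \<dots> \<le> (\<Sum>j\<in>A t \<union> A t'. ?d * m)"
  proof (rule sum_norm_le)
    fix j assume "j \<in> A t \<union> A t'"
    then have j: "j \<in> level_index n" by (auto simp: A_def)
    show "norm ((schauder T n j t - schauder T n j t') *\<^sub>R c n j) \<le> ?d * m"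
      unfolding norm_scaleR by (rule mult_mono[OF schauder_Lipschitz[OF T] c[OF j] d0]) simp
  qed
  also have "\<dots> = real (card (A t \<union> A t')) * (?d * m)" by simp
  also have "\<dots> \<le> 2 * (?d * m)" using cK d0 m by (intro mult_right_mono mult_nonneg_nonneg) auto
  finally show ?thesis by (simp add: mult_ac)
qed

lemma level_zero: "level T c n 0 = 0"
  by (auto simp: level_def schauder_def tent_def intro!: sum.neutral)

lemma level_le:
  assumes T: "T > 0" and c: "\<And>j. j \<in> level_index n \<Longrightarrow> norm (c n j) \<le> m" and m: "m \<ge> 0"
  shows "norm (level T c n t) \<le> 2 * m"
proof -
  have "norm (level T c n t - level T c n 0) \<le> 2 * m * min 1 (2 ^ n * \<bar>t - 0\<bar> / T)"
    by (rule level_increment[where c = c, OF T c m])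
  also have "\<dots> \<le> 2 * m * 1" using m by (intro mult_left_mono) auto
  finally show ?thesis by (simp add: level_zero)
qed

lemma min_le_powr: "0 \<le> x \<Longrightarrow> 0 < \<beta> \<Longrightarrow> \<beta> \<le> 1 \<Longrightarrow> min 1 x \<le> x powr \<beta>" for x \<beta> :: real
proof -
  assume x: "0 \<le> x" and \<beta>: "0 < \<beta>" "\<beta> \<le> 1"
  consider "x = 0" | "0 < x" "x \<le> 1" | "1 < x" using x by linarith
  then show ?thesis
  proof cases
    case 2
    then have "x powr 1 \<le> x powr \<beta>" using \<beta> by (intro powr_mono') auto
    then show ?thesis using 2 by simp
  next
    case 3
    then have "1 \<le> x powr \<beta>" using \<beta> by (intro ge_one_powr_ge_zero) auto
    then show ?thesis using 3 by simp
  qed (use \<beta> in auto)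
qed

text \<open>Level n contributes at most 2^(-b n) min(1, 2^n |t - t'|/T), and bounding the minimum by
  its second entry to the power \<beta> leaves a geometric series of ratio 2^(\<beta> - b).
  \<open>K\<close> does not depend on the coefficients, so for random coefficients the bound is
  pathwise.\<close>

lemma faber_bounds:
  assumes T: "T > 0" and \<beta>: "0 < \<beta>" "\<beta> \<le> 1" "\<beta> < b"
  shows "\<exists>K>0. \<forall>(c :: nat \<Rightarrow> nat \<Rightarrow> 'a::banach) \<zeta>. 0 \<le> \<zeta> \<longrightarrow> (\<forall>n. \<forall>j\<in>level_index n. norm (c n j) \<le> \<zeta> * 2 powr (- b * real n)) \<longrightarrow>
    (\<forall>t. summable (\<lambda>n. level T c n t) \<and> norm (faber T c t) \<le> K * \<zeta>) \<and>
    (\<forall>t t'. norm (faber T c t - faber T c t') \<le> K * \<zeta> * \<bar>t - t'\<bar> powr \<beta>)"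
proof -
  define q where "q = (2::real) powr (- b)"
  define r where "r = (2::real) powr (\<beta> - b)"
  have q: "0 < q" "q < 1" using \<beta> powr_less_mono[of "- b" 0 2] by (auto simp: q_def)
  have r: "0 < r" "r < 1" using \<beta> powr_less_mono[of "\<beta> - b" 0 2] by (auto simp: r_def)
  have qn: "2 powr (- b * real n) = q ^ n" for n by (simp add: q_def powr_powr flip: powr_realpow)
  define K where "K = 2 / (1 - q) + 2 * T powr (- \<beta>) / (1 - r)"
  have K1: "2 / (1 - q) \<le> K" "2 * T powr (- \<beta>) / (1 - r) \<le> K" "0 < K"
    using q r by (auto simp: K_def intro!: add_pos_nonneg)
  show ?thesis
  proof (intro exI[of _ K] conjI K1(3) allI impI)
    fix c :: "nat \<Rightarrow> nat \<Rightarrow> 'a" and \<zeta> :: real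
    assume \<zeta>: "0 \<le> \<zeta>" and c: "\<forall>n. \<forall>j\<in>level_index n. norm (c n j) \<le> \<zeta> * 2 powr (- b * real n)"
    have c': "norm (c n j) \<le> \<zeta> * q ^ n" if "j \<in> level_index n" for n j
      using c[rule_format, OF that] unfolding qn .
    have m: "0 \<le> \<zeta> * q ^ n" for n using \<zeta> q by simp
    have le: "norm (level T c n t) \<le> 2 * (\<zeta> * q ^ n)" for n t by (rule level_le[OF T c' m])
    have sq: "summable (\<lambda>n. 2 * (\<zeta> * q ^ n))" using q by (intro summable_mult summable_geometric) auto
    show sm: "summable (\<lambda>n. level T c n t)" for t
      by (rule summable_comparison_test'[OF sq, where N = 0]) (rule le)
    show "norm (faber T c t) \<le> K * \<zeta>" for t
    proof -
      have "norm (faber T c t) \<le> (\<Sum>n. 2 * (\<zeta> * q ^ n))"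
        unfolding faber_def by (rule norm_suminf_le[OF le sq])
      also have "\<dots> = 2 / (1 - q) * \<zeta>"
        using q by (simp add: suminf_mult suminf_geometric summable_geometric)
      also have "\<dots> \<le> K * \<zeta>" by (rule mult_right_mono[OF K1(1) \<zeta>])
      finally show ?thesis .
    qed
    show "norm (faber T c t - faber T c t') \<le> K * \<zeta> * \<bar>t - t'\<bar> powr \<beta>" for t t'
    proof -
      let ?a = "2 * (\<zeta> * T powr (- \<beta>) * \<bar>t - t'\<bar> powr \<beta>)"
      have le2: "norm (level T c n t - level T c n t') \<le> ?a * r ^ n" for n
      proof -
        have "norm (level T c n t - level T c n t') \<le> 2 * (\<zeta> * q ^ n) * min 1 (2 ^ n * \<bar>t - t'\<bar> / T)"
          by (rule level_increment[OF T c' m])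
        also have "\<dots> \<le> 2 * (\<zeta> * q ^ n) * (2 ^ n * \<bar>t - t'\<bar> / T) powr \<beta>"
          using T \<beta> m by (intro mult_left_mono min_le_powr) auto
        also have "(2 ^ n * \<bar>t - t'\<bar> / T) powr \<beta> = (2 powr \<beta>) ^ n * \<bar>t - t'\<bar> powr \<beta> * T powr (- \<beta>)"
        proof -
          have "((2::real) ^ n) powr \<beta> = (2 powr \<beta>) ^ n" by (simp add: powr_powr mult.commute flip: powr_realpow)
          then show ?thesis using T by (simp add: powr_divide powr_mult powr_minus_divide)
        qed
        also have "2 * (\<zeta> * q ^ n) * ((2 powr \<beta>) ^ n * \<bar>t - t'\<bar> powr \<beta> * T powr (- \<beta>)) = ?a * (q * 2 powr \<beta>) ^ n"
          by (simp add: power_mult_distrib mult_ac)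
        also have "q * 2 powr \<beta> = r" by (simp add: q_def r_def powr_add[symmetric])
        finally show ?thesis .
      qed
      have sr: "summable (\<lambda>n. ?a * r ^ n)" using r by (intro summable_mult summable_geometric) auto
      have "faber T c t - faber T c t' = (\<Sum>n. level T c n t - level T c n t')"
        unfolding faber_def by (rule suminf_diff[OF sm sm])
      also have "norm \<dots> \<le> (\<Sum>n. ?a * r ^ n)" by (rule norm_suminf_le[OF le2 sr])
      also have "\<dots> = ?a * (1 / (1 - r))" using r by (subst suminf_mult) (auto simp: suminf_geometric summable_geometric)
      also have "\<dots> = 2 * T powr (- \<beta>) / (1 - r) * (\<zeta> * \<bar>t - t'\<bar> powr \<beta>)" by simp
      also have "\<dots> \<le> K * (\<zeta> * \<bar>t - t'\<bar> powr \<beta>)" using \<zeta> by (intro mult_right_mono K1(2)) auto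
      finally show ?thesis by (simp add: mult.assoc)
    qed
  qed
qed

text \<open>The kinks of the hat in the rescaled variable are the integers 0, P and 2P, hence it is
  affine between consecutive integers.\<close>

lemma tent_midpoint:
  assumes P: "P > (0::int)"
  shows "tent ((of_int a + 1/2) / of_int P) = (tent (of_int a / of_int P) + tent ((of_int a + 1) / of_int P)) / 2"
proof -
  have P0: "(0::real) < of_int P" using P by simp
  have t: "tent (x / of_int P) = max 0 (of_int P - \<bar>x - of_int P\<bar>) / of_int P" for x
  proof -
    have "1 - \<bar>x / of_int P - 1\<bar> = (of_int P - \<bar>x - of_int P\<bar>) / of_int P"
    proof -
      have "x / of_int P - 1 = (x - of_int P) / of_int P" using P0 by (simp add: diff_divide_distrib)
      then have "\<bar>x / of_int P - 1\<bar> = \<bar>x - of_int P\<bar> / of_int P" using P0 by simp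
      then show ?thesis using P0 by (simp add: diff_divide_distrib)
    qed
    then show ?thesis using P0 by (simp add: tent_def max_def divide_le_0_iff zero_le_divide_iff)
  qed
  have "max 0 (of_int P - \<bar>of_int a + 1/2 - of_int P\<bar>)
      = (max 0 (of_int P - \<bar>of_int a - of_int P\<bar>) + max 0 (of_int P - \<bar>of_int a + 1 - of_int P :: real\<bar>)) / 2"
  proof -
    consider "a + 1 \<le> 0" | "0 \<le> a" "a + 1 \<le> P" | "P \<le> a" "a + 1 \<le> 2 * P" | "2 * P \<le> a" by linarith
    then show ?thesis
    proof cases
      case 1
      then have "of_int a + 1 \<le> (0::real)" by linarith
      then show ?thesis using P0 by (simp add: max_def abs_if)
    next
      case 2
      then have "(0::real) \<le> of_int a" "of_int a + 1 \<le> (of_int P::real)" by linarith+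
      then show ?thesis using P0 by (simp add: max_def abs_if)
    next
      case 3
      then have "(of_int P::real) \<le> of_int a" "of_int a + 1 \<le> (2 * of_int P::real)" by linarith+
      then show ?thesis using P0 by (simp add: max_def abs_if)
    next
      case 4
      then have "(2 * of_int P::real) \<le> of_int a" by linarith
      then show ?thesis using P0 by (simp add: max_def abs_if)
    qed
  qed
  then show ?thesis unfolding t by (simp add: add_divide_distrib)
qed

definition node :: "real \<Rightarrow> nat \<Rightarrow> nat \<Rightarrow> real" where "node T n i = T * real i / 2 ^ n"

text \<open>The second difference at an odd node. At level 0 the right neighbour is the time 2T;
  paths are extended by 0 beyond \<open>T\<close> and start at 0, so that this coefficient is the
  value at \<open>T\<close>.\<close>

definition coef :: "real \<Rightarrow> (real \<Rightarrow> 'a::real_normed_vector) \<Rightarrow> nat \<Rightarrow> nat \<Rightarrow> 'a" where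
  "coef T Y n j = Y (node T n (2 * j + 1)) - (1/2) *\<^sub>R Y (node T n (2 * j)) - (1/2) *\<^sub>R Y (node T n (2 * j + 2))"

lemma node_double: "node T (Suc n) (2 * i) = node T n i" by (simp add: node_def)

lemma node_refine: "n \<le> N \<Longrightarrow> node T n i = node T N (i * 2 ^ (N - n))"
proof -
  assume "n \<le> N"
  then have "(2::real) ^ N = 2 ^ n * 2 ^ (N - n)" by (simp flip: power_add)
  then show ?thesis by (simp add: node_def)
qed

lemma schauder_node: "T > 0 \<Longrightarrow> schauder T n j (node T n i) = (if i = 2 * j + 1 then 1 else 0)"
proof -
  assume "T > 0"
  then have t: "schauder T n j (node T n i) = tent (real i - 2 * real j)" by (simp add: schauder_def node_def)
  consider "i = 2 * j + 1" | "i \<le> 2 * j" | "i \<ge> 2 * j + 2" by linarith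
  then show ?thesis
  proof cases
    case 1
    then show ?thesis unfolding t by (simp add: tent_def)
  next
    case 2
    then have "real i - 2 * real j \<le> 0" by linarith
    then have "tent (real i - 2 * real j) = 0" by (simp add: tent_def)
    then show ?thesis unfolding t using 2 by simp
  next
    case 3
    then have "real i - 2 * real j \<ge> 2" by linarith
    then have "tent (real i - 2 * real j) = 0" by (simp add: tent_def)
    then show ?thesis unfolding t using 3 by simp
  qed
qed

lemma schauder_midpoint:
  assumes T: "T > 0" and m: "m \<le> n"
  shows "schauder T m j (node T (Suc n) (2 * i + 1)) = (schauder T m j (node T n i) + schauder T m j (node T n (Suc i))) / 2"
proof -
  let ?P = "2 ^ (n - m) :: int"
  let ?a = "int i - 2 * int j * ?P"
  have n: "(2::real) ^ n = 2 ^ m * 2 ^ (n - m)" using m by (simp flip: power_add)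
  have 1: "2 ^ m * node T n i / T - 2 * real j = of_int ?a / of_int ?P"
    "2 ^ m * node T n (Suc i) / T - 2 * real j = (of_int ?a + 1) / of_int ?P"
    "2 ^ m * node T (Suc n) (2 * i + 1) / T - 2 * real j = (of_int ?a + 1/2) / of_int ?P"
    using T by (simp_all add: node_def n field_simps)
  show ?thesis unfolding schauder_def 1 by (rule tent_midpoint) simp
qed

text \<open>Nodes with even index come from the previous level, and the new hats vanish there. At an
  odd node the coarser levels are affine between its neighbours, so they produce the mean of the two
  values, which the new coefficient corrects to the right value.\<close>

lemma partial_sum_node:
  assumes T: "T > 0" and Y0: "Y 0 = 0" and YT: "\<And>t. t > T \<Longrightarrow> Y t = 0" and i: "i \<le> 2 ^ n"
  shows "(\<Sum>m\<le>n. level T (coef T Y) m (node T n i)) = Y (node T n i)"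
  using i
proof (induction n arbitrary: i)
  case 0
  have L: "level_index 0 = {0}" by (auto simp: level_index_def)
  have n: "node T 0 0 = 0" "node T 0 1 = T" "node T 0 2 = 2 * T" by (simp_all add: node_def)
  have "Y (2 * T) = 0" using T by (intro YT) simp
  then have "coef T Y 0 0 = Y T" using Y0 n by (simp add: coef_def numeral_2_eq_2)
  then have "level T (coef T Y) 0 (node T 0 i) = (if i = 1 then Y T else 0)"
    unfolding level_def L by (simp add: schauder_node[OF T])
  moreover have "i = 0 \<or> i = 1" using 0 by auto
  ultimately show ?case using n Y0 by auto
next
  case (Suc n)
  have lev: "level T (coef T Y) (Suc n) (node T (Suc n) i)
      = (if odd i then coef T Y (Suc n) (i div 2) else 0)"
  proof (cases "odd i")
    case True
    then obtain j where j: "i = 2 * j + 1" by (auto elim: oddE)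
    have "j \<in> level_index (Suc n)" using Suc.prems j by (simp add: level_index_def)
    then have "level T (coef T Y) (Suc n) (node T (Suc n) i) = (\<Sum>j'\<in>{j}. coef T Y (Suc n) j')"
      unfolding level_def by (intro sum.mono_neutral_cong_right) (auto simp: schauder_node[OF T] j)
    then show ?thesis using j by simp
  next
    case False
    then show ?thesis unfolding level_def by (auto simp: schauder_node[OF T] intro!: sum.neutral)
  qed
  show ?case
  proof (cases "odd i")
    case False
    then obtain i' where i': "i = 2 * i'" by (auto elim: evenE)
    have "i' \<le> 2 ^ n" using Suc.prems i' by simp
    from Suc.IH[OF this] show ?thesis using lev False unfolding i' node_double by simp
  next
    case True
    then obtain j where j: "i = 2 * j + 1" by (auto elim: oddE)
    have j2: "Suc j \<le> 2 ^ n" using Suc.prems j by simp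
    have "level T c m (node T (Suc n) i) = (1/2) *\<^sub>R level T c m (node T n j) + (1/2) *\<^sub>R level T c m (node T n (Suc j))"
      if "m \<le> n" for m and c :: "nat \<Rightarrow> nat \<Rightarrow> 'a"
      unfolding level_def j schauder_midpoint[OF T that]
      by (simp add: scaleR_sum_right sum.distrib[symmetric] add_divide_distrib scaleR_add_left)
    then have "(\<Sum>m\<le>n. level T (coef T Y) m (node T (Suc n) i))
        = (\<Sum>m\<le>n. (1/2) *\<^sub>R level T (coef T Y) m (node T n j) + (1/2) *\<^sub>R level T (coef T Y) m (node T n (Suc j)))"
      by (intro sum.cong) auto
    also have "\<dots> = (1/2) *\<^sub>R (\<Sum>m\<le>n. level T (coef T Y) m (node T n j)) + (1/2) *\<^sub>R (\<Sum>m\<le>n. level T (coef T Y) m (node T n (Suc j)))"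
      by (simp add: sum.distrib scaleR_sum_right)
    also have "\<dots> = (1/2) *\<^sub>R Y (node T n j) + (1/2) *\<^sub>R Y (node T n (Suc j))"
      using Suc.IH[of j] Suc.IH[OF j2] j2 by simp
    finally have "(\<Sum>m\<le>Suc n. level T (coef T Y) m (node T (Suc n) i))
        = (1/2) *\<^sub>R Y (node T n j) + (1/2) *\<^sub>R Y (node T n (Suc j)) + coef T Y (Suc n) j"
      using lev True j by simp
    also have "\<dots> = Y (node T (Suc n) i)"
    proof -
      have "node T (Suc n) (2 * j + 2) = node T n (Suc j)" using node_double[of T n "Suc j"] by simp
      then show ?thesis by (simp add: coef_def node_double j)
    qed
    finally show ?thesis .
  qed
qed

lemma faber_node:
  assumes T: "T > 0" and Y0: "Y 0 = 0" and YT: "\<And>t. t > T \<Longrightarrow> Y t = 0" and i: "i \<le> 2 ^ n"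
  shows "faber T (coef T Y) (node T n i) = Y (node T n i)"
proof -
  have "(\<Sum>m\<le>N. level T (coef T Y) m (node T n i)) = Y (node T n i)" if "N \<ge> n" for N
  proof -
    have "i * 2 ^ (N - n) \<le> 2 ^ n * 2 ^ (N - n)" using i by simp
    then have "i * 2 ^ (N - n) \<le> 2 ^ N" using that by (simp flip: power_add)
    from partial_sum_node[of T Y, OF T Y0 YT this] show ?thesis by (simp add: node_refine[OF that])
  qed
  then have "(\<lambda>N. \<Sum>m\<le>N. level T (coef T Y) m (node T n i)) \<longlonglongrightarrow> Y (node T n i)"
    by (intro tendsto_eventually eventually_sequentiallyI[of n]) auto
  then have "(\<lambda>m. level T (coef T Y) m (node T n i)) sums Y (node T n i)" by (simp add: sums_def_le)
  then show ?thesis unfolding faber_def by (rule sums_unique[symmetric])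
qed

subsection \<open>The stochastic convolution\<close>

lemma suminf_commute_ennreal: "(\<Sum>j. \<Sum>k. f j k) = (\<Sum>k. \<Sum>j. f j k :: ennreal)"
proof -
  have "(\<Sum>j. \<Sum>k. f j k) = (\<integral>\<^sup>+j. (\<Sum>k. f j k) \<partial>count_space UNIV)" by (rule nn_integral_count_space_nat[symmetric])
  also have "\<dots> = (\<Sum>k. \<integral>\<^sup>+j. f j k \<partial>count_space UNIV)" by (rule nn_integral_suminf) simp
  also have "\<dots> = (\<Sum>k. \<Sum>j. f j k)" by (simp only: nn_integral_count_space_nat)
  finally show ?thesis .
qed

text \<open>Jensen's inequality for the m-th power with weights a i divided by their sum.
  Unnormalised weights make the later bound depend on their sum and not on the number of
  terms.\<close>

lemma power_mean_weighted:
  fixes a z :: "'i \<Rightarrow> real"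
  assumes S: "finite S" and a: "\<And>i. i \<in> S \<Longrightarrow> 0 < a i" and z: "\<And>i. i \<in> S \<Longrightarrow> 0 \<le> z i" and m: "m \<ge> 1"
  shows "(\<Sum>i\<in>S. a i * z i) ^ m \<le> (\<Sum>i\<in>S. a i) ^ (m - 1) * (\<Sum>i\<in>S. a i * z i ^ m)"
proof (cases "S = {}")
  case False
  define s where "s = (\<Sum>i\<in>S. a i)"
  have s: "s > 0" unfolding s_def by (rule sum_pos[OF S False a])
  have cvx: "convex_on {0::real..} (\<lambda>x. x ^ m)"
  proof (cases "even m")
    case True
    show ?thesis by (rule convex_on_subset[OF convex_power_even[OF True]]) auto
  qed (rule convex_power_odd)
  have "(\<Sum>i\<in>S. (a i / s) *\<^sub>R z i) ^ m \<le> (\<Sum>i\<in>S. (a i / s) * z i ^ m)"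
  proof (rule convex_on_sum[OF S False cvx])
    show "(\<Sum>i\<in>S. a i / s) = 1" using s by (simp add: sum_divide_distrib[symmetric] s_def[symmetric])
    show "0 \<le> a i / s" if "i \<in> S" for i using a[OF that] s by simp
    show "z i \<in> {0..}" if "i \<in> S" for i using z[OF that] by simp
  qed
  also have "(\<Sum>i\<in>S. (a i / s) *\<^sub>R z i) = (\<Sum>i\<in>S. a i * z i) / s" by (simp add: sum_divide_distrib)
  also have "(\<Sum>i\<in>S. (a i / s) * z i ^ m) = (\<Sum>i\<in>S. a i * z i ^ m) / s" by (simp add: sum_divide_distrib)
  finally have "(\<Sum>i\<in>S. a i * z i) ^ m / s ^ m \<le> (\<Sum>i\<in>S. a i * z i ^ m) / s" by (simp only: power_divide)
  then have "(\<Sum>i\<in>S. a i * z i) ^ m / s ^ m * s ^ m \<le> (\<Sum>i\<in>S. a i * z i ^ m) / s * s ^ m"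
    using s by (intro mult_right_mono) auto
  moreover have "s ^ m = s * s ^ (m - 1)" using m by (simp flip: power_Suc)
  ultimately show ?thesis using s by (simp add: s_def[symmetric] mult.commute)
qed (use m in \<open>simp add: power_0_left\<close>)

text \<open>\<open>B\<close> is uniform over the modes, the Lipschitz constants may depend on the
  mode. The first is combined with the finite trace \<open>tr\<close> to sum over modes, the second
  serves limits within one mode.\<close>

locale stochastic_conv = wiener M e F Q R W + onb_weights e lam
  for M :: "'w measure" and e :: "nat \<Rightarrow> 'h::{real_inner,banach,second_countable_topology}"
    and F :: "real \<Rightarrow> 'w measure" and Q R :: "'h \<Rightarrow> 'h" and W :: "real \<Rightarrow> 'w \<Rightarrow> 'h" and lam :: "nat \<Rightarrow> real" +
  fixes u :: "nat \<Rightarrow> real \<Rightarrow> real" and T B :: real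
  assumes T: "T > 0" and B: "B \<ge> 0" and ub: "\<And>k x. x \<in> {0..T} \<Longrightarrow> \<bar>u k x\<bar> \<le> B"
    and ul: "\<And>k. \<exists>\<Lambda>\<ge>0. \<forall>x\<in>{0..T}. \<forall>y\<in>{0..T}. \<bar>u k x - u k y\<bar> \<le> \<Lambda> * \<bar>x - y\<bar>"
    and tr: "summable (\<lambda>k. (norm (R (e k)))\<^sup>2)"
begin

definition psi :: "nat \<Rightarrow> real \<Rightarrow> real \<Rightarrow> real" where "psi k t \<sigma> = u k (t - \<sigma>)"
definition comp :: "nat \<Rightarrow> real \<Rightarrow> 'w \<Rightarrow> real" where "comp k t \<omega> = wiener_integral t (psi k t) (e k) \<omega>"
text \<open>An explicit representative of the convolution. All estimates are made for it; that it is
  a stochastic integral and hence agrees almost surely with the chosen one is shown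
  afterwards.\<close>

definition X :: "real \<Rightarrow> 'w \<Rightarrow> 'h" where "X t \<omega> = (\<Sum>k. comp k t \<omega> *\<^sub>R e k)"
text \<open>Equal to the inner product of Q e_k with e_k, the diagonal of the covariance. Different
  modes may be correlated, since Q need not commute with A.\<close>

definition q :: "nat \<Rightarrow> real" where "q k = (norm (R (e k)))\<^sup>2"
definition var :: "nat \<Rightarrow> real \<Rightarrow> real \<Rightarrow> real" where
  "var k t t' = (LINT \<sigma>|lborel. (restr t (psi k t) \<sigma> - restr t' (psi k t') \<sigma>)\<^sup>2)"

lemma psi_lip: "t \<in> {0..T} \<Longrightarrow> \<exists>\<Lambda>. lip t (psi k t) \<Lambda>"
proof -
  assume t: "t \<in> {0..T}"
  obtain \<Lambda> where \<Lambda>: "\<Lambda> \<ge> 0" "\<forall>x\<in>{0..T}. \<forall>y\<in>{0..T}. \<bar>u k x - u k y\<bar> \<le> \<Lambda> * \<bar>x - y\<bar>" using ul by blast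
  have "\<bar>psi k t x - psi k t y\<bar> \<le> \<Lambda> * \<bar>x - y\<bar>" if "x \<in> {0..t}" "y \<in> {0..t}" for x y
  proof -
    have "\<bar>u k (t - x) - u k (t - y)\<bar> \<le> \<Lambda> * \<bar>(t - x) - (t - y)\<bar>"
      by (rule \<Lambda>(2)[rule_format]) (use t that in auto)
    then show ?thesis by (simp add: psi_def abs_minus_commute)
  qed
  with \<Lambda>(1) show ?thesis by (auto simp: lip_def)
qed

lemma q_nonneg: "q k \<ge> 0" by (simp add: q_def)

lemma comp_zero [simp]: "comp k 0 \<omega> = 0" by (simp add: comp_def wiener_integral_zero)

lemma X_zero [simp]: "X 0 \<omega> = 0" by (simp add: X_def)

lemma comp_measurable: "t \<ge> 0 \<Longrightarrow> comp k t \<in> borel_measurable M"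
  unfolding comp_def[abs_def] by (rule wiener_integral_measurable)

lemma X_measurable: "t \<ge> 0 \<Longrightarrow> X t \<in> borel_measurable M"
proof -
  assume "t \<ge> 0"
  note [measurable] = comp_measurable[OF this]
  show ?thesis unfolding X_def[abs_def] suminf_eq_lim
    by (rule borel_measurable_lim_metric) measurable
qed

lemma comp_moment:
  assumes "t \<in> {0..T}" "t' \<in> {0..T}"
  shows "(\<integral>\<^sup>+\<omega>. ennreal ((comp k t \<omega> - comp k t' \<omega>) ^ (2 * m)) \<partial>M) \<le> ennreal (gaussian_moment m * (q k * var k t t') ^ m)"
proof -
  obtain \<Lambda> \<Lambda>' where "lip t (psi k t) \<Lambda>" "lip t' (psi k t') \<Lambda>'" using psi_lip assms by blast
  then show ?thesis unfolding comp_def q_def var_def using assms by (intro wiener_integral_diff_moment) auto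
qed

lemma restr_le: "t \<in> {0..T} \<Longrightarrow> \<bar>restr t (psi k t) \<sigma>\<bar> \<le> B * indicator {0<..t} \<sigma>"
  by (cases "\<sigma> \<in> {0<..t}") (auto simp: restr_def psi_def intro!: ub)

lemma stepf_le:
  assumes t: "t \<in> {0..T}" shows "\<bar>stepf t (psi k t) n \<sigma>\<bar> \<le> B * indicator {0<..t} \<sigma>"
proof -
  have t0: "t \<ge> 0" using t by simp
  have "\<bar>stepf t (psi k t) n \<sigma>\<bar> \<le> (\<Sum>i<2^n. \<bar>psi k t (grid t n i) * indicator {grid t n i<..grid t n (Suc i)} \<sigma>\<bar>)"
    unfolding stepf_def by (rule sum_abs)
  also have "\<dots> \<le> (\<Sum>i<2^n. B * indicator {grid t n i<..grid t n (Suc i)} \<sigma>)"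
  proof (rule sum_mono)
    fix i :: nat assume "i \<in> {..<2^n}"
    then have "t - grid t n i \<in> {0..T}" using grid_facts(1)[OF t0, of n i] grid_facts(3)[OF t0, of i n] t by auto
    then have "\<bar>psi k t (grid t n i)\<bar> \<le> B" unfolding psi_def by (rule ub)
    then show "\<bar>psi k t (grid t n i) * indicator {grid t n i<..grid t n (Suc i)} \<sigma>\<bar> \<le> B * indicator {grid t n i<..grid t n (Suc i)} \<sigma>"
      by (simp add: abs_mult mult_right_mono)
  qed
  also have "\<dots> = B * indicator {0<..t} \<sigma>" by (simp only: sum_distrib_left[symmetric] stepf_cells[OF t0])
  finally show ?thesis .
qed

lemma var_zero_le:
  assumes t: "t \<in> {0..T}" shows "var k t 0 \<le> B\<^sup>2 * T"
proof -
  have le: "(restr t (psi k t) \<sigma> - restr 0 (psi k 0) \<sigma>)\<^sup>2 \<le> B\<^sup>2 * indicator {0<..t} \<sigma>" for \<sigma>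
  proof -
    have "restr 0 (psi k 0) \<sigma> = 0" by (simp add: restr_def)
    moreover have "(restr t (psi k t) \<sigma>)\<^sup>2 \<le> (B * indicator {0<..t} \<sigma>)\<^sup>2"
      using power_mono[OF restr_le[OF t] abs_ge_zero, of k \<sigma> 2] by simp
    ultimately show ?thesis by (cases "\<sigma> \<in> {0<..t}") auto
  qed
  have "var k t 0 \<le> (LINT \<sigma>|lborel. B\<^sup>2 * indicator {0<..t} \<sigma>)" unfolding var_def
    by (rule integral_mono'[OF _ le]) (use t in \<open>auto intro!: integrable_mult_right\<close>)
  also have "\<dots> = B\<^sup>2 * t" using t by simp
  also have "\<dots> \<le> B\<^sup>2 * T" using t by (intro mult_left_mono) auto
  finally show ?thesis .
qed

lemma var_nonneg: "0 \<le> var k t t'" by (simp add: var_def)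

lemma AE_summable_comp:
  assumes t: "t \<in> {0..T}" shows "AE \<omega> in M. summable (\<lambda>k. (comp k t \<omega>)\<^sup>2)"
proof -
  note [measurable] = comp_measurable[of t]
  have t0: "0 \<le> t" using t by simp
  have m: "(\<lambda>\<omega>. ennreal ((comp k t \<omega>)\<^sup>2)) \<in> borel_measurable M" for k using comp_measurable[OF t0, of k] by measurable
  have "(\<integral>\<^sup>+\<omega>. (\<Sum>k. ennreal ((comp k t \<omega>)\<^sup>2)) \<partial>M) = (\<Sum>k. \<integral>\<^sup>+\<omega>. ennreal ((comp k t \<omega>)\<^sup>2) \<partial>M)"
    by (rule nn_integral_suminf[OF m])
  also have "\<dots> \<le> (\<Sum>k. ennreal (q k * (B\<^sup>2 * T)))"
  proof (intro suminf_le allI)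
    fix k
    have "(\<integral>\<^sup>+\<omega>. ennreal ((comp k t \<omega>)\<^sup>2) \<partial>M) \<le> ennreal (q k * var k t 0)"
      using comp_moment[OF t, of 0 k 1] T by (simp add: gaussian_moment_def)
    also have "\<dots> \<le> ennreal (q k * (B\<^sup>2 * T))"
      by (intro ennreal_leI mult_left_mono var_zero_le[OF t] q_nonneg)
    finally show "(\<integral>\<^sup>+\<omega>. ennreal ((comp k t \<omega>)\<^sup>2) \<partial>M) \<le> ennreal (q k * (B\<^sup>2 * T))" .
  qed auto
  also have "\<dots> < \<top>"
  proof -
    have "summable (\<lambda>k. q k * (B\<^sup>2 * T))" using tr by (intro summable_mult2) (simp add: q_def)
    then have "(\<Sum>k. ennreal (q k * (B\<^sup>2 * T))) \<noteq> \<top>" using q_nonneg T by (intro ennreal_suminf_neq_top) auto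
    then show ?thesis by (simp add: less_top)
  qed
  finally have "AE \<omega> in M. (\<Sum>k. ennreal ((comp k t \<omega>)\<^sup>2)) \<noteq> \<infinity>"
    by (intro nn_integral_PInf_AE borel_measurable_suminf_order m) simp
  then show ?thesis by eventually_elim (auto intro!: summable_suminf_not_top)
qed

lemma AE_X_inner:
  assumes t: "t \<in> {0..T}" shows "AE \<omega> in M. \<forall>k. X t \<omega> \<bullet> e k = comp k t \<omega>"
  using AE_summable_comp[OF t] by eventually_elim (auto simp: X_def intro!: suminf_e_inner)

lemma resolvent_summable:
  assumes x: "x \<in> {0..T}" shows "summable (\<lambda>k. (u k x * (v \<bullet> e k))\<^sup>2)"
proof (rule summable_comparison_test'[where N = 0 and g = "\<lambda>k. B\<^sup>2 * (v \<bullet> e k)\<^sup>2"])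
  show "summable (\<lambda>k. B\<^sup>2 * (v \<bullet> e k)\<^sup>2)" by (intro summable_mult summable_inner_sq)
  fix k
  have "(u k x)\<^sup>2 \<le> B\<^sup>2" using power_mono[OF ub[OF x] abs_ge_zero, of k 2] by simp
  then show "norm ((u k x * (v \<bullet> e k))\<^sup>2) \<le> B\<^sup>2 * (v \<bullet> e k)\<^sup>2"
    by (simp add: power_mult_distrib mult_right_mono)
qed

lemma resolvent_inner: "x \<in> {0..T} \<Longrightarrow> resolvent_family e u x v \<bullet> e k = u k x * (v \<bullet> e k)"
  unfolding resolvent_family_def by (rule suminf_e_inner[OF resolvent_summable])

lemma resolvent_bounded_linear:
  assumes x: "x \<in> {0..T}" shows "bounded_linear (resolvent_family e u x)"
proof (rule bounded_linear_intro[where K = B])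
  show "resolvent_family e u x (v + w) = resolvent_family e u x v + resolvent_family e u x w" for v w
    by (rule e_eqI) (simp add: resolvent_inner[OF x] inner_add_left distrib_left)
  show "resolvent_family e u x (c *\<^sub>R v) = c *\<^sub>R resolvent_family e u x v" for c v
    by (rule e_eqI) (simp add: resolvent_inner[OF x])
  fix v
  have "(norm (resolvent_family e u x v))\<^sup>2 \<le> B\<^sup>2 * (norm v)\<^sup>2"
  proof (rule sums_le[OF _ parseval sums_mult[OF parseval]])
    fix k
    have "(u k x)\<^sup>2 \<le> B\<^sup>2" using power_mono[OF ub[OF x] abs_ge_zero, of k 2] by simp
    then show "(resolvent_family e u x v \<bullet> e k)\<^sup>2 \<le> B\<^sup>2 * (v \<bullet> e k)\<^sup>2"
      by (simp add: resolvent_inner[OF x] power_mult_distrib mult_right_mono)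
  qed
  then have "(norm (resolvent_family e u x v))\<^sup>2 \<le> (norm v * B)\<^sup>2" by (simp add: power_mult_distrib mult.commute)
  then show "norm (resolvent_family e u x v) \<le> norm v * B" by (rule power2_le_imp_le) (use B in simp)
qed

definition appr :: "real \<Rightarrow> nat \<Rightarrow> nat \<Rightarrow> 'w \<Rightarrow> 'h \<Rightarrow> 'h" where
  "appr t m i \<omega> = resolvent_family e u (t - grid t m i)"

definition err :: "real \<Rightarrow> nat \<Rightarrow> nat \<Rightarrow> real" where
  "err t m k = (LINT \<sigma>|lborel. (restr t (psi k t) \<sigma> - stepf t (psi k t) m \<sigma>)\<^sup>2)"

lemma grid_T: "t \<in> {0..T} \<Longrightarrow> i < 2 ^ m \<Longrightarrow> t - grid t m i \<in> {0..T}"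
  using grid_facts(1)[of t m i] grid_facts(3)[of t i m] by auto

lemma elementary_data_appr:
  assumes t: "t \<in> {0..T}" shows "elementary_data M F t (2 ^ m) (grid t m) (appr t m)"
  unfolding elementary_data_def
  using grid_facts[of t m] t resolvent_bounded_linear[OF grid_T[OF t]] by (auto simp: appr_def[abs_def])

lemma appr_integral_inner:
  assumes t: "t \<in> {0..T}"
  shows "elementary_integral W (2 ^ m) (grid t m) (appr t m) \<omega> \<bullet> e k = riemann t (psi k t) (e k) m \<omega>"
  unfolding elementary_integral_def riemann_def inner_sum_left appr_def
  by (intro sum.cong refl) (simp add: resolvent_inner[OF grid_T[OF t]] psi_def)

lemma appr_process_inner:
  assumes t: "t \<in> {0..T}"
  shows "elementary_process (2 ^ m) (grid t m) (appr t m) \<sigma> \<omega> v \<bullet> e k = stepf t (psi k t) m \<sigma> * (v \<bullet> e k)"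
proof -
  have "elementary_process (2 ^ m) (grid t m) (appr t m) \<sigma> \<omega> v \<bullet> e k
      = (\<Sum>i<2^m. indicator {grid t m i<..grid t m (Suc i)} \<sigma> * (appr t m i \<omega> v \<bullet> e k))"
    unfolding elementary_process_def inner_sum_left inner_scaleR_left ..
  also have "\<dots> = (\<Sum>i<2^m. psi k t (grid t m i) * indicator {grid t m i<..grid t m (Suc i)} \<sigma> * (v \<bullet> e k))"
  proof (intro sum.cong refl)
    fix i :: nat assume "i \<in> {..<2^m}"
    then have "appr t m i \<omega> v \<bullet> e k = psi k t (grid t m i) * (v \<bullet> e k)"
      using resolvent_inner[OF grid_T[OF t]] by (simp add: appr_def psi_def)
    then show "indicator {grid t m i<..grid t m (Suc i)} \<sigma> * (appr t m i \<omega> v \<bullet> e k)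
        = psi k t (grid t m i) * indicator {grid t m i<..grid t m (Suc i)} \<sigma> * (v \<bullet> e k)" by (simp only: mult_ac)
  qed
  also have "\<dots> = stepf t (psi k t) m \<sigma> * (v \<bullet> e k)" unfolding stepf_def sum_distrib_right ..
  finally show ?thesis .
qed

lemma err_sq_le:
  assumes t: "t \<in> {0..T}"
  shows "(restr t (psi k t) \<sigma> - stepf t (psi k t) m \<sigma>)\<^sup>2 \<le> (2 * B)\<^sup>2 * indicator {0<..t} \<sigma>"
proof -
  have "\<bar>restr t (psi k t) \<sigma> - stepf t (psi k t) m \<sigma>\<bar> \<le> 2 * B * indicator {0<..t} \<sigma>"
    using restr_le[OF t, of k \<sigma>] stepf_le[OF t, of k m \<sigma>] by linarith
  from power_mono[OF this abs_ge_zero, of 2] show ?thesis by (cases "\<sigma> \<in> {0<..t}") auto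
qed

lemma err_integrable:
  assumes t: "t \<in> {0..T}"
  shows "integrable lborel (\<lambda>\<sigma>. (restr t (psi k t) \<sigma> - stepf t (psi k t) m \<sigma>)\<^sup>2)"
proof (rule Bochner_Integration.integrable_bound)
  show "integrable lborel (\<lambda>\<sigma>. (2 * B)\<^sup>2 * indicator {0<..t} \<sigma> :: real)" using t by (intro integrable_mult_right) auto
  obtain \<Lambda> where "lip t (psi k t) \<Lambda>" using psi_lip[OF t] by blast
  then have [measurable]: "restr t (psi k t) \<in> borel_measurable borel" using t by (intro restr_measurable) auto
  show "(\<lambda>\<sigma>. (restr t (psi k t) \<sigma> - stepf t (psi k t) m \<sigma>)\<^sup>2) \<in> borel_measurable lborel" by measurable
  show "AE \<sigma> in lborel. norm ((restr t (psi k t) \<sigma> - stepf t (psi k t) m \<sigma>)\<^sup>2) \<le> norm ((2 * B)\<^sup>2 * indicator {0<..t} \<sigma> :: real)"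
    using err_sq_le[OF t, of k _ m] by (intro AE_I2) simp
qed

text \<open>In each mode the error is O(4^-m) with a constant depending on the mode. The bound
  (2B)^2 T is uniform and becomes summable against \<open>q\<close> by the finite trace, so
  dominated convergence for series applies.\<close>

lemma err_total_tendsto:
  assumes t: "t \<in> {0..T}"
  shows "(\<lambda>m. \<Sum>k. ennreal (q k * err t m k)) \<longlonglongrightarrow> 0"
proof -
  have e0: "0 \<le> err t m k" for m k by (simp add: err_def)
  have eB: "err t m k \<le> (2 * B)\<^sup>2 * T" for m k
  proof -
    have "err t m k \<le> (LINT \<sigma>|lborel. (2 * B)\<^sup>2 * indicator {0<..t} \<sigma>)" unfolding err_def
      by (rule integral_mono'[OF _ err_sq_le[OF t]]) (use t in \<open>auto intro!: integrable_mult_right\<close>)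
    also have "\<dots> = (2 * B)\<^sup>2 * t" using t by simp
    also have "\<dots> \<le> (2 * B)\<^sup>2 * T" using t by (intro mult_left_mono) auto
    finally show ?thesis .
  qed
  have lim: "(\<lambda>m. q k * err t m k) \<longlonglongrightarrow> q k * 0" for k
  proof (rule tendsto_mult_left)
    obtain \<Lambda> where l: "lip t (psi k t) \<Lambda>" using psi_lip[OF t] by blast
    have t0: "t \<ge> 0" using t by simp
    have errle: "err t m k \<le> (\<Lambda> * t)\<^sup>2 * t * (1/4) ^ m" for m
    proof -
      have le: "(restr t (psi k t) \<sigma> - stepf t (psi k t) m \<sigma>)\<^sup>2 \<le> (\<Lambda> * t / 2 ^ m)\<^sup>2 * indicator {0<..t} \<sigma>" for \<sigma>
        using power_mono[OF stepf_restr[OF t0 l, of m \<sigma>] abs_ge_zero, of 2]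
        by (cases "\<sigma> \<in> {0<..t}") (auto simp: power2_commute)
      have "err t m k \<le> (LINT \<sigma>|lborel. (\<Lambda> * t / 2 ^ m)\<^sup>2 * indicator {0<..t} \<sigma>)" unfolding err_def
        by (rule integral_mono'[OF _ le]) (use t in \<open>auto intro!: integrable_mult_right\<close>)
      also have "\<dots> = (\<Lambda> * t / 2 ^ m)\<^sup>2 * t" using t by simp
      also have "\<dots> = (\<Lambda> * t)\<^sup>2 * t * (1/4) ^ m"
        by (simp add: power_divide power_mult[symmetric] mult.commute power2_eq_square flip: power_mult_distrib)
      finally show ?thesis .
    qed
    have lim0: "(\<lambda>m. (\<Lambda> * t)\<^sup>2 * t * (1/4::real) ^ m) \<longlonglongrightarrow> 0"
      by (intro tendsto_mult_right_zero LIMSEQ_power_zero) auto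
    show "(\<lambda>m. err t m k) \<longlonglongrightarrow> 0"
      by (rule tendsto_sandwich[OF always_eventually[OF allI[OF e0]] always_eventually[OF allI[OF errle]] tendsto_const lim0])
  qed
  have sq: "summable (\<lambda>k. q k * ((2 * B)\<^sup>2 * T))" using tr by (intro summable_mult2) (simp add: q_def)
  have le: "q k * err t m k \<le> q k * ((2 * B)\<^sup>2 * T)" for k m by (rule mult_left_mono[OF eB q_nonneg])
  have bd: "\<forall>\<^sub>F (k, m) in sequentially \<times>\<^sub>F sequentially. norm (q k * err t m k) \<le> q k * ((2 * B)\<^sup>2 * T)"
  proof (rule always_eventually, rule allI)
    fix x :: "nat \<times> nat"
    show "case x of (k, m) \<Rightarrow> norm (q k * err t m k) \<le> q k * ((2 * B)\<^sup>2 * T)"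
      using le[of "fst x" "snd x"] e0[of "snd x" "fst x"] q_nonneg[of "fst x"]
      by (simp only: case_prod_beta' real_norm_def abs_mult abs_of_nonneg)
  qed
  have "(\<lambda>m. \<Sum>k. q k * err t m k) \<longlonglongrightarrow> (\<Sum>k. q k * 0)"
    by (rule tannerys_theorem[OF lim bd sq, THEN conjunct2, THEN conjunct2]) simp
  then have "(\<lambda>m. ennreal (\<Sum>k. q k * err t m k)) \<longlonglongrightarrow> ennreal 0" by (intro tendsto_ennrealI) simp
  moreover have "(\<Sum>k. ennreal (q k * err t m k)) = ennreal (\<Sum>k. q k * err t m k)" for m
    using e0 q_nonneg le by (intro suminf_ennreal2 summable_comparison_test'[OF sq, where N = 0]) auto
  ultimately show ?thesis by simp
qed

text \<open>Both processes are diagonal in the basis. Exchanging the double sum and using the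
  symmetry of R collects the squares of the coordinates of R e_k into \<open>q k\<close>. At
  \<sigma> = 0 the identity may fail, because the half open cut off vanishes there.\<close>

lemma hs_error:
  assumes t: "t \<in> {0..T}" and s: "\<sigma> \<in> {0<..t}"
  shows "hs_norm2 e (\<lambda>v. resolvent_family e u (t - \<sigma>) (R v) - elementary_process (2 ^ m) (grid t m) (appr t m) \<sigma> \<omega> (R v))
    = (\<Sum>k. ennreal (q k * (restr t (psi k t) \<sigma> - stepf t (psi k t) m \<sigma>)\<^sup>2))"
proof -
  let ?d = "\<lambda>k. restr t (psi k t) \<sigma> - stepf t (psi k t) m \<sigma>"
  have x: "t - \<sigma> \<in> {0..T}" using t s by auto
  have "ennreal ((norm (resolvent_family e u (t - \<sigma>) w - elementary_process (2 ^ m) (grid t m) (appr t m) \<sigma> \<omega> w))\<^sup>2)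
      = (\<Sum>k. ennreal ((?d k)\<^sup>2 * (w \<bullet> e k)\<^sup>2))" for w
    unfolding parseval_ennreal[symmetric] inner_diff_left resolvent_inner[OF x] appr_process_inner[OF t]
    using s by (simp add: restr_def psi_def power_mult_distrib left_diff_distrib[symmetric])
  then have "hs_norm2 e (\<lambda>v. resolvent_family e u (t - \<sigma>) (R v) - elementary_process (2 ^ m) (grid t m) (appr t m) \<sigma> \<omega> (R v))
      = (\<Sum>j. \<Sum>k. ennreal ((?d k)\<^sup>2 * (R (e j) \<bullet> e k)\<^sup>2))" unfolding hs_norm2_def by simp
  also have "\<dots> = (\<Sum>k. \<Sum>j. ennreal ((?d k)\<^sup>2 * (R (e j) \<bullet> e k)\<^sup>2))" by (rule suminf_commute_ennreal)
  also have "\<dots> = (\<Sum>k. ennreal (q k * (?d k)\<^sup>2))"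
  proof (rule suminf_cong)
    fix k
    have "(\<Sum>j. ennreal ((?d k)\<^sup>2 * (R (e j) \<bullet> e k)\<^sup>2)) = (\<Sum>j. ennreal ((?d k)\<^sup>2) * ennreal ((R (e k) \<bullet> e j)\<^sup>2))"
    proof (intro suminf_cong)
      fix j
      have "R (e j) \<bullet> e k = R (e k) \<bullet> e j" by (subst R_sym) (rule inner_commute)
      then show "ennreal ((?d k)\<^sup>2 * (R (e j) \<bullet> e k)\<^sup>2) = ennreal ((?d k)\<^sup>2) * ennreal ((R (e k) \<bullet> e j)\<^sup>2)"
        by (simp only:) (rule ennreal_mult, simp_all)
    qed
    also have "\<dots> = ennreal ((?d k)\<^sup>2) * ennreal ((norm (R (e k)))\<^sup>2)"
      by (simp only: ennreal_suminf_cmult parseval_ennreal)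
    also have "\<dots> = ennreal (q k * (?d k)\<^sup>2)" by (simp add: q_def ennreal_mult mult.commute)
    finally show "(\<Sum>j. ennreal ((?d k)\<^sup>2 * (R (e j) \<bullet> e k)\<^sup>2)) = ennreal (q k * (?d k)\<^sup>2)" .
  qed
  finally show ?thesis .
qed

text \<open>The approximating processes freeze the resolvent at the left end of each dyadic cell.
  Their integrals have the Riemann sums as coordinates, so both convergences required of a
  stochastic integral are bounded by the same scalar errors \<open>err\<close>.\<close>

theorem X_stochastic_integral:
  assumes t: "t \<in> {0..T}"
  shows "has_stochastic_integral M F e R W t (\<lambda>\<sigma> \<omega>. resolvent_family e u (t - \<sigma>)) (X t)"
  unfolding has_stochastic_integral_def
proof (intro conjI ballI allI)
  have t0: "t \<ge> 0" using t by simp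
  show "bounded_linear (resolvent_family e u (t - \<sigma>))" if "\<sigma> \<in> {0..t}" for \<sigma> \<omega>
    using that t by (intro resolvent_bounded_linear) auto
  show "X t \<in> borel_measurable M" by (rule X_measurable[OF t0])
  show "(\<lambda>(\<sigma>, \<omega>). indicator {0..t} \<sigma> *\<^sub>R resolvent_family e u (t - \<sigma>) v) \<in> borel_measurable (lborel \<Otimes>\<^sub>M M)" for v
  proof -
    have cont: "continuous_on {0..t} (\<lambda>\<sigma>. u k (t - \<sigma>))" for k
    proof -
      obtain \<Lambda> where \<Lambda>: "\<Lambda> \<ge> 0" "\<forall>x\<in>{0..T}. \<forall>y\<in>{0..T}. \<bar>u k x - u k y\<bar> \<le> \<Lambda> * \<bar>x - y\<bar>" using ul by blast
      have "\<Lambda>-lipschitz_on {0..T} (u k)" using \<Lambda> by (auto simp: lipschitz_on_def dist_real_def)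
      then have "continuous_on {0..T} (u k)" by (rule lipschitz_on_continuous_on)
      then show ?thesis by (rule continuous_on_compose2) (use t in \<open>auto intro!: continuous_intros\<close>)
    qed
    have um: "(\<lambda>\<sigma>. indicator {0..t} \<sigma> *\<^sub>R u k (t - \<sigma>)) \<in> borel_measurable borel" for k
      by (rule borel_measurable_continuous_on_indicator[OF _ cont]) auto
    define U where "U k \<sigma> = indicator {0..t} \<sigma> *\<^sub>R u k (t - \<sigma>)" for k \<sigma>
    have um': "U k \<in> borel_measurable borel" for k using um[of k] by (simp only: U_def[abs_def])
    have "indicator {0..t} \<sigma> *\<^sub>R resolvent_family e u (t - \<sigma>) v
        = (\<Sum>k. (U k \<sigma> * (v \<bullet> e k)) *\<^sub>R e k)" for \<sigma>
      by (cases "\<sigma> \<in> {0..t}") (auto simp: resolvent_family_def U_def)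
    moreover have "(\<lambda>\<sigma>. \<Sum>k. (U k \<sigma> * (v \<bullet> e k)) *\<^sub>R e k) \<in> borel_measurable borel"
      unfolding suminf_eq_lim
      by (intro borel_measurable_lim_metric borel_measurable_sum borel_measurable_scaleR borel_measurable_times um' borel_measurable_const)
    ultimately have "(\<lambda>\<sigma>. indicator {0..t} \<sigma> *\<^sub>R resolvent_family e u (t - \<sigma>) v) \<in> borel_measurable lborel" by simp
    from measurable_compose[OF measurable_fst this, of M] show ?thesis by (simp add: case_prod_beta')
  qed
  have hs: "(\<integral>\<^sup>+(\<sigma>, \<omega>). indicator {0..t} \<sigma> * hs_norm2 e (\<lambda>v. resolvent_family e u (t - \<sigma>) (R v)
      - elementary_process (2 ^ m) (grid t m) (appr t m) \<sigma> \<omega> (R v)) \<partial>(lborel \<Otimes>\<^sub>M M)) = (\<Sum>k. ennreal (q k * err t m k))" for m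
  proof -
    let ?h = "\<lambda>\<sigma>. (\<Sum>k. ennreal (q k * (restr t (psi k t) \<sigma> - stepf t (psi k t) m \<sigma>)\<^sup>2))"
    let ?c = "hs_norm2 e (\<lambda>v. resolvent_family e u t (R v))"
    \<comment> \<open>At \<sigma> = 0 the elementary processes vanish while the integrand does not;
      this single point is kept apart so that the identity \<open>eq\<close> holds everywhere and is
      dropped only under the integral.\<close>
    let ?H = "\<lambda>\<sigma>. if \<sigma> = 0 then ?c else ?h \<sigma>"
    have hm: "(\<lambda>\<sigma>. ennreal (q k * (restr t (psi k t) \<sigma> - stepf t (psi k t) m \<sigma>)\<^sup>2)) \<in> borel_measurable borel" for k
      using borel_measurable_integrable[OF err_integrable[OF t, of k m]] by measurable
    have hm2: "?h \<in> borel_measurable borel" by (rule borel_measurable_suminf_order[OF hm])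
    have hm3: "?h \<in> borel_measurable lborel" unfolding measurable_lborel2 by (rule hm2)
    have Hm: "?H \<in> borel_measurable lborel"
    proof (rule measurable_If)
      show "?h \<in> borel_measurable lborel" by (rule hm3)
    qed simp_all
    have eq: "indicator {0..t} \<sigma> * hs_norm2 e (\<lambda>v. resolvent_family e u (t - \<sigma>) (R v)
      - elementary_process (2 ^ m) (grid t m) (appr t m) \<sigma> \<omega> (R v)) = ?H \<sigma>" for \<sigma> \<omega>
    proof -
      consider "\<sigma> = 0" | "\<sigma> \<in> {0<..t}" | "\<sigma> \<noteq> 0" "\<sigma> \<notin> {0..t}" using t0 by fastforce
      then show ?thesis
      proof cases
        case 1
        have "elementary_process (2 ^ m) (grid t m) (appr t m) 0 \<omega> v = 0" for v
          using grid_facts(1)[OF t0, of m] by (auto simp: elementary_process_def indicator_def not_less intro!: sum.neutral)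
        then show ?thesis using 1 t0 by simp
      next
        case 2
        then show ?thesis using hs_error[OF t 2, of m \<omega>] by simp
      next
        case 3
        then have "restr t (psi k t) \<sigma> - stepf t (psi k t) m \<sigma> = 0" for k
          using restr_le[OF t, of k \<sigma>] stepf_le[OF t, of k m \<sigma>] by simp
        then show ?thesis using 3 by simp
      qed
    qed
    have "(\<integral>\<^sup>+(\<sigma>, \<omega>). ?H \<sigma> \<partial>(lborel \<Otimes>\<^sub>M M)) = (\<integral>\<^sup>+\<sigma>. \<integral>\<^sup>+\<omega>. ?H \<sigma> \<partial>M \<partial>lborel)"
    proof (subst nn_integral_fst[symmetric])
      show "(\<lambda>(\<sigma>, \<omega>). ?H \<sigma>) \<in> borel_measurable (lborel \<Otimes>\<^sub>M M)"
        unfolding case_prod_beta' by (rule measurable_compose[OF measurable_fst Hm])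
    qed simp
    also have "\<dots> = (\<integral>\<^sup>+\<sigma>. ?H \<sigma> \<partial>lborel)" by (simp add: emeasure_space_1)
    also have "\<dots> = (\<integral>\<^sup>+\<sigma>. ?h \<sigma> \<partial>lborel)"
    proof (rule nn_integral_cong_AE)
      show "AE \<sigma> in lborel. ?H \<sigma> = ?h \<sigma>" using AE_lborel_singleton[of 0] by eventually_elim simp
    qed
    also have "\<dots> = (\<Sum>k. \<integral>\<^sup>+\<sigma>. ennreal (q k * (restr t (psi k t) \<sigma> - stepf t (psi k t) m \<sigma>)\<^sup>2) \<partial>lborel)"
      by (rule nn_integral_suminf) (use hm in simp)
    also have "\<dots> = (\<Sum>k. ennreal (q k * err t m k))"
    proof (rule suminf_cong)
      fix k
      have "(\<integral>\<^sup>+\<sigma>. ennreal (q k * (restr t (psi k t) \<sigma> - stepf t (psi k t) m \<sigma>)\<^sup>2) \<partial>lborel)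
          = ennreal (LINT \<sigma>|lborel. q k * (restr t (psi k t) \<sigma> - stepf t (psi k t) m \<sigma>)\<^sup>2)"
        by (rule nn_integral_eq_integral[OF integrable_mult_right[OF err_integrable[OF t]]]) (simp add: q_nonneg)
      then show "(\<integral>\<^sup>+\<sigma>. ennreal (q k * (restr t (psi k t) \<sigma> - stepf t (psi k t) m \<sigma>)\<^sup>2) \<partial>lborel) = ennreal (q k * err t m k)"
        by (simp only: err_def integral_mult_right_zero)
    qed
    finally show ?thesis unfolding eq .
  qed
  have L2: "(\<integral>\<^sup>+\<omega>. ennreal ((norm (X t \<omega> - elementary_integral W (2 ^ m) (grid t m) (appr t m) \<omega>))\<^sup>2) \<partial>M)
      \<le> (\<Sum>k. ennreal (q k * err t m k))" for m
  proof -
    have dm: "(\<lambda>\<omega>. ennreal ((comp k t \<omega> - riemann t (psi k t) (e k) m \<omega>)\<^sup>2)) \<in> borel_measurable M" for k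
      using comp_measurable[OF t0, of k] riemann_measurable[OF t0] by measurable
    have "(\<integral>\<^sup>+\<omega>. ennreal ((norm (X t \<omega> - elementary_integral W (2 ^ m) (grid t m) (appr t m) \<omega>))\<^sup>2) \<partial>M)
        = (\<integral>\<^sup>+\<omega>. (\<Sum>k. ennreal ((comp k t \<omega> - riemann t (psi k t) (e k) m \<omega>)\<^sup>2)) \<partial>M)"
    proof (rule nn_integral_cong_AE)
      show "AE \<omega> in M. ennreal ((norm (X t \<omega> - elementary_integral W (2 ^ m) (grid t m) (appr t m) \<omega>))\<^sup>2)
        = (\<Sum>k. ennreal ((comp k t \<omega> - riemann t (psi k t) (e k) m \<omega>)\<^sup>2))"
        using AE_X_inner[OF t]
        by eventually_elim (simp add: parseval_ennreal[symmetric] inner_diff_left appr_integral_inner[OF t])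
    qed
    also have "\<dots> = (\<Sum>k. \<integral>\<^sup>+\<omega>. ennreal ((comp k t \<omega> - riemann t (psi k t) (e k) m \<omega>)\<^sup>2) \<partial>M)"
      by (rule nn_integral_suminf[OF dm])
    also have "\<dots> \<le> (\<Sum>k. ennreal (q k * err t m k))"
    proof (intro suminf_le allI)
      fix k
      obtain \<Lambda> where "lip t (psi k t) \<Lambda>" using psi_lip[OF t] by blast
      from wiener_integral_riemann[OF t0 this, of "e k" m]
      show "(\<integral>\<^sup>+\<omega>. ennreal ((comp k t \<omega> - riemann t (psi k t) (e k) m \<omega>)\<^sup>2) \<partial>M) \<le> ennreal (q k * err t m k)"
        by (simp only: comp_def q_def err_def)
    qed auto
    finally show ?thesis .
  qed
  show "\<exists>n \<tau> L. (\<forall>m. elementary_data M F t (n m) (\<tau> m) (L m)) \<and>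
        (\<lambda>m. \<integral>\<^sup>+(\<sigma>, \<omega>). indicator {0..t} \<sigma> *
            hs_norm2 e (\<lambda>v. resolvent_family e u (t - \<sigma>) (R v) - elementary_process (n m) (\<tau> m) (L m) \<sigma> \<omega> (R v))
            \<partial>(lborel \<Otimes>\<^sub>M M)) \<longlonglongrightarrow> 0 \<and>
        (\<lambda>m. \<integral>\<^sup>+\<omega>. ennreal ((norm (X t \<omega> - elementary_integral W (n m) (\<tau> m) (L m) \<omega>))\<^sup>2) \<partial>M) \<longlonglongrightarrow> 0"
  proof (intro exI[of _ "\<lambda>m. 2 ^ m"] exI[of _ "\<lambda>m. grid t m"] exI[of _ "\<lambda>m. appr t m"] conjI allI)
    show "elementary_data M F t (2 ^ m) (grid t m) (appr t m)" for m by (rule elementary_data_appr[OF t])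
    show "(\<lambda>m. \<integral>\<^sup>+(\<sigma>, \<omega>). indicator {0..t} \<sigma> *
            hs_norm2 e (\<lambda>v. resolvent_family e u (t - \<sigma>) (R v) - elementary_process (2 ^ m) (grid t m) (appr t m) \<sigma> \<omega> (R v))
            \<partial>(lborel \<Otimes>\<^sub>M M)) \<longlonglongrightarrow> 0"
      unfolding hs by (rule err_total_tendsto[OF t])
    show "(\<lambda>m. \<integral>\<^sup>+\<omega>. ennreal ((norm (X t \<omega> - elementary_integral W (2 ^ m) (grid t m) (appr t m) \<omega>))\<^sup>2) \<partial>M) \<longlonglongrightarrow> 0"
      by (rule tendsto_sandwich[OF always_eventually[OF allI[OF zero_le]] always_eventually[OF allI[OF L2]]
            tendsto_const err_total_tendsto[OF t]])
  qed
qed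

end

section \<open>Moments of the increments\<close>

lemma gaussian_moment_nonneg: "0 \<le> gaussian_moment m" by (simp add: gaussian_moment_def)

lemma min_le_geometric:
  fixes a b \<theta> :: real
  assumes "a > 0" "b > 0" "0 \<le> \<theta>" "\<theta> \<le> 1"
  shows "min a b \<le> a powr \<theta> * b powr (1 - \<theta>)"
proof -
  have m: "min a b > 0" using assms by simp
  have "min a b = min a b powr \<theta> * min a b powr (1 - \<theta>)" using m by (simp flip: powr_add)
  also have "\<dots> \<le> a powr \<theta> * b powr (1 - \<theta>)"
    using m assms by (intro mult_mono powr_mono2) auto
  finally show ?thesis .
qed

context stochastic_conv
begin

text \<open>Interpolating the minimum bounds the variance of mode k by C h^\<theta>
  lam_k^(-(1-\<theta>)/\<rho>), and the premise on s makes the weighted variances summable against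
  \<open>S\<close>. Since the modes may be correlated, the m-th moment of the sum of squares is
  taken by Jensen's inequality with weights proportional to the variance bounds. \<open>A\<close> is
  chosen before m, so one constant serves all moments.\<close>

lemma X_moment:
  assumes lam: "\<And>k. lam k \<ge> l0" "l0 > 0"
    and C: "C \<ge> 0" "\<And>k t' t. 0 \<le> t' \<Longrightarrow> t' \<le> t \<Longrightarrow> t \<le> T \<Longrightarrow> var k t t' \<le> C * min (t - t') (lam k powr (- 1 / \<rho>))"
    and S: "summable (\<lambda>k. lam k powr \<epsilon> * q k)"
    and \<theta>: "0 \<le> \<theta>" "\<theta> \<le> 1" and s: "s - (1 - \<theta>) / \<rho> \<le> \<epsilon>"
  shows "\<exists>A\<ge>0. \<forall>m\<ge>1. \<forall>t' t. 0 \<le> t' \<longrightarrow> t' \<le> t \<longrightarrow> t \<le> T \<longrightarrow>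
    (\<integral>\<^sup>+\<omega>. (hnorm2 s (X t \<omega> - X t' \<omega>)) ^ m \<partial>M) \<le> ennreal (gaussian_moment m * (A * (t - t') powr \<theta>) ^ m)"
proof -
  have l: "lam k > 0" for k using lam(1)[of k] lam(2) by linarith
  define e1 where "e1 = s - (1 - \<theta>) / \<rho>"
  define c0 where "c0 = l0 powr (e1 - \<epsilon>)"
  \<comment> \<open>The summand (1/2)^k keeps the weights positive, as they are divided by in
    Jensen's inequality. \<open>c0\<close> absorbs the difference between the exponent
    \<open>e1\<close> and \<epsilon> through the lower bound on the eigenvalues.\<close>
  define a0 where "a0 k = C * (c0 * (lam k powr \<epsilon> * q k)) + (1/2) ^ k" for k
  have a0: "a0 k > 0" for k
    unfolding a0_def using C(1) q_nonneg[of k] by (intro add_nonneg_pos mult_nonneg_nonneg) (auto simp: c0_def)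
  have sa0: "summable a0" unfolding a0_def[abs_def]
    by (intro summable_add summable_mult S summable_geometric) auto
  define A where "A = (\<Sum>k. a0 k)"
  have A0: "A \<ge> 0" unfolding A_def using a0 by (intro suminf_nonneg sa0) (simp add: less_imp_le)
  have AK: "(\<Sum>k<K. a0 k) \<le> A" for K
    unfolding A_def using a0 by (intro sum_le_suminf sa0) (auto simp: less_imp_le)
  show ?thesis
  proof (intro exI[of _ A] conjI A0 allI impI)
    fix m :: nat and t' t assume m: "1 \<le> m" and t: "0 \<le> t'" "t' \<le> t" "t \<le> T"
    have tT: "t \<in> {0..T}" "t' \<in> {0..T}" using t by auto
    show "(\<integral>\<^sup>+\<omega>. (hnorm2 s (X t \<omega> - X t' \<omega>)) ^ m \<partial>M) \<le> ennreal (gaussian_moment m * (A * (t - t') powr \<theta>) ^ m)"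
    proof (cases "t = t'")
      case True
      have "hnorm2 s 0 ^ m = 0" using m by (simp add: hnorm2_def power_0_left)
      then show ?thesis using True m by (simp add: power_0_left)
    next
      case False
      define h where "h = t - t'"
      have h: "h > 0" using False t by (simp add: h_def)
      define H where "H = h powr \<theta>"
      have H: "H > 0" using h by (simp add: H_def)
      define a where "a k = H * a0 k" for k
      have a: "a k > 0" for k using H a0 by (simp add: a_def)
      have vle: "lam k powr s * (q k * var k t t') \<le> a k" for k
      proof -
        have lp: "(lam k powr (- 1 / \<rho>)) > 0" using l[of k] by simp
        have "var k t t' \<le> C * min h (lam k powr (- 1 / \<rho>))" unfolding h_def by (rule C(2)[OF t])
        also have "\<dots> \<le> C * (H * (lam k powr (- 1 / \<rho>)) powr (1 - \<theta>))"
          unfolding H_def by (intro mult_left_mono min_le_geometric h lp \<theta> C(1))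
        finally have "lam k powr s * (q k * var k t t') \<le> lam k powr s * (q k * (C * (H * (lam k powr (- 1 / \<rho>)) powr (1 - \<theta>))))"
          using q_nonneg[of k] by (intro mult_left_mono) auto
        also have "\<dots> = H * (C * (q k * (lam k powr s * lam k powr (- 1 / \<rho> * (1 - \<theta>)))))" by (simp add: powr_powr mult_ac)
        also have "lam k powr s * lam k powr (- 1 / \<rho> * (1 - \<theta>)) = lam k powr (e1 - \<epsilon>) * lam k powr \<epsilon>"
          by (simp add: powr_add[symmetric] e1_def)
        also have "H * (C * (q k * (lam k powr (e1 - \<epsilon>) * lam k powr \<epsilon>))) \<le> H * (C * (q k * (c0 * lam k powr \<epsilon>)))"
          unfolding c0_def using H C(1) q_nonneg[of k] lam l[of k] s
          by (intro mult_left_mono mult_right_mono powr_mono2') (auto simp: e1_def)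
        also have "\<dots> \<le> a k" unfolding a_def a0_def using H by (simp add: mult_ac)
        finally show ?thesis .
      qed
      define Y where "Y k \<omega> = (lam k powr (s / 2) * (comp k t \<omega> - comp k t' \<omega>))\<^sup>2" for k \<omega>
      have Y0: "0 \<le> Y k \<omega>" for k \<omega> by (simp add: Y_def)
      have Ym: "Y k \<in> borel_measurable M" for k
      proof -
        have t0: "0 \<le> t" using t by linarith
        note [measurable] = comp_measurable[OF t0, of k] comp_measurable[OF t(1), of k]
        show ?thesis unfolding Y_def[abs_def] by measurable
      qed
      note [measurable] = Ym
      have EY: "(\<integral>\<^sup>+\<omega>. ennreal (Y k \<omega> ^ i) \<partial>M) \<le> ennreal (gaussian_moment i * a k ^ i)" for k i
      proof -
        let ?l = "(lam k powr s) ^ i"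
        have ls: "(lam k powr (s / 2))\<^sup>2 = lam k powr s" by (simp add: power2_eq_square flip: powr_add)
        have "Y k \<omega> ^ i = ?l * (comp k t \<omega> - comp k t' \<omega>) ^ (2 * i)" for \<omega>
          by (simp add: Y_def power_mult_distrib ls power_mult)
        then have "(\<integral>\<^sup>+\<omega>. ennreal (Y k \<omega> ^ i) \<partial>M) = (\<integral>\<^sup>+\<omega>. ennreal ?l * ennreal ((comp k t \<omega> - comp k t' \<omega>) ^ (2 * i)) \<partial>M)"
          by (simp add: ennreal_mult)
        also have "\<dots> = ennreal ?l * (\<integral>\<^sup>+\<omega>. ennreal ((comp k t \<omega> - comp k t' \<omega>) ^ (2 * i)) \<partial>M)"
        proof (rule nn_integral_cmult)
          have t0: "0 \<le> t" using t by linarith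
          note [measurable] = comp_measurable[OF t0, of k] comp_measurable[OF t(1), of k]
          show "(\<lambda>\<omega>. ennreal ((comp k t \<omega> - comp k t' \<omega>) ^ (2 * i))) \<in> borel_measurable M" by measurable
        qed
        also have "\<dots> \<le> ennreal ?l * ennreal (gaussian_moment i * (q k * var k t t') ^ i)"
          by (intro mult_left_mono comp_moment tT) auto
        also have "\<dots> = ennreal (?l * (gaussian_moment i * (q k * var k t t') ^ i))"
          using gaussian_moment_nonneg[of i] q_nonneg[of k] var_nonneg[of k t t'] by (intro ennreal_mult[symmetric]) auto
        also have "?l * (gaussian_moment i * (q k * var k t t') ^ i) = gaussian_moment i * (lam k powr s * (q k * var k t t')) ^ i"
          by (simp add: power_mult_distrib)
        also have "ennreal \<dots> \<le> ennreal (gaussian_moment i * a k ^ i)"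
          using q_nonneg[of k] var_nonneg[of k t t']
          by (intro ennreal_leI mult_left_mono power_mono vle gaussian_moment_nonneg) auto
        finally show ?thesis .
      qed
      \<comment> \<open>Truncation keeps Jensen's inequality to finite sums. The bound is
        independent of K, so Fatou's lemma extends it to the full series below.\<close>
      have part: "(\<integral>\<^sup>+\<omega>. ennreal ((\<Sum>k<K. Y k \<omega>) ^ m) \<partial>M) \<le> ennreal (gaussian_moment m * (A * H) ^ m)" for K
      proof -
        define sa where "sa = (\<Sum>k<K. a k)"
        have sa: "0 \<le> sa" "sa \<le> A * H"
        proof -
          show "0 \<le> sa" unfolding sa_def using a by (intro sum_nonneg) (simp add: less_imp_le)
          have "sa = (\<Sum>k<K. a0 k) * H" by (simp add: sa_def a_def sum_distrib_left mult.commute)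
          then show "sa \<le> A * H" using AK[of K] H by (simp add: mult_right_mono)
        qed
        have c0: "0 \<le> sa ^ (m - 1) * (a k / a k ^ m)" for k using sa a[of k] by (simp add: less_imp_le)
        have "(\<Sum>k<K. Y k \<omega>) ^ m \<le> (\<Sum>k<K. sa ^ (m - 1) * (a k / a k ^ m) * Y k \<omega> ^ m)" for \<omega>
        proof -
          \<comment> \<open>The values are the ratios of Y k to a k: the m-th moment of each is at
            most that of a squared standard normal, so the weights recombine to the full m-th power
            of their sum.\<close>
          have "(\<Sum>k<K. a k * (Y k \<omega> / a k)) ^ m \<le> (\<Sum>k<K. a k) ^ (m - 1) * (\<Sum>k<K. a k * (Y k \<omega> / a k) ^ m)"
            by (rule power_mean_weighted) (use a Y0 m in \<open>auto simp: less_imp_le\<close>)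
          moreover have "a k * (Y k \<omega> / a k) = Y k \<omega>" for k using a[of k] by simp
          ultimately show ?thesis by (simp add: sa_def sum_distrib_left power_divide mult_ac)
        qed
        then have "(\<integral>\<^sup>+\<omega>. ennreal ((\<Sum>k<K. Y k \<omega>) ^ m) \<partial>M) \<le> (\<integral>\<^sup>+\<omega>. ennreal (\<Sum>k<K. sa ^ (m - 1) * (a k / a k ^ m) * Y k \<omega> ^ m) \<partial>M)"
          by (intro nn_integral_mono ennreal_leI)
        also have "\<dots> = (\<integral>\<^sup>+\<omega>. (\<Sum>k<K. ennreal (sa ^ (m - 1) * (a k / a k ^ m)) * ennreal (Y k \<omega> ^ m)) \<partial>M)"
        proof (rule nn_integral_cong)
          fix \<omega>
          have "ennreal (\<Sum>k<K. sa ^ (m - 1) * (a k / a k ^ m) * Y k \<omega> ^ m) = (\<Sum>k<K. ennreal (sa ^ (m - 1) * (a k / a k ^ m) * Y k \<omega> ^ m))"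
            by (rule sum_ennreal[symmetric]) (intro mult_nonneg_nonneg[OF c0] zero_le_power Y0)
          also have "\<dots> = (\<Sum>k<K. ennreal (sa ^ (m - 1) * (a k / a k ^ m)) * ennreal (Y k \<omega> ^ m))"
            by (intro sum.cong refl ennreal_mult c0 zero_le_power Y0)
          finally show "ennreal (\<Sum>k<K. sa ^ (m - 1) * (a k / a k ^ m) * Y k \<omega> ^ m) = (\<Sum>k<K. ennreal (sa ^ (m - 1) * (a k / a k ^ m)) * ennreal (Y k \<omega> ^ m))" .
        qed
        also have "\<dots> = (\<Sum>k<K. ennreal (sa ^ (m - 1) * (a k / a k ^ m)) * (\<integral>\<^sup>+\<omega>. ennreal (Y k \<omega> ^ m) \<partial>M))"
          by (subst nn_integral_sum) (auto simp: nn_integral_cmult)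
        also have "\<dots> \<le> (\<Sum>k<K. ennreal (sa ^ (m - 1) * (a k / a k ^ m)) * ennreal (gaussian_moment m * a k ^ m))"
          by (intro sum_mono mult_left_mono EY) auto
        also have "\<dots> = (\<Sum>k<K. ennreal (gaussian_moment m * sa ^ (m - 1) * a k))"
        proof (intro sum.cong refl)
          fix k
          have "ennreal (sa ^ (m - 1) * (a k / a k ^ m)) * ennreal (gaussian_moment m * a k ^ m)
              = ennreal (sa ^ (m - 1) * (a k / a k ^ m) * (gaussian_moment m * a k ^ m))"
            using a[of k] gaussian_moment_nonneg[of m] by (intro ennreal_mult[symmetric] c0) (simp add: less_imp_le)
          also have "sa ^ (m - 1) * (a k / a k ^ m) * (gaussian_moment m * a k ^ m) = gaussian_moment m * sa ^ (m - 1) * a k"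
            using a[of k] by simp
          finally show "ennreal (sa ^ (m - 1) * (a k / a k ^ m)) * ennreal (gaussian_moment m * a k ^ m) = ennreal (gaussian_moment m * sa ^ (m - 1) * a k)" .
        qed
        also have "\<dots> = ennreal (\<Sum>k<K. gaussian_moment m * sa ^ (m - 1) * a k)"
          using a gaussian_moment_nonneg[of m] sa by (intro sum_ennreal) (simp add: less_imp_le)
        also have "(\<Sum>k<K. gaussian_moment m * sa ^ (m - 1) * a k) = gaussian_moment m * (sa ^ (m - 1) * sa)"
          by (simp add: sum_distrib_left[symmetric] sa_def)
        also have "sa ^ (m - 1) * sa = sa ^ m" using m by (metis One_nat_def Suc_le_eq power_minus_mult)
        also have "ennreal (gaussian_moment m * sa ^ m) \<le> ennreal (gaussian_moment m * (A * H) ^ m)"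
          using sa by (intro ennreal_leI mult_left_mono power_mono gaussian_moment_nonneg)
        finally show ?thesis .
      qed
      have hY: "AE \<omega> in M. hnorm2 s (X t \<omega> - X t' \<omega>) = (\<Sum>k. ennreal (Y k \<omega>))"
        using AE_X_inner[OF tT(1)] AE_X_inner[OF tT(2)]
        by eventually_elim (simp add: hnorm2_def Y_def inner_diff_left)
      have "(\<integral>\<^sup>+\<omega>. (\<Sum>k. ennreal (Y k \<omega>)) \<partial>M) = (\<Sum>k. \<integral>\<^sup>+\<omega>. ennreal (Y k \<omega>) \<partial>M)"
        by (rule nn_integral_suminf) measurable
      also have "\<dots> \<le> (\<Sum>k. ennreal (a k))"
        using EY[of _ 1] by (intro suminf_le allI) (auto simp: gaussian_moment_def)
      also have "\<dots> < \<top>"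
      proof -
        have "summable a" unfolding a_def[abs_def] by (intro summable_mult sa0)
        then have "(\<Sum>k. ennreal (a k)) \<noteq> \<top>" using a by (intro ennreal_suminf_neq_top) (simp_all add: less_imp_le)
        then show ?thesis by (simp add: less_top)
      qed
      finally have "AE \<omega> in M. (\<Sum>k. ennreal (Y k \<omega>)) \<noteq> \<infinity>"
        by (intro nn_integral_PInf_AE) (auto intro!: borel_measurable_suminf_order)
      then have lim: "AE \<omega> in M. (hnorm2 s (X t \<omega> - X t' \<omega>)) ^ m = liminf (\<lambda>K. ennreal ((\<Sum>k<K. Y k \<omega>) ^ m))"
        using hY
      proof eventually_elim
        fix \<omega> assume fin: "(\<Sum>k. ennreal (Y k \<omega>)) \<noteq> \<infinity>" and eq: "hnorm2 s (X t \<omega> - X t' \<omega>) = (\<Sum>k. ennreal (Y k \<omega>))"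
        have sm: "summable (\<lambda>k. Y k \<omega>)" by (rule summable_suminf_not_top) (use fin Y0 in auto)
        have "(\<Sum>k. ennreal (Y k \<omega>)) = ennreal (\<Sum>k. Y k \<omega>)" by (rule suminf_ennreal2[OF Y0 sm])
        then have "(hnorm2 s (X t \<omega> - X t' \<omega>)) ^ m = ennreal ((\<Sum>k. Y k \<omega>) ^ m)"
          using eq Y0 by (simp add: ennreal_power suminf_nonneg[OF sm])
        moreover have "(\<lambda>K. ennreal ((\<Sum>k<K. Y k \<omega>) ^ m)) \<longlonglongrightarrow> ennreal ((\<Sum>k. Y k \<omega>) ^ m)"
          by (intro tendsto_ennrealI tendsto_power summable_LIMSEQ sm)
        ultimately show "(hnorm2 s (X t \<omega> - X t' \<omega>)) ^ m = liminf (\<lambda>K. ennreal ((\<Sum>k<K. Y k \<omega>) ^ m))"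
          using lim_imp_Liminf[OF sequentially_bot] by metis
      qed
      have "(\<integral>\<^sup>+\<omega>. (hnorm2 s (X t \<omega> - X t' \<omega>)) ^ m \<partial>M) = (\<integral>\<^sup>+\<omega>. liminf (\<lambda>K. ennreal ((\<Sum>k<K. Y k \<omega>) ^ m)) \<partial>M)"
        by (rule nn_integral_cong_AE[OF lim])
      also have "\<dots> \<le> liminf (\<lambda>K. \<integral>\<^sup>+\<omega>. ennreal ((\<Sum>k<K. Y k \<omega>) ^ m) \<partial>M)"
        by (rule nn_integral_liminf) measurable
      also have "\<dots> \<le> ennreal (gaussian_moment m * (A * H) ^ m)"
        by (rule order_trans[OF Liminf_le_Limsup Limsup_bounded]) (simp_all add: part)
      finally show ?thesis by (simp only: H_def h_def)
    qed
  qed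
qed

end

subsection \<open>Weighted coefficient arrays\<close>

lemma level_diff: "level T (\<lambda>n j. c n j - d n j) n t = level T c n t - level T d n t"
  by (simp add: level_def sum_subtractf[symmetric] scaleR_right_diff_distrib)

lemma ennreal_add_power_le: "(x + y) ^ m \<le> 2 ^ m * (x ^ m + y ^ m)" for x y :: ennreal
proof -
  have "(x + y) ^ m \<le> (2 * max x y) ^ m"
    by (intro power_mono) (auto simp: mult_2 intro!: add_mono)
  also have "\<dots> = 2 ^ m * max x y ^ m" by (simp add: power_mult_distrib)
  also have "max x y ^ m \<le> x ^ m + y ^ m"
    by (cases "x \<le> y") (auto simp: max_def add_increasing add_increasing2)
  then have "2 ^ m * max x y ^ m \<le> 2 ^ m * (x ^ m + y ^ m)" by (rule mult_left_mono) simp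
  finally show ?thesis .
qed

lemma ennreal_le_root:
  assumes "x ^ m \<le> ennreal \<sigma>" "m \<ge> 1" "0 \<le> \<sigma>"
  shows "x \<le> ennreal (root m \<sigma>)"
proof (cases x)
  case (real a)
  then have "ennreal (a ^ m) \<le> ennreal \<sigma>" using assms by (simp add: ennreal_power)
  then have "a ^ m \<le> \<sigma>" using assms by (simp add: ennreal_le_iff)
  then have "root m (a ^ m) \<le> root m \<sigma>" using assms by simp
  then show ?thesis using real assms by (simp add: real_root_power_cancel ennreal_leI)
next
  case top
  then show ?thesis using assms by (simp add: top_power_ennreal top_unique)
qed

context onb_weights
begin

text \<open>The square of the coefficient norm that corresponds, for 0 < b < 1, to Hoelder
  continuity of order b with values in the space of order s. Squares and extended values match
  \<open>hnorm2\<close>, so that it is measurable for random arrays without any prior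
  finiteness.\<close>

definition array_norm :: "real \<Rightarrow> real \<Rightarrow> (nat \<Rightarrow> nat \<Rightarrow> 'h) \<Rightarrow> ennreal" where
  "array_norm b s c = (SUP p\<in>Sigma UNIV level_index. ennreal (2 powr (2 * b * real (fst p))) * hnorm2 s (c (fst p) (snd p)))"

lemma array_norm_ge:
  "j \<in> level_index n \<Longrightarrow> ennreal (2 powr (2 * b * real n)) * hnorm2 s (c n j) \<le> array_norm b s c"
  unfolding array_norm_def by (rule SUP_upper2[of "(n, j)"]) auto

lemma array_norm_le:
  "(\<And>n j. j \<in> level_index n \<Longrightarrow> ennreal (2 powr (2 * b * real n)) * hnorm2 s (c n j) \<le> a) \<Longrightarrow> array_norm b s c \<le> a"
  unfolding array_norm_def by (rule SUP_least) auto

lemma array_norm_mono_weight: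
  assumes "b \<le> b'" shows "array_norm b s c \<le> array_norm b' s c"
proof (rule array_norm_le)
  fix n j assume j: "j \<in> level_index n"
  have "ennreal (2 powr (2 * b * real n)) * hnorm2 s (c n j) \<le> ennreal (2 powr (2 * b' * real n)) * hnorm2 s (c n j)"
    using assms by (intro mult_right_mono ennreal_leI powr_mono) (simp_all add: mult_right_mono)
  also have "\<dots> \<le> array_norm b' s c" by (rule array_norm_ge[OF j])
  finally show "ennreal (2 powr (2 * b * real n)) * hnorm2 s (c n j) \<le> array_norm b' s c" .
qed

lemma array_norm_mono_order:
  assumes lam: "\<And>k. lam k \<ge> l0" "l0 > 0" and s: "s \<le> s'"
  shows "array_norm b s c \<le> ennreal (l0 powr (s - s')) * array_norm b s' c"
proof (rule array_norm_le)
  fix n j assume j: "j \<in> level_index n"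
  have "ennreal (2 powr (2 * b * real n)) * hnorm2 s (c n j)
      \<le> ennreal (2 powr (2 * b * real n)) * (ennreal (l0 powr (s - s')) * hnorm2 s' (c n j))"
    by (intro mult_left_mono hnorm2_mono lam s) simp
  also have "\<dots> = ennreal (l0 powr (s - s')) * (ennreal (2 powr (2 * b * real n)) * hnorm2 s' (c n j))" by (simp only: mult_ac)
  also have "\<dots> \<le> ennreal (l0 powr (s - s')) * array_norm b s' c" by (intro mult_left_mono array_norm_ge j) simp
  finally show "ennreal (2 powr (2 * b * real n)) * hnorm2 s (c n j) \<le> ennreal (l0 powr (s - s')) * array_norm b s' c" .
qed

lemma array_norm_entry:
  assumes c: "array_norm b s c \<le> ennreal (\<zeta>\<^sup>2)" and \<zeta>: "0 \<le> \<zeta>" and j: "j \<in> level_index n"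
  shows "c n j \<in> Hdot e lam s" "norm (frac_pow e lam (s / 2) (c n j)) \<le> \<zeta> * 2 powr (- b * real n)"
proof -
  let ?w = "2 powr (b * real n)"
  have w: "2 powr (2 * b * real n) = ?w\<^sup>2" 
    unfolding power2_eq_square powr_add[symmetric] by (rule arg_cong[where f = "\<lambda>x. 2 powr x"]) simp
  have le: "ennreal (?w\<^sup>2) * hnorm2 s (c n j) \<le> ennreal (\<zeta>\<^sup>2)"
    using order_trans[OF array_norm_ge[OF j] c] by (simp only: w)
  have "hnorm2 s (c n j) \<noteq> \<top>"
  proof
    assume "hnorm2 s (c n j) = \<top>"
    then have "ennreal (?w\<^sup>2) * hnorm2 s (c n j) = \<top>" by (simp add: ennreal_mult_top)
    with le show False by (simp add: top_unique)
  qed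
  then show 1: "c n j \<in> Hdot e lam s" by (simp add: Hdot_iff less_top)
  let ?y = "norm (frac_pow e lam (s / 2) (c n j))"
  have "hnorm2 s (c n j) = ennreal (?y\<^sup>2)" using Hdot_norm_eq[OF 1] by (simp add: Hdot_norm_def)
  then have "ennreal ((?w * ?y)\<^sup>2) \<le> ennreal (\<zeta>\<^sup>2)" using le by (simp add: power_mult_distrib ennreal_mult)
  then have "(?w * ?y)\<^sup>2 \<le> \<zeta>\<^sup>2" by (simp add: ennreal_le_iff)
  then have "?w * ?y \<le> \<zeta>" using \<zeta> by (rule power2_le_imp_le)
  then have "(?w * ?y) * 2 powr (- b * real n) \<le> \<zeta> * 2 powr (- b * real n)" by (rule mult_right_mono) simp
  moreover have "(?w * ?y) * 2 powr (- b * real n) = ?y * (?w * 2 powr (- b * real n))" by (simp only: mult_ac)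
  moreover have "?w * 2 powr (- b * real n) = 1" by (simp flip: powr_add)
  ultimately show "?y \<le> \<zeta> * 2 powr (- b * real n)" by (simp only: mult_1_right)
qed

lemma frac_pow_zero: "(\<And>k. lam k > 0) \<Longrightarrow> frac_pow e lam 0 v = v"
proof -
  assume l: "\<And>k. lam k > 0"
  have "lam k powr 0 = 1" for k using l[of k] by simp
  then show ?thesis by (simp add: frac_pow_def expansion)
qed

text \<open>At order 0 the weighted norm is that of H, and any positive weight gives the levels a
  geometric majorant.\<close>

lemma array_norm_summable:
  assumes T: "T > 0" and b: "b > 0" and lam: "\<And>k. lam k > 0" and c: "array_norm b 0 c < \<top>"
  shows "summable (\<lambda>n. level T c n t)"
proof -
  let ?z = "sqrt (enn2real (array_norm b 0 c))"
  have z: "0 \<le> ?z" "array_norm b 0 c \<le> ennreal (?z\<^sup>2)" using c by (simp_all add: less_top)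
  have "norm (c n j) \<le> ?z * 2 powr (- b * real n)" if "j \<in> level_index n" for n j
    using array_norm_entry(2)[OF z(2,1) that] frac_pow_zero[OF lam] by simp
  moreover have "0 < min 1 (b / 2)" "min 1 (b / 2) \<le> 1" "min 1 (b / 2) < b" using b by auto
  ultimately show ?thesis using faber_bounds[OF T, of "min 1 (b / 2)" b] z(1) by blast
qed

text \<open>The series with coefficients mapped by the fractional power converges in H by
  \<open>faber_bounds\<close>, and closedness identifies its sum. For negative s the array norm does
  not control convergence in H, which is why summability of the levels is a separate
  premise.\<close>

lemma faber_Hdot:
  assumes T: "T > 0" and \<beta>: "0 < \<beta>" "\<beta> \<le> 1" "\<beta> < b"
  shows "\<exists>K>0. \<forall>c \<zeta>. 0 \<le> \<zeta> \<longrightarrow> array_norm b s c \<le> ennreal (\<zeta>\<^sup>2) \<longrightarrow> (\<forall>t. summable (\<lambda>n. level T c n t)) \<longrightarrow>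
    (\<forall>t. faber T c t \<in> Hdot e lam s \<and> Hdot_norm e lam s (faber T c t) \<le> K * \<zeta>) \<and>
    (\<forall>t t'. Hdot_norm e lam s (faber T c t - faber T c t') \<le> K * \<zeta> * \<bar>t - t'\<bar> powr \<beta>)"
proof -
  obtain K where K: "K > 0" and fb: "\<And>(c :: nat \<Rightarrow> nat \<Rightarrow> 'h) \<zeta>. 0 \<le> \<zeta> \<Longrightarrow> (\<forall>n. \<forall>j\<in>level_index n. norm (c n j) \<le> \<zeta> * 2 powr (- b * real n)) \<Longrightarrow>
    (\<forall>t. summable (\<lambda>n. level T c n t) \<and> norm (faber T c t) \<le> K * \<zeta>) \<and>
    (\<forall>t t'. norm (faber T c t - faber T c t') \<le> K * \<zeta> * \<bar>t - t'\<bar> powr \<beta>)"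
    using faber_bounds[OF T \<beta>] by blast
  show ?thesis
  proof (intro exI[of _ K] conjI K allI impI)
    fix c \<zeta> assume \<zeta>: "0 \<le> \<zeta>" and c: "array_norm b s c \<le> ennreal (\<zeta>\<^sup>2)" and sm: "\<forall>t. summable (\<lambda>n. level T c n t)"
    define c' where "c' n j = frac_pow e lam (s / 2) (c n j)" for n j
    note en = array_norm_entry[OF c \<zeta>]
    have b': "\<forall>n. \<forall>j\<in>level_index n. norm (c' n j) \<le> \<zeta> * 2 powr (- b * real n)"
      unfolding c'_def using en(2) by blast
    have lH: "level T c n t \<in> Hdot e lam s" for n t
      unfolding level_def by (intro Hdot_sum Hdot_scaleR en(1))
    have lf: "frac_pow e lam (s / 2) (level T c n t) = level T c' n t" for n t
      unfolding level_def c'_def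
      by (subst frac_pow_sum) (auto simp: frac_pow_scaleR en(1) intro!: Hdot_scaleR en(1))
    have s1: "(\<lambda>n. level T c n t) sums faber T c t" for t
      unfolding faber_def by (rule summable_sums[OF sm[rule_format]])
    have s2: "(\<lambda>n. frac_pow e lam (s / 2) (level T c n t)) sums faber T c' t" for t
      unfolding lf faber_def using fb[OF \<zeta> b'] by (intro summable_sums) blast
    note cl = frac_pow_closed[OF s1 lH s2]
    show "faber T c t \<in> Hdot e lam s" for t by (rule cl(1))
    show "Hdot_norm e lam s (faber T c t) \<le> K * \<zeta>" for t
      unfolding Hdot_norm_def cl(2) using fb[OF \<zeta> b'] by blast
    show "Hdot_norm e lam s (faber T c t - faber T c t') \<le> K * \<zeta> * \<bar>t - t'\<bar> powr \<beta>" for t t'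
      unfolding Hdot_norm_def frac_pow_diff[OF cl(1) cl(1)] cl(2) using fb[OF \<zeta> b'] by blast
  qed
qed

text \<open>The constant is doubled because the Hoelder norm adds the supremum norm to the seminorm,
  each at most K \<zeta>. Boundedness of the quotients and of the norms is established first, since
  suprema of reals are informative for bounded sets.\<close>

lemma faber_spaces:
  assumes T: "T > 0" and \<beta>: "0 < \<beta>" "\<beta> \<le> 1" "\<beta> < b"
  shows "\<exists>K>0. \<forall>c \<zeta>. 0 \<le> \<zeta> \<longrightarrow> array_norm b s c \<le> ennreal (\<zeta>\<^sup>2) \<longrightarrow> (\<forall>t. summable (\<lambda>n. level T c n t)) \<longrightarrow>
    (faber T c \<in> cont_space e lam s T \<and> 0 \<le> cont_norm e lam s T (faber T c) \<and> cont_norm e lam s T (faber T c) \<le> K * \<zeta>) \<and>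
    (faber T c \<in> hoelder_space e lam s T \<beta> \<and> 0 \<le> hoelder_norm e lam s T \<beta> (faber T c) \<and> hoelder_norm e lam s T \<beta> (faber T c) \<le> K * \<zeta>)"
proof -
  obtain K where K: "K > 0" and f: "\<And>c \<zeta>. 0 \<le> \<zeta> \<Longrightarrow> array_norm b s c \<le> ennreal (\<zeta>\<^sup>2) \<Longrightarrow> (\<forall>t. summable (\<lambda>n. level T c n t)) \<Longrightarrow>
    (\<forall>t. faber T c t \<in> Hdot e lam s \<and> Hdot_norm e lam s (faber T c t) \<le> K * \<zeta>) \<and>
    (\<forall>t t'. Hdot_norm e lam s (faber T c t - faber T c t') \<le> K * \<zeta> * \<bar>t - t'\<bar> powr \<beta>)"
    using faber_Hdot[OF T \<beta>, of s] by blast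
  have N0: "0 \<le> Hdot_norm e lam s v" for v by (simp add: Hdot_norm_def)
  have "(faber T c \<in> cont_space e lam s T \<and> 0 \<le> cont_norm e lam s T (faber T c) \<and> cont_norm e lam s T (faber T c) \<le> 2 * K * \<zeta>) \<and>
    (faber T c \<in> hoelder_space e lam s T \<beta> \<and> 0 \<le> hoelder_norm e lam s T \<beta> (faber T c) \<and> hoelder_norm e lam s T \<beta> (faber T c) \<le> 2 * K * \<zeta>)"
    if c: "0 \<le> \<zeta>" "array_norm b s c \<le> ennreal (\<zeta>\<^sup>2)" "\<forall>t. summable (\<lambda>n. level T c n t)" for c \<zeta>
  proof -
    let ?f = "faber T c"
    let ?Q = "hoelder_quotients e lam s T \<beta> ?f"
    have H: "?f t \<in> Hdot e lam s" "Hdot_norm e lam s (?f t) \<le> K * \<zeta>"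
      and D: "Hdot_norm e lam s (?f t - ?f t') \<le> K * \<zeta> * \<bar>t - t'\<bar> powr \<beta>" for t t'
      using f[OF c] by blast+
    have cN: "0 \<le> cont_norm e lam s T ?f" "cont_norm e lam s T ?f \<le> K * \<zeta>"
    proof -
      have "bdd_above ((\<lambda>t. Hdot_norm e lam s (?f t)) ` {0..T})" using H(2) by (intro bdd_aboveI2)
      then have "Hdot_norm e lam s (?f 0) \<le> cont_norm e lam s T ?f"
        unfolding cont_norm_def by (rule cSUP_upper2[of _ _ 0]) (use T in auto)
      then show "0 \<le> cont_norm e lam s T ?f" using N0[of "?f 0"] by linarith
      show "cont_norm e lam s T ?f \<le> K * \<zeta>" unfolding cont_norm_def using H(2) T by (intro cSUP_least) auto
    qed
    have qle: "q \<le> K * \<zeta>" if "q \<in> ?Q" for q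
    proof -
      obtain t t' where q: "q = Hdot_norm e lam s (?f t - ?f t') / \<bar>t - t'\<bar> powr \<beta>" and ne: "t \<noteq> t'"
        using \<open>q \<in> ?Q\<close> unfolding hoelder_quotients_def by blast
      show ?thesis unfolding q using D[of t t'] ne by (simp add: pos_divide_le_eq)
    qed
    have qin: "Hdot_norm e lam s (?f 0 - ?f T) / \<bar>0 - T\<bar> powr \<beta> \<in> ?Q"
    proof -
      have "0 \<in> {0..T}" "T \<in> {0..T}" "0 \<noteq> T" using T by auto
      then show ?thesis unfolding hoelder_quotients_def by blast
    qed
    have bdd: "bdd_above ?Q" using qle by (intro bdd_aboveI)
    have "0 \<le> Hdot_norm e lam s (?f 0 - ?f T) / \<bar>0 - T\<bar> powr \<beta>" by (simp add: N0)
    also have "\<dots> \<le> Sup ?Q" by (rule cSup_upper[OF qin bdd])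
    finally have S0: "0 \<le> Sup ?Q" .
    have S1: "Sup ?Q \<le> K * \<zeta>" using qin qle by (intro cSup_least) auto
    have cont: "?f \<in> cont_space e lam s T"
    proof -
      have "((\<lambda>t'. Hdot_norm e lam s (?f t' - ?f t)) \<longlongrightarrow> 0) (at t within {0..T})" for t
      proof (rule tendsto_sandwich[OF always_eventually[OF allI[OF N0]] always_eventually[OF allI[OF D]] tendsto_const])
        have "((\<lambda>t'. \<bar>t' - t\<bar>) \<longlongrightarrow> 0) (at t within {0..T})"
          by (rule tendsto_eq_intros | simp)+
        then have "((\<lambda>t'. \<bar>t' - t\<bar> powr \<beta>) \<longlongrightarrow> 0 powr \<beta>) (at t within {0..T})"
          using \<beta> by (intro tendsto_powr2 tendsto_const) auto
        then show "((\<lambda>t'. K * \<zeta> * \<bar>t' - t\<bar> powr \<beta>) \<longlongrightarrow> 0) (at t within {0..T})"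
          by (intro tendsto_mult_right_zero) simp
      qed
      then show ?thesis using H(1) by (simp add: cont_space_def)
    qed
    have Kz: "0 \<le> K * \<zeta>" using K c by simp
    show ?thesis using cont cN H(1) bdd S0 S1 Kz by (auto simp: hoelder_space_def hoelder_norm_def)
  qed
  then show ?thesis using K by (intro exI[of _ "2 * K"]) simp
qed

text \<open>The fractional power carries the norm of \<open>Hdot\<close> to that of H, and every
  subset of H is separable. A countable dense part of the image is pulled back.\<close>

lemma Hdot_separable:
  "\<exists>D0. countable D0 \<and> D0 \<subseteq> Hdot e lam s \<and> (\<forall>v\<in>Hdot e lam s. \<forall>\<delta>>0. \<exists>d\<in>D0. hnorm2 s (v - d) < ennreal \<delta>)"
proof -
  let ?f = "frac_pow e lam (s / 2)"
  obtain S where S: "countable S" "S \<subseteq> ?f ` Hdot e lam s" "?f ` Hdot e lam s \<subseteq> closure S"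
    using separable[of "?f ` Hdot e lam s"] by blast
  let ?D = "inv_into (Hdot e lam s) ?f ` S"
  have D: "?D \<subseteq> Hdot e lam s" using S(2) by (auto intro: inv_into_into)
  have "\<exists>d\<in>?D. hnorm2 s (v - d) < ennreal \<delta>" if v: "v \<in> Hdot e lam s" and \<delta>: "\<delta> > 0" for v \<delta>
  proof -
    have "?f v \<in> closure S" using S(3) v by blast
    then obtain x where x: "x \<in> S" "dist x (?f v) < sqrt \<delta>" using \<delta> closure_approachable[of "?f v" S] by (metis real_sqrt_gt_zero)
    let ?d = "inv_into (Hdot e lam s) ?f x"
    have d: "?d \<in> Hdot e lam s" "?f ?d = x" using x(1) S(2) by (auto intro: inv_into_into f_inv_into_f)
    have "Hdot_norm e lam s (v - ?d) < sqrt \<delta>"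
      unfolding Hdot_norm_def frac_pow_diff[OF v d(1)] d(2) using x(2) by (simp add: dist_norm norm_minus_commute)
    then have "(Hdot_norm e lam s (v - ?d))\<^sup>2 < (sqrt \<delta>)\<^sup>2"
      by (intro power_strict_mono) (auto simp: Hdot_norm_def)
    then have "hnorm2 s (v - ?d) < ennreal \<delta>"
      using \<delta> unfolding Hdot_norm_eq[OF Hdot_diff[OF v d(1)], symmetric] by (intro ennreal_lessI) auto
    then show ?thesis using x(1) by blast
  qed
  then show ?thesis using D S(1) by (intro exI[of _ ?D]) auto
qed

text \<open>Finite arrays with entries from a countable dense set. With unchanged weight they would
  not be dense, since high levels contribute to the supremum as much as low ones; with the smaller
  weight b' the high levels become uniformly small. The set serves all weights at once, depending
  only on the order s.\<close>

lemma finite_arrays_dense: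
  "\<exists>D. countable D \<and> D \<noteq> {} \<and>
    (\<forall>d\<in>D. (\<forall>b. array_norm b s d < \<top>) \<and> (\<forall>T t. summable (\<lambda>n. level T d n t))) \<and>
    (\<forall>b b' c \<delta>. b' < b \<longrightarrow> array_norm b s c < \<top> \<longrightarrow> 0 < \<delta> \<longrightarrow> (\<exists>d\<in>D. array_norm b' s (\<lambda>n j. c n j - d n j) \<le> ennreal \<delta>))"
proof -
  obtain D0 where D0': "countable D0 \<and> D0 \<subseteq> Hdot e lam s \<and> (\<forall>v\<in>Hdot e lam s. \<forall>\<delta>>0. \<exists>d\<in>D0. hnorm2 s (v - d) < ennreal \<delta>)"
    using Hdot_separable[of s] by (rule exE)
  note D0 = D0'[THEN conjunct1] D0'[THEN conjunct2, THEN conjunct1]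
    and dense = D0'[THEN conjunct2, THEN conjunct2, rule_format]
  define I where "I n0 = Sigma {..<n0::nat} level_index" for n0
  define ex :: "nat \<Rightarrow> (nat \<times> nat \<Rightarrow> 'h) \<Rightarrow> nat \<Rightarrow> nat \<Rightarrow> 'h" where
    "ex n0 f n j = (if (n, j) \<in> I n0 then f (n, j) else 0)" for n0 f n j
  define D where "D = (\<Union>n0. ex n0 ` (PiE (I n0) (\<lambda>_. D0)))"
  have fI: "finite (I n0)" for n0 by (simp add: I_def)
  have cD: "countable D" unfolding D_def by (intro countable_UN countable_image countable_PiE fI D0(1)) simp
  have "ex 0 (\<lambda>_. undefined) \<in> D" unfolding D_def by (intro UN_I[of 0] imageI) (auto simp: I_def)
  then have neD: "D \<noteq> {}" by blast
  have nice: "(\<forall>b. array_norm b s d < \<top>) \<and> (\<forall>T t. summable (\<lambda>n. level T d n t))" if dD: "d \<in> D" for d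
  proof -
    obtain n0 f where f: "f \<in> PiE (I n0) (\<lambda>_. D0)" and d: "d = ex n0 f" using dD unfolding D_def by blast
    have dz: "d n j = 0" if "(n, j) \<notin> I n0" for n j using that by (simp add: d ex_def)
    have dH: "d n j \<in> Hdot e lam s" for n j
      using f D0(2) by (auto simp: d ex_def Hdot_zero dest: PiE_mem)
    have "array_norm b s d < \<top>" for b
    proof -
      let ?t = "\<lambda>p. ennreal (2 powr (2 * b * real (fst p))) * hnorm2 s (d (fst p) (snd p))"
      have "array_norm b s d \<le> (\<Sum>p\<in>I n0. ?t p)"
      proof (rule array_norm_le)
        fix n j
        show "ennreal (2 powr (2 * b * real n)) * hnorm2 s (d n j) \<le> (\<Sum>p\<in>I n0. ?t p)"
        proof (cases "(n, j) \<in> I n0")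
          case True
          then show ?thesis using member_le_sum[OF True, of ?t] fI by auto
        next
          case False
          have "hnorm2 s 0 = 0" by (simp add: hnorm2_def)
          then show ?thesis using dz[OF False] by simp
        qed
      qed
      also have "\<dots> < \<top>" using dH fI by (simp add: ennreal_sum_less_top[OF fI] ennreal_mult_less_top Hdot_iff[symmetric])
      finally show ?thesis .
    qed
    moreover have "summable (\<lambda>n. level T d n t)" for T t
      by (rule summable_finite[of "{..<n0}"]) (auto simp: level_def dz I_def)
    ultimately show ?thesis by blast
  qed
  have appr: "\<exists>d\<in>D. array_norm b' s (\<lambda>n j. c n j - d n j) \<le> ennreal \<delta>"
    if b: "b' < b" and c: "array_norm b s c < \<top>" and \<delta>: "0 < \<delta>" for b b' c \<delta>
  proof -
    define S where "S = enn2real (array_norm b s c)"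
    have S: "array_norm b s c = ennreal S" "0 \<le> S" using c by (simp_all add: S_def less_top)
    \<comment> \<open>r^n is the gain on level n from the smaller weight. All levels from n0 on fall
      below \<delta> at once, and finitely many entries remain to be approximated.\<close>
    define r where "r = (2::real) powr (2 * (b' - b))"
    have r: "0 < r" "r < 1" using b powr_less_mono[of "2 * (b' - b)" 0 2] by (auto simp: r_def)
    have lim: "(\<lambda>n. r ^ n * S) \<longlonglongrightarrow> 0" using r by (intro tendsto_mult_left_zero LIMSEQ_power_zero) auto
    from order_tendstoD(2)[OF lim \<delta>] obtain n0 where n0: "\<And>n. n \<ge> n0 \<Longrightarrow> r ^ n * S < \<delta>"
      unfolding eventually_sequentially by blast
    have cH: "c n j \<in> Hdot e lam s" if "j \<in> level_index n" for n j
      by (rule array_norm_entry(1)[where \<zeta> = "sqrt S" and b = b, OF _ _ that]) (use S in auto)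
    have "\<exists>x. x \<in> D0 \<and> ennreal (2 powr (2 * b' * real (fst p))) * hnorm2 s (c (fst p) (snd p) - x) \<le> ennreal \<delta>" if "p \<in> I n0" for p
    proof -
      let ?w = "2 powr (2 * b' * real (fst p))"
      have "c (fst p) (snd p) \<in> Hdot e lam s" using that by (intro cH) (auto simp: I_def)
      then obtain x where x: "x \<in> D0" "hnorm2 s (c (fst p) (snd p) - x) < ennreal (\<delta> / ?w)"
        using dense[of _ "\<delta> / ?w"] \<delta> by (metis divide_pos_pos powr_gt_zero zero_neq_numeral)
      have "ennreal ?w * hnorm2 s (c (fst p) (snd p) - x) \<le> ennreal ?w * ennreal (\<delta> / ?w)"
        using x(2) by (intro mult_left_mono) auto
      also have "\<dots> = ennreal (?w * (\<delta> / ?w))" using \<delta> by (intro ennreal_mult[symmetric]) auto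
      also have "?w * (\<delta> / ?w) = \<delta>" by simp
      finally show ?thesis using x(1) by blast
    qed
    then obtain g where g: "\<And>p. p \<in> I n0 \<Longrightarrow> g p \<in> D0"
      "\<And>p. p \<in> I n0 \<Longrightarrow> ennreal (2 powr (2 * b' * real (fst p))) * hnorm2 s (c (fst p) (snd p) - g p) \<le> ennreal \<delta>" by metis
    let ?d = "ex n0 (restrict g (I n0))"
    have "?d \<in> D" unfolding D_def using g(1) by (intro UN_I[of n0] imageI) auto
    moreover have "array_norm b' s (\<lambda>n j. c n j - ?d n j) \<le> ennreal \<delta>"
    proof (rule array_norm_le)
      fix n j assume j: "j \<in> level_index n"
      show "ennreal (2 powr (2 * b' * real n)) * hnorm2 s (c n j - ?d n j) \<le> ennreal \<delta>"
      proof (cases "(n, j) \<in> I n0")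
        case True
        then show ?thesis using g(2)[OF True] by (simp add: ex_def)
      next
        case False
        then have n: "n \<ge> n0" using j by (auto simp: I_def)
        have w: "2 powr (2 * b' * real n) = r ^ n * 2 powr (2 * b * real n)"
          by (simp add: r_def powr_powr powr_add[symmetric] algebra_simps flip: powr_realpow)
        have "ennreal (2 powr (2 * b' * real n)) * hnorm2 s (c n j - ?d n j)
            = ennreal (r ^ n) * (ennreal (2 powr (2 * b * real n)) * hnorm2 s (c n j))"
          using False r unfolding w by (simp add: ex_def ennreal_mult mult.assoc)
        also have "\<dots> \<le> ennreal (r ^ n) * ennreal S"
          unfolding S(1)[symmetric] by (intro mult_left_mono array_norm_ge j) simp
        also have "\<dots> = ennreal (r ^ n * S)" using S r by (intro ennreal_mult[symmetric]) auto
        also have "\<dots> \<le> ennreal \<delta>" using n0[OF n] by (intro ennreal_leI) simp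
        finally show ?thesis .
      qed
    qed
    ultimately show ?thesis by blast
  qed
  show ?thesis
  proof (intro exI[of _ D] conjI)
    show "\<forall>d\<in>D. (\<forall>b. array_norm b s d < \<top>) \<and> (\<forall>T t. summable (\<lambda>n. level T d n t))"
      by (rule ballI) (rule nice)
    show "\<forall>b b' c \<delta>. b' < b \<longrightarrow> array_norm b s c < \<top> \<longrightarrow> 0 < \<delta> \<longrightarrow> (\<exists>d\<in>D. array_norm b' s (\<lambda>n j. c n j - d n j) \<le> ennreal \<delta>)"
      by (intro allI impI appr)
  qed (rule cD neD)+
qed

end

section \<open>Bochner integrability of random Faber-Schauder series\<close>

lemma AE_finite_of_power:
  assumes Z [measurable]: "Z \<in> borel_measurable M" and m: "m \<ge> 1" and fin: "(\<integral>\<^sup>+\<omega>. Z \<omega> ^ m \<partial>M) < \<top>"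
  shows "AE \<omega> in M. Z \<omega> < (\<top> :: ennreal)"
proof -
  have "AE \<omega> in M. Z \<omega> ^ m \<noteq> \<infinity>"
    by (rule nn_integral_PInf_AE) (use fin in auto)
  then show ?thesis
  proof eventually_elim
    fix \<omega> assume "Z \<omega> ^ m \<noteq> \<infinity>"
    then show "Z \<omega> < \<top>" using m by (cases "Z \<omega> = \<top>") (auto simp: less_top top_power_ennreal)
  qed
qed

context onb_weights
begin

lemma array_norm_measurable:
  assumes "\<And>n j. C n j \<in> borel_measurable M"
  shows "(\<lambda>\<omega>. array_norm b s (\<lambda>n j. C n j \<omega>)) \<in> borel_measurable M"
proof -
  note [measurable] = assms
  show ?thesis unfolding array_norm_def
    by (rule borel_measurable_SUP) (auto intro!: countableI_type borel_measurable_times_ennreal measurable_compose[OF assms borel_measurable_hnorm2])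
qed

text \<open>The n-th simple function selects, among the first n + 1 arrays of an enumerated dense
  set, one closest to the random array in the norm with weight b'. \<open>V\<close> and
  \<open>N\<close> are kept abstract so that the continuous and the Hoelder space are handled
  together; \<open>VN\<close> expresses that the b' norm controls both membership and N.\<close>

lemma bochner_Lp_faber:
  fixes C :: "nat \<Rightarrow> nat \<Rightarrow> 'w \<Rightarrow> 'h"
  assumes M: "finite_measure M" and C: "\<And>n j. C n j \<in> borel_measurable M"
    and VN: "\<And>c \<zeta>. 0 \<le> \<zeta> \<Longrightarrow> array_norm b' s c \<le> ennreal (\<zeta>\<^sup>2) \<Longrightarrow> (\<And>t. summable (\<lambda>n. level T c n t)) \<Longrightarrow>
      faber T c \<in> V \<and> 0 \<le> N (faber T c) \<and> N (faber T c) \<le> K * \<zeta>"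
    and K: "K > 0" and b: "b' < b"
    and X: "AE \<omega> in M. X \<omega> = faber T (\<lambda>n j. C n j \<omega>)"
    and sm: "AE \<omega> in M. \<forall>t. summable (\<lambda>n. level T (\<lambda>n j. C n j \<omega>) n t)"
    and mom: "(\<integral>\<^sup>+\<omega>. array_norm b s (\<lambda>n j. C n j \<omega>) ^ m \<partial>M) < \<top>" and m: "m \<ge> 1" and p: "0 \<le> p" "p \<le> 2 * real m"
  shows "bochner_Lp M V N p X"
proof -
  interpret finite_measure M by (rule M)
  define Z where "Z \<omega> = array_norm b s (\<lambda>n j. C n j \<omega>)" for \<omega>
  have Zm [measurable]: "Z \<in> borel_measurable M" unfolding Z_def[abs_def] by (rule array_norm_measurable[OF C])
  have Zfin: "AE \<omega> in M. Z \<omega> < \<top>" by (rule AE_finite_of_power[OF Zm m]) (use mom in \<open>simp add: Z_def\<close>)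
  obtain D where D': "countable D \<and> D \<noteq> {} \<and>
    (\<forall>d\<in>D. (\<forall>b. array_norm b s d < \<top>) \<and> (\<forall>T t. summable (\<lambda>n. level T d n t))) \<and>
    (\<forall>b b' c \<delta>. b' < b \<longrightarrow> array_norm b s c < \<top> \<longrightarrow> 0 < \<delta> \<longrightarrow> (\<exists>d\<in>D. array_norm b' s (\<lambda>n j. c n j - d n j) \<le> ennreal \<delta>))"
    using finite_arrays_dense[of s] by (rule exE)
  note D = D'[THEN conjunct1] D'[THEN conjunct2, THEN conjunct1]
    and Dn = D'[THEN conjunct2, THEN conjunct2, THEN conjunct1, THEN bspec]
    and Dd = D'[THEN conjunct2, THEN conjunct2, THEN conjunct2, rule_format]
  define d where "d = from_nat_into D"
  have dD: "d i \<in> D" for i unfolding d_def by (rule from_nat_into[OF D(2)])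
  define G where "G i \<omega> = array_norm b' s (\<lambda>n j. C n j \<omega> - d i n j)" for i \<omega>
  have Gm [measurable]: "G i \<in> borel_measurable M" for i
    unfolding G_def[abs_def] by (rule array_norm_measurable) (use C in measurable)
  \<comment> \<open>The running minimiser: the index changes when the new array is strictly closer.
    Defined by recursion, it is measurable step by step and takes finitely many values for each
    n.\<close>
  define sel where "sel = (\<lambda>n \<omega>. rec_nat (0::nat) (\<lambda>n i. if G (Suc n) \<omega> < G i \<omega> then Suc n else i) n)"
  have sel0: "sel 0 \<omega> = 0" and selS: "sel (Suc n) \<omega> = (if G (Suc n) \<omega> < G (sel n \<omega>) \<omega> then Suc n else sel n \<omega>)" for n \<omega>
    by (simp_all add: sel_def)
  have sel_le: "sel n \<omega> \<le> n" for n \<omega>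
    by (induction n) (auto simp: sel0 selS intro: le_SucI)
  have sel_min: "i \<le> n \<Longrightarrow> G (sel n \<omega>) \<omega> \<le> G i \<omega>" for i n \<omega>
  proof (induction n)
    case (Suc n)
    then show ?case by (cases "i = Suc n") (auto simp: selS le_Suc_eq not_less intro: order_trans less_imp_le)
  qed (simp add: sel0)
  have sel_m: "sel n \<in> measurable M (count_space UNIV)" for n
  proof (induction n)
    case 0
    have "sel 0 = (\<lambda>_. 0)" by (rule ext) (rule sel0)
    then show ?case by simp
  next
    case (Suc n)
    have [measurable]: "sel n \<in> measurable M (count_space UNIV)" by (rule Suc)
    have [measurable]: "(\<lambda>\<omega>. G (sel n \<omega>) \<omega>) \<in> borel_measurable M"
      by (rule measurable_compose_countable[OF Gm Suc])
    have "sel (Suc n) = (\<lambda>\<omega>. if G (Suc n) \<omega> < G (sel n \<omega>) \<omega> then Suc n else sel n \<omega>)" by (rule ext) (rule selS)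
    then show ?case by simp
  qed
  define f where "f n \<omega> = faber T (d (sel n \<omega>))" for n \<omega>
  have sf: "simple_function M (f n)" for n
  proof -
    have "simple_function M (sel n)"
      unfolding simple_function_def
    proof
      show "finite (sel n ` space M)" by (rule finite_subset[of _ "{..n}"]) (use sel_le in auto)
      show "\<forall>x\<in>sel n ` space M. sel n -` {x} \<inter> space M \<in> sets M"
        using measurable_sets[OF sel_m] by auto
    qed
    then have "simple_function M ((\<lambda>i. faber T (d i)) \<circ> sel n)" by (rule simple_function_compose)
    then show ?thesis by (simp only: f_def[abs_def] comp_def)
  qed
  have zeta: "array_norm b' s c \<le> ennreal ((sqrt (enn2real a))\<^sup>2)" if "array_norm b' s c \<le> a" "a < \<top>" for c a
    using that by (simp add: less_top)
  have fV: "f n ` space M \<subseteq> V" for n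
  proof
    fix y assume "y \<in> f n ` space M"
    then obtain i where y: "y = faber T (d i)" by (auto simp: f_def)
    have "array_norm b' s (d i) < \<top>" and sd: "summable (\<lambda>n. level T (d i) n t)" for t
      using Dn[OF dD, THEN conjunct1] Dn[OF dD, THEN conjunct2] by simp_all
    then show "y \<in> V" unfolding y using VN[OF _ zeta[OF order_refl]] by simp
  qed
  note [[linarith_split_limit = 0]]
  show ?thesis unfolding bochner_Lp_def
  proof (intro conjI exI[of _ f] allI sf fV)
    show "AE \<omega> in M. X \<omega> \<in> V" using X sm Zfin
    proof eventually_elim
      fix \<omega> assume x: "X \<omega> = faber T (\<lambda>n j. C n j \<omega>)" "\<forall>t. summable (\<lambda>n. level T (\<lambda>n j. C n j \<omega>) n t)" "Z \<omega> < \<top>"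
      have "array_norm b' s (\<lambda>n j. C n j \<omega>) \<le> Z \<omega>" unfolding Z_def using b by (intro array_norm_mono_weight) simp
      from VN[OF _ zeta[OF this x(3)]] x(1,2) show "X \<omega> \<in> V" by simp
    qed
    show "AE \<omega> in M. (\<lambda>n. N (\<lambda>t. f n \<omega> t - X \<omega> t)) \<longlonglongrightarrow> 0" using X sm Zfin
    proof eventually_elim
      fix \<omega> assume x: "X \<omega> = faber T (\<lambda>n j. C n j \<omega>)" "\<forall>t. summable (\<lambda>n. level T (\<lambda>n j. C n j \<omega>) n t)" "Z \<omega> < \<top>"
      let ?c = "\<lambda>n j. C n j \<omega>"
      define Dc where "Dc i = (\<lambda>n j. d i n j - ?c n j)" for i
      have lv: "level T (Dc i) n t = level T (d i) n t - level T ?c n t" for i n t unfolding Dc_def by (rule level_diff)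
      have sd: "summable (\<lambda>n. level T (d i) n t)" for i t using Dn[OF dD] by blast
      have smD: "summable (\<lambda>n. level T (Dc i) n t)" for i t
        unfolding lv using sd x(2) by (intro summable_diff) auto
      have fD: "(\<lambda>t. faber T (d i) t - X \<omega> t) = faber T (Dc i)" for i
      proof
        fix t
        show "faber T (d i) t - X \<omega> t = faber T (Dc i) t"
          unfolding x(1) faber_def lv using sd x(2) by (intro suminf_diff) auto
      qed
      have hd: "hnorm2 s (v - w) = hnorm2 s (w - v)" for v w
        unfolding hnorm2_def by (intro suminf_cong arg_cong[where f = ennreal])
          (simp add: power_mult_distrib inner_diff_left power2_commute[of "v \<bullet> _"])
      have GD: "array_norm b' s (Dc i) = G i \<omega>" for i
        unfolding G_def Dc_def array_norm_def by (simp only: hd)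
      have Gsmall: "\<exists>n0. \<forall>n\<ge>n0. G (sel n \<omega>) \<omega> \<le> ennreal \<delta>" if \<delta>: "\<delta> > 0" for \<delta>
      proof -
        obtain d0 where d0: "d0 \<in> D" "array_norm b' s (\<lambda>n j. ?c n j - d0 n j) \<le> ennreal \<delta>"
          using Dd[OF b x(3)[unfolded Z_def] \<delta>] by blast
        obtain i where "d i = d0" unfolding d_def using from_nat_into_surj[OF D(1) d0(1)] by blast
        then have "G i \<omega> \<le> ennreal \<delta>" using d0(2) by (simp add: G_def)
        then show ?thesis using sel_min[of i] order_trans by blast
      qed
      show "(\<lambda>n. N (\<lambda>t. f n \<omega> t - X \<omega> t)) \<longlonglongrightarrow> 0"
      proof (rule LIMSEQ_I)
        fix r :: real assume r: "0 < r"
        define z where "z = r / (2 * K)"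
        have z: "z > 0" using r K by (simp add: z_def)
        then obtain n0 where n0: "\<And>n. n \<ge> n0 \<Longrightarrow> G (sel n \<omega>) \<omega> \<le> ennreal (z\<^sup>2)" using Gsmall[of "z\<^sup>2"] by auto
        have "norm (N (\<lambda>t. f n \<omega> t - X \<omega> t) - 0) < r" if "n \<ge> n0" for n
        proof -
          have "0 \<le> N (faber T (Dc (sel n \<omega>))) \<and> N (faber T (Dc (sel n \<omega>))) \<le> K * z"
            using VN[of z "Dc (sel n \<omega>)"] z n0[OF that] smD unfolding GD by simp
          moreover have "K * z < r" using r K by (simp add: z_def)
          ultimately show ?thesis unfolding f_def fD by simp
        qed
        then show "\<exists>n0. \<forall>n\<ge>n0. norm (N (\<lambda>t. f n \<omega> t - X \<omega> t) - 0) < r" by blast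
      qed
    qed
    have le: "AE \<omega> in M. ennreal (N (X \<omega>) powr p) \<le> ennreal (K powr p) * (1 + Z \<omega> ^ m)" using X sm Zfin
    proof eventually_elim
      fix \<omega> assume x: "X \<omega> = faber T (\<lambda>n j. C n j \<omega>)" "\<forall>t. summable (\<lambda>n. level T (\<lambda>n j. C n j \<omega>) n t)" "Z \<omega> < \<top>"
      let ?z = "sqrt (enn2real (Z \<omega>))"
      have z0: "0 \<le> ?z" by simp
      have "array_norm b' s (\<lambda>n j. C n j \<omega>) \<le> Z \<omega>" unfolding Z_def using b by (intro array_norm_mono_weight) simp
      from VN[OF z0 zeta[OF this x(3)]] x(1,2) have NX: "0 \<le> N (X \<omega>)" "N (X \<omega>) \<le> K * ?z" by simp_all
      have "N (X \<omega>) powr p \<le> (K * ?z) powr p" using NX p by (intro powr_mono2) auto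
      also have "\<dots> = K powr p * ?z powr p" using K by (simp add: powr_mult)
      \<comment> \<open>N(X) is at most K times the root of Z, so its p-th power involves Z^(p/2).
        As p <= 2m this is below 1 + Z^m, whatever the size of Z.\<close>
      also have "?z powr p \<le> 1 + enn2real (Z \<omega>) ^ m"
      proof (cases "?z \<le> 1")
        case True
        then have "?z powr p \<le> 1 powr p" using p z0 by (intro powr_mono2) auto
        then show ?thesis using zero_le_power[OF enn2real_nonneg, of "Z \<omega>" m] by (simp only: powr_one_eq_one)
      next
        case False
        then have z1: "1 < ?z" by simp
        then have "?z powr p \<le> ?z powr (2 * real m)" using p by (intro powr_mono) auto
        also have "\<dots> = ?z ^ (2 * m)" using z1 powr_realpow[of ?z "2 * m"] by simp
        also have "\<dots> = (?z\<^sup>2) ^ m" by (rule power_mult)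
        also have "?z\<^sup>2 = enn2real (Z \<omega>)" by simp
        finally show ?thesis by simp
      qed
      finally have "N (X \<omega>) powr p \<le> K powr p * (1 + enn2real (Z \<omega>) ^ m)" by (simp add: mult_left_mono)
      then have "ennreal (N (X \<omega>) powr p) \<le> ennreal (K powr p * (1 + enn2real (Z \<omega>) ^ m))" by (rule ennreal_leI)
      also have "\<dots> = ennreal (K powr p) * (1 + ennreal (enn2real (Z \<omega>)) ^ m)"
      proof -
        have "ennreal (1 + enn2real (Z \<omega>) ^ m) = 1 + ennreal (enn2real (Z \<omega>)) ^ m"
          using ennreal_plus[of 1 "enn2real (Z \<omega>) ^ m"] ennreal_power[of "enn2real (Z \<omega>)" m] by simp
        moreover have "ennreal (K powr p * (1 + enn2real (Z \<omega>) ^ m)) = ennreal (K powr p) * ennreal (1 + enn2real (Z \<omega>) ^ m)"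
          by (rule ennreal_mult) simp_all
        ultimately show ?thesis by (simp only:)
      qed
      also have "ennreal (enn2real (Z \<omega>)) = Z \<omega>" using x(3) by (simp add: less_top)
      finally show "ennreal (N (X \<omega>) powr p) \<le> ennreal (K powr p) * (1 + Z \<omega> ^ m)" .
    qed
    have "(\<integral>\<^sup>+\<omega>. ennreal (N (X \<omega>) powr p) \<partial>M) \<le> (\<integral>\<^sup>+\<omega>. ennreal (K powr p) * (1 + Z \<omega> ^ m) \<partial>M)"
      by (rule nn_integral_mono_AE[OF le])
    also have "\<dots> = ennreal (K powr p) * ((\<integral>\<^sup>+\<omega>. 1 \<partial>M) + (\<integral>\<^sup>+\<omega>. Z \<omega> ^ m \<partial>M))"
      by (simp add: nn_integral_cmult nn_integral_add)
    also have "\<dots> < \<infinity>"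
    proof -
      have "emeasure M (space M) < \<top>"
        using emeasure_finite[of "space M"] by (simp only: less_top infinity_ennreal_def)
      then have "(\<integral>\<^sup>+\<omega>. 1 \<partial>M) + (\<integral>\<^sup>+\<omega>. Z \<omega> ^ m \<partial>M) < \<top>"
        using mom by (simp add: Z_def)
      then show ?thesis by (simp add: ennreal_mult_less_top)
    qed
    finally show "(\<integral>\<^sup>+\<omega>. ennreal (N (X \<omega>) powr p) \<partial>M) < \<infinity>" .
  qed
qed

text \<open>Replacing the supremum by the sum of the m-th powers costs the number of coefficients
  per level. This is the origin of the summand 1 in
  \<open>2 * real m * b + 1 < \<theta> * real m\<close>, that is, of the loss 1/(2m) in the
  exponent.\<close>

lemma array_norm_power_le:
  assumes m: "m \<ge> 1"
  shows "array_norm b s c ^ m \<le> (\<Sum>n. \<Sum>j\<in>level_index n. ennreal ((2 powr (2 * b * real n)) ^ m) * hnorm2 s (c n j) ^ m)" (is "_ \<le> ?S")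
proof (cases ?S)
  case top
  then show ?thesis by simp
next
  case (real \<sigma>)
  have "array_norm b s c \<le> ennreal (root m \<sigma>)"
  proof (rule array_norm_le, rule ennreal_le_root[OF _ m])
    fix n j assume j: "j \<in> level_index n"
    let ?g = "\<lambda>n j. ennreal ((2 powr (2 * b * real n)) ^ m) * hnorm2 s (c n j) ^ m"
    have "(ennreal (2 powr (2 * b * real n)) * hnorm2 s (c n j)) ^ m = ?g n j"
      by (simp add: power_mult_distrib ennreal_power)
    also have "\<dots> \<le> (\<Sum>j\<in>level_index n. ?g n j)" by (rule member_le_sum[OF j]) auto
    also have "\<dots> = (\<Sum>i\<in>{n}. \<Sum>j\<in>level_index i. ?g i j)" by simp
    also have "\<dots> \<le> ?S" by (rule sum_le_suminf) auto
    finally show "(ennreal (2 powr (2 * b * real n)) * hnorm2 s (c n j)) ^ m \<le> ennreal \<sigma>" using real by simp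
  qed (use real in simp)
  then have "array_norm b s c ^ m \<le> ennreal (root m \<sigma>) ^ m" by (rule power_mono) simp
  also have "\<dots> = ennreal \<sigma>" using real m by (simp add: ennreal_power real_root_ge_zero)
  finally show ?thesis using real by simp
qed

end

section \<open>Faber-Schauder coefficients of the stochastic convolution\<close>

context stochastic_conv
begin

text \<open>The extension by 0 beyond \<open>T\<close> is the one that interpolation at the nodes
  asks for at level 0.\<close>

definition C :: "nat \<Rightarrow> nat \<Rightarrow> 'w \<Rightarrow> 'h" where
  "C n j \<omega> = coef T (\<lambda>t. if t \<le> T then X t \<omega> else 0) n j"

lemma node_nonneg: "0 \<le> node T n i" using T by (simp add: node_def)

lemma C_measurable: "C n j \<in> borel_measurable M"
proof -
  have "(\<lambda>\<omega>. if t \<le> T then X t \<omega> else 0) \<in> borel_measurable M" if "t \<ge> 0" for t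
    using X_measurable[OF that] by (cases "t \<le> T") auto
  note Y = this[OF node_nonneg]
  show ?thesis unfolding C_def[abs_def] coef_def
    by (intro borel_measurable_diff borel_measurable_scaleR borel_measurable_const Y)
qed

lemma hnorm2_half_diff: "hnorm2 s ((1/2) *\<^sub>R v - (1/2) *\<^sub>R w) \<le> hnorm2 s v + hnorm2 s w"
proof -
  have "hnorm2 s ((1/2) *\<^sub>R v - (1/2) *\<^sub>R w)
      \<le> (\<Sum>k. ennreal ((lam k powr (s / 2) * (v \<bullet> e k))\<^sup>2) + ennreal ((lam k powr (s / 2) * (w \<bullet> e k))\<^sup>2))"
    unfolding hnorm2_def
  proof (intro suminf_le allI)
    fix k
    have sq: "((x - y) / 2)\<^sup>2 \<le> x\<^sup>2 + y\<^sup>2" for x y :: real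
    proof -
      have "4 * (x\<^sup>2 + y\<^sup>2) - (x - y)\<^sup>2 = (x + y)\<^sup>2 + 2 * x\<^sup>2 + 2 * y\<^sup>2" by (simp add: power2_eq_square algebra_simps)
      then have "(x - y)\<^sup>2 \<le> 4 * (x\<^sup>2 + y\<^sup>2)"
        using zero_le_power2[of "x + y"] zero_le_power2[of x] zero_le_power2[of y] by linarith
      then show ?thesis by (simp add: power_divide)
    qed
    have "(lam k powr (s / 2) * (((1/2) *\<^sub>R v - (1/2) *\<^sub>R w) \<bullet> e k))\<^sup>2
        = ((lam k powr (s / 2) * (v \<bullet> e k) - lam k powr (s / 2) * (w \<bullet> e k)) / 2)\<^sup>2"
      by (simp add: inner_diff_left right_diff_distrib diff_divide_distrib)
    also have "\<dots> \<le> (lam k powr (s / 2) * (v \<bullet> e k))\<^sup>2 + (lam k powr (s / 2) * (w \<bullet> e k))\<^sup>2" by (rule sq)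
    finally show "ennreal ((lam k powr (s / 2) * (((1/2) *\<^sub>R v - (1/2) *\<^sub>R w) \<bullet> e k))\<^sup>2)
        \<le> ennreal ((lam k powr (s / 2) * (v \<bullet> e k))\<^sup>2) + ennreal ((lam k powr (s / 2) * (w \<bullet> e k))\<^sup>2)"
      by (simp add: ennreal_plus[symmetric] ennreal_leI del: ennreal_plus)
  qed auto
  also have "\<dots> = hnorm2 s v + hnorm2 s w" unfolding hnorm2_def by (rule suminf_add[symmetric]) auto
  finally show ?thesis .
qed

text \<open>For n >= 1 a second difference is half the difference of two neighbouring increments. At
  level 0 the coefficient is a single increment over [0,T], which is listed twice to keep one form
  for all levels.\<close>

lemma C_increments:
  assumes j: "j \<in> level_index n"
  shows "\<exists>x0 x1 y0 y1. 0 \<le> x0 \<and> x0 \<le> x1 \<and> x1 \<le> T \<and> x1 - x0 = T / 2 ^ n \<and> 0 \<le> y0 \<and> y0 \<le> y1 \<and> y1 \<le> T \<and> y1 - y0 = T / 2 ^ n \<and>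
    (\<forall>\<omega> s. hnorm2 s (C n j \<omega>) \<le> hnorm2 s (X x1 \<omega> - X x0 \<omega>) + hnorm2 s (X y1 \<omega> - X y0 \<omega>))"
proof (cases n)
  case 0
  then have j0: "j = 0" using j by (simp add: level_index_def)
  have n: "node T 0 (Suc 0) = T" "node T 0 0 = 0" "node T 0 (Suc (Suc 0)) = 2 * T" by (simp_all add: node_def)
  have "C n j \<omega> = X T \<omega> - X 0 \<omega>" for \<omega> using T by (simp add: C_def coef_def 0 j0 n numeral_2_eq_2)
  then have "hnorm2 s (C n j \<omega>) \<le> hnorm2 s (X T \<omega> - X 0 \<omega>) + hnorm2 s (X T \<omega> - X 0 \<omega>)" for s \<omega>
    by (simp add: add_increasing2)
  moreover have "0 \<le> T" "T - 0 = T / 2 ^ n" using T 0 by simp_all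
  ultimately show ?thesis by blast
next
  case (Suc n')
  let ?x = "\<lambda>i. node T n (2 * j + i)"
  have "2 * j < 2 * 2 ^ n'" using j Suc by (simp add: level_index_def)
  then have "Suc j \<le> 2 ^ n'" by simp
  then have "2 * j + 2 \<le> 2 ^ n" using Suc by simp
  then have le: "real (2 * j + 2) \<le> 2 ^ n" by (metis of_nat_le_iff of_nat_numeral of_nat_power)
  have gap: "?x (Suc i) - ?x i = T / 2 ^ n" for i by (simp add: node_def diff_divide_distrib[symmetric] right_diff_distrib[symmetric])
  have xT: "?x 2 \<le> T" unfolding node_def using mult_left_mono[OF le, of T] T by (simp add: pos_divide_le_eq)
  have g: "?x 1 - ?x 0 = T / 2 ^ n" "?x 2 - ?x 1 = T / 2 ^ n" using gap[of 0] gap[of 1] by (simp_all add: numeral_2_eq_2)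
  have pos: "0 < T / 2 ^ n" using T by simp
  have ord: "?x 0 \<le> ?x 1" "?x 1 \<le> ?x 2" "?x 1 \<le> T" "0 \<le> ?x 0" "0 \<le> ?x 1"
    using g pos xT node_nonneg[of n "2 * j + 0"] by linarith+
  have Ceq: "C n j \<omega> = (1/2) *\<^sub>R (X (?x 1) \<omega> - X (?x 0) \<omega>) - (1/2) *\<^sub>R (X (?x 2) \<omega> - X (?x 1) \<omega>)" for \<omega>
  proof -
    have "C n j \<omega> = X (?x 1) \<omega> - (1/2) *\<^sub>R X (?x 0) \<omega> - (1/2) *\<^sub>R X (?x 2) \<omega>"
      using ord xT by (simp add: C_def coef_def)
    also have "X (?x 1) \<omega> = (1/2) *\<^sub>R X (?x 1) \<omega> + (1/2) *\<^sub>R X (?x 1) \<omega>" by (simp add: scaleR_add_left[symmetric])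
    finally show ?thesis by (simp only: scaleR_diff_right) (simp only: algebra_simps)
  qed
  show ?thesis
    by (rule exI[of _ "?x 0"], rule exI[of _ "?x 1"], rule exI[of _ "?x 1"], rule exI[of _ "?x 2"])
      (use ord xT g hnorm2_half_diff in \<open>auto simp only: Ceq\<close>)
qed

lemma C_moment:
  assumes m: "m \<ge> 1" and A: "A \<ge> 0"
    and mom: "\<And>t' t. 0 \<le> t' \<Longrightarrow> t' \<le> t \<Longrightarrow> t \<le> T \<Longrightarrow>
      (\<integral>\<^sup>+\<omega>. (hnorm2 s (X t \<omega> - X t' \<omega>)) ^ m \<partial>M) \<le> ennreal (gaussian_moment m * (A * (t - t') powr \<theta>) ^ m)"
    and j: "j \<in> level_index n"
  shows "(\<integral>\<^sup>+\<omega>. hnorm2 s (C n j \<omega>) ^ m \<partial>M) \<le> ennreal (2 * 2 ^ m * (gaussian_moment m * (A * (T / 2 ^ n) powr \<theta>) ^ m))"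
proof -
  let ?g = "gaussian_moment m * (A * (T / 2 ^ n) powr \<theta>) ^ m"
  have g0: "0 \<le> ?g" using A gaussian_moment_nonneg[of m] by simp
  obtain x0 x1 y0 y1 where x: "0 \<le> x0" "x0 \<le> x1" "x1 \<le> T" "x1 - x0 = T / 2 ^ n" and y: "0 \<le> y0" "y0 \<le> y1" "y1 \<le> T" "y1 - y0 = T / 2 ^ n"
    and le: "\<And>\<omega>. hnorm2 s (C n j \<omega>) \<le> hnorm2 s (X x1 \<omega> - X x0 \<omega>) + hnorm2 s (X y1 \<omega> - X y0 \<omega>)"
    using C_increments[OF j] by blast
  have [measurable]: "X x0 \<in> borel_measurable M" "X x1 \<in> borel_measurable M" "X y0 \<in> borel_measurable M" "X y1 \<in> borel_measurable M"
    using x y by (intro X_measurable; linarith)+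
  have "(\<integral>\<^sup>+\<omega>. hnorm2 s (C n j \<omega>) ^ m \<partial>M)
      \<le> (\<integral>\<^sup>+\<omega>. 2 ^ m * (hnorm2 s (X x1 \<omega> - X x0 \<omega>) ^ m + hnorm2 s (X y1 \<omega> - X y0 \<omega>) ^ m) \<partial>M)"
    by (intro nn_integral_mono order_trans[OF power_mono[OF le] ennreal_add_power_le]) simp
  also have "\<dots> = 2 ^ m * ((\<integral>\<^sup>+\<omega>. hnorm2 s (X x1 \<omega> - X x0 \<omega>) ^ m \<partial>M) + (\<integral>\<^sup>+\<omega>. hnorm2 s (X y1 \<omega> - X y0 \<omega>) ^ m \<partial>M))"
    by (simp add: nn_integral_cmult nn_integral_add)
  also have "\<dots> \<le> 2 ^ m * (ennreal ?g + ennreal ?g)"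
    using mom[OF x(1-3)] mom[OF y(1-3)] unfolding x(4) y(4) by (intro mult_left_mono add_mono) auto
  also have "\<dots> = ennreal (2 ^ m) * ennreal (?g + ?g)"
  proof -
    have "(2::ennreal) ^ m = ennreal (2 ^ m)" using ennreal_power[of 2 m] by simp
    moreover have "ennreal ?g + ennreal ?g = ennreal (?g + ?g)" by (rule ennreal_plus[symmetric, OF g0 g0])
    ultimately show ?thesis by (simp only:)
  qed
  also have "\<dots> = ennreal (2 ^ m * (?g + ?g))" using g0 by (intro ennreal_mult[symmetric]) auto
  also have "2 ^ m * (?g + ?g) = 2 * 2 ^ m * ?g" by simp
  finally show ?thesis .
qed

text \<open>Level n has at most 2^n coefficients, each with moment of order 2^(-\<theta> n m),
  against a weight 2^(2 b n m). The premise on \<open>b\<close> says that the ratio of the resulting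
  geometric series is below 1.\<close>

lemma array_moment:
  assumes m: "m \<ge> 1" and A: "A \<ge> 0"
    and mom: "\<And>t' t. 0 \<le> t' \<Longrightarrow> t' \<le> t \<Longrightarrow> t \<le> T \<Longrightarrow>
      (\<integral>\<^sup>+\<omega>. (hnorm2 s (X t \<omega> - X t' \<omega>)) ^ m \<partial>M) \<le> ennreal (gaussian_moment m * (A * (t - t') powr \<theta>) ^ m)"
    and b: "2 * real m * b + 1 < \<theta> * real m"
  shows "(\<integral>\<^sup>+\<omega>. array_norm b s (\<lambda>n j. C n j \<omega>) ^ m \<partial>M) < \<top>"
proof -
  define x where "x = (2::real) powr (1 + 2 * real m * b - \<theta> * real m)"
  have x: "0 < x" "x < 1" using b powr_less_mono[of "1 + 2 * real m * b - \<theta> * real m" 0 2] by (auto simp: x_def)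
  define c where "c = 2 * 2 ^ m * (gaussian_moment m * (A * T powr \<theta>) ^ m)"
  have c0: "0 \<le> c" using A gaussian_moment_nonneg[of m] by (simp add: c_def)
  have Cm: "(\<lambda>\<omega>. ennreal w * hnorm2 s (C n j \<omega>) ^ m) \<in> borel_measurable M" for w n j
    using measurable_compose[OF C_measurable borel_measurable_hnorm2[of s]] by measurable
  have "(\<integral>\<^sup>+\<omega>. array_norm b s (\<lambda>n j. C n j \<omega>) ^ m \<partial>M)
      \<le> (\<integral>\<^sup>+\<omega>. (\<Sum>n. \<Sum>j\<in>level_index n. ennreal ((2 powr (2 * b * real n)) ^ m) * hnorm2 s (C n j \<omega>) ^ m) \<partial>M)"
    by (intro nn_integral_mono array_norm_power_le m)
  also have "\<dots> = (\<Sum>n. \<integral>\<^sup>+\<omega>. (\<Sum>j\<in>level_index n. ennreal ((2 powr (2 * b * real n)) ^ m) * hnorm2 s (C n j \<omega>) ^ m) \<partial>M)"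
    by (intro nn_integral_suminf borel_measurable_sum Cm)
  also have "\<dots> \<le> (\<Sum>n. ennreal (c * x ^ n))"
  proof (intro suminf_le allI)
    fix n
    let ?w = "(2 powr (2 * b * real n)) ^ m"
    let ?g = "2 * 2 ^ m * (gaussian_moment m * (A * (T / 2 ^ n) powr \<theta>) ^ m)"
    have g0: "0 \<le> ?g" using A gaussian_moment_nonneg[of m] by simp
    have "level_index n \<subseteq> {..<2 ^ n}" by (auto simp: level_index_def)
    from card_mono[OF finite_lessThan this] have cd: "card (level_index n) \<le> 2 ^ n" by simp
    have "(\<integral>\<^sup>+\<omega>. (\<Sum>j\<in>level_index n. ennreal ?w * hnorm2 s (C n j \<omega>) ^ m) \<partial>M)
        = (\<Sum>j\<in>level_index n. \<integral>\<^sup>+\<omega>. ennreal ?w * hnorm2 s (C n j \<omega>) ^ m \<partial>M)"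
      by (intro nn_integral_sum Cm)
    also have "\<dots> \<le> (\<Sum>j\<in>level_index n. ennreal (?w * ?g))"
    proof (rule sum_mono)
      fix j assume j: "j \<in> level_index n"
      have "(\<integral>\<^sup>+\<omega>. ennreal ?w * hnorm2 s (C n j \<omega>) ^ m \<partial>M) = ennreal ?w * (\<integral>\<^sup>+\<omega>. hnorm2 s (C n j \<omega>) ^ m \<partial>M)"
        using Cm[of 1 n j] by (intro nn_integral_cmult) simp
      also have "\<dots> \<le> ennreal ?w * ennreal ?g" by (intro mult_left_mono C_moment[OF m A mom j]) auto
      also have "\<dots> = ennreal (?w * ?g)" using g0 by (intro ennreal_mult[symmetric]) auto
      finally show "(\<integral>\<^sup>+\<omega>. ennreal ?w * hnorm2 s (C n j \<omega>) ^ m \<partial>M) \<le> ennreal (?w * ?g)" .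
    qed
    also have "\<dots> = ennreal (real (card (level_index n)) * (?w * ?g))"
      using g0 by (simp add: ennreal_mult ennreal_of_nat_eq_real_of_nat)
    also have "\<dots> \<le> ennreal (2 ^ n * (?w * ?g))"
    proof (intro ennreal_leI mult_right_mono)
      show "real (card (level_index n)) \<le> 2 ^ n" using cd by (metis of_nat_le_iff of_nat_numeral of_nat_power)
    qed (use g0 in simp)
    also have "2 ^ n * (?w * ?g) = c * x ^ n"
    proof -
      have 1: "(T / 2 ^ n) powr \<theta> = T powr \<theta> * 2 powr (- \<theta> * real n)"
        using T by (simp add: powr_divide powr_minus_divide powr_powr mult.commute flip: powr_realpow)
      have pw: "((2::real) powr a) ^ k = 2 powr (real k * a)" for a k by (simp add: powr_powr mult.commute flip: powr_realpow)
      have "2 ^ n * ?w * (2 powr (- \<theta> * real n)) ^ m = x ^ n"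
        unfolding x_def pw by (simp add: powr_add[symmetric] algebra_simps flip: powr_realpow)
      then show ?thesis unfolding c_def 1 power_mult_distrib by (simp add: mult_ac)
    qed
    finally show "(\<integral>\<^sup>+\<omega>. (\<Sum>j\<in>level_index n. ennreal ?w * hnorm2 s (C n j \<omega>) ^ m) \<partial>M) \<le> ennreal (c * x ^ n)" .
  qed auto
  also have "\<dots> < \<top>"
  proof -
    have "summable (\<lambda>n. c * x ^ n)" using x by (intro summable_mult summable_geometric) auto
    then have "(\<Sum>n. ennreal (c * x ^ n)) \<noteq> \<top>" using c0 x by (intro ennreal_suminf_neq_top) auto
    then show ?thesis by (simp add: less_top)
  qed
  finally show ?thesis .
qed

end

subsection \<open>The continuous modification\<close>

context stochastic_conv
begin

text \<open>Three exponents are kept apart: \<open>b\<close> for which the moments are finite, b' <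
  b in whose norm finite arrays approximate, and \<beta> < b' for which that norm controls the
  Hoelder quotients.\<close>

lemma bochner_Lp_paths:
  assumes A: "A \<ge> 0"
    and mom: "\<And>t' t. 0 \<le> t' \<Longrightarrow> t' \<le> t \<Longrightarrow> t \<le> T \<Longrightarrow>
      (\<integral>\<^sup>+\<omega>. (hnorm2 s (X t \<omega> - X t' \<omega>)) ^ m \<partial>M) \<le> ennreal (gaussian_moment m * (A * (t - t') powr \<theta>) ^ m)"
    and m: "m \<ge> 1" and b: "2 * real m * b + 1 < \<theta> * real m" "b' < b"
    and \<beta>: "0 < \<beta>" "\<beta> \<le> 1" "\<beta> < b'" and p: "0 \<le> p" "p \<le> 2 * real m"
    and WS: "AE \<omega> in M. Y \<omega> = faber T (\<lambda>n j. C n j \<omega>)"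
    and sm: "AE \<omega> in M. \<forall>t. summable (\<lambda>n. level T (\<lambda>n j. C n j \<omega>) n t)"
  shows "bochner_Lp M (cont_space e lam s T) (cont_norm e lam s T) p Y"
    "bochner_Lp M (hoelder_space e lam s T \<beta>) (hoelder_norm e lam s T \<beta>) p Y"
proof -
  obtain K where K: "K > 0" and f: "\<And>c \<zeta>. 0 \<le> \<zeta> \<Longrightarrow> array_norm b' s c \<le> ennreal (\<zeta>\<^sup>2) \<Longrightarrow> (\<forall>t. summable (\<lambda>n. level T c n t)) \<Longrightarrow>
    (faber T c \<in> cont_space e lam s T \<and> 0 \<le> cont_norm e lam s T (faber T c) \<and> cont_norm e lam s T (faber T c) \<le> K * \<zeta>) \<and>
    (faber T c \<in> hoelder_space e lam s T \<beta> \<and> 0 \<le> hoelder_norm e lam s T \<beta> (faber T c) \<and> hoelder_norm e lam s T \<beta> (faber T c) \<le> K * \<zeta>)"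
    using faber_spaces[OF T \<beta>, of s] by blast
  have fm: "finite_measure M" by unfold_locales
  note am = array_moment[OF m A mom b(1)]
  show "bochner_Lp M (cont_space e lam s T) (cont_norm e lam s T) p Y"
    by (rule bochner_Lp_faber[OF fm C_measurable _ K b(2) WS sm am m p]) (use f in blast)
  show "bochner_Lp M (hoelder_space e lam s T \<beta>) (hoelder_norm e lam s T \<beta>) p Y"
    by (rule bochner_Lp_faber[OF fm C_measurable _ K b(2) WS sm am m p]) (use f in blast)
qed

text \<open>One null set has to serve all orders s < smax. Finiteness of the array norm is secured
  at countably many orders tending to smax and inherited by the lower ones; order 0 is included
  because it gives convergence of the series in H. The series agrees with X at dyadic times, and
  mean square continuity of X identifies it at every other time.\<close>

lemma continuous_modification:
  assumes lam: "\<And>k. lam k \<ge> l0" "l0 > 0" and smax: "smax > 0" and \<rho>: "\<rho> > 0"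
    and mom: "\<forall>s \<theta>. 0 \<le> \<theta> \<longrightarrow> \<theta> \<le> 1 \<longrightarrow> \<theta> \<le> (smax - s) * \<rho> \<longrightarrow> (\<exists>A\<ge>0. \<forall>m\<ge>1. \<forall>t' t. 0 \<le> t' \<longrightarrow> t' \<le> t \<longrightarrow> t \<le> T \<longrightarrow>
      (\<integral>\<^sup>+\<omega>. (hnorm2 s (X t \<omega> - X t' \<omega>)) ^ m \<partial>M) \<le> ennreal (gaussian_moment m * (A * (t - t') powr \<theta>) ^ m))"
  shows "\<exists>WS. (\<forall>t\<in>{0..T}. WS t \<in> borel_measurable M \<and> (AE \<omega> in M. WS t \<omega> = X t \<omega>)) \<and>
    (\<forall>s<smax. \<forall>\<omega>\<in>space M. (\<lambda>t. WS t \<omega>) \<in> cont_space e lam s T) \<and>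
    (AE \<omega> in M. (\<lambda>t. WS t \<omega>) = faber T (\<lambda>n j. C n j \<omega>)) \<and>
    (AE \<omega> in M. \<forall>t. summable (\<lambda>n. level T (\<lambda>n j. C n j \<omega>) n t))"
proof -
  have l: "lam k > 0" for k using lam(1)[of k] lam(2) by linarith
  define a where "a b s \<omega> = array_norm b s (\<lambda>n j. C n j \<omega>)" for b s \<omega>
  have "\<exists>b. b > 0 \<and> (AE \<omega> in M. a b s \<omega> < \<top>)" if s: "s < smax" for s
  proof -
    define \<theta> where "\<theta> = min 1 ((smax - s) * \<rho>)"
    have th: "0 < \<theta>" "\<theta> \<le> 1" "\<theta> \<le> (smax - s) * \<rho>" using s \<rho> by (auto simp: \<theta>_def)
    obtain A where A: "A \<ge> 0" "\<And>m t' t. m \<ge> 1 \<Longrightarrow> 0 \<le> t' \<Longrightarrow> t' \<le> t \<Longrightarrow> t \<le> T \<Longrightarrow>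
      (\<integral>\<^sup>+\<omega>. (hnorm2 s (X t \<omega> - X t' \<omega>)) ^ m \<partial>M) \<le> ennreal (gaussian_moment m * (A * (t - t') powr \<theta>) ^ m)"
      using mom[rule_format, of \<theta> s] th by force
    \<comment> \<open>m \<theta> > 2 leaves room for the weight \<theta>/4 in the moment condition,
      which then reads 1 < m \<theta>/2.\<close>
    obtain m :: nat where m: "2 / \<theta> < real m" using reals_Archimedean2 by blast
    have "0 < 2 / \<theta>" using th by simp
    then have "0 < real m" using m by linarith
    then have m1: "m \<ge> 1" by simp
    have "2 < real m * \<theta>" using m th by (simp add: pos_divide_less_eq)
    then have b: "2 * real m * (\<theta> / 4) + 1 < \<theta> * real m" by (simp add: field_simps)
    have "(\<integral>\<^sup>+\<omega>. a (\<theta> / 4) s \<omega> ^ m \<partial>M) < \<top>" unfolding a_def by (rule array_moment[OF m1 A(1) A(2)[OF m1] b])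
    then have "AE \<omega> in M. a (\<theta> / 4) s \<omega> < \<top>"
      by (rule AE_finite_of_power[OF _ m1, rotated]) (unfold a_def, rule array_norm_measurable[OF C_measurable])
    then show ?thesis using th by (intro exI[of _ "\<theta> / 4"]) simp
  qed
  then obtain bb where bb: "\<And>s. s < smax \<Longrightarrow> bb s > 0" "\<And>s. s < smax \<Longrightarrow> AE \<omega> in M. a (bb s) s \<omega> < \<top>" by metis
  define S where "S = insert 0 (range (\<lambda>i. smax - inverse (real (Suc i))))"
  have S: "countable S" "\<And>s. s \<in> S \<Longrightarrow> s < smax" using smax by (auto simp: S_def)
  have "AE \<omega> in M. \<forall>s\<in>S. a (bb s) s \<omega> < \<top>" by (subst AE_ball_countable[OF S(1)]) (use S(2) bb(2) in blast)
  then obtain N where N: "{\<omega> \<in> space M. \<not> (\<forall>s\<in>S. a (bb s) s \<omega> < \<top>)} \<subseteq> N" "emeasure M N = 0" "N \<in> sets M"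
    by (rule AE_E)
  have good: "a (bb s) s \<omega> < \<top>" if "\<omega> \<in> space M" "\<omega> \<notin> N" "s \<in> S" for s \<omega> using N(1) that by blast
  have AEN: "AE \<omega> in M. \<omega> \<in> space M \<and> \<omega> \<notin> N"
    using AE_not_in[of N M] AE_space[of M] N(2,3) by (auto simp: null_sets_def)
  define f where "f \<omega> = faber T (\<lambda>n j. C n j \<omega>)" for \<omega>
  have zS: "0 \<in> S" by (simp add: S_def)
  have gsm: "summable (\<lambda>n. level T (\<lambda>n j. C n j \<omega>) n t)" if "\<omega> \<in> space M" "\<omega> \<notin> N" for \<omega> t
    using good[OF that zS] by (intro array_norm_summable[OF T bb(1)[OF smax] l]) (simp add: a_def)
  have gcont: "f \<omega> \<in> cont_space e lam s T" if w: "\<omega> \<in> space M" "\<omega> \<notin> N" and s: "s < smax" for \<omega> s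
  proof -
    obtain i where i: "inverse (real (Suc i)) < smax - s" using reals_Archimedean[of "smax - s"] s by auto
    define s' where "s' = smax - inverse (real (Suc i))"
    have s': "s' \<in> S" "s \<le> s'" using i by (auto simp: s'_def S_def)
    let ?b = "bb s'"
    have b: "?b > 0" using bb(1)[OF S(2)[OF s'(1)]] .
    have "array_norm ?b s (\<lambda>n j. C n j \<omega>) \<le> ennreal (l0 powr (s - s')) * a ?b s' \<omega>"
      unfolding a_def by (rule array_norm_mono_order[OF lam s'(2)])
    also have "\<dots> < \<top>" using good[OF w s'(1)] by (simp add: ennreal_mult_less_top)
    finally have fin: "array_norm ?b s (\<lambda>n j. C n j \<omega>) < \<top>" .
    let ?z = "sqrt (enn2real (array_norm ?b s (\<lambda>n j. C n j \<omega>)))"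
    have z: "0 \<le> ?z" "array_norm ?b s (\<lambda>n j. C n j \<omega>) \<le> ennreal (?z\<^sup>2)" using fin by (simp_all add: less_top)
    have "0 < min 1 (?b / 2)" "min 1 (?b / 2) \<le> 1" "min 1 (?b / 2) < ?b" using b by auto
    from faber_spaces[OF T this, of s] z gsm[OF w] show ?thesis unfolding f_def by blast
  qed
  \<comment> \<open>The zero path on the null set makes every path continuous, not just almost every
    one.\<close>
  define WS where "WS t \<omega> = (if \<omega> \<in> N then 0 else f \<omega> t)" for t \<omega>
  have fm: "(\<lambda>\<omega>. f \<omega> t) \<in> borel_measurable M" for t
  proof -
    note [measurable] = C_measurable
    show ?thesis unfolding f_def faber_def level_def suminf_eq_lim
      by (rule borel_measurable_lim_metric) measurable
  qed
  have WSm: "WS t \<in> borel_measurable M" for t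
    unfolding WS_def[abs_def] by (rule measurable_If_set[OF _ fm]) (use N(3) sets.sets_into_space[OF N(3)] in \<open>simp_all add: Int_absorb2\<close>)
  have WSf: "AE \<omega> in M. (\<lambda>t. WS t \<omega>) = f \<omega>" using AEN by eventually_elim (simp add: WS_def)
  have mod: "AE \<omega> in M. WS t \<omega> = X t \<omega>" if t: "t \<in> {0..T}" for t
  proof -
    \<comment> \<open>Convergence in H, that is order 0, suffices to identify the limit; this order
      is admissible because smax > 0.\<close>
    define \<theta> where "\<theta> = min 1 (smax * \<rho>)"
    have th: "0 < \<theta>" "\<theta> \<le> 1" "\<theta> \<le> (smax - 0) * \<rho>" using smax \<rho> by (auto simp: \<theta>_def)
    obtain A where A: "A \<ge> 0" "\<And>m t' t. m \<ge> 1 \<Longrightarrow> 0 \<le> t' \<Longrightarrow> t' \<le> t \<Longrightarrow> t \<le> T \<Longrightarrow>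
      (\<integral>\<^sup>+\<omega>. (hnorm2 0 (X t \<omega> - X t' \<omega>)) ^ m \<partial>M) \<le> ennreal (gaussian_moment m * (A * (t - t') powr \<theta>) ^ m)"
      using mom[rule_format, of \<theta> 0] th by force
    \<comment> \<open>The last node of level n not beyond \<open>t\<close>. At these nodes the
      series reproduces X, and they approach \<open>t\<close> at rate T/2^n.\<close>
    define i where "i n = nat \<lfloor>2 ^ n * t / T\<rfloor>" for n
    define d where "d n = node T n (i n)" for n
    have y0: "0 \<le> 2 ^ n * t / T" for n using t T by simp
    have iy: "real (i n) \<le> 2 ^ n * t / T" "2 ^ n * t / T < real (i n) + 1" for n
      using y0[of n] unfolding i_def by linarith+
    have i2: "i n \<le> 2 ^ n" for n
    proof -
      have "2 ^ n * t / T \<le> 2 ^ n" using t T by (simp add: pos_divide_le_eq)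
      then have "real (i n) \<le> 2 ^ n" using iy(1)[of n] by linarith
      then show ?thesis by simp
    qed
    have dt: "0 \<le> d n" "d n \<le> t" "t - d n \<le> T / 2 ^ n" for n
    proof -
      show "0 \<le> d n" unfolding d_def by (rule node_nonneg)
      have "T * real (i n) \<le> 2 ^ n * t" using iy(1)[of n] T by (simp add: pos_le_divide_eq mult.commute)
      then show "d n \<le> t" by (simp add: d_def node_def pos_divide_le_eq mult.commute)
      have "2 ^ n * t < (real (i n) + 1) * T" using iy(2)[of n] T by (simp add: pos_divide_less_eq)
      then have "t \<le> (real (i n) + 1) * T / 2 ^ n" by (simp add: pos_le_divide_eq mult.commute)
      also have "\<dots> = d n + T / 2 ^ n" by (simp add: d_def node_def field_simps)
      finally show "t - d n \<le> T / 2 ^ n" by simp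
    qed
    have lim2: "(\<lambda>n. T / 2 ^ n) \<longlonglongrightarrow> 0"
      by (rule LIMSEQ_divide_realpow_zero) simp
    have dlim: "d \<longlonglongrightarrow> t"
    proof (rule LIM_zero_cancel, rule tendsto_rabs_zero_cancel)
      have "\<bar>d n - t\<bar> \<le> T / 2 ^ n" for n using dt[of n] by simp
      from tendsto_sandwich[OF always_eventually[OF allI[OF abs_ge_zero]] always_eventually[OF allI[OF this]] tendsto_const lim2]
      show "(\<lambda>n. \<bar>d n - t\<bar>) \<longlonglongrightarrow> 0" .
    qed
    have dT: "d n \<in> {0..T}" for n using dt[of n] t by auto
    have Xlim: "AE \<omega> in M. (\<lambda>n. X (d n) \<omega>) \<longlonglongrightarrow> WS t \<omega>" using AEN
    proof eventually_elim
      fix \<omega> assume w: "\<omega> \<in> space M \<and> \<omega> \<notin> N"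
      have "f \<omega> \<in> cont_space e lam 0 T" using w smax by (intro gcont) auto
      then have "((\<lambda>t'. Hdot_norm e lam 0 (f \<omega> t' - f \<omega> t)) \<longlongrightarrow> 0) (at t within {0..T})" using t by (simp add: cont_space_def)
      then have "((\<lambda>t'. norm (f \<omega> t' - f \<omega> t)) \<longlongrightarrow> 0) (at t within {0..T})"
        by (simp add: Hdot_norm_def frac_pow_zero[OF l])
      then have "(f \<omega> \<longlongrightarrow> f \<omega> t) (at t within {0..T})" by (rule LIM_zero_cancel[OF tendsto_norm_zero_cancel])
      then have "continuous (at t within {0..T}) (f \<omega>)" by (simp add: continuous_within)
      from continuous_within_tendsto_compose'[OF this dT dlim]
      have 1: "(\<lambda>n. f \<omega> (d n)) \<longlonglongrightarrow> f \<omega> t" .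
      define Y where "Y t = (if t \<le> T then X t \<omega> else 0)" for t
      have fY: "f \<omega> = faber T (coef T Y)" unfolding f_def by (intro arg_cong[where f = "faber T"] ext) (simp add: C_def Y_def[abs_def])
      have "f \<omega> (d n) = Y (d n)" for n
        unfolding fY d_def by (rule faber_node[OF T _ _ i2]) (use T in \<open>simp_all add: Y_def\<close>)
      then have "f \<omega> (d n) = X (d n) \<omega>" for n using dT[of n] by (simp add: Y_def)
      then show "(\<lambda>n. X (d n) \<omega>) \<longlonglongrightarrow> WS t \<omega>" using 1 w by (simp add: WS_def)
    qed
    have [measurable]: "X t \<in> borel_measurable M" "X (d n) \<in> borel_measurable M" "WS t \<in> borel_measurable M" for n
      using t dt(1) WSm by (auto intro!: X_measurable)
    have h0: "hnorm2 0 v = ennreal ((norm v)\<^sup>2)" for v by (rule hnorm2_zero[OF l])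
    define g where "g n = gaussian_moment 1 * (A * (T / 2 ^ n) powr \<theta>)" for n
    have gl: "(\<lambda>n. ennreal (g n)) \<longlonglongrightarrow> ennreal 0"
    proof -
      have "(\<lambda>n. (T / 2 ^ n) powr \<theta>) \<longlonglongrightarrow> 0 powr \<theta>" using th T by (intro tendsto_powr2 lim2 tendsto_const) auto
      then show ?thesis unfolding g_def by (intro tendsto_ennrealI tendsto_mult_right_zero) simp
    qed
    have gb: "(\<integral>\<^sup>+\<omega>. ennreal ((norm (X t \<omega> - X (d n) \<omega>))\<^sup>2) \<partial>M) \<le> ennreal (g n)" for n
    proof -
      have "(\<integral>\<^sup>+\<omega>. ennreal ((norm (X t \<omega> - X (d n) \<omega>))\<^sup>2) \<partial>M) \<le> ennreal (gaussian_moment 1 * (A * (t - d n) powr \<theta>))"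
        using A(2)[of 1 "d n" t] dt[of n] t by (simp add: h0)
      also have "\<dots> \<le> ennreal (g n)" unfolding g_def
        using dt[of n] th A(1) by (intro ennreal_leI mult_left_mono powr_mono2 gaussian_moment_nonneg) auto
      finally show ?thesis .
    qed
    have "(\<integral>\<^sup>+\<omega>. ennreal ((norm (X t \<omega> - WS t \<omega>))\<^sup>2) \<partial>M)
        = (\<integral>\<^sup>+\<omega>. liminf (\<lambda>n. ennreal ((norm (X t \<omega> - X (d n) \<omega>))\<^sup>2)) \<partial>M)"
    proof (rule nn_integral_cong_AE)
      show "AE \<omega> in M. ennreal ((norm (X t \<omega> - WS t \<omega>))\<^sup>2) = liminf (\<lambda>n. ennreal ((norm (X t \<omega> - X (d n) \<omega>))\<^sup>2))"
        using Xlim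
      proof eventually_elim
        fix \<omega> assume "(\<lambda>n. X (d n) \<omega>) \<longlonglongrightarrow> WS t \<omega>"
        then have "(\<lambda>n. ennreal ((norm (X t \<omega> - X (d n) \<omega>))\<^sup>2)) \<longlonglongrightarrow> ennreal ((norm (X t \<omega> - WS t \<omega>))\<^sup>2)"
          by (intro tendsto_intros)
        from lim_imp_Liminf[OF sequentially_bot this] show "ennreal ((norm (X t \<omega> - WS t \<omega>))\<^sup>2) = liminf (\<lambda>n. ennreal ((norm (X t \<omega> - X (d n) \<omega>))\<^sup>2))" by (rule sym)
      qed
    qed
    also have "\<dots> \<le> liminf (\<lambda>n. \<integral>\<^sup>+\<omega>. ennreal ((norm (X t \<omega> - X (d n) \<omega>))\<^sup>2) \<partial>M)"
      by (rule nn_integral_liminf) measurable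
    also have "\<dots> \<le> liminf (\<lambda>n. ennreal (g n))" by (intro Liminf_mono always_eventually allI gb)
    also have "\<dots> = 0" using lim_imp_Liminf[OF sequentially_bot gl] by simp
    finally have "(\<integral>\<^sup>+\<omega>. ennreal ((norm (X t \<omega> - WS t \<omega>))\<^sup>2) \<partial>M) = 0" by simp
    then have "AE \<omega> in M. ennreal ((norm (X t \<omega> - WS t \<omega>))\<^sup>2) = 0" by (subst (asm) nn_integral_0_iff_AE) measurable
    then show ?thesis by eventually_elim (simp add: ennreal_eq_0_iff)
  qed
  have zero: "(\<lambda>t. 0) \<in> cont_space e lam s T" for s
    by (simp add: cont_space_def Hdot_zero Hdot_norm_def frac_pow_def)
  show ?thesis
  proof (intro exI[of _ WS] conjI ballI allI impI)
    show "WS t \<in> borel_measurable M" for t by (rule WSm)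
    show "AE \<omega> in M. WS t \<omega> = X t \<omega>" if "t \<in> {0..T}" for t by (rule mod[OF that])
    show "(\<lambda>t. WS t \<omega>) \<in> cont_space e lam s T" if "s < smax" "\<omega> \<in> space M" for s \<omega>
      using gcont[OF that(2) _ that(1)] zero by (cases "\<omega> \<in> N") (auto simp: WS_def)
    show "AE \<omega> in M. (\<lambda>t. WS t \<omega>) = faber T (\<lambda>n j. C n j \<omega>)" using WSf by (simp only: f_def)
    show "AE \<omega> in M. \<forall>t. summable (\<lambda>n. level T (\<lambda>n j. C n j \<omega>) n t)" using AEN by eventually_elim (auto intro: gsm)
  qed
qed

lemma stochastic_convolution_eq:
  assumes t: "t \<in> {0..T}"
  shows "AE \<omega> in M. X t \<omega> = stochastic_convolution M F e R W (resolvent_family e u) t \<omega>"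
proof -
  note X = X_stochastic_integral[OF t]
  have "has_stochastic_integral M F e R W t (\<lambda>\<sigma> \<omega>. resolvent_family e u (t - \<sigma>))
      (stochastic_convolution M F e R W (resolvent_family e u) t)"
    unfolding stochastic_convolution_def stochastic_integral_def by (rule someI[where P = "has_stochastic_integral M F e R W t (\<lambda>\<sigma> \<omega>. resolvent_family e u (t - \<sigma>))", OF X])
  from stochastic_integral_unique[OF X this] show ?thesis .
qed

text \<open>The two integrands can differ only at x = 0, where the half open \<open>restr\<close>
  vanishes and the closed indicator does not. This connects the deterministic estimate on the
  resolvent with the variances of the modes.\<close>

lemma var_eq:
  assumes t: "0 \<le> t'" "t' \<le> t" "t \<le> T"
  shows "var k t t' = (LINT x|lborel. indicator {0..t} x * (zero_extension (u k) (t - x) - zero_extension (u k) (t' - x))\<^sup>2)"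
    (is "_ = (LINT x|lborel. ?g x)")
proof -
  define f where "f x = (restr t (psi k t) x - restr t' (psi k t') x)\<^sup>2" for x
  obtain \<Lambda> \<Lambda>' where "lip t (psi k t) \<Lambda>" "lip t' (psi k t') \<Lambda>'" using psi_lip[of t k] psi_lip[of t' k] t by auto
  then have [measurable]: "restr t (psi k t) \<in> borel_measurable borel" "restr t' (psi k t') \<in> borel_measurable borel"
    using t by (auto intro!: restr_measurable)
  have fm [measurable]: "f \<in> borel_measurable borel" unfolding f_def by measurable
  have gf: "?g x = f x" if "x \<noteq> 0" for x
    using that t by (cases "x < 0"; cases "x \<le> t'"; cases "x \<le> t")
      (auto simp: f_def restr_def psi_def zero_extension_def indicator_def)
  have "?g = (\<lambda>x. if x = 0 then ?g 0 else f x)" using gf by auto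
  also have "\<dots> \<in> borel_measurable borel" by (rule measurable_If[OF measurable_const fm]) simp_all
  finally have gm: "?g \<in> borel_measurable borel" .
  have "AE x in lborel. f x = ?g x" using AE_lborel_singleton[of 0] by eventually_elim (rule gf[symmetric])
  then have "(LINT x|lborel. f x) = (LINT x|lborel. ?g x)"
    using fm gm by (intro integral_cong_AE) simp_all
  then show ?thesis by (simp only: var_def f_def)
qed

text \<open>The Hilbert-Schmidt norm is a double sum over coordinates of R e_j. By symmetry of R and
  an exchange of the sums it becomes the sum of lam_k^s times the squared norm of R e_k, the form in
  which the moment estimate uses it.\<close>

lemma hilbert_schmidt_weights:
  assumes R: "range R \<subseteq> frac_dom e lam (s / 2)" and hs: "hilbert_schmidt e (\<lambda>v. frac_pow e lam (s / 2) (R v))"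
  shows "summable (\<lambda>k. lam k powr s * q k)"
proof -
  have H: "R v \<in> Hdot e lam s" for v using R by (auto simp: Hdot_def)
  have "(\<Sum>k. ennreal (lam k powr s * q k)) = (\<Sum>k. \<Sum>j. ennreal ((lam k powr (s / 2) * (R (e j) \<bullet> e k))\<^sup>2))"
  proof (rule suminf_cong)
    fix k
    have w: "(lam k powr (s / 2))\<^sup>2 = lam k powr s" by (simp add: power2_eq_square flip: powr_add)
    have "(lam k powr (s / 2) * (R (e j) \<bullet> e k))\<^sup>2 = lam k powr s * (R (e k) \<bullet> e j)\<^sup>2" for j
    proof -
      have "R (e j) \<bullet> e k = R (e k) \<bullet> e j" by (subst R_sym) (rule inner_commute)
      then show ?thesis by (simp only: power_mult_distrib w)
    qed
    then have "(\<Sum>j. ennreal ((lam k powr (s / 2) * (R (e j) \<bullet> e k))\<^sup>2)) = (\<Sum>j. ennreal (lam k powr s) * ennreal ((R (e k) \<bullet> e j)\<^sup>2))"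
      by (simp add: ennreal_mult)
    also have "\<dots> = ennreal (lam k powr s) * ennreal (q k)" by (simp only: ennreal_suminf_cmult parseval_ennreal q_def)
    also have "\<dots> = ennreal (lam k powr s * q k)" using q_nonneg by (simp add: ennreal_mult)
    finally show "ennreal (lam k powr s * q k) = (\<Sum>j. ennreal ((lam k powr (s / 2) * (R (e j) \<bullet> e k))\<^sup>2))" by (rule sym)
  qed
  also have "\<dots> = (\<Sum>j. \<Sum>k. ennreal ((lam k powr (s / 2) * (R (e j) \<bullet> e k))\<^sup>2))" by (rule suminf_commute_ennreal)
  also have "\<dots> = (\<Sum>j. ennreal ((norm (frac_pow e lam (s / 2) (R (e j))))\<^sup>2))"
    using Hdot_norm_eq[OF H] by (simp add: hnorm2_def Hdot_norm_def)
  also have "\<dots> \<noteq> \<top>" using hs by (intro ennreal_suminf_neq_top) (auto simp: hilbert_schmidt_def)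
  finally show ?thesis using q_nonneg by (intro summable_suminf_not_top) auto
qed

end

theorem corollary3p9:
  fixes \<rho> r T :: real
    and b :: "real \<Rightarrow> real"
    and D :: "'h::{real_inner,banach,second_countable_topology} set"
    and A Q R :: "'h \<Rightarrow> 'h"
    and e :: "nat \<Rightarrow> 'h" and lam :: "nat \<Rightarrow> real"
    and u :: "nat \<Rightarrow> real \<Rightarrow> real"
    and M :: "'w measure" and F :: "real \<Rightarrow> 'w measure"
    and W :: "real \<Rightarrow> 'w \<Rightarrow> 'h"
  assumes "1 < \<rho>" and "\<rho> < 2" and "admissible_kernel \<rho> b"
    and "linear_on_domain D A" and "closure D = UNIV" and "unbounded_op D A"
    and "self_adjoint_op D A" and "pos_definite_op D A" and "has_compact_inverse D A"
    and "eigenpairs D A e lam"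
    and "\<And>k. scalar_resolvent b (lam k) (u k)"
    and "prob_space M" and "normal_filtration M F"
    and "psd_op Q" and "finite_trace e Q" and "is_psd_sqrt R Q"
    and "Q_wiener M F Q W"
    and "1 - 1 / \<rho> \<le> r" and "r < 1"
    and "range R \<subseteq> frac_dom e lam ((r - 1 + 1 / \<rho>) / 2)"
    and "hilbert_schmidt e (\<lambda>v. frac_pow e lam ((r - 1 + 1 / \<rho>) / 2) (R v))"
    and "0 < T"
  shows "\<exists>WS. is_modification M {0..T} WS
                (stochastic_convolution M F e R W (resolvent_family e u)) \<and>
    (\<forall>s < r - 1 + 2 / \<rho>.
       (\<forall>\<omega>\<in>space M. (\<lambda>t. WS t \<omega>) \<in> cont_space e lam s T) \<and>
       (let \<kappa> = (r - s - 1) * \<rho> in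
        \<forall>p > 2. min (1 / 2) (\<kappa> / 2 + 1) - 1 / p > 0 \<longrightarrow>
          (\<forall>\<beta>. 0 < \<beta> \<and> \<beta> < min (1 / 2) (\<kappa> / 2 + 1) - 1 / p \<longrightarrow>
             bochner_Lp M (hoelder_space e lam s T \<beta>) (hoelder_norm e lam s T \<beta>) p
               (\<lambda>\<omega> t. WS t \<omega>))) \<and>
       (\<forall>p \<ge> 1.
          bochner_Lp M (cont_space e lam s T) (cont_norm e lam s T) p (\<lambda>\<omega> t. WS t \<omega>) \<and>
          (\<exists>C > 0. (\<integral>\<^sup>+\<omega>. ennreal ((SUP t\<in>{0..T}. Hdot_norm e lam s (WS t \<omega>)) powr p) \<partial>M)
                     \<le> ennreal C)))"
proof -
  note \<rho> = assms(1,2) and T = \<open>0 < T\<close> and R = \<open>is_psd_sqrt R Q\<close>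
  have onb: "orthonormal_basis e" and l0: "0 < lam 0" and lmono: "mono lam"
    using \<open>eigenpairs D A e lam\<close> by (auto simp: eigenpairs_def)
  have lge: "lam 0 \<le> lam k" for k using lmono by (simp add: monoD)
  have lpos: "0 < lam k" for k using lge[of k] l0 by linarith
  have li: "locally_integrable b" and se: "subexponential b" and sec: "sectorial_lt_half_pi b"
    using \<open>admissible_kernel \<rho> b\<close> by (auto simp: admissible_kernel_def)
  obtain \<delta> where \<delta>: "\<delta> > 0" "\<delta> \<le> 1" "\<And>z. Re z > 0 \<Longrightarrow> Re (laplace b z) \<ge> \<delta> * norm (laplace b z)"
    using sector_real_part[OF sec] by blast
  have pos: "0 \<le> Re (laplace b z)" if "Re z > 0" for z
  proof -
    have "0 \<le> \<delta> * norm (laplace b z)" using \<delta>(1) by simp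
    also have "\<dots> \<le> Re (laplace b z)" by (rule \<delta>(3)[OF that])
    finally show ?thesis .
  qed
  have sv: "scalar_volterra b (lam k) (u k)" for k
    by (intro scalar_volterra.intro laplace_kernel.intro scalar_volterra_axioms.intro li se lpos assms(11) pos)
  have Qq: "Q (e k) \<bullet> e k = (norm (R (e k)))\<^sup>2" for k
  proof -
    have sym: "R x \<bullet> y = x \<bullet> R y" for x y using R unfolding is_psd_sqrt_def psd_op_def by blast
    have "R (R (e k)) = Q (e k)" using R by (simp add: is_psd_sqrt_def)
    with sym[of "R (e k)" "e k"] have "Q (e k) \<bullet> e k = R (e k) \<bullet> R (e k)" by simp
    then show ?thesis by (simp add: power2_norm_eq_inner)
  qed
  \<comment> \<open>exp T bounds all modes on [0,T] at once: it is the energy estimate with rate 1,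
    which does not depend on the eigenvalue.\<close>
  interpret stochastic_conv M e F Q R W lam u T "exp T"
  proof (intro stochastic_conv.intro wiener.intro onb_weights.intro onb.intro wiener_axioms.intro stochastic_conv_axioms.intro)
    show "summable (\<lambda>k. (norm (R (e k)))\<^sup>2)" using \<open>finite_trace e Q\<close> by (simp add: finite_trace_def Qq)
    show "\<bar>u k x\<bar> \<le> exp T" if "x \<in> {0..T}" for k x
    proof -
      have "\<bar>u k x\<bar> \<le> exp (1 * x)" by (rule scalar_volterra.resolvent_le_exp[OF sv]) (use that in auto)
      also have "\<dots> \<le> exp T" using that by simp
      finally show ?thesis .
    qed
    show "\<exists>\<Lambda>\<ge>0. \<forall>x\<in>{0..T}. \<forall>y\<in>{0..T}. \<bar>u k x - u k y\<bar> \<le> \<Lambda> * \<bar>x - y\<bar>" for k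
      using T by (intro scalar_volterra.Lipschitz_on_interval[OF sv]) simp
  qed (use assms onb in auto)
  have "\<exists>Cv>0. \<forall>\<mu> u t' t. \<mu> > 0 \<longrightarrow> scalar_resolvent b \<mu> u \<longrightarrow> 0 \<le> t' \<longrightarrow> t' \<le> t \<longrightarrow> t \<le> T \<longrightarrow>
      (LINT x|lborel. indicator {0..t} x * (zero_extension u (t - x) - zero_extension u (t' - x))\<^sup>2)
        \<le> Cv * min (t - t') (\<mu> powr (- 1 / \<rho>))" (is "\<exists>Cv>0. ?P Cv")
  proof (rule resolvent_increment[where T = T, OF \<open>admissible_kernel \<rho> b\<close>])
    fix C :: real
    assume c: "C > 0" and h: "\<And>\<mu> u t' t. \<mu> > 0 \<Longrightarrow> scalar_resolvent b \<mu> u \<Longrightarrow> 0 \<le> t' \<Longrightarrow> t' \<le> t \<Longrightarrow> t \<le> T \<Longrightarrow>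
      (LINT x|lborel. indicator {0..t} x * (zero_extension u (t - x) - zero_extension u (t' - x))\<^sup>2)
        \<le> C * min (t - t') (\<mu> powr (- 1 / \<rho>))"
    show ?thesis by (intro exI[of _ C] conjI allI impI c h)
  qed
  then obtain Cv where Cv: "Cv > 0" "?P Cv" by blast
  have var_le: "var k t t' \<le> Cv * min (t - t') (lam k powr (- 1 / \<rho>))" if "0 \<le> t'" "t' \<le> t" "t \<le> T" for k t' t
    unfolding var_eq[OF that] by (rule Cv(2)[rule_format, OF lpos assms(11) that])
  have Cv0: "Cv \<ge> 0" using Cv(1) by simp
  note wts = hilbert_schmidt_weights[OF assms(20,21)]
  \<comment> \<open>The order at which the time exponent degenerates: (smax - s) \<rho> = \<kappa> +
    2. The lower bound on \<open>r\<close> gives smax >= 1/\<rho>, so order 0 lies below it.\<close>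
  define smax where "smax = r - 1 + 2 / \<rho>"
  have two: "2 / \<rho> = 1 / \<rho> + 1 / \<rho>" by simp
  have "0 < 1 / \<rho>" using \<rho> by simp
  then have smax: "smax > 0" using assms(18) two unfolding smax_def by linarith
  have \<rho>0: "\<rho> > 0" using \<rho> by simp
  \<comment> \<open>The condition on \<theta> is the premise s - (1 - \<theta>)/\<rho> <= r - 1 +
    1/\<rho> of the moment estimate, solved for \<theta>.\<close>
  have mom: "\<exists>A\<ge>0. \<forall>m\<ge>1. \<forall>t' t. 0 \<le> t' \<longrightarrow> t' \<le> t \<longrightarrow> t \<le> T \<longrightarrow>
      (\<integral>\<^sup>+\<omega>. (hnorm2 s (X t \<omega> - X t' \<omega>)) ^ m \<partial>M) \<le> ennreal (gaussian_moment m * (A * (t - t') powr \<theta>) ^ m)"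
    if th: "0 \<le> \<theta>" "\<theta> \<le> 1" "\<theta> \<le> (smax - s) * \<rho>" for s \<theta>
  proof (rule X_moment[OF lge l0 Cv0 var_le wts th(1,2)])
    have "\<theta> / \<rho> \<le> smax - s" using th(3) \<rho>0 by (simp add: pos_divide_le_eq)
    then show "s - (1 - \<theta>) / \<rho> \<le> r - 1 + 1 / \<rho>"
      using two unfolding smax_def diff_divide_distrib by linarith
  qed
  have mom': "\<forall>s \<theta>. 0 \<le> \<theta> \<longrightarrow> \<theta> \<le> 1 \<longrightarrow> \<theta> \<le> (smax - s) * \<rho> \<longrightarrow> (\<exists>A\<ge>0. \<forall>m\<ge>1. \<forall>t' t. 0 \<le> t' \<longrightarrow> t' \<le> t \<longrightarrow> t \<le> T \<longrightarrow>
      (\<integral>\<^sup>+\<omega>. (hnorm2 s (X t \<omega> - X t' \<omega>)) ^ m \<partial>M) \<le> ennreal (gaussian_moment m * (A * (t - t') powr \<theta>) ^ m))"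
    by (intro allI impI mom)
  obtain WS where WS': "(\<forall>t\<in>{0..T}. WS t \<in> borel_measurable M \<and> (AE \<omega> in M. WS t \<omega> = X t \<omega>)) \<and>
    (\<forall>s<smax. \<forall>\<omega>\<in>space M. (\<lambda>t. WS t \<omega>) \<in> cont_space e lam s T) \<and>
    (AE \<omega> in M. (\<lambda>t. WS t \<omega>) = faber T (\<lambda>n j. C n j \<omega>)) \<and>
    (AE \<omega> in M. \<forall>t. summable (\<lambda>n. level T (\<lambda>n j. C n j \<omega>) n t))"
    using continuous_modification[OF lge l0 smax \<rho>0 mom'] by (rule exE)
  note WS = WS'[THEN conjunct1, rule_format, THEN conjunct1] WS'[THEN conjunct1, rule_format, THEN conjunct2]
      WS'[THEN conjunct2, THEN conjunct1, rule_format]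
    and WSf = WS'[THEN conjunct2, THEN conjunct2, THEN conjunct1]
    and sm = WS'[THEN conjunct2, THEN conjunct2, THEN conjunct2]
  have modif: "is_modification M {0..T} WS (stochastic_convolution M F e R W (resolvent_family e u))"
    unfolding is_modification_def
  proof (intro ballI conjI)
    fix t assume t: "t \<in> {0..T}"
    show "WS t \<in> borel_measurable M" by (rule WS(1)[OF t])
    show "AE \<omega> in M. WS t \<omega> = stochastic_convolution M F e R W (resolvent_family e u) t \<omega>"
      using WS(2)[OF t] stochastic_convolution_eq[OF t] by eventually_elim (rule trans)
  qed
  have Lp: "bochner_Lp M (cont_space e lam s T) (cont_norm e lam s T) p (\<lambda>\<omega> t. WS t \<omega>)"
      "bochner_Lp M (hoelder_space e lam s T \<beta>) (hoelder_norm e lam s T \<beta>) p (\<lambda>\<omega> t. WS t \<omega>)"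
    if th: "0 \<le> \<theta>" "\<theta> \<le> 1" "\<theta> \<le> (smax - s) * \<rho>"
      and b: "m \<ge> 1" "2 * real m * b + 1 < \<theta> * real m" "b' < b" "0 < \<beta>" "\<beta> \<le> 1" "\<beta> < b'" "0 \<le> p" "p \<le> 2 * real m"
    for s \<theta> m b b' \<beta> p
  proof -
    obtain a where a: "a \<ge> 0" "\<And>m t' t. m \<ge> 1 \<Longrightarrow> 0 \<le> t' \<Longrightarrow> t' \<le> t \<Longrightarrow> t \<le> T \<Longrightarrow>
      (\<integral>\<^sup>+\<omega>. (hnorm2 s (X t \<omega> - X t' \<omega>)) ^ m \<partial>M) \<le> ennreal (gaussian_moment m * (a * (t - t') powr \<theta>) ^ m)"
      using mom[OF th] by force
    note L = bochner_Lp_paths[OF a(1) a(2)[OF b(1)] b WSf sm]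
    show "bochner_Lp M (cont_space e lam s T) (cont_norm e lam s T) p (\<lambda>\<omega> t. WS t \<omega>)" by (rule L(1))
    show "bochner_Lp M (hoelder_space e lam s T \<beta>) (hoelder_norm e lam s T \<beta>) p (\<lambda>\<omega> t. WS t \<omega>)" by (rule L(2))
  qed
  have hoelder: "bochner_Lp M (hoelder_space e lam s T \<beta>) (hoelder_norm e lam s T \<beta>) p (\<lambda>\<omega> t. WS t \<omega>)"
    if s: "s < smax" and p: "p > 2" and \<beta>: "0 < \<beta>" "\<beta> < min (1 / 2) ((r - s - 1) * \<rho> / 2 + 1) - 1 / p" for s p \<beta>
  proof -
    define \<theta> where "\<theta> = min 1 ((smax - s) * \<rho>)"
    have th: "0 \<le> \<theta>" "\<theta> \<le> 1" "\<theta> \<le> (smax - s) * \<rho>" using s \<rho>0 by (auto simp: \<theta>_def)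
    have "(smax - s) * \<rho> = (r - s - 1) * \<rho> + 2" using \<rho>0 by (simp add: smax_def field_simps)
    then have "min (1 / 2) ((r - s - 1) * \<rho> / 2 + 1) = \<theta> / 2" by (simp add: \<theta>_def min_def)
    then have b1: "\<beta> < \<theta> / 2 - 1 / p" using \<beta>(2) by simp
    \<comment> \<open>A third of the gap: \<beta>, \<beta> + g, \<beta> + 2g and \<theta>/2 - 1/p
      are strictly increasing and provide the path, approximation and moment exponents.\<close>
    define g where "g = (\<theta> / 2 - 1 / p - \<beta>) / 3"
    have g: "g > 0" using b1 by (simp add: g_def)
    define bb where "bb = \<beta> + 2 * g"
    have "3 * g = \<theta> / 2 - 1 / p - \<beta>" by (simp add: g_def)
    then have bb: "bb < \<theta> / 2 - 1 / p" using g unfolding bb_def by linarith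
    \<comment> \<open>The least integer with 2m >= p. Then 2m/p >= 1, and the loss 1/p granted in
      the statement covers the loss 1/(2m) of the moment condition.\<close>
    define m where "m = nat \<lceil>p / 2\<rceil>"
    have mp: "p / 2 \<le> real m" unfolding m_def by linarith
    have m0: "real m > 0" using mp p by linarith
    then have m1: "m \<ge> 1" by simp
    have "2 * real m * bb < 2 * real m * (\<theta> / 2 - 1 / p)" using bb m0 by (intro mult_strict_left_mono) auto
    also have "\<dots> = \<theta> * real m - 2 * real m / p" by (simp add: right_diff_distrib)
    also have "\<dots> \<le> \<theta> * real m - 1" using mp p by (simp add: pos_le_divide_eq)
    finally have mb: "2 * real m * bb + 1 < \<theta> * real m" by simp
    have "0 < 1 / p" using p by simp
    then have "\<beta> \<le> 1" using b1 th(2) by linarith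
    then show ?thesis using mp p \<beta>(1) g
      by (intro Lp(2)[OF th m1 mb, of "\<beta> + g"]) (auto simp: bb_def)
  qed
  have cont: "bochner_Lp M (cont_space e lam s T) (cont_norm e lam s T) p (\<lambda>\<omega> t. WS t \<omega>)"
    if s: "s < smax" and p: "p \<ge> 1" for s p
  proof -
    define \<theta> where "\<theta> = min 1 ((smax - s) * \<rho>)"
    have th: "0 < \<theta>" "0 \<le> \<theta>" "\<theta> \<le> 1" "\<theta> \<le> (smax - s) * \<rho>" using s \<rho>0 by (auto simp: \<theta>_def)
    \<comment> \<open>For continuity no exponent has to be matched, so a moment of any high order
      may be used: large enough for p, and for the weight \<theta>/4 to be admissible.\<close>
    obtain m :: nat where m: "p + 2 / \<theta> < real m" using reals_Archimedean2 by blast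
    have "0 < 2 / \<theta>" using th by simp
    then have mp: "p \<le> 2 * real m" "2 / \<theta> < real m" "0 < real m" using m p by linarith+
    have m1: "m \<ge> 1" using mp(3) by simp
    have "2 < real m * \<theta>" using mp(2) th by (simp add: pos_divide_less_eq)
    then have mb: "2 * real m * (\<theta> / 4) + 1 < \<theta> * real m" by (simp add: field_simps)
    show ?thesis using mp(1) p th
      by (intro Lp(1)[OF th(2-4) m1 mb, of "\<theta> / 8" "\<theta> / 16"]) auto
  qed
  have sup: "\<exists>C > 0. (\<integral>\<^sup>+\<omega>. ennreal ((SUP t\<in>{0..T}. Hdot_norm e lam s (WS t \<omega>)) powr p) \<partial>M) \<le> ennreal C"
    if s: "s < smax" and p: "p \<ge> 1" for s p
  proof -
    let ?I = "\<integral>\<^sup>+\<omega>. ennreal ((SUP t\<in>{0..T}. Hdot_norm e lam s (WS t \<omega>)) powr p) \<partial>M"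
    have I: "?I < \<infinity>" using cont[OF s p] by (simp add: bochner_Lp_def cont_norm_def)
    then have "?I = ennreal (enn2real ?I)" by (simp add: less_top)
    also have "\<dots> \<le> ennreal (enn2real ?I + 1)" by (rule ennreal_leI) simp
    finally show ?thesis by (intro exI[of _ "enn2real ?I + 1"] conjI) (simp_all add: add_nonneg_pos)
  qed
  show ?thesis
    unfolding Let_def smax_def[symmetric]
    by (intro exI[of _ WS] conjI modif allI impI ballI WS(3) cont sup hoelder) auto
qed

end
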